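(* Let $b$ be prime, $m\in\mathbb{N}_0$, $N=b^m$, $s\in\mathbb{N}$, and let $\gamma_{\mathfrak{u}}=\Gamma(|\mathfrak{u}|)\prod_{j\in\mathfrak{u}}\gamma_j$, $\mathfrak{u}\subseteq\{1,\ldots,s\}$, be POD (product and order dependent) weights. Given a sequence of integer reduction indices $0\le w_1\le w_2\le\cdots$, the reduced component-by-component (CBC) algorithm for a prime power $N=b^m$ points in $s$ dimensions, as specified by the procedure "Fast reduced CBC construction for POD weights" written out in the context, can construct a lattice rule with near optimal worst-case error, namely such that the resulting randomly shifted lattice rule $Q_N$ satisfies, for all $\lambda\in(1/2,1]$ and $F\in\mathcal{W}_{s,\boldsymbol{\gamma}}$, $$\sqrt{\mathbb{E}_{\boldsymbol{\Delta}}\big[|I_s(F)-Q_N(F)|^2\big]}\;\le\;\left(\sum_{\emptyset\ne\mathfrak{u}\subseteq\{1,\ldots,s\}}\gamma_{\mathfrak{u}}^{\lambda}\,\varrho^{|\mathfrak{u}|}(\lambda)\,b^{\min\{m,\max_{j\in\mathfrak{u}}w_j\}}\right)^{1/(2\lambda)}\left(\frac{2}{N}\right)^{1/(2\lambda)}\|F\|_{\mathcal{W}_{s,\boldsymbol{\gamma}}},$$ where $\varrho(\lambda)=2\zeta(2\lambda)(2\pi^2)^{-\lambda}$, with an arithmetic cost of $$\mathcal{O}\!\left(\sum_{j=1}^{\min\{s,s^*\}}(m-w_j+j)\,b^{m-w_j}\right),$$ where $s^*$ is defined to be the largest integer such that $w_{s^*}<m$. The memory cost is $\mathcal{O}\big(\sum_{j=1}^{\min\{s,s^*\}}b^{m-w_j}\big)$.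 In case of product weights, $\mathcal{O}\big(\sum_{j=1}^{\min\{s,s^*\}}(m-w_j)\,b^{m-w_j}\big)$ operations are required for the construction, with memory $\mathcal{O}(b^{m-w_1})$.
   Context: Weights: $\boldsymbol{\gamma}=(\gamma_{\mathfrak{u}})_{\mathfrak{u}\subseteq\{1,\ldots,s\}}$ are non-negative. POD weights have the form $\gamma_{\mathfrak{u}}=\Gamma(|\mathfrak{u}|)\prod_{j\in\mathfrak{u}}\gamma_j$ with numbers $\Gamma(\ell)$, $\ell\in\mathbb{N}_0$, $\Gamma(0)=1$, and $\gamma_j$, $j\in\mathbb{N}$, so that $\gamma_\emptyset=1$. Product weights are of the form $\gamma_{\mathfrak{u}}=\prod_{j\in\mathfrak{u}}\gamma_j$. Integral and rule: $I_s(F)=\int_{[-\frac12,\frac12]^s}F(\boldsymbol{y})\,d\boldsymbol{y}$. For a generating vector $\boldsymbol{z}\in\mathbb{Z}^s$ and a shift $\boldsymbol{\Delta}$ uniformly distributed on $[0,1]^s$, the randomly shifted lattice rule is $Q_N(F)=\frac1N\sum_{k=1}^N F(\{k\boldsymbol{z}/N+\boldsymbol{\Delta}\}-(\frac12,\ldots,\frac12))$, where $\{\cdot\}$ is the component-wise fractional part; $\mathbb{E}_{\boldsymbol{\Delta}}$ is expectation over $\boldsymbol{\Delta}$. Weighted unanchored Sobolev space: $\mathcal{W}_{s,\boldsymbol{\gamma}}$ is the Hilbert space of functions on $[-\frac12,\frac12]^s$ with square integrable mixed first derivatives and norm $$\|F\|_{\mathcal{W}_{s,\boldsymbol{\gamma}}}=\Big(\sum_{\mathfrak{u}\subseteq\{1,\ldots,s\}}\gamma_{\mathfrak{u}}^{-1}\int_{[-\frac12,\frac12]^{|\mathfrak{u}|}}\Big(\int_{[-\frac12,\frac12]^{s-|\mathfrak{u}|}}\frac{\partial^{|\mathfrak{u}|}F}{\partial\boldsymbol{y}_{\mathfrak{u}}}(\boldsymbol{y}_{\mathfrak{u}};\boldsymbol{y}_{-\mathfrak{u}})\,d\boldsymbol{y}_{-\mathfrak{u}}\Big)^2d\boldsymbol{y}_{\mathfrak{u}}\Big)^{1/2},$$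 with $\boldsymbol{y}_{\mathfrak{u}}=(y_j)_{j\in\mathfrak{u}}$ and $\boldsymbol{y}_{-\mathfrak{u}}=(y_j)_{j\in\{1,\ldots,s\}\setminus\mathfrak{u}}$. Korobov space: in the weighted Korobov space of smoothness $\alpha>1$ with POD weights, the squared worst-case error of the (unshifted) $N$-point lattice rule with generating vector $\boldsymbol{z}$ is $$e_{N,s}^2(\boldsymbol{z})=\frac1N\sum_{k=0}^{N-1}\sum_{\ell=1}^{s}\sum_{\mathfrak{u}\subseteq\{1,\ldots,s\},\,|\mathfrak{u}|=\ell}\Gamma(\ell)\prod_{j\in\mathfrak{u}}\gamma_j\,\omega(\{kz_j/N\}),\qquad \omega(x)=\sum_{0\ne h\in\mathbb{Z}}\frac{e^{2\pi\mathrm{i}hx}}{|h|^{\alpha}}.$$ The shift-averaged kernel of $\mathcal{W}_{s,\boldsymbol{\gamma}}$ equals the kernel of the Korobov space with $\alpha=2$ and weights $\gamma_{\mathfrak{u}}/(2\pi^2)^{|\mathfrak{u}|}$ (again POD weights); the rule for $\mathcal{W}_{s,\boldsymbol{\gamma}}$ is constructed by running the procedure below for this Korobov space. Reduced CBC principle: for $j$ from $1$ to $s$ and as long as $w_j<m$, select $z_j\in\mathbb{Z}_{b^{m-w_j}}^\times$ minimizing $e_{N,j}^2(b^{w_1}z_1,\ldots,b^{w_{j-1}}z_{j-1},b^{w_j}z)$ over $z\in\mathbb{Z}_{b^{m-w_j}}^\times$; set all remaining $z_j:=0$; return $(b^{w_1}z_1,\ldots,b^{w_s}z_s)$. Notation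 for the procedure: $\mathbb{Z}_n^\times=\{z\in\mathbb{Z}_n:\gcd(z,n)=1\}$ (with $\mathbb{Z}_1^\times=\{0\}$), $\varphi$ is Euler's totient function, and $$\Omega_n=\Big[\omega\Big(\frac{kz\bmod n}{n}\Big)\Big]_{z\in\mathbb{Z}_n^\times,\;k\in\mathbb{Z}_n}\in\mathbb{R}^{\varphi(n)\times n};$$ $\Omega_n(z,:)$ is the row corresponding to $z$, and $.*$ is the element-wise product of vectors. Values of $\omega$ are assumed computable at unit cost. For integers $0\le w'\le w''\le m$ the "fold and sum" operator $P^m_{w'',w'}:\mathbb{R}^{b^{m-w'}}\to\mathbb{R}^{b^{m-w''}}$ divides a vector of length $b^{m-w'}$ into $b^{w''-w'}$ consecutive blocks of length $b^{m-w''}$ and sums them: $P^m_{w'',w'}\boldsymbol{v}=[\,I_{b^{m-w''}}|\cdots|I_{b^{m-w''}}\,]\,\boldsymbol{v}$, with $b^{w''-w'}$ copies of the identity matrix $I_{b^{m-w''}}$. $\mathbf{1}_n$ and $\mathbf{0}_n$ are the all-ones and all-zeros vectors of length $n$. Procedure "Fast reduced CBC construction for POD weights". Input: prime power $N=b^m$ with $m\in\mathbb{N}_0$, integer reduction indices $0\le w_1\le\cdots\le w_s$, and weights $\Gamma(\ell)$, $\ell\in\mathbb{N}_0$, with $\Gamma(0)=1$, and $\gamma_j$, $j\in\mathbb{N}$, such that $\gamma_{\mathfrak{u}}=\Gamma(|\mathfrak{u}|)\prod_{j\in\mathfrak{u}}\gamma_j$. Optional: adjust $m:=\max\{0,m-w_1\}$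 and, for $j$ from $s$ down to $1$, adjust $w_j:=w_j-w_1$. Set $\boldsymbol{q}_{0,0}:=\mathbf{1}_{b^m}$, $\boldsymbol{q}_{0,1}:=\mathbf{0}_{b^m}$, $w_0:=0$. For $j$ from $1$ to $s$ and as long as $w_j<m$ do: (1) Set $\overline{\boldsymbol{q}}_j:=\sum_{\ell=1}^{j}\frac{\Gamma(\ell)}{\Gamma(\ell-1)}\big[P^m_{w_j,w_{j-1}}\boldsymbol{q}_{j-1,\ell-1}\big]\in\mathbb{R}^{b^{m-w_j}}$ (with $\boldsymbol{q}_{j-1,\ell-1}\in\mathbb{R}^{b^{m-w_{j-1}}}$). (2) Calculate $\boldsymbol{T}_j:=\Omega_{b^{m-w_j}}\overline{\boldsymbol{q}}_j\in\mathbb{R}^{\varphi(b^{m-w_j})}$ by exploiting the block-circulant structure of $\Omega_{b^{m-w_j}}$ using FFTs. (3) Set $z_j:=\operatorname{argmin}_{z\in\mathbb{Z}_{b^{m-w_j}}^\times}\boldsymbol{T}_j(z)$, with $\boldsymbol{T}_j(z)$ the component corresponding to $z$. (4) Set $\boldsymbol{q}_{j,0}:=\mathbf{1}_{b^{m-w_j}}$ and $\boldsymbol{q}_{j,j+1}:=\mathbf{0}_{b^{m-w_j}}$, and for $\ell$ from $j$ down to $1$ set $$\boldsymbol{q}_{j,\ell}:=\big[P^m_{w_j,w_{j-1}}\boldsymbol{q}_{j-1,\ell}\big]+\frac{\Gamma(\ell)}{\Gamma(\ell-1)}\,\gamma_j\,\Omega_{b^{m-w_j}}(z_j,:)\;{.*}\;\big[P^m_{w_j,w_{j-1}}\boldsymbol{q}_{j-1,\ell-1}\big]\in\mathbb{R}^{b^{m-w_j}}.$$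 (5) Optional: calculate the squared worst-case error by $e_j^2:=\frac{1}{b^m}\sum_{k\in\mathbb{Z}_{b^{m-w_j}}}\sum_{\ell=1}^{j}\boldsymbol{q}_{j,\ell}(k)$. Set all remaining $z_j:=0$ (for $j$ with $w_j\ge m$). Return: generating vector $\widetilde{\boldsymbol{z}}:=(b^{w_1}z_1,\ldots,b^{w_s}z_s)$ for $N=b^m$. (The $w_j$ and $m$ might have been adjusted to make $w_1=0$.)
   Formalization: In step (4), q_{j,0} is the folded vector P q_{j-1,0} (all entries b^{w_j}) instead of the all-ones vector; as printed, the error bound fails, e.g. for b=89, m=3, w=(0,2,2,2), s=4 with suitable POD weights. The costs are for the adjusted m and w_j. *)

theory Defs
  imports
    "HOL-Analysis.Analysis"
    "HOL-Computational_Algebra.Primes"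
    "HOL-Library.Extended_Nat"
begin

section \<open>Weights\<close>

definition pod_weight :: "(nat \<Rightarrow> real) \<Rightarrow> (nat \<Rightarrow> real) \<Rightarrow> nat set \<Rightarrow> real" where
  "pod_weight \<Gamma> \<gamma> u = \<Gamma> (card u) * (\<Prod>j\<in>u. \<gamma> j)"

text \<open>
  The construction divides \<open>\<Gamma> l\<close> by \<open>\<Gamma> (l - 1)\<close>, so a vanishing \<open>\<Gamma> (l - 1)\<close> is admitted only
  together with a vanishing \<open>\<Gamma> l\<close>, the quotient \<open>0 / 0\<close> then being \<open>0\<close>. All positive weights and
  all finite-order weights are covered.
\<close>
definition pod_parameters :: "nat \<Rightarrow> (nat \<Rightarrow> real) \<Rightarrow> (nat \<Rightarrow> real) \<Rightarrow> bool" where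
  "pod_parameters s \<Gamma> \<gamma> \<longleftrightarrow>
     \<Gamma> 0 = 1 \<and>
     (\<forall>l\<in>{1..s}. 0 \<le> \<Gamma> l \<and> (\<Gamma> (l - 1) = 0 \<longrightarrow> \<Gamma> l = 0)) \<and>
     (\<forall>j\<in>{1..s}. 0 \<le> \<gamma> j)"

definition reduction_indices :: "(nat \<Rightarrow> nat) \<Rightarrow> bool" where
  "reduction_indices w \<longleftrightarrow> mono_on {1..} w"

section \<open>The weighted unanchored Sobolev space\<close>

text \<open>
  Vectors indexed by \<open>u \<subseteq> {1..s}\<close> are the extensional functions of \<open>\<Pi>\<^sub>E j\<in>u. _\<close>, integrated with
  respect to the product measure \<open>\<Pi>\<^sub>M\<close>.
\<close>

definition cube :: "nat set \<Rightarrow> (nat \<Rightarrow> real) set" where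
  "cube u = (\<Pi>\<^sub>E j\<in>u. {-1/2..1/2})"

definition cube_measure :: "nat set \<Rightarrow> (nat \<Rightarrow> real) measure" where
  "cube_measure u = (\<Pi>\<^sub>M j\<in>u. restrict_space lborel {-1/2..1/2})"

definition partial_deriv :: "nat \<Rightarrow> ((nat \<Rightarrow> real) \<Rightarrow> real) \<Rightarrow> (nat \<Rightarrow> real) \<Rightarrow> real" where
  "partial_deriv j f y = deriv (\<lambda>t. f (y(j := t))) (y j)"

definition mixed_deriv :: "nat list \<Rightarrow> ((nat \<Rightarrow> real) \<Rightarrow> real) \<Rightarrow> (nat \<Rightarrow> real) \<Rightarrow> real" where
  "mixed_deriv js f = fold partial_deriv js f"

text \<open>
  Test functions have compact support in the open cube, and all their mixed first derivatives
  exist, in any order of differentiation, and are continuous. By mollification they define the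
  same weak derivatives as the smooth test functions.
\<close>
definition test_function :: "nat \<Rightarrow> ((nat \<Rightarrow> real) \<Rightarrow> real) \<Rightarrow> bool" where
  "test_function s \<phi> \<longleftrightarrow>
     (\<exists>\<delta>>0. \<forall>y. (\<exists>j\<in>{1..s}. \<bar>y j\<bar> > 1/2 - \<delta>) \<longrightarrow> \<phi> y = 0) \<and>
     (\<forall>js. distinct js \<and> set js \<subseteq> {1..s} \<longrightarrow>
        continuous_on UNIV (mixed_deriv js \<phi>) \<and>
        (\<forall>j\<in>{1..s} - set js. \<forall>y. (\<lambda>t. mixed_deriv js \<phi> (y(j := t))) differentiable (at (y j))))"

text \<open>\<open>G\<close> is a square integrable weak derivative \<open>\<partial>\<^sup>|\<^sup>u\<^sup>| F / \<partial>y\<^sub>u\<close>; it is unique up to null sets.\<close>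
definition is_weak_deriv ::
  "nat \<Rightarrow> nat set \<Rightarrow> ((nat \<Rightarrow> real) \<Rightarrow> real) \<Rightarrow> ((nat \<Rightarrow> real) \<Rightarrow> real) \<Rightarrow> bool" where
  "is_weak_deriv s u F G \<longleftrightarrow>
     G \<in> borel_measurable (cube_measure {1..s}) \<and>
     integrable (cube_measure {1..s}) (\<lambda>y. (G y)\<^sup>2) \<and>
     (\<forall>\<phi>. test_function s \<phi> \<longrightarrow>
        (LINT y|cube_measure {1..s}. F y * mixed_deriv (sorted_list_of_set u) \<phi> y) =
        (-1) ^ card u * (LINT y|cube_measure {1..s}. G y * \<phi> y))"

definition weak_deriv ::
  "nat \<Rightarrow> nat set \<Rightarrow> ((nat \<Rightarrow> real) \<Rightarrow> real) \<Rightarrow> (nat \<Rightarrow> real) \<Rightarrow> real" where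
  "weak_deriv s u F = (SOME G. is_weak_deriv s u F G)"

text \<open>The integral over \<open>y\<^sub>u\<close> of the squared integral of the derivative over \<open>y\<^sub>-\<^sub>u\<close>.\<close>
definition deriv_energy :: "nat \<Rightarrow> nat set \<Rightarrow> ((nat \<Rightarrow> real) \<Rightarrow> real) \<Rightarrow> real" where
  "deriv_energy s u F =
     (LINT x|cube_measure u.
        (LINT y|cube_measure ({1..s} - u). weak_deriv s u F (merge u ({1..s} - u) (x, y)))\<^sup>2)"

text \<open>
  Point values enter the quadrature rule, so the elements are the continuous representatives.
  If \<open>\<gamma> u = 0\<close>, a finite norm forces the corresponding integral to vanish, and its contribution
  \<open>0 / 0\<close> to the norm is \<open>0\<close>.
\<close>
definition sobolev_space :: "nat \<Rightarrow> (nat set \<Rightarrow> real) \<Rightarrow> ((nat \<Rightarrow> real) \<Rightarrow> real) set" where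
  "sobolev_space s \<gamma> =
     {F. continuous_on (cube {1..s}) F \<and>
         (\<forall>u\<subseteq>{1..s}. \<exists>G. is_weak_deriv s u F G) \<and>
         (\<forall>u\<subseteq>{1..s}. \<gamma> u = 0 \<longrightarrow> deriv_energy s u F = 0)}"

definition sobolev_norm :: "nat \<Rightarrow> (nat set \<Rightarrow> real) \<Rightarrow> ((nat \<Rightarrow> real) \<Rightarrow> real) \<Rightarrow> real" where
  "sobolev_norm s \<gamma> F = sqrt (\<Sum>u\<in>Pow {1..s}. deriv_energy s u F / \<gamma> u)"

section \<open>Randomly shifted lattice rules\<close>

definition cube_integral :: "nat \<Rightarrow> ((nat \<Rightarrow> real) \<Rightarrow> real) \<Rightarrow> real" where
  "cube_integral s F = (LINT y|cube_measure {1..s}. F y)"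

definition shifted_lattice_rule ::
  "nat \<Rightarrow> nat \<Rightarrow> (nat \<Rightarrow> int) \<Rightarrow> (nat \<Rightarrow> real) \<Rightarrow> ((nat \<Rightarrow> real) \<Rightarrow> real) \<Rightarrow> real" where
  "shifted_lattice_rule s N z \<Delta> F =
     1 / real N * (\<Sum>k=1..N. F (\<lambda>j\<in>{1..s}. frac (real k * of_int (z j) / real N + \<Delta> j) - 1/2))"

definition rms_error :: "nat \<Rightarrow> nat \<Rightarrow> (nat \<Rightarrow> int) \<Rightarrow> ((nat \<Rightarrow> real) \<Rightarrow> real) \<Rightarrow> real" where
  "rms_error s N z F =
     sqrt (LINT \<Delta>|(\<Pi>\<^sub>M j\<in>{1..s}. restrict_space lborel {0..1}).
             \<bar>cube_integral s F - shifted_lattice_rule s N z \<Delta> F\<bar>\<^sup>2)"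

definition zeta_real :: "real \<Rightarrow> real" where
  "zeta_real x = (\<Sum>n. 1 / real (Suc n) powr x)"

definition rho :: "real \<Rightarrow> real" where
  "rho lam = 2 * zeta_real (2 * lam) * (2 * pi\<^sup>2) powr (- lam)"

section \<open>The fast reduced component-by-component construction\<close>

definition korobov_omega :: "real \<Rightarrow> real \<Rightarrow> real" where
  "korobov_omega \<alpha> x =
     Re (\<Sum>\<^sub>\<infinity>h\<in>UNIV - {0::int}. cis (2 * pi * of_int h * x) / of_real (\<bar>of_int h\<bar> powr \<alpha>))"

text \<open>
  The shift-averaged kernel of the Sobolev space is the kernel of the Korobov space of
  smoothness 2 with POD weights given by \<open>\<Gamma>\<close> and these \<open>\<gamma> j\<close>.
\<close>
definition korobov_weights :: "(nat \<Rightarrow> real) \<Rightarrow> nat \<Rightarrow> real" where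
  "korobov_weights \<gamma> j = \<gamma> j / (2 * pi\<^sup>2)"

definition unit_residues :: "nat \<Rightarrow> nat set" where
  "unit_residues n = {z. z < n \<and> coprime z n}"

text \<open>Vectors of length \<open>n\<close> are functions of which only the values on \<open>{..<n}\<close> matter.\<close>

definition omega_matrix :: "nat \<Rightarrow> nat \<Rightarrow> nat \<Rightarrow> real" where
  "omega_matrix n z k = korobov_omega 2 (real (k * z mod n) / real n)"

definition fold_sum :: "nat \<Rightarrow> nat \<Rightarrow> nat \<Rightarrow> nat \<Rightarrow> (nat \<Rightarrow> real) \<Rightarrow> nat \<Rightarrow> real" where
  "fold_sum b m w'' w' v k = (\<Sum>i<b ^ (w'' - w'). v (i * b ^ (m - w'') + k))"

text \<open>\<open>w 0\<close> is to be read as \<open>0\<close>.\<close>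
definition fold_to :: "nat \<Rightarrow> nat \<Rightarrow> (nat \<Rightarrow> nat) \<Rightarrow> nat \<Rightarrow> (nat \<Rightarrow> real) \<Rightarrow> nat \<Rightarrow> real" where
  "fold_to b m w j = fold_sum b m (w j) (if j = 1 then 0 else w (j - 1))"

text \<open>
  The vector \<open>q\<^sub>j\<^sub>,\<^sub>l\<close> for given components \<open>z\<close>. The vector \<open>q\<^sub>j\<^sub>,\<^sub>0\<close> is obtained by folding the all-ones
  vector of length \<open>b ^ m\<close>, so that all its entries are \<open>b ^ w j\<close>. Resetting it to ones would agree
  with this only when \<open>w j = 0\<close>; for \<open>w j > 0\<close> it would lose the multiplicities of the folded points
  in all terms with lowest index above \<open>j\<close>, so that the later steps would no longer minimise the
  worst-case error, and the error bound would fail.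
\<close>
fun cbc_q ::
  "nat \<Rightarrow> nat \<Rightarrow> (nat \<Rightarrow> nat) \<Rightarrow> (nat \<Rightarrow> real) \<Rightarrow> (nat \<Rightarrow> real) \<Rightarrow> (nat \<Rightarrow> nat) \<Rightarrow>
   nat \<Rightarrow> nat \<Rightarrow> nat \<Rightarrow> real" where
  "cbc_q b m w \<Gamma> \<gamma> z 0 l k = (if l = 0 then 1 else 0)"
| "cbc_q b m w \<Gamma> \<gamma> z (Suc j) l k =
     (if l = 0 then fold_to b m w (Suc j) (cbc_q b m w \<Gamma> \<gamma> z j 0) k
      else if l \<le> Suc j then
        fold_to b m w (Suc j) (cbc_q b m w \<Gamma> \<gamma> z j l) k +
        \<Gamma> l / \<Gamma> (l - 1) * \<gamma> (Suc j) * omega_matrix (b ^ (m - w (Suc j))) (z (Suc j)) k *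
        fold_to b m w (Suc j) (cbc_q b m w \<Gamma> \<gamma> z j (l - 1)) k
      else 0)"

definition cbc_qbar ::
  "nat \<Rightarrow> nat \<Rightarrow> (nat \<Rightarrow> nat) \<Rightarrow> (nat \<Rightarrow> real) \<Rightarrow> (nat \<Rightarrow> real) \<Rightarrow> (nat \<Rightarrow> nat) \<Rightarrow>
   nat \<Rightarrow> nat \<Rightarrow> real" where
  "cbc_qbar b m w \<Gamma> \<gamma> z j k =
     (\<Sum>l=1..j. \<Gamma> l / \<Gamma> (l - 1) * fold_to b m w j (cbc_q b m w \<Gamma> \<gamma> z (j - 1) (l - 1)) k)"

definition cbc_T ::
  "nat \<Rightarrow> nat \<Rightarrow> (nat \<Rightarrow> nat) \<Rightarrow> (nat \<Rightarrow> real) \<Rightarrow> (nat \<Rightarrow> real) \<Rightarrow> (nat \<Rightarrow> nat) \<Rightarrow>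
   nat \<Rightarrow> nat \<Rightarrow> real" where
  "cbc_T b m w \<Gamma> \<gamma> z j y =
     (\<Sum>k<b ^ (m - w j). omega_matrix (b ^ (m - w j)) y k * cbc_qbar b m w \<Gamma> \<gamma> z j k)"

text \<open>
  The possible outcomes \<open>z\<close> of the construction, whichever minimiser is selected in a tie; \<open>cbc_T\<close>
  at step \<open>j\<close> depends on \<open>z 1, \<dots>, z (j - 1)\<close> only.
\<close>
definition reduced_cbc_output ::
  "nat \<Rightarrow> nat \<Rightarrow> (nat \<Rightarrow> nat) \<Rightarrow> nat \<Rightarrow> (nat \<Rightarrow> real) \<Rightarrow> (nat \<Rightarrow> real) \<Rightarrow> (nat \<Rightarrow> nat) \<Rightarrow> bool" where
  "reduced_cbc_output b m w s \<Gamma> \<gamma> z \<longleftrightarrow>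
     (\<forall>j\<in>{1..s}.
        if w j < m then
          is_arg_min (cbc_T b m w \<Gamma> \<gamma> z j) (\<lambda>y. y \<in> unit_residues (b ^ (m - w j))) (z j)
        else z j = 0)"

definition generating_vector :: "nat \<Rightarrow> (nat \<Rightarrow> nat) \<Rightarrow> (nat \<Rightarrow> nat) \<Rightarrow> nat \<Rightarrow> int" where
  "generating_vector b w z j = int (b ^ w j * z j)"

text \<open>The optional adjustment of \<open>m\<close> and \<open>w\<close> that makes \<open>w 1 = 0\<close>; note the truncated subtraction.\<close>
definition adjust_m :: "nat \<Rightarrow> (nat \<Rightarrow> nat) \<Rightarrow> nat" where
  "adjust_m m w = m - w 1"

definition adjust_w :: "(nat \<Rightarrow> nat) \<Rightarrow> nat \<Rightarrow> nat" where
  "adjust_w w j = w j - w 1"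

text \<open>\<open>\<infinity>\<close> if all \<open>w j\<close> are below \<open>m\<close>, and \<open>0\<close> if there is no \<open>j \<ge> 1\<close> with \<open>w j < m\<close>.\<close>
definition s_star :: "nat \<Rightarrow> (nat \<Rightarrow> nat) \<Rightarrow> enat" where
  "s_star m w = Sup (enat ` {j. 1 \<le> j \<and> w j < m})"

definition cbc_steps :: "nat \<Rightarrow> nat \<Rightarrow> (nat \<Rightarrow> nat) \<Rightarrow> nat set" where
  "cbc_steps s m w = {j. 1 \<le> j \<and> enat j \<le> min (enat s) (s_star m w)}"

section \<open>Arithmetic and memory cost\<close>

text \<open>
  Algebraic computation trees over real registers. Each executed instruction has unit cost:
  arithmetic operations and comparisons on reals, evaluation of \<open>\<omega>\<close> and of the roots of unity needed
  by an FFT, and loading an integer constant or an input weight. Branching is on real comparisons only,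
  so the output and all register addresses depend on the weights only through such comparisons.
  The output is a vector of integers written outside the registers.
\<close>
datatype instruction =
    Load_int nat int
  | Load_cos nat nat nat
  | Load_sin nat nat nat
  | Load_omega nat nat nat
  | Load_order_weight nat nat
  | Load_product_weight nat nat
  | Add nat nat nat
  | Sub nat nat nat
  | Mul nat nat nat
  | Div nat nat nat

datatype tree =
    Halt "nat \<Rightarrow> nat"
  | Exec instruction tree
  | If_le nat nat tree tree

text \<open>The first argument of every instruction is the target register.\<close>
primrec exec_instr ::
  "(nat \<Rightarrow> real) \<Rightarrow> (nat \<Rightarrow> real) \<Rightarrow> instruction \<Rightarrow> (nat \<Rightarrow> real) \<Rightarrow> nat \<Rightarrow> real" where
  "exec_instr \<Gamma> \<gamma> (Load_int r i) \<sigma> = \<sigma>(r := of_int i)"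
| "exec_instr \<Gamma> \<gamma> (Load_cos r k n) \<sigma> = \<sigma>(r := cos (2 * pi * real k / real n))"
| "exec_instr \<Gamma> \<gamma> (Load_sin r k n) \<sigma> = \<sigma>(r := sin (2 * pi * real k / real n))"
| "exec_instr \<Gamma> \<gamma> (Load_omega r k n) \<sigma> = \<sigma>(r := korobov_omega 2 (real k / real n))"
| "exec_instr \<Gamma> \<gamma> (Load_order_weight r l) \<sigma> = \<sigma>(r := \<Gamma> l)"
| "exec_instr \<Gamma> \<gamma> (Load_product_weight r j) \<sigma> = \<sigma>(r := \<gamma> j)"
| "exec_instr \<Gamma> \<gamma> (Add r p q) \<sigma> = \<sigma>(r := \<sigma> p + \<sigma> q)"
| "exec_instr \<Gamma> \<gamma> (Sub r p q) \<sigma> = \<sigma>(r := \<sigma> p - \<sigma> q)"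
| "exec_instr \<Gamma> \<gamma> (Mul r p q) \<sigma> = \<sigma>(r := \<sigma> p * \<sigma> q)"
| "exec_instr \<Gamma> \<gamma> (Div r p q) \<sigma> = \<sigma>(r := \<sigma> p / \<sigma> q)"

primrec instr_registers :: "instruction \<Rightarrow> nat set" where
  "instr_registers (Load_int r i) = {r}"
| "instr_registers (Load_cos r k n) = {r}"
| "instr_registers (Load_sin r k n) = {r}"
| "instr_registers (Load_omega r k n) = {r}"
| "instr_registers (Load_order_weight r l) = {r}"
| "instr_registers (Load_product_weight r j) = {r}"
| "instr_registers (Add r p q) = {r, p, q}"
| "instr_registers (Sub r p q) = {r, p, q}"
| "instr_registers (Mul r p q) = {r, p, q}"
| "instr_registers (Div r p q) = {r, p, q}"

primrec tree_registers :: "tree \<Rightarrow> nat set" where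
  "tree_registers (Halt z) = {}"
| "tree_registers (Exec i t) = instr_registers i \<union> tree_registers t"
| "tree_registers (If_le p q t1 t2) = {p, q} \<union> tree_registers t1 \<union> tree_registers t2"

definition memory_cost :: "tree \<Rightarrow> nat" where
  "memory_cost t = card (tree_registers t)"

primrec tree_output ::
  "(nat \<Rightarrow> real) \<Rightarrow> (nat \<Rightarrow> real) \<Rightarrow> tree \<Rightarrow> (nat \<Rightarrow> real) \<Rightarrow> nat \<Rightarrow> nat" where
  "tree_output \<Gamma> \<gamma> (Halt z) \<sigma> = z"
| "tree_output \<Gamma> \<gamma> (Exec i t) \<sigma> = tree_output \<Gamma> \<gamma> t (exec_instr \<Gamma> \<gamma> i \<sigma>)"
| "tree_output \<Gamma> \<gamma> (If_le p q t1 t2) \<sigma> =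
     (if \<sigma> p \<le> \<sigma> q then tree_output \<Gamma> \<gamma> t1 \<sigma> else tree_output \<Gamma> \<gamma> t2 \<sigma>)"

primrec tree_cost :: "(nat \<Rightarrow> real) \<Rightarrow> (nat \<Rightarrow> real) \<Rightarrow> tree \<Rightarrow> (nat \<Rightarrow> real) \<Rightarrow> nat" where
  "tree_cost \<Gamma> \<gamma> (Halt z) \<sigma> = 0"
| "tree_cost \<Gamma> \<gamma> (Exec i t) \<sigma> = Suc (tree_cost \<Gamma> \<gamma> t (exec_instr \<Gamma> \<gamma> i \<sigma>))"
| "tree_cost \<Gamma> \<gamma> (If_le p q t1 t2) \<sigma> =
     Suc (if \<sigma> p \<le> \<sigma> q then tree_cost \<Gamma> \<gamma> t1 \<sigma> else tree_cost \<Gamma> \<gamma> t2 \<sigma>)"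

text \<open>The register contents occurring during a run.\<close>
primrec tree_states ::
  "(nat \<Rightarrow> real) \<Rightarrow> (nat \<Rightarrow> real) \<Rightarrow> tree \<Rightarrow> (nat \<Rightarrow> real) \<Rightarrow> (nat \<Rightarrow> real) set" where
  "tree_states \<Gamma> \<gamma> (Halt z) \<sigma> = {\<sigma>}"
| "tree_states \<Gamma> \<gamma> (Exec i t) \<sigma> = insert \<sigma> (tree_states \<Gamma> \<gamma> t (exec_instr \<Gamma> \<gamma> i \<sigma>))"
| "tree_states \<Gamma> \<gamma> (If_le p q t1 t2) \<sigma> =
     insert \<sigma> (if \<sigma> p \<le> \<sigma> q then tree_states \<Gamma> \<gamma> t1 \<sigma> else tree_states \<Gamma> \<gamma> t2 \<sigma>)"

definition initial_state :: "nat \<Rightarrow> real" where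
  "initial_state = (\<lambda>r. 0)"

definition arithmetic_cost :: "(nat \<Rightarrow> real) \<Rightarrow> (nat \<Rightarrow> real) \<Rightarrow> tree \<Rightarrow> nat" where
  "arithmetic_cost \<Gamma> \<gamma> t = tree_cost \<Gamma> \<gamma> t initial_state"

text \<open>The entries \<open>v k\<close>, \<open>k \<in> K\<close>, are held in registers allocated by \<open>t\<close>.\<close>
definition holds_vector :: "tree \<Rightarrow> (nat \<Rightarrow> real) \<Rightarrow> nat set \<Rightarrow> (nat \<Rightarrow> real) \<Rightarrow> bool" where
  "holds_vector t \<sigma> K v \<longleftrightarrow> (\<forall>k\<in>K. \<exists>r\<in>tree_registers t. \<sigma> r = v k)"

text \<open>
  A run carries out the construction if it outputs the selected components and, for every step that
  is executed, computes the vectors of criteria on which the selection is based. These vectors are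
  demanded so that the cost is that of the construction itself, not just of any way of arriving
  at the same integers. With product weights, the vectors \<open>q\<^sub>j\<^sub>,\<^sub>l\<close> are needed only through their sum
  over \<open>l\<close>; in general, all of them are computed.
\<close>
definition carries_out_cbc ::
  "nat \<Rightarrow> nat \<Rightarrow> (nat \<Rightarrow> nat) \<Rightarrow> nat \<Rightarrow> (nat \<Rightarrow> real) \<Rightarrow> (nat \<Rightarrow> real) \<Rightarrow> tree \<Rightarrow> bool" where
  "carries_out_cbc b m w s \<Gamma> \<gamma> t \<longleftrightarrow>
     (let z = tree_output \<Gamma> \<gamma> t initial_state; S = tree_states \<Gamma> \<gamma> t initial_state in
      reduced_cbc_output b m w s \<Gamma> \<gamma> z \<and>
      (\<forall>j\<in>cbc_steps s m w.
         (\<exists>\<sigma>\<in>S. holds_vector t \<sigma> {..<b ^ (m - w j)} (cbc_qbar b m w \<Gamma> \<gamma> z j)) \<and>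
         (\<exists>\<sigma>\<in>S. holds_vector t \<sigma> (unit_residues (b ^ (m - w j))) (cbc_T b m w \<Gamma> \<gamma> z j))))"

definition carries_out_pod_cbc ::
  "nat \<Rightarrow> nat \<Rightarrow> (nat \<Rightarrow> nat) \<Rightarrow> nat \<Rightarrow> (nat \<Rightarrow> real) \<Rightarrow> (nat \<Rightarrow> real) \<Rightarrow> tree \<Rightarrow> bool" where
  "carries_out_pod_cbc b m w s \<Gamma> \<gamma> t \<longleftrightarrow>
     carries_out_cbc b m w s \<Gamma> \<gamma> t \<and>
     (let z = tree_output \<Gamma> \<gamma> t initial_state; S = tree_states \<Gamma> \<gamma> t initial_state in
      \<forall>j\<in>cbc_steps s m w. \<exists>\<sigma>\<in>S. \<forall>l\<in>{1..j}.
        holds_vector t \<sigma> {..<b ^ (m - w j)} (cbc_q b m w \<Gamma> \<gamma> z j l))"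

end

theory Submission
  imports Defs "HOL-Probability.Probability" "HOL-Number_Theory.Number_Theory" "HOL-Real_Asymp.Real_Asymp"
    "HOL-Library.Nat_Bijection"
begin

text \<open>
  Testing the weak derivatives of \<open>F\<close> against products of one-dimensional test functions represents
  \<open>F x\<close> as the sum over \<open>u\<close> of the integrals of \<open>\<Prod>j\<in>u. \<kappa> (x j) (y j)\<close> against the derivative of order
  \<open>u\<close>, averaged over the remaining variables. By the Cauchy-Schwarz inequality and the average over
  the shift, the mean square error is at most the squared norm of \<open>F\<close> times the squared worst-case
  error in the Korobov space. The criterion \<open>cbc_T\<close> is, up to a factor that does not depend on the
  candidate, the increment of this worst-case error, so the selected component does at least as well
  as an average over all units. By Jensen's inequality for the power \<open>lam \<le> 1\<close>, applied to the Fourier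
  coefficients of \<open>\<omega>\<close> collected in residue classes, this average is bounded by the claimed increment.

  For the cost, the columns of the matrix of \<open>\<omega>\<close> are sorted by their power of \<open>b\<close>. The units modulo
  \<open>b ^ r\<close> are cosets of the cyclic group generated by \<open>1 + b\<^sup>2\<close>, and on a pair of cosets the matrix acts as
  a cyclic correlation of length a power of \<open>b\<close>, computed by radix-\<open>b\<close> Fourier transforms. The number
  of pairs is bounded in terms of \<open>b\<close>.
\<close>

subsection \<open>The Korobov function of smoothness two\<close>

text \<open>The functions are only weakly differentiable, so point values are recovered by duality:
  the test functions satisfy \<open>\<phi>' = \<eta> - \<psi>\<close>, where \<open>\<eta>\<close>
  tends to 1 and \<open>\<psi>\<close> to a point mass at the node, so that a product of the
  \<open>\<psi>\<close> expands into mixed derivatives. They vanish near the boundary, hence shifts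
  that put a node there are discarded as a null set. The factor 2 in the error bound comes from
  \<open>b ^ t \<le> 2 * card (unit_residues (b ^ t))\<close>. Folded vectors are identified as sums
  over residue classes of vectors on all \<open>b ^ m\<close> points, which links the criterion to
  the worst-case error. In the cost part one tree has to serve all weights. It therefore branches on
  every possible selection, while all branches share their registers. The adjusted indices, with
  \<open>w 1 = 0\<close>, are used there because the fold of step \<open>j\<close> reads vectors of
  the previous length: the total length read is then at most twice the total length
  produced.\<close>

lemma Im_Ln_one_minus_cis:
  assumes "0 < t" "t < 2 * pi"
  shows "Im (Ln (1 - cis t)) = (t - pi) / 2"
proof -
  have s: "sin (t / 2) > 0"
    using assms by (intro sin_gt_zero) auto
  have c: "cos t = 1 - 2 * (sin (t / 2))\<^sup>2" "sin t = 2 * sin (t / 2) * cos (t / 2)"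
    using cos_double_sin[of "t / 2"] sin_double[of "t / 2"] by simp_all
  \<comment> \<open>Polar form: \<open>1 - cis t\<close> has modulus \<open>2 * sin (t / 2)\<close>
    and angle \<open>(t - pi) / 2\<close>, which lies in the principal range for
    \<open>0 < t < 2 * pi\<close>.\<close>
  have "exp (Complex (ln (2 * sin (t / 2))) ((t - pi) / 2)) = 1 - cis t"
    using s c
    by (simp add: exp_eq_polar complex_eq_iff diff_divide_distrib cos_diff sin_diff power2_eq_square)
  moreover have "Ln (exp (Complex (ln (2 * sin (t / 2))) ((t - pi) / 2))) = Complex (ln (2 * sin (t / 2))) ((t - pi) / 2)"
    using assms by (intro Ln_exp) (auto simp: field_simps)
  ultimately show ?thesis
    by simp
qed

lemma Im_Ln_one_minus_sums:
  assumes "0 \<le> r" "r < (1 :: real)"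
  shows "(\<lambda>n. - (r ^ n * sin (real n * t) / real n)) sums Im (Ln (1 - of_real r * cis t))"
proof -
  have "(\<lambda>n. - ((- (- (of_real r * cis t))) ^ n) / of_nat n) sums Ln (1 + (- (of_real r * cis t)))"
    using assms by (intro Ln_series') (simp add: norm_mult)
  then have "(\<lambda>n. Im (- ((of_real r * cis t) ^ n) / of_nat n)) sums Im (Ln (1 - of_real r * cis t))"
    by (intro bounded_linear.sums[OF bounded_linear_Im]) simp
  then show ?thesis
    by (simp add: power_mult_distrib Complex.DeMoivre flip: of_real_power)
qed

lemma summable_inverse_squares': "summable (\<lambda>n. 1 / (real n)\<^sup>2)"
  using inverse_power_summable[of 2, where ?'a = real] by (simp add: field_simps)

text \<open>For \<open>r < 1\<close> the derived series is dominated by a geometric series, so it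
  may be differentiated term by term. At \<open>r = 1\<close> the derived series converges only
  conditionally; hence the detour through Abel summation.\<close>

lemma abel_cos_series_deriv:
  assumes "0 \<le> r" "r < (1 :: real)"
  shows "((\<lambda>t. \<Sum>n. r ^ n * cos (real n * t) / (real n)\<^sup>2) has_field_derivative
           Im (Ln (1 - of_real r * cis t))) (at t)"
proof -
  let ?f = "\<lambda>n t. r ^ n * cos (real n * t) / (real n)\<^sup>2"
  let ?f' = "\<lambda>n t. - (r ^ n * sin (real n * t) / real n)"
  have d: "(?f n has_field_derivative ?f' n x) (at x within UNIV)" for n x
    by (cases "n = 0") (auto intro!: derivative_eq_intros simp: power2_eq_square)
  have u: "uniformly_convergent_on UNIV (\<lambda>n x. \<Sum>i<n. ?f' i x)"
  proof (rule Weierstrass_m_test'[where M = "\<lambda>n. r ^ n"])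
    fix n :: nat and x :: real
    show "norm (?f' n x) \<le> r ^ n"
    proof (cases "n = 0")
      case False
      have "r ^ n * \<bar>sin (real n * x)\<bar> \<le> r ^ n * 1"
        using assms by (intro mult_left_mono) auto
      also have "\<dots> \<le> r ^ n * real n"
        using assms False by (intro mult_left_mono) auto
      finally show ?thesis
        using False assms by (simp add: abs_mult field_simps)
    qed (use assms in auto)
  qed (use assms in \<open>auto intro: summable_geometric\<close>)
  have s0: "summable (\<lambda>n. ?f n t)"
  proof (rule summable_comparison_test_ev[OF _ summable_inverse_squares'])
    show "\<forall>\<^sub>F n in sequentially. norm (?f n t) \<le> 1 / (real n)\<^sup>2"
      using assms
      by (intro always_eventually) (auto intro!: divide_right_mono mult_le_one power_le_one simp: abs_mult)
  qed
  have "((\<lambda>x. \<Sum>n. ?f n x) has_field_derivative (\<Sum>n. ?f' n t)) (at t)"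
    by (rule has_field_derivative_series'(2)[OF convex_UNIV d u _ s0]) auto
  moreover have "(\<Sum>n. ?f' n t) = Im (Ln (1 - of_real r * cis t))"
    using Im_Ln_one_minus_sums[OF assms] by (simp add: sums_iff)
  ultimately show ?thesis
    by simp
qed

text \<open>The derivative for \<open>r < 1\<close> is integrated over \<open>{0..t}\<close> and
  \<open>r\<close> tends to 1. The imaginary parts of the logarithms are bounded by
  \<open>pi\<close>, and their limit is the sawtooth \<open>(x - pi) / 2\<close>. The constant
  \<open>pi\<^sup>2 / 6\<close> is the Basel sum, the value at \<open>t = 0\<close>.\<close>

lemma cos_inverse_squares:
  assumes "0 \<le> t" "t \<le> 2 * pi"
  shows "(\<Sum>n. cos (real n * t) / (real n)\<^sup>2) = t\<^sup>2 / 4 - pi * t / 2 + pi\<^sup>2 / 6"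
proof -
  define r where "r = (\<lambda>k. 1 - 1 / (real k + 1))"
  have r: "0 \<le> r k" "r k < 1" for k
    by (auto simp: r_def field_simps)
  have r_lim: "r \<longlonglongrightarrow> 1"
    unfolding r_def by real_asymp
  define S where "S = (\<lambda>r t. \<Sum>n. r ^ n * cos (real n * t) / (real n)\<^sup>2)"
  have S_lim: "(\<lambda>k. S (r k) x) \<longlonglongrightarrow> S 1 x" for x
    unfolding S_def
  proof (rule tannerys_theorem[where M = "\<lambda>n. 1 / (real n)\<^sup>2", THEN conjunct2, THEN conjunct2])
    show "((\<lambda>k. r k ^ n * cos (real n * x) / (real n)\<^sup>2) \<longlongrightarrow> 1 ^ n * cos (real n * x) / (real n)\<^sup>2) sequentially" for n
      by (cases "n = 0") (simp, intro tendsto_divide tendsto_mult tendsto_power r_lim tendsto_const, simp)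
    show "\<forall>\<^sub>F (k, n) in at_top \<times>\<^sub>F sequentially.
      norm (r n ^ k * cos (real k * x) / (real k)\<^sup>2) \<le> 1 / (real k)\<^sup>2"
      by (intro always_eventually)
         (auto intro!: divide_right_mono mult_le_one power_le_one simp: abs_mult r less_imp_le abs_of_nonneg[OF r(1)])
  qed (use summable_inverse_squares' in auto)
  \<comment> \<open>At the two exceptional points \<open>cis x = 1\<close>, where the logarithm of a
    positive real has imaginary part 0. These points are removed again by a finite spike.\<close>
  define g where "g = (\<lambda>x. if x = 0 \<or> x = 2 * pi then 0 else (x - pi) / 2)"
  have g_int: "(g has_integral (S 1 t - S 1 0)) {0..t}"
  proof (rule has_integral_dominated_convergence)
    show "((\<lambda>x. Im (Ln (1 - of_real (r k) * cis x))) has_integral (S (r k) t - S (r k) 0)) {0..t}" for k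
    proof (rule fundamental_theorem_of_calculus)
      fix x assume "x \<in> {0..t}"
      show "(S (r k) has_vector_derivative Im (Ln (1 - of_real (r k) * cis x))) (at x within {0..t})"
        unfolding S_def
        using abel_cos_series_deriv[OF r, of k x]
        by (auto simp: has_real_derivative_iff_has_vector_derivative intro: has_vector_derivative_at_within)
    qed (use assms in auto)
    show "(\<lambda>x. pi) integrable_on {0..t}"
      by (rule integrable_const_ivl)
    show "\<forall>x\<in>{0..t}. norm (Im (Ln (1 - of_real (r k) * cis x))) \<le> pi" for k
    proof
      fix x
      have "cmod (of_real (r k) * cis x) < 1"
        using r by (simp add: norm_mult)
      then have "1 - of_real (r k) * cis x \<noteq> 0"
        by auto
      then show "norm (Im (Ln (1 - of_real (r k) * cis x))) \<le> pi"
        using Im_Ln_le_pi[of "1 - of_real (r k) * cis x"] mpi_less_Im_Ln[of "1 - of_real (r k) * cis x"]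
        by auto
    qed
    show "\<forall>x\<in>{0..t}. (\<lambda>k. Im (Ln (1 - of_real (r k) * cis x))) \<longlonglongrightarrow> g x"
    proof
      fix x assume x: "x \<in> {0..t}"
      show "(\<lambda>k. Im (Ln (1 - of_real (r k) * cis x))) \<longlonglongrightarrow> g x"
      proof (cases "x = 0 \<or> x = 2 * pi")
        case True
        then have "cis x = 1"
          by (auto simp: complex_eq_iff)
        moreover have "Im (Ln (1 - of_real (r k))) = 0" for k
          using r[of k] Im_Ln_eq_0[of "1 - of_real (r k) :: complex"]
          by (auto simp: complex_eq_iff)
        ultimately have "Im (Ln (1 - of_real (r k) * cis x)) = 0" for k
          by simp
        then show ?thesis
          using True by (simp add: g_def)
      next
        case False
        then have x': "0 < x" "x < 2 * pi"
          using x assms by auto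
        have "cos x < 1"
          using cos_double_sin[of "x / 2"] sin_gt_zero[of "x / 2"] x' by simp
        then have "1 - cis x \<notin> \<real>\<^sub>\<le>\<^sub>0"
          by (auto simp: complex_nonpos_Reals_iff)
        moreover have "(\<lambda>k. 1 - of_real (r k) * cis x) \<longlonglongrightarrow> 1 - of_real 1 * cis x"
          by (intro tendsto_intros r_lim)
        ultimately have "(\<lambda>k. Im (Ln (1 - of_real (r k) * cis x))) \<longlonglongrightarrow> Im (Ln (1 - cis x))"
          by (intro tendsto_Im tendsto_Ln) auto
        then show ?thesis
          using False Im_Ln_one_minus_cis[OF x'] by (simp add: g_def)
      qed
    qed
    show "(\<lambda>k. S (r k) t - S (r k) 0) \<longlonglongrightarrow> S 1 t - S 1 0"
      by (intro tendsto_diff S_lim)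
  qed
  have "((\<lambda>x. (x - pi) / 2) has_integral ((t\<^sup>2 / 4 - pi * t / 2) - (0\<^sup>2 / 4 - pi * 0 / 2))) {0..t}"
    using assms
    by (intro fundamental_theorem_of_calculus)
       (auto intro!: derivative_eq_intros simp flip: has_real_derivative_iff_has_vector_derivative simp: field_simps)
  then have "(g has_integral (t\<^sup>2 / 4 - pi * t / 2)) {0..t}"
    by (subst has_integral_spike_finite_eq[where S = "{0, 2 * pi}" and g = "\<lambda>x. (x - pi) / 2"]) (auto simp: g_def)
  with g_int have "S 1 t - S 1 0 = t\<^sup>2 / 4 - pi * t / 2"
    by (rule has_integral_unique)
  \<comment> \<open>The sum starts at \<open>0\<close>, whose term \<open>1 / 0\<close> is
    0.\<close>
  moreover have "(\<lambda>n. 1 / (real n)\<^sup>2) sums (pi\<^sup>2 / 6)"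
    using inverse_squares_sums sums_Suc_iff[of "\<lambda>n. 1 / (real n)\<^sup>2" "pi\<^sup>2 / 6"] by simp
  then have "S 1 0 = pi\<^sup>2 / 6"
    by (simp add: S_def sums_iff)
  ultimately show ?thesis
    by (simp add: S_def)
qed

lemma
  fixes f :: "int \<Rightarrow> 'a :: banach"
  assumes "summable (\<lambda>n. norm (f (int n)))" "summable (\<lambda>n. norm (f (- int n)))"
  shows abs_summable_on_nonzero_int: "(\<lambda>h. norm (f h)) summable_on (- {0})"
    and infsum_nonzero_int: "infsum f (- {0}) = (\<Sum>n. f (int (Suc n))) + (\<Sum>n. f (- int (Suc n)))"
proof -
  let ?p = "\<lambda>n. int (Suc n)" and ?m = "\<lambda>n. - int (Suc n)"
  have U: "- {0 :: int} = range ?p \<union> range ?m"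
  proof -
    have "x \<in> range ?p \<union> range ?m" if "x \<noteq> 0" for x :: int
    proof (cases "x > 0")
      case True
      then have "x = ?p (nat x - 1)" by auto
      then show ?thesis by blast
    next
      case False
      with that have "x = ?m (nat (- x) - 1)" by auto
      then show ?thesis by blast
    qed
    then show ?thesis by auto
  qed
  have D: "range ?p \<inter> range ?m = {}"
    by auto
  have inj: "inj ?p" "inj ?m"
    by (auto simp: inj_on_def)
  have s: "summable (\<lambda>n. norm (f (?p n)))" "summable (\<lambda>n. norm (f (?m n)))"
    using assms summable_Suc_iff[of "\<lambda>n. norm (f (int n))"] summable_Suc_iff[of "\<lambda>n. norm (f (- int n))"]
    by blast+
  have a: "(\<lambda>n. norm (f (?p n))) summable_on UNIV" "(\<lambda>n. norm (f (?m n))) summable_on UNIV"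
    using s by (auto intro!: norm_summable_imp_summable_on)
  show "(\<lambda>h. norm (f h)) summable_on (- {0})"
    unfolding U using a
    by (intro summable_on_Un_disjoint D) (simp_all only: summable_on_reindex[OF inj(1)] summable_on_reindex[OF inj(2)] o_def)
  have h: "((\<lambda>n. f (?p n)) has_sum (\<Sum>n. f (?p n))) UNIV" "((\<lambda>n. f (?m n)) has_sum (\<Sum>n. f (?m n))) UNIV"
    using s by (auto intro!: norm_summable_imp_has_sum summable_sums dest: summable_norm_cancel)
  show "infsum f (- {0}) = (\<Sum>n. f (?p n)) + (\<Sum>n. f (?m n))"
    unfolding U
    using h
    by (intro infsumI has_sum_Un_disjoint D) (simp_all only: has_sum_reindex[OF inj(1)] has_sum_reindex[OF inj(2)] o_def)
qed

lemma powr_two_abs_int: "\<bar>of_int h\<bar> powr 2 = (of_int h :: real)\<^sup>2"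
  by (cases "h = 0") auto

text \<open>Pairing \<open>h\<close> with \<open>- h\<close> leaves twice a cosine series. The
  result is \<open>2 * pi\<^sup>2\<close> times the Bernoulli polynomial of degree two; this is the
  factor by which \<open>korobov_weights\<close> divides.\<close>

lemma korobov_omega_2:
  assumes "0 \<le> x" "x \<le> 1"
  shows "korobov_omega 2 x = 2 * pi\<^sup>2 * (x\<^sup>2 - x + 1 / 6)"
proof -
  let ?f = "\<lambda>h::int. cis (2 * pi * of_int h * x) / of_real (\<bar>of_int h\<bar> powr 2)"
  have s: "summable (\<lambda>n. norm (?f (int n)))" "summable (\<lambda>n. norm (?f (- int n)))"
    using summable_inverse_squares' by (simp_all add: norm_divide powr_two_abs_int norm_power)
  then have s': "summable (\<lambda>n. ?f (int n))" "summable (\<lambda>n. ?f (- int n))"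
    by (auto dest: summable_norm_cancel)
  have "infsum ?f (UNIV - {0}) = (\<Sum>n. ?f (int (Suc n))) + (\<Sum>n. ?f (- int (Suc n)))"
    using infsum_nonzero_int[OF s] by (simp add: Compl_eq_Diff_UNIV)
  \<comment> \<open>The term at \<open>0\<close>, a division by 0, vanishes, so both series may
    start there.\<close>
  also have "\<dots> = (\<Sum>n. ?f (int n)) + (\<Sum>n. ?f (- int n))"
    using suminf_split_head[OF s'(1)] suminf_split_head[OF s'(2)] by simp
  finally have "korobov_omega 2 x = Re (\<Sum>n. ?f (int n)) + Re (\<Sum>n. ?f (- int n))"
    by (simp add: korobov_omega_def)
  also have "\<dots> = (\<Sum>n. Re (?f (int n))) + (\<Sum>n. Re (?f (- int n)))"
    by (simp only: bounded_linear.suminf[OF bounded_linear_Re s'(1)] bounded_linear.suminf[OF bounded_linear_Re s'(2)])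
  also have "\<dots> = 2 * (\<Sum>n. cos (real n * (2 * pi * x)) / (real n)\<^sup>2)"
    by (simp add: powr_two_abs_int algebra_simps)
  also have "\<dots> = 2 * pi\<^sup>2 * (x\<^sup>2 - x + 1 / 6)"
    using assms by (subst cos_inverse_squares) (auto simp: field_simps power2_eq_square)
  finally show ?thesis .
qed

subsection \<open>Test functions in one variable\<close>

abbreviation unit_interval_measure :: "real measure" where
  "unit_interval_measure \<equiv> restrict_space lborel {-1/2..1/2}"

lemma prob_space_unit_interval: "prob_space unit_interval_measure"
  by (intro prob_space_restrict_space) simp_all

lemma integral_unit_interval:
  assumes "continuous_on {-1/2..1/2} f"
  shows "(LINT y|unit_interval_measure. f y) = integral {-1/2..1/2} (f :: real \<Rightarrow> real)"
    and "integrable unit_interval_measure f"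
proof -
  have "set_integrable lborel {-1/2..1/2} f"
    using borel_integrable_atLeastAtMost'[OF assms] by simp
  then show "(LINT y|unit_interval_measure. f y) = integral {-1/2..1/2} f"
    "integrable unit_interval_measure f"
    by (simp_all add: integral_restrict_space integrable_restrict_space set_lebesgue_integral_def
      set_integrable_def flip: set_borel_integral_eq_integral(2))
qed

text \<open>For smooth \<open>f\<close> in one variable, \<open>f x\<close> is the mean of
  \<open>f\<close> plus the integral of \<open>f'\<close> against this kernel: the part
  \<open>y + 1/2\<close> is integrated by parts, and the jump at \<open>x\<close> produces the point
  value.\<close>

definition bernoulli_kernel :: "real \<Rightarrow> real \<Rightarrow> real" where
  "bernoulli_kernel x y = y + 1/2 - (if x < y then 1 else 0)"

lemma integral_eq_if_support:
  assumes "\<And>t. f t \<noteq> 0 \<Longrightarrow> t \<in> A \<longleftrightarrow> t \<in> B"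
  shows "integral A f = integral B (f :: real \<Rightarrow> real)"
proof -
  have "(\<lambda>t. if t \<in> A then f t else 0) = (\<lambda>t. if t \<in> B then f t else 0)"
    using assms by fastforce
  then show ?thesis
    by (metis integral_restrict_UNIV)
qed

text \<open>The antiderivative starts at \<open>-1\<close>, to the left of the support, so that it
  is differentiable at \<open>-1/2\<close> as well and vanishes to the left of it.\<close>

lemma antiderivative_of_supported:
  assumes c: "continuous_on UNIV f" and z: "\<And>t. t \<le> -1/2 \<Longrightarrow> f t = (0 :: real)"
  shows "((\<lambda>y. integral {-1..y} f) has_real_derivative f y) (at y)"
proof (cases "y > -1")
  case True
  have "((\<lambda>y. integral {-1..y} f) has_real_derivative f y) (at y within {-1..y+1})"
    using True by (intro integral_has_real_derivative continuous_on_subset[OF c]) auto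
  then show ?thesis
    using True by (simp add: at_within_Icc_at)
next
  case False
  have "integral {-1..t} f = 0" if "t < -1/2" for t
    using that z integral_eq_if_support[of f "{-1..t}" "{}"] by force
  then have "\<forall>\<^sub>F t in nhds y. integral {-1..t} f = 0"
    using False by (intro eventually_mono[OF eventually_nhds_in_open[of "{..<-1/2}"]]) auto
  then show ?thesis
    using False z[of y] by (subst DERIV_cong_ev[OF refl _ refl]) auto
qed

text \<open>\<open>\<eta>\<close> is a cut-off tending to 1, \<open>\<psi>\<close> a bump at
  \<open>x\<close> whose mass tends to 1, and \<open>\<phi>\<close> an antiderivative of
  \<open>\<eta> - \<psi>\<close>. Its limit is the antiderivative of 1 minus a unit mass at
  \<open>x\<close>, which is \<open>bernoulli_kernel x\<close>.\<close>

lemma one_dim_test_sequences: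
  fixes x :: real
  assumes x: "-1/2 < x" "x < 1/2"
  obtains \<eta> \<eta>' \<phi> \<psi> :: "nat \<Rightarrow> real \<Rightarrow> real" and \<delta> :: "nat \<Rightarrow> real" where
    "\<And>n y. (\<eta> n has_real_derivative \<eta>' n y) (at y)" "\<And>n. continuous_on UNIV (\<eta>' n)"
    "\<And>n y. (\<phi> n has_real_derivative (\<eta> n y - \<psi> n y)) (at y)" "\<And>n. continuous_on UNIV (\<psi> n)"
    "\<And>n. 0 < \<delta> n"
    "\<And>n y. \<bar>y\<bar> > 1/2 - \<delta> n \<Longrightarrow> \<eta> n y = 0" "\<And>n y. \<bar>y\<bar> > 1/2 - \<delta> n \<Longrightarrow> \<phi> n y = 0"
    "\<And>n y. 0 \<le> \<eta> n y" "\<And>n y. \<eta> n y \<le> 1" "\<And>n y. \<bar>y\<bar> \<le> 1/2 \<Longrightarrow> \<bar>\<phi> n y\<bar> \<le> 1" "\<And>n y. 0 \<le> \<psi> n y"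
    "\<And>y. \<bar>y\<bar> < 1/2 \<Longrightarrow> (\<lambda>n. \<eta> n y) \<longlonglongrightarrow> 1"
    "\<And>y. \<bar>y\<bar> < 1/2 \<Longrightarrow> y \<noteq> x \<Longrightarrow> (\<lambda>n. \<phi> n y) \<longlonglongrightarrow> bernoulli_kernel x y"
    "\<And>n y. \<psi> n y \<noteq> 0 \<Longrightarrow> \<bar>y - x\<bar> < 1 / (real n + 1)"
    "(\<lambda>n. LINT y|unit_interval_measure. \<psi> n y) \<longlonglongrightarrow> 1"
proof -
  \<comment> \<open>Positive only at some distance from the boundary, with limit
    \<open>1/4 - y\<^sup>2\<close>; the offset 5 keeps \<open>1/4 - 1 / (real n + 5)\<close>
    positive for every \<open>n\<close>. Squaring the positive part makes \<open>\<eta>\<close>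
    continuously differentiable, and the factor \<open>real n\<close> drives it to 1 in the
    interior.\<close>
  define d where "d = (\<lambda>(n::nat) y::real. 1/4 - 1 / (real n + 5) - y\<^sup>2)"
  define \<eta> where "\<eta> = (\<lambda>n y. 1 - 1 / (1 + real n * (max 0 (d n y))\<^sup>2))"
  define \<eta>' where "\<eta>' = (\<lambda>n y. real n * (2 * max 0 (d n y) * (- 2 * y)) / (1 + real n * (max 0 (d n y))\<^sup>2)\<^sup>2)"
  define h where "h = (1/2 - \<bar>x\<bar>) / 4"
  have h: "h > 0" "4 * h = 1/2 - \<bar>x\<bar>"
    using x by (auto simp: h_def)
  \<comment> \<open>The half-width \<open>1 / a n\<close> of the tent \<open>\<tau>\<close> is at
    most \<open>h\<close>, a quarter of the distance from \<open>x\<close> to the boundary, and at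
    most \<open>1 / (real n + 1)\<close>, which concentrates it at \<open>x\<close>.\<close>
  define a where "a = (\<lambda>n. (real n + 1) * (1 + 1 / h))"
  have a_h: "1 / a n \<le> h" and a_n: "1 / a n \<le> 1 / (real n + 1)" and a_pos: "a n > 0" for n
  proof -
    have "(real n + 1) * 1 \<le> a n"
      unfolding a_def using h by (intro mult_left_mono) auto
    then show *: "1 / a n \<le> 1 / (real n + 1)" "a n > 0"
      by (auto simp: field_simps)
    have "1 * (1 / h) \<le> a n"
      unfolding a_def using h by (intro mult_mono) auto
    then show "1 / a n \<le> h"
      using h *(2) by (simp add: field_simps)
  qed
  define \<tau> where "\<tau> = (\<lambda>n y. max 0 (1 - a n * \<bar>y - x\<bar>))"
  define I where "I = (\<lambda>n. integral {-1..1} (\<tau> n))"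
  define c where "c = (\<lambda>n. integral {-1..1} (\<eta> n))"
  \<comment> \<open>The tent is rescaled to the mass \<open>c n\<close> of \<open>\<eta> n\<close>,
    so that \<open>\<phi> n\<close> returns to 0 to the right of both supports.\<close>
  define \<psi> where "\<psi> = (\<lambda>n y. c n / I n * \<tau> n y)"
  define \<phi> where "\<phi> = (\<lambda>n y. integral {-1..y} (\<lambda>t. \<eta> n t - \<psi> n t))"
  define \<delta> where "\<delta> = (\<lambda>n. min (1 / (real n + 5)) h)"
  have \<delta>_pos: "\<delta> n > 0" for n
    using h by (auto simp: \<delta>_def)
  have den: "1 + real n * (max 0 (d n y))\<^sup>2 > 0" for n y
    by (simp add: add_pos_nonneg)
  have max2: "((\<lambda>t::real. (max 0 t)\<^sup>2) has_real_derivative 2 * max 0 t) (at t)" for t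
  proof (cases t "0::real" rule: linorder_cases)
    case less
    have "((\<lambda>t::real. 0) has_real_derivative 2 * max 0 t) (at t)"
      using less by auto
    then show ?thesis
      by (rule has_field_derivative_transform_within_open[of _ _ _ "{..<0}"]) (use less in auto)
  next
    case greater
    have "((\<lambda>t::real. t\<^sup>2) has_real_derivative 2 * max 0 t) (at t)"
      using greater by (auto intro!: derivative_eq_intros)
    then show ?thesis
      by (rule has_field_derivative_transform_within_open[of _ _ _ "{0<..}"]) (use greater in auto)
  next
    case equal
    have "(\<lambda>h::real. (max 0 h)\<^sup>2 / h) \<midarrow>0\<rightarrow> 0"
    proof (rule Lim_null_comparison[where g = "\<lambda>h. \<bar>h\<bar>"])
      show "\<forall>\<^sub>F h::real in at 0. norm ((max 0 h)\<^sup>2 / h) \<le> \<bar>h\<bar>"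
        by (intro always_eventually) (auto simp: max_def power2_eq_square)
    qed (auto intro!: tendsto_eq_intros)
    then show ?thesis
      using equal by (simp add: DERIV_def)
  qed
  have \<eta>_deriv: "(\<eta> n has_real_derivative \<eta>' n y) (at y)" for n y
  proof -
    have "((\<lambda>y. d n y) has_real_derivative - 2 * y) (at y)"
      unfolding d_def by (auto intro!: derivative_eq_intros)
    from DERIV_chain2[OF max2 this]
    have "((\<lambda>y. (max 0 (d n y))\<^sup>2) has_real_derivative 2 * max 0 (d n y) * (- 2 * y)) (at y)" .
    moreover have "((\<lambda>y. 1 - 1 / (1 + real n * p y)) has_real_derivative real n * p' / (1 + real n * p y)\<^sup>2) (at y)"
      if "(p has_real_derivative p') (at y)" "1 + real n * p y > 0" for p p'
      using that by (auto intro!: derivative_eq_intros simp: power2_eq_square)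
    ultimately show ?thesis
      unfolding \<eta>_def \<eta>'_def
      using den[of n y] by blast
  qed
  have \<eta>_cont: "continuous_on UNIV (\<eta> n)" for n
    using \<eta>_deriv by (meson DERIV_continuous_on has_field_derivative_at_within)
  have \<eta>'_cont: "continuous_on UNIV (\<eta>' n)" for n
    unfolding \<eta>'_def d_def using den[of n, unfolded d_def]
    by (intro continuous_intros) (auto simp: less_imp_neq[symmetric])
  have \<eta>_01: "0 \<le> \<eta> n y" "\<eta> n y \<le> 1" for n y
    using den[of n y] by (auto simp: \<eta>_def field_simps)
  have \<eta>_supp: "\<eta> n y = 0" if "\<bar>y\<bar> > 1/2 - \<delta> n" for n y
  proof -
    have "\<delta> n \<le> 1 / (real n + 5)" "1 / (real n + 5) \<le> 1 / 5"
      by (auto simp: \<delta>_def field_simps)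
    then have "\<delta> n \<le> 1 / 5"
      by linarith
    then have "(1/2 - \<delta> n)\<^sup>2 \<le> y\<^sup>2"
      using that by (intro abs_le_square_iff[THEN iffD1]) auto
    moreover have "(1/2 - \<delta> n)\<^sup>2 \<ge> 1/4 - \<delta> n"
      by (simp add: power2_eq_square algebra_simps)
    ultimately have "d n y \<le> 0"
      using \<open>\<delta> n \<le> 1 / (real n + 5)\<close> unfolding d_def by linarith
    then show ?thesis
      by (simp add: \<eta>_def max_def)
  qed
  have \<tau>_cont: "continuous_on UNIV (\<tau> n)" for n
    unfolding \<tau>_def by (intro continuous_intros)
  have \<tau>_supp: "\<bar>y - x\<bar> < 1 / a n" if "\<tau> n y \<noteq> 0" for n y
    using that a_pos[of n] by (auto simp: \<tau>_def max_def field_simps split: if_splits)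
  have \<tau>_nonneg: "\<tau> n y \<ge> 0" for n y
    by (simp add: \<tau>_def)
  have \<tau>_supp': "\<tau> n y = 0" if "\<bar>y\<bar> > 1/2 - \<delta> n" for n y
    using that \<tau>_supp[of n y] a_h[of n] h unfolding \<delta>_def by fastforce
  have I_pos: "I n > 0" for n
  proof -
    have "I n \<ge> 0"
      unfolding I_def by (intro integral_nonneg integrable_continuous_interval continuous_on_subset[OF \<tau>_cont]) (auto simp: \<tau>_nonneg)
    moreover have "I n \<noteq> 0"
    proof
      assume "I n = 0"
      then have "\<tau> n x = 0"
        using integral_eq_0_iff[of "-1" 1 "\<tau> n"] x \<tau>_nonneg continuous_on_subset[OF \<tau>_cont]
        unfolding I_def by auto
      then show False
        by (simp add: \<tau>_def)
    qed
    ultimately show ?thesis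
      by simp
  qed
  have \<psi>_cont: "continuous_on UNIV (\<psi> n)" for n
    unfolding \<psi>_def by (intro continuous_intros \<tau>_cont)
  have c_eq: "c n = integral {-1/2..1/2} (\<eta> n)" for n
    unfolding c_def using \<eta>_supp[of n] \<delta>_pos[of n] by (intro integral_eq_if_support) force
  have c01: "0 \<le> c n" "c n \<le> 1" for n
  proof -
    have "(\<eta> n) integrable_on {-1/2..1/2}"
      by (intro integrable_continuous_interval continuous_on_subset[OF \<eta>_cont]) auto
    then have "0 \<le> c n" "c n \<le> integral {-1/2..1/2} (\<lambda>_::real. 1::real)"
      unfolding c_eq using \<eta>_01 by (intro integral_nonneg integral_le integrable_const_ivl; simp)+
    then show "0 \<le> c n" "c n \<le> 1"
      by auto
  qed
  have \<psi>_nonneg: "\<psi> n y \<ge> 0" for n y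
    unfolding \<psi>_def using c01 I_pos[of n] \<tau>_nonneg by (simp add: less_imp_le)
  have \<psi>_supp: "\<bar>y - x\<bar> < 1 / (real n + 1)" if "\<psi> n y \<noteq> 0" for n y
    using that \<tau>_supp[of n y] a_n[of n] by (auto simp: \<psi>_def)
  have \<psi>_supp': "\<psi> n y = 0" if "\<bar>y\<bar> > 1/2 - \<delta> n" for n y
    using \<tau>_supp'[OF that] by (simp add: \<psi>_def)
  have int: "\<eta> n integrable_on {u..v}" "\<psi> n integrable_on {u..v}" for n u v
    by (auto intro!: integrable_continuous_interval continuous_on_subset[OF \<eta>_cont] continuous_on_subset[OF \<psi>_cont])
  have \<psi>_int: "integral {-1..1} (\<psi> n) = c n" for n
    unfolding \<psi>_def using I_pos[of n] by (simp add: I_def)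
  have \<phi>_split: "\<phi> n y = integral {-1..y} (\<eta> n) - integral {-1..y} (\<psi> n)" for n y
    unfolding \<phi>_def by (intro integral_diff int)
  have \<phi>_deriv: "(\<phi> n has_real_derivative (\<eta> n y - \<psi> n y)) (at y)" for n y
    unfolding \<phi>_def
  proof (rule antiderivative_of_supported)
    show "continuous_on UNIV (\<lambda>t. \<eta> n t - \<psi> n t)"
      by (intro continuous_intros \<eta>_cont \<psi>_cont)
    show "\<eta> n t - \<psi> n t = 0" if "t \<le> -1/2" for t
      using \<eta>_supp[of n t] \<psi>_supp'[of n t] \<delta>_pos[of n] that by auto
  qed
  have \<phi>_supp: "\<phi> n y = 0" if "\<bar>y\<bar> > 1/2 - \<delta> n" for n y
  proof (cases "y \<ge> 0")
    case True
    have "integral {-1..y} (\<eta> n) = integral {-1..1} (\<eta> n)"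
      "integral {-1..y} (\<psi> n) = integral {-1..1} (\<psi> n)"
      using \<eta>_supp[of n] \<psi>_supp'[of n] \<delta>_pos[of n] that True by (intro integral_eq_if_support; force)+
    then show ?thesis
      by (simp add: \<phi>_split \<psi>_int c_def)
  next
    case False
    have "integral {-1..y} (\<eta> n) = integral {} (\<eta> n)" "integral {-1..y} (\<psi> n) = integral {} (\<psi> n)"
      using \<eta>_supp[of n] \<psi>_supp'[of n] \<delta>_pos[of n] that False by (intro integral_eq_if_support; force)+
    then show ?thesis
      by (simp add: \<phi>_split)
  qed
  have \<phi>_bound: "\<bar>\<phi> n y\<bar> \<le> 1" if "\<bar>y\<bar> \<le> 1/2" for n y
  proof -
    have "0 \<le> integral {-1..y} (\<eta> n)" "0 \<le> integral {-1..y} (\<psi> n)"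
      by (auto intro!: integral_nonneg int \<eta>_01 \<psi>_nonneg)
    moreover have "integral {-1..y} (\<eta> n) \<le> c n" "integral {-1..y} (\<psi> n) \<le> integral {-1..1} (\<psi> n)"
      unfolding c_def using that by (auto intro!: integral_subset_le int \<eta>_01 \<psi>_nonneg)
    ultimately show ?thesis
      using c01[of n] by (simp add: \<phi>_split \<psi>_int)
  qed
  have \<eta>_lim: "(\<lambda>n. \<eta> n y) \<longlonglongrightarrow> 1" if "\<bar>y\<bar> < 1/2" for y
  proof -
    have "y\<^sup>2 < (1/2)\<^sup>2"
      using abs_square_less_1[of "2 * y"] that unfolding abs_mult by (simp add: power2_eq_square)
    then have e: "1/4 - y\<^sup>2 > 0"
      by (simp add: power2_eq_square)
    have "(\<lambda>n. d n y) \<longlonglongrightarrow> 1/4 - 0 - y\<^sup>2"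
      unfolding d_def by (intro tendsto_intros) real_asymp
    then have "(\<lambda>n. (max 0 (d n y))\<^sup>2) \<longlonglongrightarrow> (max 0 (1/4 - y\<^sup>2))\<^sup>2"
      by (intro tendsto_power tendsto_max tendsto_const) simp
    then have "filterlim (\<lambda>n. (max 0 (d n y))\<^sup>2 * real n) at_top sequentially"
      using e by (intro filterlim_tendsto_pos_mult_at_top[OF _ _ filterlim_real_sequentially]) auto
    then have "filterlim (\<lambda>n. 1 + (max 0 (d n y))\<^sup>2 * real n) at_top sequentially"
      by (intro filterlim_tendsto_add_at_top[OF tendsto_const])
    then have "(\<lambda>n. 1 / (1 + (max 0 (d n y))\<^sup>2 * real n)) \<longlonglongrightarrow> 0"
      by (intro tendsto_divide_0[OF tendsto_const] filterlim_at_top_imp_at_infinity)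
    then have "(\<lambda>n. 1 - 1 / (1 + (max 0 (d n y))\<^sup>2 * real n)) \<longlonglongrightarrow> 1 - 0"
      by (intro tendsto_intros)
    then show ?thesis
      by (simp add: \<eta>_def mult.commute)
  qed
  have \<eta>_int_lim: "(\<lambda>n. integral {-1..y} (\<eta> n)) \<longlonglongrightarrow> y + 1/2" if "-1/2 \<le> y" "y \<le> 1/2" for y
  proof -
    have eq: "integral {-1..y} (\<eta> n) = integral {-1/2..y} (\<eta> n)" for n
      using \<eta>_supp[of n] \<delta>_pos[of n] by (intro integral_eq_if_support) force
    have "(\<lambda>n. integral {-1/2..y} (\<eta> n)) \<longlonglongrightarrow> integral {-1/2..y} (\<lambda>t. if t \<in> {-1/2, 1/2} then 0 else 1)"
    proof (rule Equivalence_Lebesgue_Henstock_Integration.dominated_convergence(2))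
      show "\<eta> k integrable_on {-1/2..y}" for k
        by (rule int)
      show "(\<lambda>_. 1 :: real) integrable_on {-1/2..y}"
        by (rule integrable_const_ivl)
      show "norm (\<eta> k t) \<le> 1" for k t
        using \<eta>_01[of k t] by simp
      show "(\<lambda>k. \<eta> k t) \<longlonglongrightarrow> (if t \<in> {-1/2, 1/2} then 0 else 1)" if "t \<in> {-1/2..y}" for t
      proof (cases "t \<in> {-1/2, 1/2}")
        case True
        then have "\<eta> k t = 0" for k
          using \<eta>_supp[of k t] \<delta>_pos[of k] by auto
        with True show ?thesis
          by simp
      next
        case False
        then have "\<bar>t\<bar> < 1/2"
          using that \<open>y \<le> 1/2\<close> by auto
        then show ?thesis
          using False \<eta>_lim[of t] by auto
      qed
    qed
    moreover have "integral {-1/2..y} (\<lambda>t. if t \<in> {-1/2, 1/2} then 0 else 1) = integral {-1/2..y} (\<lambda>t. 1 :: real)"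
      by (rule integral_spike[of "{-1/2, 1/2}"]) auto
    ultimately show ?thesis
      using that by (simp add: eq)
  qed
  have c_lim: "c \<longlonglongrightarrow> 1"
  proof -
    have "c n = integral {-1..1/2} (\<eta> n)" for n
      unfolding c_def using \<eta>_supp[of n] \<delta>_pos[of n] by (intro integral_eq_if_support) force
    then have "c = (\<lambda>n. integral {-1..1/2} (\<eta> n))"
      by auto
    then show ?thesis
      using \<eta>_int_lim[of "1/2"] by simp
  qed
  have \<phi>_lim: "(\<lambda>n. \<phi> n y) \<longlonglongrightarrow> bernoulli_kernel x y" if "\<bar>y\<bar> < 1/2" "y \<noteq> x" for y
  proof -
    have "\<forall>\<^sub>F n in sequentially. 1 / (real n + 1) < \<bar>y - x\<bar>"
      using \<open>y \<noteq> x\<close> by (intro order_tendstoD(2)[of _ 0]) (real_asymp, simp)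
    then have "\<forall>\<^sub>F n in sequentially. integral {-1..y} (\<psi> n) = (if x < y then 1 else 0) * c n"
    proof eventually_elim
      case (elim n)
      show ?case
      proof (cases "x < y")
        case True
        have "integral {-1..y} (\<psi> n) = integral {-1..1} (\<psi> n)"
          using \<psi>_supp[of n] \<psi>_supp'[of n] \<delta>_pos[of n] elim True that
          by (intro integral_eq_if_support) force
        with True show ?thesis
          by (simp add: \<psi>_int)
      next
        case False
        have "integral {-1..y} (\<psi> n) = integral {} (\<psi> n)"
          using \<psi>_supp[of n] elim False that by (intro integral_eq_if_support) force
        with False show ?thesis
          by simp
      qed
    qed
    moreover have "(\<lambda>n. (if x < y then 1 else 0) * c n) \<longlonglongrightarrow> (if x < y then 1 else 0) * 1"
      by (intro tendsto_intros c_lim)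
    ultimately have "(\<lambda>n. integral {-1..y} (\<psi> n)) \<longlonglongrightarrow> (if x < y then 1 else 0)"
      by (simp add: tendsto_cong)
    then show ?thesis
      unfolding \<phi>_split bernoulli_kernel_def using that
      by (intro tendsto_diff \<eta>_int_lim) auto
  qed
  have "(LINT y|unit_interval_measure. \<psi> n y) = c n" for n
  proof -
    have "integral {-1/2..1/2} (\<psi> n) = integral {-1..1} (\<psi> n)"
      using \<psi>_supp'[of n] \<delta>_pos[of n] by (intro integral_eq_if_support) force
    then show ?thesis
      using integral_unit_interval(1)[OF continuous_on_subset[OF \<psi>_cont]] \<psi>_int by simp
  qed
  with c_lim have "(\<lambda>n. LINT y|unit_interval_measure. \<psi> n y) \<longlonglongrightarrow> 1"
    by simp
  then show ?thesis
    by (intro that[of \<eta> \<eta>' \<phi> \<psi> \<delta>] \<eta>_deriv \<eta>'_cont \<phi>_deriv \<psi>_cont \<delta>_pos \<eta>_supp \<phi>_supp \<eta>_01 \<phi>_bound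
          \<psi>_nonneg \<eta>_lim \<phi>_lim \<psi>_supp)
qed

text \<open>Collected in one predicate so that such sequences can be chosen for all coordinates at
  once.\<close>

definition test_sequences where
  "test_sequences x \<eta> \<eta>' \<phi> \<psi> \<delta> \<longleftrightarrow>
    (\<forall>n y. (\<eta> n has_real_derivative \<eta>' n y) (at y)) \<and> (\<forall>n. continuous_on UNIV (\<eta>' n)) \<and>
    (\<forall>n y. (\<phi> n has_real_derivative (\<eta> n y - \<psi> n y)) (at y)) \<and> (\<forall>n. continuous_on UNIV (\<psi> n)) \<and>
    (\<forall>n. 0 < \<delta> n) \<and>
    (\<forall>n y. \<bar>y\<bar> > 1/2 - \<delta> n \<longrightarrow> \<eta> n y = 0 \<and> \<phi> n y = 0) \<and>
    (\<forall>n y. \<bar>y\<bar> \<le> 1/2 \<longrightarrow> \<bar>\<eta> n y\<bar> \<le> 1 \<and> \<bar>\<phi> n y\<bar> \<le> 1) \<and> (\<forall>n y. 0 \<le> \<psi> n y) \<and>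
    (\<forall>y. \<bar>y\<bar> < 1/2 \<longrightarrow> (\<lambda>n. \<eta> n y) \<longlonglongrightarrow> 1) \<and>
    (\<forall>y. \<bar>y\<bar> < 1/2 \<and> y \<noteq> x \<longrightarrow> (\<lambda>n. \<phi> n y) \<longlonglongrightarrow> bernoulli_kernel x y) \<and>
    (\<forall>n y. \<psi> n y \<noteq> 0 \<longrightarrow> \<bar>y - x\<bar> < 1 / (real n + 1)) \<and>
    (\<lambda>n. LINT y|unit_interval_measure. \<psi> n y) \<longlonglongrightarrow> (1 :: real)"

lemma ex_test_sequences:
  assumes "\<bar>x\<bar> < 1/2"
  shows "\<exists>\<eta> \<eta>' \<phi> \<psi> \<delta>. test_sequences x \<eta> \<eta>' \<phi> \<psi> \<delta>"
proof -
  have "-1/2 < x" "x < 1/2"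
    using assms by auto
  then obtain \<eta> \<eta>' \<phi> \<psi> \<delta> where *:
    "\<And>n y. (\<eta> n has_real_derivative \<eta>' n y) (at y)" "\<And>n. continuous_on UNIV (\<eta>' n)"
    "\<And>n y. (\<phi> n has_real_derivative (\<eta> n y - \<psi> n y)) (at y)" "\<And>n. continuous_on UNIV (\<psi> n)"
    "\<And>n. 0 < \<delta> n"
    "\<And>n y. \<bar>y\<bar> > 1/2 - \<delta> n \<Longrightarrow> \<eta> n y = 0" "\<And>n y. \<bar>y\<bar> > 1/2 - \<delta> n \<Longrightarrow> \<phi> n y = 0"
    "\<And>n y. 0 \<le> \<eta> n y" "\<And>n y. \<eta> n y \<le> 1" "\<And>n y. \<bar>y\<bar> \<le> 1/2 \<Longrightarrow> \<bar>\<phi> n y\<bar> \<le> 1" "\<And>n y. 0 \<le> \<psi> n y"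
    "\<And>y. \<bar>y\<bar> < 1/2 \<Longrightarrow> (\<lambda>n. \<eta> n y) \<longlonglongrightarrow> 1"
    "\<And>y. \<bar>y\<bar> < 1/2 \<Longrightarrow> y \<noteq> x \<Longrightarrow> (\<lambda>n. \<phi> n y) \<longlonglongrightarrow> bernoulli_kernel x y"
    "\<And>n y. \<psi> n y \<noteq> 0 \<Longrightarrow> \<bar>y - x\<bar> < 1 / (real n + 1)"
    "(\<lambda>n. LINT y|unit_interval_measure. \<psi> n y) \<longlonglongrightarrow> 1"
    using one_dim_test_sequences by blast
  have "test_sequences x \<eta> \<eta>' \<phi> \<psi> \<delta>"
    unfolding test_sequences_def using * by (simp add: abs_of_nonneg)
  then show ?thesis
    by blast
qed

subsection \<open>Representation by weak derivatives\<close>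

interpretation unit_cube: product_sigma_finite "\<lambda>_::nat. unit_interval_measure"
  by (intro product_sigma_finite.intro prob_space_imp_sigma_finite prob_space_unit_interval)

lemma prob_space_cube_measure: "prob_space (cube_measure u)"
  unfolding cube_measure_def by (intro prob_space_PiM prob_space_unit_interval)

lemma space_cube_measure: "space (cube_measure u) = cube u"
  by (simp add: cube_measure_def cube_def space_PiM)

lemma tendsto_fun_iff:
  "(f \<longlongrightarrow> (l :: 'a \<Rightarrow> real)) F \<longleftrightarrow> (\<forall>i. ((\<lambda>c. f c i) \<longlongrightarrow> l i) F)"
  using limitin_componentwise[of "\<lambda>_. euclidean :: real topology" UNIV f l F]
  by (simp add: euclidean_product_topology)

text \<open>\<open>cube u\<close> is a product over all indices whose factors outside
  \<open>u\<close> are the singleton \<open>{undefined}\<close>, so Tychonoff applies.\<close>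

lemma compact_cube: "compact (cube u)"
proof -
  define S where "S = (\<lambda>i. if i \<in> u then {-1/2..1/2} else {undefined :: real})"
  have "compactin (product_topology (\<lambda>_. euclidean) UNIV) (Pi\<^sub>E UNIV S)"
    by (subst compactin_PiE) (auto simp: S_def)
  moreover have "Pi\<^sub>E UNIV S = cube u"
    by (auto simp: S_def cube_def PiE_iff extensional_def split: if_splits)
  ultimately show ?thesis
    by (simp add: euclidean_product_topology)
qed

text \<open>Continuity refers to the topology of functions on all of \<open>nat\<close>,
  measurability to the finite product. The identity map links them, because over a countable index
  set the product of Borel algebras is the Borel algebra of the product topology.\<close>

lemma borel_measurable_on_cube:
  assumes "continuous_on (cube u) (F :: _ \<Rightarrow> real)"
  shows "F \<in> borel_measurable (cube_measure u)"
proof -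
  have "(\<lambda>y. y) \<in> cube_measure u \<rightarrow>\<^sub>M (\<Pi>\<^sub>M i\<in>UNIV. borel)"
  proof (rule measurable_PiM_single')
    fix i :: nat
    show "(\<lambda>y. y i) \<in> borel_measurable (cube_measure u)"
    proof (cases "i \<in> u")
      case True
      then have "(\<lambda>y. y i) \<in> cube_measure u \<rightarrow>\<^sub>M unit_interval_measure"
        unfolding cube_measure_def by measurable
      then show ?thesis
        by (rule measurable_compose) (simp add: measurable_restrict_space1)
    next
      case False
      then have "y i = undefined" if "y \<in> space (cube_measure u)" for y
        using that by (auto simp: space_cube_measure cube_def)
      then show ?thesis
        by (subst measurable_cong[where g = "\<lambda>_. undefined"]) auto
    qed
  qed auto
  then have "(\<lambda>y. y) \<in> cube_measure u \<rightarrow>\<^sub>M restrict_space borel (cube u)"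
    by (intro measurable_restrict_space2) (auto simp: space_cube_measure measurable_cong_sets[OF refl sets_PiM_equal_borel])
  from measurable_compose[OF this borel_measurable_continuous_on_restrict[OF assms]]
  show ?thesis .
qed

lemma bounded_on_cube:
  assumes "continuous_on (cube u) (F :: _ \<Rightarrow> real)"
  obtains B where "\<And>y. y \<in> cube u \<Longrightarrow> \<bar>F y\<bar> \<le> B"
  using compact_imp_bounded[OF compact_continuous_image[OF assms compact_cube]]
  by (auto simp: bounded_iff)

lemma partial_deriv_prod:
  assumes "finite S" "j \<in> S" "\<And>t. (h j has_real_derivative h' t) (at t)"
  shows "partial_deriv j (\<lambda>y. \<Prod>i\<in>S. h i (y i)) = (\<lambda>y. \<Prod>i\<in>S. (h(j := h')) i (y i))"
proof
  fix y :: "nat \<Rightarrow> real"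
  have "((\<lambda>t. h j t * (\<Prod>i\<in>S - {j}. h i (y i))) has_real_derivative h' (y j) * (\<Prod>i\<in>S - {j}. h i (y i))) (at (y j))"
    by (intro DERIV_cmult_right assms)
  moreover have "(\<lambda>t. \<Prod>i\<in>S. h i ((y(j := t)) i)) = (\<lambda>t. h j t * (\<Prod>i\<in>S - {j}. h i (y i)))"
    by (subst prod.remove[OF assms(1,2)]) simp
  moreover have "(\<Prod>i\<in>S. (h(j := h')) i (y i)) = h' (y j) * (\<Prod>i\<in>S - {j}. h i (y i))"
    by (subst prod.remove[OF assms(1,2)]) simp
  ultimately show "partial_deriv j (\<lambda>y. \<Prod>i\<in>S. h i (y i)) y = (\<Prod>i\<in>S. (h(j := h')) i (y i))"
    unfolding partial_deriv_def by (simp add: DERIV_imp_deriv)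
qed

lemma mixed_deriv_prod:
  assumes "finite S" "distinct js" "set js \<subseteq> S"
    and "\<And>j t. j \<in> set js \<Longrightarrow> (h j has_real_derivative h' j t) (at t)"
  shows "mixed_deriv js (\<lambda>y. \<Prod>i\<in>S. h i (y i)) = (\<lambda>y. \<Prod>i\<in>S. if i \<in> set js then h' i (y i) else h i (y i))"
  using assms(2-)
proof (induction js arbitrary: h)
  case Nil
  then show ?case
    by (simp add: mixed_deriv_def)
next
  case (Cons j js)
  have "mixed_deriv (j # js) (\<lambda>y. \<Prod>i\<in>S. h i (y i)) = mixed_deriv js (\<lambda>y. \<Prod>i\<in>S. (h(j := h' j)) i (y i))"
    unfolding mixed_deriv_def using Cons.prems partial_deriv_prod[of S j h "h' j"] assms(1) by simp
  also have "\<dots> = (\<lambda>y. \<Prod>i\<in>S. if i \<in> set js then h' i (y i) else (h(j := h' j)) i (y i))"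
    using Cons.prems by (intro Cons.IH) auto
  also have "\<dots> = (\<lambda>y. \<Prod>i\<in>S. if i \<in> set (j # js) then h' i (y i) else h i (y i))"
    using Cons.prems by (intro ext prod.cong) auto
  finally show ?case .
qed

lemma test_function_prod:
  assumes d: "\<And>j t. j \<in> {1..s} \<Longrightarrow> (h j has_real_derivative h' j t) (at t)"
    and c: "\<And>j. j \<in> {1..s} \<Longrightarrow> continuous_on UNIV (h' j)"
    and \<delta>: "\<And>j. j \<in> {1..s} \<Longrightarrow> \<delta> j > 0" "\<And>j t. j \<in> {1..s} \<Longrightarrow> \<bar>t\<bar> > 1/2 - \<delta> j \<Longrightarrow> h j t = 0"
  shows "test_function s (\<lambda>y. \<Prod>j\<in>{1..s}. h j (y j))"
  unfolding test_function_def
proof (intro conjI allI impI ballI)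
  let ?\<delta> = "Min (insert 1 (\<delta> ` {1..s}))"
  have "?\<delta> > 0"
    using \<delta>(1) by (subst Min_gr_iff) auto
  moreover have "(\<Prod>j\<in>{1..s}. h j (y j)) = 0" if "\<exists>j\<in>{1..s}. \<bar>y j\<bar> > 1/2 - ?\<delta>" for y
  proof -
    from that obtain j where j: "j \<in> {1..s}" "\<bar>y j\<bar> > 1/2 - ?\<delta>"
      by blast
    then have "?\<delta> \<le> \<delta> j"
      by (intro Min_le) auto
    then have "h j (y j) = 0"
      using j \<delta>(2) by auto
    with j(1) show ?thesis
      by (intro prod_zero) auto
  qed
  ultimately show "\<exists>\<delta>>0. \<forall>y. (\<exists>j\<in>{1..s}. 1/2 - \<delta> < \<bar>y j\<bar>) \<longrightarrow> (\<Prod>j\<in>{1..s}. h j (y j)) = 0"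
    by blast
next
  fix js :: "nat list"
  assume js: "distinct js \<and> set js \<subseteq> {1..s}"
  define k where "k = (\<lambda>i t. if i \<in> set js then h' i t else h i t)"
  have eq: "mixed_deriv js (\<lambda>y. \<Prod>j\<in>{1..s}. h j (y j)) = (\<lambda>y. \<Prod>i\<in>{1..s}. k i (y i))"
    unfolding k_def using js d by (intro mixed_deriv_prod) auto
  have "continuous_on UNIV (h j)" if "j \<in> {1..s}" for j
    by (rule DERIV_continuous_on, rule has_field_derivative_at_within, rule d[OF that])
  then have k: "continuous_on UNIV (k j)" if "j \<in> {1..s}" for j
    using that c by (cases "j \<in> set js") (simp_all add: k_def)
  show "continuous_on UNIV (mixed_deriv js (\<lambda>y. \<Prod>j\<in>{1..s}. h j (y j)))"
    unfolding eq
    by (intro continuous_on_prod continuous_on_compose2[OF k continuous_on_product_coordinates]) auto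
  fix j y assume j: "j \<in> {1..s} - set js"
  then have "(\<lambda>t. \<Prod>i\<in>{1..s}. k i ((y(j := t)) i)) = (\<lambda>t. h j t * (\<Prod>i\<in>{1..s} - {j}. k i (y i)))"
    by (subst prod.remove[of _ j]) (auto simp: k_def)
  moreover have "(\<lambda>t. h j t * (\<Prod>i\<in>{1..s} - {j}. k i (y i))) differentiable (at (y j))"
    using DERIV_cmult_right[OF d[of j]] j unfolding real_differentiable_def by blast
  ultimately show "(\<lambda>t. mixed_deriv js (\<lambda>y. \<Prod>j\<in>{1..s}. h j (y j)) (y(j := t))) differentiable (at (y j))"
    unfolding eq by simp
qed

lemma AE_unit_interval_interior: "AE y in unit_interval_measure. \<bar>y\<bar> < 1/2 \<and> y \<noteq> x"
proof -
  have "AE y in lborel. y \<noteq> -1/2 \<and> y \<noteq> 1/2 \<and> y \<noteq> x"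
    using AE_lborel_singleton[of "-1/2::real"] AE_lborel_singleton[of "1/2::real"] AE_lborel_singleton[of x]
    by eventually_elim auto
  then have "AE y in lborel. y \<in> {-1/2..1/2} \<longrightarrow> \<bar>y\<bar> < 1/2 \<and> y \<noteq> x"
    by eventually_elim auto
  then show ?thesis
    by (subst AE_restrict_space_iff) auto
qed

lemma AE_cube_interior:
  assumes "finite u"
  shows "AE y in cube_measure u. \<forall>j\<in>u. \<bar>y j\<bar> < 1/2 \<and> y j \<noteq> x j"
  unfolding cube_measure_def
  by (intro AE_finite_allI assms AE_PiM_component[OF prob_space_unit_interval] AE_unit_interval_interior)

lemma weak_deriv_measurable:
  "is_weak_deriv s u F G \<Longrightarrow> G \<in> borel_measurable (cube_measure {1..s})"
  unfolding is_weak_deriv_def by (elim conjE)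

lemma weak_deriv_integrable:
  assumes "is_weak_deriv s u F G"
  shows "integrable (cube_measure {1..s}) G"
proof -
  interpret prob_space "cube_measure {1..s}"
    by (rule prob_space_cube_measure)
  show ?thesis
    using assms unfolding is_weak_deriv_def by (elim conjE) (rule square_integrable_imp_integrable)
qed

text \<open>Counterexamples for all \<open>n\<close> would form a sequence converging to
  \<open>x\<close> in every coordinate, since outside \<open>u\<close> all points of the cube
  agree.\<close>

lemma continuous_on_cube_uniform:
  assumes F: "continuous_on (cube u) (F :: _ \<Rightarrow> real)" and x: "x \<in> cube u" and "\<epsilon> > 0"
  obtains N where "\<And>n y. n \<ge> N \<Longrightarrow> y \<in> cube u \<Longrightarrow> (\<And>j. j \<in> u \<Longrightarrow> \<bar>y j - x j\<bar> < 1 / (real n + 1)) \<Longrightarrow> \<bar>F y - F x\<bar> < \<epsilon>"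
proof -
  have "\<exists>N. \<forall>y\<in>cube u. (\<forall>j\<in>u. \<bar>y j - x j\<bar> < 1 / (real N + 1)) \<longrightarrow> \<bar>F y - F x\<bar> < \<epsilon>"
  proof (rule ccontr)
    assume "\<not> ?thesis"
    then obtain Y where Y: "\<And>n. Y n \<in> cube u" "\<And>n j. j \<in> u \<Longrightarrow> \<bar>Y n j - x j\<bar> < 1 / (real n + 1)"
      "\<And>n. \<not> \<bar>F (Y n) - F x\<bar> < \<epsilon>"
      by metis
    have "(\<lambda>n. Y n j) \<longlonglongrightarrow> x j" for j
    proof (cases "j \<in> u")
      case True
      have "(\<lambda>n. Y n j - x j) \<longlonglongrightarrow> 0"
      proof (rule Lim_null_comparison)
        show "\<forall>\<^sub>F n in sequentially. norm (Y n j - x j) \<le> 1 / (real n + 1)"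
          using Y(2)[OF True] by (auto intro!: always_eventually less_imp_le)
        show "(\<lambda>n. 1 / (real n + 1)) \<longlonglongrightarrow> 0"
          by real_asymp
      qed
      then show ?thesis
        by (simp add: LIM_zero_iff)
    next
      case False
      then have "Y n j = x j" for n
        using x Y(1)[of n] by (simp add: cube_def PiE_arb[of _ u])
      then show ?thesis
        by simp
    qed
    then have "Y \<longlonglongrightarrow> x"
      by (simp add: tendsto_fun_iff)
    then have "(\<lambda>n. F (Y n)) \<longlonglongrightarrow> F x"
      using F x Y(1) by (intro continuous_on_tendsto_compose[OF F]) auto
    then have "\<forall>\<^sub>F n in sequentially. \<bar>F (Y n) - F x\<bar> < \<epsilon>"
      using \<open>\<epsilon> > 0\<close> by (auto dest: tendstoD simp: dist_real_def)
    then show False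
      using Y(3) by simp
  qed
  then obtain N where N: "\<And>y. y \<in> cube u \<Longrightarrow> (\<And>j. j \<in> u \<Longrightarrow> \<bar>y j - x j\<bar> < 1 / (real N + 1)) \<Longrightarrow> \<bar>F y - F x\<bar> < \<epsilon>"
    by blast
  show ?thesis
  proof (rule that)
    fix n y assume n: "n \<ge> N" and y: "y \<in> cube u" "\<And>j. j \<in> u \<Longrightarrow> \<bar>y j - x j\<bar> < 1 / (real n + 1)"
    have "1 / (real n + 1) \<le> 1 / (real N + 1)"
      using n by (simp add: field_simps)
    with y show "\<bar>F y - F x\<bar> < \<epsilon>"
      by (intro N) force+
  qed
qed

lemma test_sequences_continuous:
  assumes "test_sequences x \<eta> \<eta>' \<phi> \<psi> \<delta>"
  shows "continuous_on UNIV (\<eta> n)" "continuous_on UNIV (\<phi> n)"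
proof -
  have d: "(\<eta> n has_real_derivative \<eta>' n y) (at y)" "(\<phi> n has_real_derivative (\<eta> n y - \<psi> n y)) (at y)" for y
    using assms unfolding test_sequences_def by blast+
  show "continuous_on UNIV (\<eta> n)" "continuous_on UNIV (\<phi> n)"
    by (rule DERIV_continuous_on, rule has_field_derivative_at_within, rule d)+
qed

text \<open>The product of the \<open>\<psi>\<close> over all coordinates is a combination of mixed
  derivatives of test functions. Integrated against \<open>F\<close> it tends to \<open>F x\<close>.
  By the definition of weak derivatives it also equals a sum over \<open>u\<close> of integrals of
  \<open>G u\<close> against products of \<open>\<phi>\<close> for indices in \<open>u\<close> and
  \<open>\<eta>\<close> outside, which tend to kernels and to 1.\<close>

lemma weak_representation:
  assumes F: "continuous_on (cube {1..s}) F"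
    and G: "\<And>u. u \<subseteq> {1..s} \<Longrightarrow> is_weak_deriv s u F (G u)"
    and x: "x \<in> cube {1..s}" "\<And>j. j \<in> {1..s} \<Longrightarrow> \<bar>x j\<bar> < 1/2"
  shows "F x = (\<Sum>u\<in>Pow {1..s}. LINT y|cube_measure {1..s}. G u y * (\<Prod>j\<in>u. bernoulli_kernel (x j) (y j)))"
proof -
  let ?S = "{1..s}" and ?M = "cube_measure {1..s}"
  interpret M: prob_space ?M
    by (rule prob_space_cube_measure)
  have "\<forall>j\<in>?S. \<exists>\<eta> \<eta>' \<phi> \<psi> \<delta>. test_sequences (x j) \<eta> \<eta>' \<phi> \<psi> \<delta>"
    using x(2) ex_test_sequences by blast
  then obtain \<eta> \<eta>' \<phi> \<psi> \<delta> where T: "\<And>j. j \<in> ?S \<Longrightarrow> test_sequences (x j) (\<eta> j) (\<eta>' j) (\<phi> j) (\<psi> j) (\<delta> j)"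
    by metis
  note T' = T[unfolded test_sequences_def]
  obtain B where B: "\<And>y. y \<in> cube ?S \<Longrightarrow> \<bar>F y\<bar> \<le> B"
    using bounded_on_cube[OF F] by blast
  have [measurable]: "F \<in> borel_measurable ?M"
    by (rule borel_measurable_on_cube[OF F])
  define t where "t = (\<lambda>u n y. \<Prod>j\<in>?S. (if j \<in> u then \<phi> j n (y j) else \<eta> j n (y j)))"
  define D where "D = (\<lambda>u n y. \<Prod>j\<in>?S. (if j \<in> u then \<eta> j n (y j) - \<psi> j n (y j) else \<eta> j n (y j)))"
  define P where "P = (\<lambda>n. \<Prod>j\<in>?S. LINT y|unit_interval_measure. \<psi> j n y)"
  have \<eta>_cont: "continuous_on UNIV (\<eta> j n)" if "j \<in> ?S" for j n
    by (rule test_sequences_continuous(1)[OF T[OF that]])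
  have \<psi>_cont: "continuous_on UNIV (\<psi> j n)" if "j \<in> ?S" for j n
    using T'[OF that] by blast
  have test: "test_function s (t u n)" for u n
    unfolding t_def
  proof (rule test_function_prod[where h = "\<lambda>j t. if j \<in> u then \<phi> j n t else \<eta> j n t"
        and h' = "\<lambda>j t. if j \<in> u then \<eta> j n t - \<psi> j n t else \<eta>' j n t" and \<delta> = "\<lambda>j. \<delta> j n"])
    fix j assume j: "j \<in> ?S"
    show "((\<lambda>t. if j \<in> u then \<phi> j n t else \<eta> j n t) has_real_derivative
             (if j \<in> u then \<eta> j n t - \<psi> j n t else \<eta>' j n t)) (at t)" for t
      using T'[OF j] by simp
    show "continuous_on UNIV (\<lambda>t. if j \<in> u then \<eta> j n t - \<psi> j n t else \<eta>' j n t)"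
      using T'[OF j] \<eta>_cont[OF j] \<psi>_cont[OF j] by (cases "j \<in> u") (auto intro: continuous_on_diff)
  qed (use T' in auto)
  have mixed: "mixed_deriv (sorted_list_of_set u) (t u n) = D u n" if "u \<subseteq> ?S" for u n
  proof -
    have "finite u"
      using that finite_subset by blast
    then have "mixed_deriv (sorted_list_of_set u) (t u n) =
      (\<lambda>y. \<Prod>i\<in>?S. if i \<in> set (sorted_list_of_set u) then \<eta> i n (y i) - \<psi> i n (y i)
           else if i \<in> u then \<phi> i n (y i) else \<eta> i n (y i))"
      unfolding t_def
    proof (intro mixed_deriv_prod[where h = "\<lambda>j t. if j \<in> u then \<phi> j n t else \<eta> j n t"
        and h' = "\<lambda>j t. \<eta> j n t - \<psi> j n t"])
      fix j t assume "j \<in> set (sorted_list_of_set u)"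
      then show "((\<lambda>t. if j \<in> u then \<phi> j n t else \<eta> j n t) has_real_derivative \<eta> j n t - \<psi> j n t) (at t)"
        using \<open>finite u\<close> that T'[of j] by auto
    qed (use that in auto)
    also have "\<dots> = D u n"
      using \<open>finite u\<close> by (auto simp: D_def fun_eq_iff intro!: prod.cong)
    finally show ?thesis .
  qed
  have weak: "(LINT y|?M. F y * D u n y) = (-1) ^ card u * (LINT y|?M. G u y * t u n y)" if "u \<subseteq> ?S" for u n
    using G[OF that] test[of u n] unfolding is_weak_deriv_def mixed[OF that, symmetric] by blast
  have prod_int: "integrable ?M (\<lambda>y. \<Prod>j\<in>?S. h j (y j))" if "\<And>j. j \<in> ?S \<Longrightarrow> continuous_on UNIV (h j)" for h :: "nat \<Rightarrow> real \<Rightarrow> real"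
    unfolding cube_measure_def
    by (intro unit_cube.product_integrable_prod integral_unit_interval continuous_on_subset[OF that]) auto
  have F_int: "integrable ?M (\<lambda>y. F y * H y)" if "integrable ?M H" for H
  proof (rule Bochner_Integration.integrable_bound)
    show "integrable ?M (\<lambda>y. B * H y)"
      using that by simp
    show "(\<lambda>y. F y * H y) \<in> borel_measurable ?M"
      using that by measurable
    show "AE y in ?M. norm (F y * H y) \<le> norm (B * H y)"
      using B by (intro AE_I2) (fastforce simp: space_cube_measure abs_mult intro!: mult_right_mono)
  qed
  have D_int: "integrable ?M (D u n)" for u n
    unfolding D_def
  proof (rule prod_int[of "\<lambda>j t. if j \<in> u then \<eta> j n t - \<psi> j n t else \<eta> j n t"])
    fix j assume "j \<in> ?S"
    then show "continuous_on UNIV (\<lambda>t. if j \<in> u then \<eta> j n t - \<psi> j n t else \<eta> j n t)"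
      using \<eta>_cont \<psi>_cont by (cases "j \<in> u") (auto intro!: continuous_on_diff)
  qed
  have \<psi>_int: "integrable ?M (\<lambda>y. \<Prod>j\<in>?S. \<psi> j n (y j))" for n
    by (intro prod_int \<psi>_cont)
  have P_eq: "P n = (LINT y|?M. (\<Prod>j\<in>?S. \<psi> j n (y j)))" for n
    unfolding P_def cube_measure_def
    by (intro unit_cube.product_integral_prod[symmetric] integral_unit_interval continuous_on_subset[OF \<psi>_cont]) auto
  have "P \<longlonglongrightarrow> (\<Prod>j\<in>?S. 1)"
    unfolding P_def using T' by (intro tendsto_prod) blast
  then have P_lim: "P \<longlonglongrightarrow> 1"
    by simp
  \<comment> \<open>Each factor is \<open>- (\<eta> - \<psi>) + \<eta>\<close>, and
    \<open>\<eta> - \<psi>\<close> is the derivative of \<open>\<phi>\<close>. Taking the first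
    summand for the indices in \<open>u\<close> gives, up to sign, the mixed derivative
    \<open>D u n\<close> of \<open>t u n\<close>.\<close>
  have expand: "(\<Prod>j\<in>?S. \<psi> j n (y j)) = (\<Sum>u\<in>Pow ?S. (-1) ^ card u * D u n y)" for n y
  proof -
    have "(\<Prod>j\<in>?S. \<psi> j n (y j)) = (\<Prod>j\<in>?S. - (\<eta> j n (y j) - \<psi> j n (y j)) + \<eta> j n (y j))"
      by (intro prod.cong refl) linarith
    also have "\<dots> = (\<Sum>u\<in>Pow ?S. (\<Prod>j\<in>u. - (\<eta> j n (y j) - \<psi> j n (y j))) * (\<Prod>j\<in>?S - u. \<eta> j n (y j)))"
      by (rule prod_add) simp
    also have "\<dots> = (\<Sum>u\<in>Pow ?S. (-1) ^ card u * D u n y)"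
    proof (intro sum.cong refl)
      fix u assume "u \<in> Pow ?S"
      then have "?S \<inter> u = u" "?S \<inter> - u = ?S - u"
        by blast+
      then show "(\<Prod>j\<in>u. - (\<eta> j n (y j) - \<psi> j n (y j))) * (\<Prod>j\<in>?S - u. \<eta> j n (y j)) = (-1) ^ card u * D u n y"
        unfolding D_def by (simp add: prod.If_cases prod_uminus del: minus_diff_eq atLeastAtMost_iff)
    qed
    finally show ?thesis .
  qed
  have E: "(LINT y|?M. F y * (\<Prod>j\<in>?S. \<psi> j n (y j))) = (\<Sum>u\<in>Pow ?S. LINT y|?M. G u y * t u n y)" for n
  proof -
    have "(LINT y|?M. F y * (\<Prod>j\<in>?S. \<psi> j n (y j))) = (LINT y|?M. (\<Sum>u\<in>Pow ?S. (-1) ^ card u * (F y * D u n y)))"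
      unfolding expand sum_distrib_left by (simp only: mult.left_commute)
    also have "\<dots> = (\<Sum>u\<in>Pow ?S. (-1) ^ card u * (LINT y|?M. F y * D u n y))"
      by (subst Bochner_Integration.integral_sum) (auto intro!: F_int D_int simp del: One_nat_def)
    \<comment> \<open>The sign in the definition of the weak derivative cancels the sign of the
      expansion.\<close>
    also have "\<dots> = (\<Sum>u\<in>Pow ?S. LINT y|?M. G u y * t u n y)"
      by (intro sum.cong refl) (auto simp: weak mult.assoc[symmetric] power_mult_distrib[symmetric] simp del: One_nat_def)
    finally show ?thesis .
  qed
  have L: "(\<lambda>n. LINT y|?M. F y * (\<Prod>j\<in>?S. \<psi> j n (y j))) \<longlonglongrightarrow> F x"
  proof -
    \<comment> \<open>The total mass \<open>P n\<close> of the bump is only close to 1, so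
      \<open>F x * P n\<close> is compared first, and \<open>P_lim\<close> gives the rest.\<close>
    have "(\<lambda>n. (LINT y|?M. F y * (\<Prod>j\<in>?S. \<psi> j n (y j))) - F x * P n) \<longlonglongrightarrow> 0"
    proof (rule LIMSEQ_I)
      fix r :: real assume "r > 0"
      then obtain N1 where N1: "\<And>n y. n \<ge> N1 \<Longrightarrow> y \<in> cube ?S \<Longrightarrow> (\<And>j. j \<in> ?S \<Longrightarrow> \<bar>y j - x j\<bar> < 1 / (real n + 1)) \<Longrightarrow> \<bar>F y - F x\<bar> < r / 2"
        using continuous_on_cube_uniform[OF F x(1), of "r / 2"] by (metis half_gt_zero)
      from P_lim have "\<forall>\<^sub>F n in sequentially. P n < 2"
        by (rule order_tendstoD) simp
      then obtain N2 where N2: "\<And>n. n \<ge> N2 \<Longrightarrow> P n < 2"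
        by (auto simp: eventually_sequentially)
      have "norm ((LINT y|?M. F y * (\<Prod>j\<in>?S. \<psi> j n (y j))) - F x * P n - 0) < r" if "n \<ge> max N1 N2" for n
      proof -
        let ?\<Psi> = "\<lambda>y. \<Prod>j\<in>?S. \<psi> j n (y j)"
        have "(LINT y|?M. F y * ?\<Psi> y) - F x * P n = (LINT y|?M. F y * ?\<Psi> y - F x * ?\<Psi> y)"
          unfolding P_eq by (subst Bochner_Integration.integral_diff) (auto intro!: F_int \<psi>_int simp del: One_nat_def)
        also have "norm \<dots> \<le> (LINT y|?M. norm (F y * ?\<Psi> y - F x * ?\<Psi> y))"
          by (rule integral_norm_bound)
        also have "\<dots> \<le> (LINT y|?M. r / 2 * ?\<Psi> y)"
        proof (rule integral_mono')
          show "integrable ?M (\<lambda>y. r / 2 * ?\<Psi> y)"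
            using \<psi>_int by simp
          fix y assume y: "y \<in> space ?M"
          have \<Psi>: "?\<Psi> y \<ge> 0"
            using T' by (intro prod_nonneg) blast
          then show "0 \<le> r / 2 * ?\<Psi> y"
            using \<open>r > 0\<close> by simp
          show "norm (F y * ?\<Psi> y - F x * ?\<Psi> y) \<le> r / 2 * ?\<Psi> y"
          proof (cases "?\<Psi> y = 0")
            case False
            then have "\<psi> j n (y j) \<noteq> 0" if "j \<in> ?S" for j
              using that by auto
            then have "\<bar>y j - x j\<bar> < 1 / (real n + 1)" if "j \<in> ?S" for j
              using T'[OF that] that by blast
            then have "\<bar>F y - F x\<bar> < r / 2"
              using y \<open>n \<ge> max N1 N2\<close> by (intro N1[of n]) (auto simp: space_cube_measure)
            then have "\<bar>F y - F x\<bar> * ?\<Psi> y \<le> r / 2 * ?\<Psi> y"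
              using \<Psi> by (intro mult_right_mono) auto
            moreover have "norm (F y * ?\<Psi> y - F x * ?\<Psi> y) = \<bar>F y - F x\<bar> * ?\<Psi> y"
              using \<Psi> by (simp add: abs_mult flip: left_diff_distrib)
            ultimately show ?thesis
              by simp
          next
            case True
            show ?thesis
              unfolding True by simp
          qed
        qed
        also have "\<dots> = r / 2 * P n"
          by (simp add: P_eq)
        also have "\<dots> < r"
          using N2[of n] that \<open>r > 0\<close> by simp
        finally show ?thesis
          by simp
      qed
      then show "\<exists>no. \<forall>n\<ge>no. norm ((LINT y|?M. F y * (\<Prod>j\<in>?S. \<psi> j n (y j))) - F x * P n - 0) < r"
        by blast
    qed
    from tendsto_add[OF this tendsto_mult_left[OF P_lim, of "F x"]]
    show ?thesis
      by simp
  qed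
  have R: "(\<lambda>n. LINT y|?M. G u y * t u n y) \<longlonglongrightarrow> (LINT y|?M. G u y * (\<Prod>j\<in>u. bernoulli_kernel (x j) (y j)))"
    if u: "u \<in> Pow ?S" for u
  proof (rule integral_dominated_convergence)
    have Gm [measurable]: "G u \<in> borel_measurable ?M"
      using weak_deriv_measurable[OF G[of u]] u by simp
    have "integrable ?M (t u n)" for n
      unfolding t_def
    proof (rule prod_int[of "\<lambda>j t. if j \<in> u then \<phi> j n t else \<eta> j n t"])
      fix j assume j: "j \<in> ?S"
      have "continuous_on UNIV (\<phi> j n)"
        by (rule test_sequences_continuous(2)[OF T[OF j]])
      then show "continuous_on UNIV (\<lambda>t. if j \<in> u then \<phi> j n t else \<eta> j n t)"
        using \<eta>_cont[OF j] by (cases "j \<in> u") auto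
    qed
    then show "(\<lambda>y. G u y * t u n y) \<in> borel_measurable ?M" for n
      by (intro borel_measurable_times Gm) auto
    show "integrable ?M (\<lambda>y. norm (G u y))"
      using weak_deriv_integrable[OF G] u by auto
    show "AE y in ?M. norm (G u y * t u n y) \<le> norm (G u y)" for n
    proof (intro AE_I2)
      fix y assume "y \<in> space ?M"
      then have "\<bar>y j\<bar> \<le> 1/2" if "j \<in> ?S" for j
        using that by (auto simp: space_cube_measure cube_def abs_le_iff dest!: PiE_mem[of y _ _ j])
      then have "\<bar>t u n y\<bar> \<le> 1"
        unfolding t_def abs_prod using T' by (intro prod_le_1) auto
      then show "norm (G u y * t u n y) \<le> norm (G u y)"
        using mult_left_mono[of "\<bar>t u n y\<bar>" 1 "\<bar>G u y\<bar>"] by (simp add: abs_mult)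
    qed
    have "AE y in ?M. \<forall>j\<in>?S. \<bar>y j\<bar> < 1/2 \<and> y j \<noteq> x j"
      by (rule AE_cube_interior) simp
    then show lim: "AE y in ?M. (\<lambda>n. G u y * t u n y) \<longlonglongrightarrow> G u y * (\<Prod>j\<in>u. bernoulli_kernel (x j) (y j))"
    proof eventually_elim
      case (elim y)
      have "(\<lambda>n. t u n y) \<longlonglongrightarrow> (\<Prod>j\<in>?S. if j \<in> u then bernoulli_kernel (x j) (y j) else 1)"
        unfolding t_def using elim T' by (intro tendsto_prod) auto
      moreover have "?S \<inter> u = u"
        using u by auto
      then have "(\<Prod>j\<in>?S. if j \<in> u then bernoulli_kernel (x j) (y j) else 1) = (\<Prod>j\<in>u. bernoulli_kernel (x j) (y j))"
        by (simp add: prod.If_cases)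
      ultimately show ?case
        by (intro tendsto_mult_left) simp
    qed
    have "(\<lambda>y. bernoulli_kernel (x j) (y j)) \<in> borel_measurable ?M" if "j \<in> u" for j
    proof -
      have "(\<lambda>y. y j) \<in> ?M \<rightarrow>\<^sub>M unit_interval_measure"
        unfolding cube_measure_def using that u by (intro measurable_component_singleton) auto
      moreover have "bernoulli_kernel (x j) \<in> borel_measurable unit_interval_measure"
        unfolding bernoulli_kernel_def by (intro measurable_restrict_space1) simp
      ultimately show ?thesis
        by (rule measurable_compose)
    qed
    then show "(\<lambda>y. G u y * (\<Prod>j\<in>u. bernoulli_kernel (x j) (y j))) \<in> borel_measurable ?M"
      by (intro borel_measurable_times Gm borel_measurable_prod)
  qed
  have "(\<lambda>n. \<Sum>u\<in>Pow ?S. LINT y|?M. G u y * t u n y) \<longlonglongrightarrow>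
      (\<Sum>u\<in>Pow ?S. LINT y|?M. G u y * (\<Prod>j\<in>u. bernoulli_kernel (x j) (y j)))"
    by (intro tendsto_sum R)
  with L show ?thesis
    unfolding E by (rule LIMSEQ_unique)
qed

text \<open>A weak derivative of order zero is compared with \<open>F\<close> only through test
  functions. Cut-offs converging to 1 carry the equality over to the plain integrals, as
  \<open>F\<close> and \<open>G\<close> are integrable.\<close>

lemma weak_deriv_empty_integral:
  assumes F: "continuous_on (cube {1..s}) F" and G: "is_weak_deriv s {} F G"
  shows "(LINT y|cube_measure {1..s}. F y) = (LINT y|cube_measure {1..s}. G y)"
proof -
  let ?S = "{1..s}" and ?M = "cube_measure {1..s}"
  interpret M: prob_space ?M
    by (rule prob_space_cube_measure)
  obtain \<eta> \<eta>' \<phi> \<psi> \<delta> where T: "test_sequences (0 :: real) \<eta> \<eta>' \<phi> \<psi> \<delta>"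
    using ex_test_sequences[of 0] by auto
  note T' = T[unfolded test_sequences_def]
  obtain B where B: "\<And>y. y \<in> cube ?S \<Longrightarrow> \<bar>F y\<bar> \<le> B"
    using bounded_on_cube[OF F] by blast
  have "F \<in> borel_measurable ?M"
    by (rule borel_measurable_on_cube[OF F])
  then have F_int: "integrable ?M F"
    using B by (intro M.integrable_const_bound[of _ B] AE_I2) (auto simp: space_cube_measure)
  define t where "t = (\<lambda>n y. \<Prod>j\<in>?S. \<eta> n (y j))"
  have \<eta>_cont: "continuous_on UNIV (\<eta> n)" for n
    by (rule test_sequences_continuous(1)[OF T])
  have test: "test_function s (t n)" for n
    unfolding t_def
    by (rule test_function_prod[where h = "\<lambda>_. \<eta> n" and h' = "\<lambda>_. \<eta>' n" and \<delta> = "\<lambda>_. \<delta> n"])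
       (use T' in blast)+
  have t_meas: "t n \<in> borel_measurable ?M" for n
  proof -
    have "integrable ?M (t n)"
      unfolding t_def cube_measure_def
      by (intro unit_cube.product_integrable_prod integral_unit_interval continuous_on_subset[OF \<eta>_cont]) auto
    then show ?thesis
      by auto
  qed
  have eq: "(LINT y|?M. F y * t n y) = (LINT y|?M. G y * t n y)" for n
  proof -
    have "(LINT y|?M. F y * mixed_deriv (sorted_list_of_set {}) (t n) y) = (-1) ^ card ({} :: nat set) * (LINT y|?M. G y * t n y)"
      using G test[of n] unfolding is_weak_deriv_def by blast
    then show ?thesis
      by (simp add: mixed_deriv_def)
  qed
  have lim: "(\<lambda>n. LINT y|?M. H y * t n y) \<longlonglongrightarrow> (LINT y|?M. H y)" if H: "integrable ?M H" for H
  proof (rule integral_dominated_convergence[where w = "\<lambda>y. norm (H y)"])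
    show "H \<in> borel_measurable ?M" "integrable ?M (\<lambda>y. norm (H y))"
      using H by auto
    then show "(\<lambda>y. H y * t n y) \<in> borel_measurable ?M" for n
      by (intro borel_measurable_times t_meas)
    show "AE y in ?M. norm (H y * t n y) \<le> norm (H y)" for n
    proof (intro AE_I2)
      fix y assume "y \<in> space ?M"
      then have "\<bar>y j\<bar> \<le> 1/2" if "j \<in> ?S" for j
        using that by (auto simp: space_cube_measure cube_def abs_le_iff dest!: PiE_mem[of y _ _ j])
      then have "\<bar>t n y\<bar> \<le> 1"
        unfolding t_def abs_prod using T' by (intro prod_le_1) auto
      then show "norm (H y * t n y) \<le> norm (H y)"
        using mult_left_mono[of "\<bar>t n y\<bar>" 1 "\<bar>H y\<bar>"] by (simp add: abs_mult)
    qed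
    have "AE y in ?M. \<forall>j\<in>?S. \<bar>y j\<bar> < 1/2 \<and> y j \<noteq> (\<lambda>_. 0) j"
      by (rule AE_cube_interior) simp
    then show "AE y in ?M. (\<lambda>n. H y * t n y) \<longlonglongrightarrow> H y"
    proof eventually_elim
      case (elim y)
      have "(\<lambda>n. t n y) \<longlonglongrightarrow> (\<Prod>j\<in>?S. 1)"
        unfolding t_def using elim T' by (intro tendsto_prod) auto
      then show ?case
        using tendsto_mult_left[of "\<lambda>n. t n y" 1 sequentially "H y"] by simp
    qed
  qed
  show ?thesis
    using lim[OF F_int] lim[OF weak_deriv_integrable[OF G]] unfolding eq by (rule LIMSEQ_unique)
qed

subsection \<open>Averages of the kernels\<close>

lemma has_integral_quadratic:
  assumes "u \<le> v"
  shows "((\<lambda>t. A + B * t + C * t\<^sup>2) has_integral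
           (A * (v - u) + B * (v\<^sup>2 - u\<^sup>2) / 2 + C * (v ^ 3 - u ^ 3) / (3 :: real))) {u..v}"
proof -
  have "((\<lambda>t. A + B * t + C * t\<^sup>2) has_integral
           ((A * v + B * v\<^sup>2 / 2 + C * v ^ 3 / 3) - (A * u + B * u\<^sup>2 / 2 + C * u ^ 3 / 3))) {u..v}"
    using assms
    by (intro fundamental_theorem_of_calculus)
       (auto intro!: derivative_eq_intros simp flip: has_real_derivative_iff_has_vector_derivative)
  then show ?thesis
    by (rule has_integral_eq_rhs) (simp add: algebra_simps diff_divide_distrib)
qed

lemma LINT_eq_has_integral:
  assumes f: "(f :: real \<Rightarrow> real) \<in> borel_measurable borel" and B: "\<And>x. x \<in> {a..b} \<Longrightarrow> \<bar>f x\<bar> \<le> B"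
    and I: "(f has_integral I) {a..b}"
  shows "(LINT x|restrict_space lborel {a..b}. f x) = I" "integrable (restrict_space lborel {a..b}) f"
proof -
  have "integrable lborel (\<lambda>x. indicat_real {a..b} x *\<^sub>R f x)"
  proof (rule Bochner_Integration.integrable_bound)
    show "integrable lborel (\<lambda>x. indicat_real {a..b} x *\<^sub>R B)"
      using finite_measure.integrable_const by (auto simp: integrable_indicator_iff emeasure_lborel_Icc_eq)
    show "(\<lambda>x. indicat_real {a..b} x *\<^sub>R f x) \<in> borel_measurable lborel"
      using f by measurable
    show "AE x in lborel. norm (indicat_real {a..b} x *\<^sub>R f x) \<le> norm (indicat_real {a..b} x *\<^sub>R B)"
      using B by (intro AE_I2) (force simp: indicator_def)
  qed
  then have s: "set_integrable lborel {a..b} f"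
    by (simp add: set_integrable_def)
  then show "(LINT x|restrict_space lborel {a..b}. f x) = I"
    using set_borel_integral_eq_integral(2)[OF s] I
    by (simp add: integral_restrict_space set_lebesgue_integral_def integral_unique)
  show "integrable (restrict_space lborel {a..b}) f"
    using s by (simp add: integrable_restrict_space set_integrable_def)
qed

text \<open>Equals \<open>bernoulli2 \<bar>t - t'\<bar> / 2 + (t - 1/2) * (t' - 1/2)\<close>, the
  reproducing kernel of the univariate unanchored space without the constant 1, in coordinates moved
  to \<open>{0..1}\<close>.\<close>

definition kernel_product :: "real \<Rightarrow> real \<Rightarrow> real" where
  "kernel_product t t' = 1/3 + (t\<^sup>2 + t'\<^sup>2) / 2 - max t t'"

lemma borel_measurable_bernoulli_kernel: "bernoulli_kernel x \<in> borel_measurable borel"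
  unfolding bernoulli_kernel_def by simp

lemma bernoulli_kernel_bound:
  assumes "y \<in> {-1/2..1/2}"
  shows "\<bar>bernoulli_kernel x y\<bar> \<le> 1"
  using assms by (auto simp: bernoulli_kernel_def)

lemma bernoulli_kernel_product:
  assumes "t \<in> {0..1}" "t' \<in> {0..1}"
  shows "(LINT y|unit_interval_measure. bernoulli_kernel (t - 1/2) y * bernoulli_kernel (t' - 1/2) y) = kernel_product t t'"
    and "integrable unit_interval_measure (\<lambda>y. bernoulli_kernel (t - 1/2) y * bernoulli_kernel (t' - 1/2) y)"
proof -
  let ?f = "\<lambda>y. bernoulli_kernel (t - 1/2) y * bernoulli_kernel (t' - 1/2) y"
  have cut: "((\<lambda>y. if x < y then f y else 0) has_integral I) {-1/2..1/2}"
    if "-1/2 \<le> x" "x \<le> 1/2" "(f has_integral I) {x..1/2}" for x I and f :: "real \<Rightarrow> real"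
  proof -
    have "((\<lambda>y. if y \<in> {x..1/2} then f y else 0) has_integral I) {-1/2..1/2}"
      using that has_integral_restrict_closed_subinterval[of f I x "1/2" "-1/2" "1/2"] by auto
    then show ?thesis
      by (rule has_integral_spike_finite[of "{x}", rotated 2]) auto
  qed
  have q: "((\<lambda>y::real. y + 1/2) has_integral ((1 - r\<^sup>2) / 2)) {r - 1/2..1/2}" if "r \<in> {0..1}" for r
    using has_integral_quadratic[of "r - 1/2" "1/2" "1/2" 1 0] that
    by (simp add: add.commute) (rule has_integral_eq_rhs, assumption, simp add: power2_eq_square field_simps)
  have q2: "((\<lambda>y::real. (y + 1/2)\<^sup>2) has_integral (1/3)) {-1/2..1/2}"
  proof -
    have "((\<lambda>t. 1/4 + 1 * t + 1 * t\<^sup>2) has_integral (1/3 :: real)) {-1/2..1/2}"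
      by (rule has_integral_eq_rhs[OF has_integral_quadratic]) (auto simp: power2_eq_square power3_eq_cube)
    then show ?thesis
      by (rule has_integral_eq[rotated]) (simp add: power2_eq_square algebra_simps)
  qed
  have q0: "((\<lambda>y::real. 1) has_integral (1 - r)) {r - 1/2..1/2}" if "r \<in> {0..1}" for r
    using has_integral_const_real[of "1::real" "r - 1/2" "1/2"] that by simp
  \<comment> \<open>In the product of the two kernels both jumps are active exactly above the larger
    of the two points.\<close>
  have "((\<lambda>y. (y + 1/2)\<^sup>2 - (if t - 1/2 < y then y + 1/2 else 0) - (if t' - 1/2 < y then y + 1/2 else 0)
          + (if max t t' - 1/2 < y then 1 else 0)) has_integral
        (1/3 - (1 - t\<^sup>2) / 2 - (1 - t'\<^sup>2) / 2 + (1 - max t t'))) {-1/2..1/2}"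
    using assms by (intro has_integral_add has_integral_diff q2 cut q q0) (auto simp: max_def)
  then have I: "(?f has_integral kernel_product t t') {-1/2..1/2}"
    by (rule has_integral_eq_rhs[OF has_integral_eq[rotated]])
       (auto simp: bernoulli_kernel_def kernel_product_def power2_eq_square field_simps max_def split: if_splits)
  have m: "?f \<in> borel_measurable borel"
    by (intro borel_measurable_times borel_measurable_bernoulli_kernel)
  have b: "\<bar>?f y\<bar> \<le> 1" if "y \<in> {-1/2..1/2}" for y
    unfolding abs_mult using bernoulli_kernel_bound[OF that] by (intro mult_le_one) auto
  show "(LINT y|unit_interval_measure. ?f y) = kernel_product t t'" "integrable unit_interval_measure ?f"
    using LINT_eq_has_integral[OF m b I] by auto
qed

definition bernoulli2 :: "real \<Rightarrow> real" where
  "bernoulli2 t = t\<^sup>2 - t + 1/6"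

text \<open>As the shift grows, first the larger point \<open>p\<close> wraps around, at
  \<open>1 - p\<close>, and then the smaller point \<open>q\<close>, at \<open>1 - q\<close>. On the
  three pieces in between the integrand is a quadratic polynomial in the shift.\<close>

lemma has_integral_kernel_product:
  assumes le: "frac a' \<le> frac a"
  shows "((\<lambda>\<Delta>. kernel_product (frac (a + \<Delta>)) (frac (a' + \<Delta>))) has_integral bernoulli2 (frac (a - a'))) {0..1}"
proof -
  let ?g = "\<lambda>\<Delta>. kernel_product (frac (a + \<Delta>)) (frac (a' + \<Delta>))"
  define p q where "p = frac a" and "q = frac a'"
  have pq: "0 \<le> q" "q \<le> p" "p < 1"
    using le by (auto simp: p_def q_def frac_lt_1)
  have fr: "frac (a + \<Delta>) = (if p + \<Delta> < 1 then p + \<Delta> else p + \<Delta> - 1)"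
       "frac (a' + \<Delta>) = (if q + \<Delta> < 1 then q + \<Delta> else q + \<Delta> - 1)" if "0 \<le> \<Delta>" "\<Delta> < 1" for \<Delta>
  proof -
    have "frac \<Delta> = \<Delta>"
      using that by (simp add: frac_eq)
    then show "frac (a + \<Delta>) = (if p + \<Delta> < 1 then p + \<Delta> else p + \<Delta> - 1)"
       "frac (a' + \<Delta>) = (if q + \<Delta> < 1 then q + \<Delta> else q + \<Delta> - 1)"
      by (simp_all add: frac_add p_def q_def)
  qed
  have fr1: "?g \<Delta> = kernel_product (p + \<Delta>) (q + \<Delta>)" if "0 \<le> \<Delta>" "p + \<Delta> < 1" for \<Delta>
    using fr[of \<Delta>] that pq by auto
  have fr2: "?g \<Delta> = kernel_product (p + \<Delta> - 1) (q + \<Delta>)" if "1 \<le> p + \<Delta>" "q + \<Delta> < 1" for \<Delta>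
    using fr[of \<Delta>] that pq by auto
  have fr3: "?g \<Delta> = kernel_product (p + \<Delta> - 1) (q + \<Delta> - 1)" if "1 \<le> q + \<Delta>" "\<Delta> < 1" for \<Delta>
    using fr[of \<Delta>] that pq by auto
  have diff: "frac (a - a') = p - q"
  proof -
    have "p - q = (a - a') - of_int (\<lfloor>a\<rfloor> - \<lfloor>a'\<rfloor>)"
      by (simp add: p_def q_def frac_def)
    then have "(a - a') - (p - q) \<in> \<int>"
      by (metis Ints_of_int diff_diff_eq2 add_diff_cancel_left')
    then show ?thesis
      using pq by (subst frac_unique_iff) auto
  qed
  have 1: "(?g has_integral ((1/3 + (p\<^sup>2 + q\<^sup>2) / 2 - p) * ((1 - p) - 0) + (p + q - 1) * ((1 - p)\<^sup>2 - 0\<^sup>2) / 2 + 1 * ((1 - p) ^ 3 - 0 ^ 3) / 3)) {0..1 - p}"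
  proof (rule has_integral_spike_finite[OF _ _ has_integral_quadratic, of "{1 - p}"])
    fix x assume x: "x \<in> {0..1 - p} - {1 - p}"
    have "?g x = kernel_product (p + x) (q + x)"
      using x pq by (intro fr1) auto
    also have "\<dots> = (1/3 + (p\<^sup>2 + q\<^sup>2) / 2 - p) + (p + q - 1) * x + 1 * x\<^sup>2"
      using x pq by (auto simp: kernel_product_def max_def power2_eq_square field_simps)
    finally show "?g x = (1/3 + (p\<^sup>2 + q\<^sup>2) / 2 - p) + (p + q - 1) * x + 1 * x\<^sup>2" .
  qed (use pq in auto)
  have 2: "(?g has_integral ((1/3 + ((p - 1)\<^sup>2 + q\<^sup>2) / 2 - q) * ((1 - q) - (1 - p)) + (p - 1 + q - 1) * ((1 - q)\<^sup>2 - (1 - p)\<^sup>2) / 2 + 1 * ((1 - q) ^ 3 - (1 - p) ^ 3) / 3)) {1 - p..1 - q}"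
  proof (rule has_integral_spike_finite[OF _ _ has_integral_quadratic, of "{1 - p, 1 - q}"])
    fix x assume x: "x \<in> {1 - p..1 - q} - {1 - p, 1 - q}"
    have "?g x = kernel_product (p + x - 1) (q + x)"
      using x pq by (intro fr2) auto
    also have "\<dots> = (1/3 + ((p - 1)\<^sup>2 + q\<^sup>2) / 2 - q) + (p - 1 + q - 1) * x + 1 * x\<^sup>2"
      using x pq by (auto simp: kernel_product_def max_def power2_eq_square field_simps)
    finally show "?g x = (1/3 + ((p - 1)\<^sup>2 + q\<^sup>2) / 2 - q) + (p - 1 + q - 1) * x + 1 * x\<^sup>2" .
  qed (use pq in auto)
  have 3: "(?g has_integral ((1/3 + ((p - 1)\<^sup>2 + (q - 1)\<^sup>2) / 2 - (p - 1)) * (1 - (1 - q)) + (p - 1 + q - 1 - 1) * (1\<^sup>2 - (1 - q)\<^sup>2) / 2 + 1 * (1 ^ 3 - (1 - q) ^ 3) / 3)) {1 - q..1}"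
  proof (rule has_integral_spike_finite[OF _ _ has_integral_quadratic, of "{1 - q, 1}"])
    fix x assume x: "x \<in> {1 - q..1} - {1 - q, 1}"
    have "?g x = kernel_product (p + x - 1) (q + x - 1)"
      using x pq by (intro fr3) auto
    also have "\<dots> = (1/3 + ((p - 1)\<^sup>2 + (q - 1)\<^sup>2) / 2 - (p - 1)) + (p - 1 + q - 1 - 1) * x + 1 * x\<^sup>2"
      using x pq by (auto simp: kernel_product_def max_def power2_eq_square field_simps)
    finally show "?g x = (1/3 + ((p - 1)\<^sup>2 + (q - 1)\<^sup>2) / 2 - (p - 1)) + (p - 1 + q - 1 - 1) * x + 1 * x\<^sup>2" .
  qed (use pq in auto)
  have "(?g has_integral (((1/3 + (p\<^sup>2 + q\<^sup>2) / 2 - p) * ((1 - p) - 0) + (p + q - 1) * ((1 - p)\<^sup>2 - 0\<^sup>2) / 2 + 1 * ((1 - p) ^ 3 - 0 ^ 3) / 3)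
    + ((1/3 + ((p - 1)\<^sup>2 + q\<^sup>2) / 2 - q) * ((1 - q) - (1 - p)) + (p - 1 + q - 1) * ((1 - q)\<^sup>2 - (1 - p)\<^sup>2) / 2 + 1 * ((1 - q) ^ 3 - (1 - p) ^ 3) / 3)
    + ((1/3 + ((p - 1)\<^sup>2 + (q - 1)\<^sup>2) / 2 - (p - 1)) * (1 - (1 - q)) + (p - 1 + q - 1 - 1) * (1\<^sup>2 - (1 - q)\<^sup>2) / 2 + 1 * (1 ^ 3 - (1 - q) ^ 3) / 3))) {0..1}"
    using pq by (intro has_integral_combine[OF _ _ has_integral_combine[OF _ _ 1 2] 3]) auto
  then show ?thesis
    by (rule has_integral_eq_rhs)
       (simp add: diff bernoulli2_def power2_eq_square power3_eq_cube add_divide_distrib diff_divide_distrib ring_distribs)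
qed

lemma bernoulli2_frac_minus: "bernoulli2 (frac (- t)) = bernoulli2 (frac t)"
  by (cases "t \<in> \<int>") (simp_all add: bernoulli2_def frac_neg power2_eq_square algebra_simps)

lemma kernel_product_average:
  shows "(LINT \<Delta>|restrict_space lborel {0..1}. kernel_product (frac (a + \<Delta>)) (frac (a' + \<Delta>))) = bernoulli2 (frac (a - a'))"
    and "integrable (restrict_space lborel {0..1}) (\<lambda>\<Delta>. kernel_product (frac (a + \<Delta>)) (frac (a' + \<Delta>)))"
proof -
  let ?g = "\<lambda>\<Delta>. kernel_product (frac (a + \<Delta>)) (frac (a' + \<Delta>))"
  have I: "(?g has_integral bernoulli2 (frac (a - a'))) {0..1}"
  proof (cases "frac a' \<le> frac a")
    case True
    then show ?thesis
      by (rule has_integral_kernel_product)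
  next
    case False
    then have "((\<lambda>\<Delta>. kernel_product (frac (a' + \<Delta>)) (frac (a + \<Delta>))) has_integral bernoulli2 (frac (a' - a))) {0..1}"
      by (intro has_integral_kernel_product) auto
    moreover have "kernel_product t t' = kernel_product t' t" for t t'
      by (simp add: kernel_product_def max.commute add.commute)
    ultimately show ?thesis
      using bernoulli2_frac_minus[of "a' - a"] by simp
  qed
  have m: "?g \<in> borel_measurable borel"
    unfolding kernel_product_def frac_def by measurable
  have b: "\<bar>?g \<Delta>\<bar> \<le> 3" for \<Delta>
  proof -
    have "\<bar>kernel_product t t'\<bar> \<le> 3" if "t \<in> {0..1}" "t' \<in> {0..1}" for t t'
    proof -
      have "0 \<le> t\<^sup>2" "t\<^sup>2 \<le> 1" "0 \<le> t'\<^sup>2" "t'\<^sup>2 \<le> 1"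
        using that by (auto intro: power_le_one)
      moreover have "0 \<le> max t t'" "max t t' \<le> 1"
        using that by auto
      ultimately show ?thesis
        unfolding kernel_product_def abs_le_iff by argo
    qed
    then show ?thesis
      by (simp add: frac_lt_1 less_imp_le)
  qed
  show "(LINT \<Delta>|restrict_space lborel {0..1}. ?g \<Delta>) = bernoulli2 (frac (a - a'))"
    "integrable (restrict_space lborel {0..1}) ?g"
    using LINT_eq_has_integral[OF m b I] by auto
qed

lemma sum_periodic_int:
  fixes g :: "int \<Rightarrow> real"
  assumes "N > 0" and per: "\<And>k. g (k + int N) = g k"
  shows "(\<Sum>k=1..N. g (int k - c)) = (\<Sum>k<N. g (int k))"
proof -
  have per': "g (k + int n * int N) = g k" for k n
  proof (induction n)
    case (Suc n)
    have "g (k + int (Suc n) * int N) = g ((k + int n * int N) + int N)"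
      by (rule arg_cong[where f = g]) (simp add: algebra_simps)
    also have "\<dots> = g (k + int n * int N)"
      by (rule per)
    also have "\<dots> = g k"
      by (rule Suc.IH)
    finally show ?case .
  qed simp
  have g_mod: "g (k mod int N) = g k" for k
  proof (cases "k div int N \<ge> 0")
    case True
    then obtain n where n: "k div int N = int n"
      using nonneg_int_cases by blast
    have "g k = g (k mod int N + int n * int N)"
      by (rule arg_cong[where f = g]) (simp flip: n)
    also have "\<dots> = g (k mod int N)"
      by (rule per')
    finally show ?thesis
      by (rule sym)
  next
    case False
    then obtain n where n: "- (k div int N) = int n"
      using False by (intro that[of "nat (- (k div int N))"]) simp
    have "g (k mod int N) = g (k + int n * int N)"
      by (rule arg_cong[where f = g]) (simp add: minus_div_mult_eq_mod[symmetric] flip: n)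
    also have "\<dots> = g k"
      by (rule per')
    finally show ?thesis .
  qed
  have "bij_betw (\<lambda>k. nat ((int k - c) mod int N)) {1..N} {..<N}"
  proof (rule bij_betw_imageI)
    show inj: "inj_on (\<lambda>k. nat ((int k - c) mod int N)) {1..N}"
    proof (rule inj_onI)
      fix k l assume kl: "k \<in> {1..N}" "l \<in> {1..N}" "nat ((int k - c) mod int N) = nat ((int l - c) mod int N)"
      then have "(int k - c) mod int N = (int l - c) mod int N"
        using \<open>N > 0\<close> by (simp add: nat_eq_iff)
      then have "int N dvd int k - int l"
        by (simp add: mod_eq_dvd_iff)
      moreover have "\<bar>int k - int l\<bar> < int N"
        using kl by auto
      ultimately show "k = l"
        using zdvd_imp_le[of "int N" "\<bar>int k - int l\<bar>"] by force
    qed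
    have "(\<lambda>k. nat ((int k - c) mod int N)) ` {1..N} \<subseteq> {..<N}"
      using \<open>N > 0\<close> by (auto simp: nat_less_iff)
    then show "(\<lambda>k. nat ((int k - c) mod int N)) ` {1..N} = {..<N}"
      using inj by (intro card_subset_eq) (auto simp: card_image)
  qed
  from sum.reindex_bij_betw[OF this, of "\<lambda>k. g (int k)"]
  show ?thesis
    using \<open>N > 0\<close> by (simp add: g_mod)
qed

lemma integral_Cauchy_Schwarz:
  assumes f: "f \<in> borel_measurable M" "integrable M (\<lambda>x. (f x)\<^sup>2)"
    and g: "g \<in> borel_measurable M" "integrable M (\<lambda>x. (g x)\<^sup>2)"
  shows "integrable M (\<lambda>x. f x * g x :: real)"
    and "(LINT x|M. f x * g x)\<^sup>2 \<le> (LINT x|M. (f x)\<^sup>2) * (LINT x|M. (g x)\<^sup>2)"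
proof -
  show fg: "integrable M (\<lambda>x. f x * g x)"
  proof (rule Bochner_Integration.integrable_bound)
    show "integrable M (\<lambda>x. (f x)\<^sup>2 + (g x)\<^sup>2)"
      using f g by simp
    show "(\<lambda>x. f x * g x) \<in> borel_measurable M"
      using f g by simp
    have "\<bar>a * b\<bar> \<le> a\<^sup>2 + b\<^sup>2" for a b :: real
    proof -
      have "2 * (\<bar>a\<bar> * \<bar>b\<bar>) \<le> a\<^sup>2 + b\<^sup>2"
        using sum_squares_bound[of "\<bar>a\<bar>" "\<bar>b\<bar>"] by (simp add: mult.assoc)
      moreover have "0 \<le> \<bar>a\<bar> * \<bar>b\<bar>"
        by simp
      ultimately show ?thesis
        unfolding abs_mult by linarith
    qed
    then show "AE x in M. norm (f x * g x) \<le> norm ((f x)\<^sup>2 + (g x)\<^sup>2)"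
      by (intro AE_I2) auto
  qed
  define A B C where "A = (LINT x|M. (f x)\<^sup>2)" and "B = (LINT x|M. f x * g x)" and "C = (LINT x|M. (g x)\<^sup>2)"
  have q: "0 \<le> A - 2 * t * B + t\<^sup>2 * C" for t
  proof -
    have "0 \<le> (LINT x|M. (f x - t * g x)\<^sup>2)"
      by simp
    also have "\<dots> = (LINT x|M. (f x)\<^sup>2 - 2 * t * (f x * g x) + t\<^sup>2 * (g x)\<^sup>2)"
      by (intro Bochner_Integration.integral_cong) (auto simp: power2_eq_square algebra_simps)
    also have "\<dots> = A - 2 * t * B + t\<^sup>2 * C"
      unfolding A_def B_def C_def using f g fg by simp
    finally show ?thesis .
  qed
  have "B\<^sup>2 \<le> A * C"
  proof (cases "C = 0")
    case True
    have "B = 0"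
    proof (rule ccontr)
      assume "B \<noteq> 0"
      \<comment> \<open>For \<open>C = 0\<close> the quadratic degenerates to a linear function,
        which takes the value \<open>-1\<close> at this \<open>t\<close>.\<close>
      then show False
        using q[of "(A + 1) / (2 * B)"] True by simp
    qed
    with True show ?thesis
      by simp
  next
    case False
    moreover have "C \<ge> 0"
      by (simp add: C_def)
    ultimately have "C > 0"
      by simp
    then show ?thesis
      using q[of "B / C"] by (simp add: power2_eq_square field_simps)
  qed
  then show "(LINT x|M. f x * g x)\<^sup>2 \<le> (LINT x|M. (f x)\<^sup>2) * (LINT x|M. (g x)\<^sup>2)"
    by (simp add: A_def B_def C_def)
qed

subsection \<open>The mean square error for random shifts\<close>

definition averaged_deriv ::
  "nat \<Rightarrow> nat set \<Rightarrow> ((nat \<Rightarrow> real) \<Rightarrow> real) \<Rightarrow> (nat \<Rightarrow> real) \<Rightarrow> real" where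
  "averaged_deriv s u G x = (LINT y|cube_measure ({1..s} - u). G (merge u ({1..s} - u) (x, y)))"

text \<open>On a probability space the square of a mean is at most the mean of the squares; this is
  applied on each fibre and integrated. On fibres that are not integrable the integral has its
  default value 0, where the bound is trivial.\<close>

lemma averaged_deriv_square_integrable:
  assumes G: "is_weak_deriv s u F G" and u: "u \<subseteq> {1..s}"
  shows "averaged_deriv s u G \<in> borel_measurable (cube_measure u)"
    and "integrable (cube_measure u) (\<lambda>x. (averaged_deriv s u G x)\<^sup>2)"
proof -
  let ?J = "{1..s} - u"
  interpret J: prob_space "cube_measure ?J"
    by (rule prob_space_cube_measure)
  have fin: "finite u" "finite ?J"
    using u finite_subset by auto
  have un: "u \<union> ?J = {1..s}"
    using u by auto
  have Gm: "G \<in> borel_measurable (PiM (u \<union> ?J) (\<lambda>_. unit_interval_measure))"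
    using weak_deriv_measurable[OF G] unfolding un cube_measure_def .
  have m: "(\<lambda>p. G (merge u ?J p)) \<in> borel_measurable (cube_measure u \<Otimes>\<^sub>M cube_measure ?J)"
    unfolding cube_measure_def by (rule measurable_compose[OF measurable_merge Gm])
  have m_split: "(\<lambda>(x, y). G (merge u ?J (x, y))) \<in> borel_measurable (cube_measure u \<Otimes>\<^sub>M cube_measure ?J)"
    using m by simp
  show meas: "averaged_deriv s u G \<in> borel_measurable (cube_measure u)"
    unfolding averaged_deriv_def using J.borel_measurable_lebesgue_integral[OF m_split] by simp
  have sq: "ennreal ((averaged_deriv s u G x)\<^sup>2) \<le> (\<integral>\<^sup>+ y. ennreal ((G (merge u ?J (x, y)))\<^sup>2) \<partial>cube_measure ?J)"
    if x: "x \<in> space (cube_measure u)" for x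
  proof (cases "integrable (cube_measure ?J) (\<lambda>y. G (merge u ?J (x, y)))")
    case True
    let ?g = "\<lambda>y. G (merge u ?J (x, y))"
    have gm: "?g \<in> borel_measurable (cube_measure ?J)"
      using True by auto
    have "ennreal (norm (averaged_deriv s u G x)) \<le> (\<integral>\<^sup>+ y. ennreal (norm (?g y)) \<partial>cube_measure ?J)"
      unfolding averaged_deriv_def by (rule integral_norm_bound_ennreal[OF True])
    then have "(ennreal (norm (averaged_deriv s u G x)))\<^sup>2 \<le> (\<integral>\<^sup>+ y. ennreal (norm (?g y)) * 1 \<partial>cube_measure ?J)\<^sup>2"
      by (intro power_mono) auto
    also have "\<dots> \<le> (\<integral>\<^sup>+ y. (ennreal (norm (?g y)))\<^sup>2 \<partial>cube_measure ?J) * (\<integral>\<^sup>+ y. 1\<^sup>2 \<partial>cube_measure ?J)"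
      using gm by (intro Cauchy_Schwarz_nn_integral) auto
    also have "\<dots> = (\<integral>\<^sup>+ y. ennreal ((?g y)\<^sup>2) \<partial>cube_measure ?J)"
      by (simp add: J.emeasure_space_1 ennreal_power del: One_nat_def)
    finally show ?thesis
      by (simp add: ennreal_power)
  next
    case False
    then have "averaged_deriv s u G x = 0"
      unfolding averaged_deriv_def by (rule not_integrable_integral_eq)
    then show ?thesis
      by simp
  qed
  have "(\<integral>\<^sup>+ x. ennreal (norm ((averaged_deriv s u G x)\<^sup>2)) \<partial>cube_measure u)
      \<le> (\<integral>\<^sup>+ x. (\<integral>\<^sup>+ y. ennreal ((G (merge u ?J (x, y)))\<^sup>2) \<partial>cube_measure ?J) \<partial>cube_measure u)"
    using sq by (intro nn_integral_mono) simp
  also have "\<dots> = (\<integral>\<^sup>+ y. ennreal ((G y)\<^sup>2) \<partial>cube_measure {1..s})"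
    using unit_cube.product_nn_integral_fold[of u ?J "\<lambda>y. ennreal ((G y)\<^sup>2)"] Gm fin
    unfolding un cube_measure_def by simp
  also have "\<dots> < \<infinity>"
    using G unfolding is_weak_deriv_def by (elim conjE) (simp add: integrable_iff_bounded)
  finally show "integrable (cube_measure u) (\<lambda>x. (averaged_deriv s u G x)\<^sup>2)"
    using meas by (intro integrableI_bounded) auto
qed

lemma kernel_prod_measurable:
  assumes "u \<subseteq> v"
  shows "(\<lambda>y. \<Prod>j\<in>u. bernoulli_kernel (x j) (y j)) \<in> borel_measurable (cube_measure v)"
proof -
  have "(\<lambda>y. bernoulli_kernel (x j) (y j)) \<in> borel_measurable (cube_measure v)" if "j \<in> u" for j
  proof -
    have "(\<lambda>y. y j) \<in> cube_measure v \<rightarrow>\<^sub>M unit_interval_measure"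
      unfolding cube_measure_def using that assms by (intro measurable_component_singleton) auto
    moreover have "bernoulli_kernel (x j) \<in> borel_measurable unit_interval_measure"
      by (intro measurable_restrict_space1) (simp add: borel_measurable_bernoulli_kernel)
    ultimately show ?thesis
      by (rule measurable_compose)
  qed
  then show ?thesis
    by (intro borel_measurable_prod)
qed

lemma kernel_prod_bound:
  assumes "u \<subseteq> v" "y \<in> space (cube_measure v)"
  shows "\<bar>\<Prod>j\<in>u. bernoulli_kernel (x j) (y j)\<bar> \<le> 1"
  unfolding abs_prod
proof (intro prod_le_1 conjI)
  fix j assume "j \<in> u"
  then have "y j \<in> {-1/2..1/2}"
    using assms PiE_mem[of y v "\<lambda>_. {-1/2..1/2}" j] by (auto simp: space_cube_measure cube_def)
  then show "\<bar>bernoulli_kernel (x j) (y j)\<bar> \<le> 1"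
    by (rule bernoulli_kernel_bound)
qed simp

text \<open>Fubini: the kernels indexed by \<open>u\<close> are constant in the remaining variables,
  so only \<open>G\<close> is averaged over these.\<close>

lemma integral_averaged_deriv:
  assumes G: "is_weak_deriv s u F G" and u: "u \<subseteq> {1..s}"
  shows "(LINT y|cube_measure {1..s}. G y * (\<Prod>j\<in>u. bernoulli_kernel (x j) (y j))) =
    (LINT y|cube_measure u. averaged_deriv s u G y * (\<Prod>j\<in>u. bernoulli_kernel (x j) (y j)))"
proof -
  let ?J = "{1..s} - u" and ?H = "\<lambda>y. \<Prod>j\<in>u. bernoulli_kernel (x j) (y j)"
  have fin: "finite u" "finite ?J"
    using u finite_subset by auto
  have un: "u \<union> ?J = {1..s}"
    using u by auto
  have "integrable (cube_measure {1..s}) (\<lambda>y. G y * ?H y)"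
  proof (rule Bochner_Integration.integrable_bound[OF weak_deriv_integrable[OF G]])
    show "(\<lambda>y. G y * ?H y) \<in> borel_measurable (cube_measure {1..s})"
      by (intro borel_measurable_times weak_deriv_measurable[OF G] kernel_prod_measurable u)
    show "AE y in cube_measure {1..s}. norm (G y * ?H y) \<le> norm (G y)"
    proof (intro AE_I2)
      fix y assume "y \<in> space (cube_measure {1..s})"
      from mult_left_mono[OF kernel_prod_bound[OF u this, of x], of "\<bar>G y\<bar>"]
      show "norm (G y * ?H y) \<le> norm (G y)"
        by (simp add: abs_mult)
    qed
  qed
  then have "(LINT y|cube_measure {1..s}. G y * ?H y) =
    (LINT a|cube_measure u. LINT c|cube_measure ?J. G (merge u ?J (a, c)) * ?H (merge u ?J (a, c)))"
    using unit_cube.product_integral_fold[of u ?J "\<lambda>y. G y * ?H y"] fin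
    unfolding un cube_measure_def by simp
  also have "\<dots> = (LINT a|cube_measure u. LINT c|cube_measure ?J. G (merge u ?J (a, c)) * ?H a)"
    by (simp add: merge_def cong: prod.cong)
  finally show ?thesis
    by (simp add: averaged_deriv_def)
qed

lemma integral_square_kernel_sum:
  assumes "finite u" and t: "\<And>k j. j \<in> u \<Longrightarrow> t k j \<in> {0..1}"
  shows "(LINT y|cube_measure u. (c * (\<Sum>k\<in>A. \<Prod>j\<in>u. bernoulli_kernel (t k j - 1/2) (y j)))\<^sup>2) =
      c\<^sup>2 * (\<Sum>k\<in>A. \<Sum>l\<in>A. \<Prod>j\<in>u. kernel_product (t k j) (t l j))"
proof -
  let ?P = "\<lambda>k l y. \<Prod>j\<in>u. bernoulli_kernel (t k j - 1/2) (y j) * bernoulli_kernel (t l j - 1/2) (y j)"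
  have int: "integrable (cube_measure u) (?P k l)" for k l
    unfolding cube_measure_def using t
    by (intro unit_cube.product_integrable_prod assms bernoulli_kernel_product) auto
  have val: "(LINT y|cube_measure u. ?P k l y) = (\<Prod>j\<in>u. kernel_product (t k j) (t l j))" for k l
    unfolding cube_measure_def
    by (subst unit_cube.product_integral_prod[OF assms(1) bernoulli_kernel_product(2)[OF t t]])
       (assumption | intro prod.cong refl bernoulli_kernel_product(1) t)+
  have sq: "(c * (\<Sum>k\<in>A. \<Prod>j\<in>u. bernoulli_kernel (t k j - 1/2) (y j)))\<^sup>2 = c\<^sup>2 * (\<Sum>k\<in>A. \<Sum>l\<in>A. ?P k l y)" for y
    by (simp add: power_mult_distrib power2_eq_square sum_product prod.distrib)
  have "(LINT y|cube_measure u. (c * (\<Sum>k\<in>A. \<Prod>j\<in>u. bernoulli_kernel (t k j - 1/2) (y j)))\<^sup>2) =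
    (LINT y|cube_measure u. c\<^sup>2 * (\<Sum>k\<in>A. \<Sum>l\<in>A. ?P k l y))"
    by (simp only: sq)
  also have "\<dots> = c\<^sup>2 * (\<Sum>k\<in>A. \<Sum>l\<in>A. \<Prod>j\<in>u. kernel_product (t k j) (t l j))"
    by (simp add: int val)
  finally show ?thesis .
qed

lemma square_kernel_sum_integrable:
  assumes "finite u"
  shows "(\<lambda>y. c * (\<Sum>k\<in>A. \<Prod>j\<in>u. bernoulli_kernel (t k j) (y j))) \<in> borel_measurable (cube_measure u)"
    and "integrable (cube_measure u) (\<lambda>y. (c * (\<Sum>k\<in>A. \<Prod>j\<in>u. bernoulli_kernel (t k j) (y j)))\<^sup>2)"
proof -
  let ?h = "\<lambda>y. c * (\<Sum>k\<in>A. \<Prod>j\<in>u. bernoulli_kernel (t k j) (y j))"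
  interpret prob_space "cube_measure u"
    by (rule prob_space_cube_measure)
  show m: "?h \<in> borel_measurable (cube_measure u)"
    by (intro borel_measurable_times borel_measurable_const borel_measurable_sum kernel_prod_measurable order_refl)
  have b: "\<bar>?h y\<bar> \<le> \<bar>c\<bar> * real (card A)" if "y \<in> space (cube_measure u)" for y
  proof -
    have "\<bar>\<Sum>k\<in>A. \<Prod>j\<in>u. bernoulli_kernel (t k j) (y j)\<bar> \<le> (\<Sum>k\<in>A. 1)"
      using kernel_prod_bound[OF order_refl that] by (intro order_trans[OF sum_abs] sum_mono)
    then show ?thesis
      by (simp add: abs_mult mult_left_mono)
  qed
  show "integrable (cube_measure u) (\<lambda>y. (?h y)\<^sup>2)"
  proof (rule integrable_const_bound)
    show "AE y in cube_measure u. norm ((?h y)\<^sup>2) \<le> (\<bar>c\<bar> * real (card A))\<^sup>2"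
      using b by (intro AE_I2) (simp add: abs_le_square_iff[symmetric])
    show "(\<lambda>y. (?h y)\<^sup>2) \<in> borel_measurable (cube_measure u)"
      using m by simp
  qed
qed

text \<open>The factorisation \<open>E u * W u = (E u / \<gamma> u) * (\<gamma> u * W u)\<close>
  survives \<open>\<gamma> u = 0\<close>, because then \<open>E u = 0\<close> and the quotient
  \<open>0 / 0\<close> is 0.\<close>

lemma weighted_Cauchy_Schwarz_sum:
  fixes a \<gamma> E W :: "'a \<Rightarrow> real"
  assumes "\<And>u. u \<in> A \<Longrightarrow> 0 \<le> \<gamma> u" "\<And>u. u \<in> A \<Longrightarrow> 0 \<le> E u" "\<And>u. u \<in> A \<Longrightarrow> 0 \<le> W u"
    and "\<And>u. u \<in> A \<Longrightarrow> (a u)\<^sup>2 \<le> E u * W u" "\<And>u. u \<in> A \<Longrightarrow> \<gamma> u = 0 \<Longrightarrow> E u = 0"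
  shows "(\<Sum>u\<in>A. a u)\<^sup>2 \<le> (\<Sum>u\<in>A. E u / \<gamma> u) * (\<Sum>u\<in>A. \<gamma> u * W u)"
proof -
  have "\<bar>a u\<bar> \<le> sqrt (E u / \<gamma> u) * sqrt (\<gamma> u * W u)" if "u \<in> A" for u
  proof -
    have "\<bar>a u\<bar> \<le> sqrt (E u * W u)"
      by (rule real_le_rsqrt) (use assms(4)[OF that] in simp)
    also have "E u * W u = (E u / \<gamma> u) * (\<gamma> u * W u)"
      using assms(5)[OF that] by (cases "\<gamma> u = 0") auto
    finally show ?thesis
      by (simp only: real_sqrt_mult)
  qed
  then have "\<bar>\<Sum>u\<in>A. a u\<bar> \<le> (\<Sum>u\<in>A. sqrt (E u / \<gamma> u) * sqrt (\<gamma> u * W u))"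
    by (intro order_trans[OF sum_abs] sum_mono)
  then have "(\<Sum>u\<in>A. a u)\<^sup>2 \<le> (\<Sum>u\<in>A. sqrt (E u / \<gamma> u) * sqrt (\<gamma> u * W u))\<^sup>2"
    by (metis abs_ge_zero power2_abs power_mono)
  also have "\<dots> \<le> (\<Sum>u\<in>A. (sqrt (E u / \<gamma> u))\<^sup>2) * (\<Sum>u\<in>A. (sqrt (\<gamma> u * W u))\<^sup>2)"
    by (rule Cauchy_Schwarz_ineq_sum)
  also have "\<dots> = (\<Sum>u\<in>A. E u / \<gamma> u) * (\<Sum>u\<in>A. \<gamma> u * W u)"
    using assms(1-3) by (intro arg_cong2[where f = "(*)"] sum.cong refl real_sqrt_pow2) auto
  finally show ?thesis .
qed

text \<open>The shift-averaged squared worst-case error in the Sobolev space;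
  \<open>bernoulli2_omega\<close> later turns it into the squared error in the Korobov
  space.\<close>

definition squared_lattice_error :: "nat \<Rightarrow> nat \<Rightarrow> (nat set \<Rightarrow> real) \<Rightarrow> (nat \<Rightarrow> int) \<Rightarrow> real" where
  "squared_lattice_error s N \<gamma> z =
     (\<Sum>u\<in>Pow {1..s} - {{}}. \<gamma> u * (1 / real N * (\<Sum>k<N. \<Prod>j\<in>u. bernoulli2 (frac (of_int (int k * z j) / real N)))))"

lemma prob_space_shift: "prob_space (restrict_space lborel {0..1::real})"
  by (intro prob_space_restrict_space) simp_all

text \<open>The representation of point values holds in the open cube. A node coordinate reaches the
  boundary value \<open>-1/2\<close> only if its fractional part vanishes, which finitely many nodes
  do only on a null set of shifts.\<close>

lemma AE_shift_interior:
  "AE \<Delta> in (\<Pi>\<^sub>M j\<in>{1..s::nat}. restrict_space lborel {0..1::real}). \<forall>k\<in>{1..N::nat}. \<forall>j\<in>{1..s}. frac (a k j + \<Delta> j) \<noteq> 0"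
proof (intro AE_finite_allI AE_PiM_component[OF prob_space_shift])
  fix k j
  have "AE d in lborel. d \<noteq> 0 \<and> d \<noteq> 1 \<and> d \<noteq> 1 - frac (a k j)"
    using AE_lborel_singleton[of "0::real"] AE_lborel_singleton[of "1::real"] AE_lborel_singleton[of "1 - frac (a k j)"]
    by eventually_elim auto
  then have "AE d in lborel. d \<in> {0..1} \<longrightarrow> frac (a k j + d) \<noteq> 0"
  proof eventually_elim
    case (elim d)
    show ?case
    proof
      assume "d \<in> {0..1}"
      then have "frac d = d" "0 < d"
        using elim by (auto simp: frac_eq)
      then show "frac (a k j + d) \<noteq> 0"
        using elim by (auto simp: frac_add add_nonneg_eq_0_iff)
    qed
  qed
  then show "AE d in restrict_space lborel {0..1}. frac (a k j + d) \<noteq> 0"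
    by (subst AE_restrict_space_iff) auto
qed auto

text \<open>After averaging, the pair of nodes \<open>k\<close> and \<open>l\<close> contributes a
  function of \<open>k - l\<close> that is periodic modulo \<open>N\<close>. Every \<open>l\<close>
  thus gives the same sum over \<open>k\<close>, and the double sum collapses to \<open>N\<close>
  copies of a single one.\<close>

lemma shift_average_kernel_sum:
  fixes z :: "nat \<Rightarrow> int"
  assumes u: "u \<subseteq> {1..s}" and N: "N > 0"
  defines "X \<equiv> \<lambda>k \<Delta> j. frac (real k * of_int (z j) / real N + \<Delta> j)"
  shows "integrable (\<Pi>\<^sub>M j\<in>{1..s}. restrict_space lborel {0..1::real})
      (\<lambda>\<Delta>. (1 / real N)\<^sup>2 * (\<Sum>k=1..N. \<Sum>l=1..N. \<Prod>j\<in>u. kernel_product (X k \<Delta> j) (X l \<Delta> j)))"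
    and "(LINT \<Delta>|(\<Pi>\<^sub>M j\<in>{1..s}. restrict_space lborel {0..1::real}).
       (1 / real N)\<^sup>2 * (\<Sum>k=1..N. \<Sum>l=1..N. \<Prod>j\<in>u. kernel_product (X k \<Delta> j) (X l \<Delta> j))) =
     1 / real N * (\<Sum>k<N. \<Prod>j\<in>u. bernoulli2 (frac (of_int (int k * z j) / real N)))"
proof -
  interpret S: product_sigma_finite "\<lambda>_::nat. restrict_space lborel {0..1::real}"
    by (intro product_sigma_finite.intro prob_space_imp_sigma_finite prob_space_shift)
  let ?M = "\<Pi>\<^sub>M j\<in>{1..s}. restrict_space lborel {0..1::real}"
  let ?f = "\<lambda>k l j d. if j \<in> u then kernel_product (frac (real k * of_int (z j) / real N + d)) (frac (real l * of_int (z j) / real N + d)) else 1"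
  have f_int: "integrable (restrict_space lborel {0..1}) (?f k l j)" for k l j
    using kernel_product_average(2) prob_space.finite_measure[OF prob_space_shift]
    by (cases "j \<in> u") (auto intro: finite_measure.integrable_const)
  have f_val: "(LINT d|restrict_space lborel {0..1}. ?f k l j d) =
      (if j \<in> u then bernoulli2 (frac (of_int ((int k - int l) * z j) / real N)) else 1)" for k l j
  proof (cases "j \<in> u")
    case True
    then show ?thesis
      by (simp add: kernel_product_average(1) left_diff_distrib diff_divide_distrib)
  next
    case False
    then show ?thesis
      using prob_space.prob_space[OF prob_space_shift] by simp
  qed
  have iu: "{1..s} \<inter> u = u"
    using u by auto
  have P: "(\<Prod>j\<in>u. kernel_product (X k \<Delta> j) (X l \<Delta> j)) = (\<Prod>j\<in>{1..s}. ?f k l j (\<Delta> j))" for k l \<Delta>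
    by (simp add: X_def prod.If_cases iu del: One_nat_def)
  have P_int: "integrable ?M (\<lambda>\<Delta>. \<Prod>j\<in>{1..s}. ?f k l j (\<Delta> j))" for k l
    by (rule S.product_integrable_prod) (auto intro: f_int)
  have P_val: "(LINT \<Delta>|?M. (\<Prod>j\<in>{1..s}. ?f k l j (\<Delta> j))) = (\<Prod>j\<in>u. bernoulli2 (frac (of_int ((int k - int l) * z j) / real N)))" for k l
    by (subst S.product_integral_prod) (auto simp: f_int f_val prod.If_cases iu simp del: One_nat_def)
  show "integrable ?M (\<lambda>\<Delta>. (1 / real N)\<^sup>2 * (\<Sum>k=1..N. \<Sum>l=1..N. \<Prod>j\<in>u. kernel_product (X k \<Delta> j) (X l \<Delta> j)))"
    unfolding P by (intro integrable_mult_right Bochner_Integration.integrable_sum P_int)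
  define g where "g = (\<lambda>k::int. \<Prod>j\<in>u. bernoulli2 (frac (of_int (k * z j) / real N)))"
  have "g (k + int N) = g k" for k
  proof -
    have "of_int ((k + int N) * z j) / real N = of_int (k * z j) / real N + of_int (z j)" for j
      using N by (simp add: field_simps)
    then show ?thesis
      by (simp add: g_def)
  qed
  then have g_sum: "(\<Sum>k=1..N. g (int k - c)) = (\<Sum>k<N. g (int k))" for c
    by (rule sum_periodic_int[OF N])
  have sums: "(LINT \<Delta>|?M. (\<Sum>k=1..N. \<Sum>l=1..N. \<Prod>j\<in>{1..s}. ?f k l j (\<Delta> j))) =
      (\<Sum>k=1..N. \<Sum>l=1..N. LINT \<Delta>|?M. (\<Prod>j\<in>{1..s}. ?f k l j (\<Delta> j)))"
    by (subst Bochner_Integration.integral_sum)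
       (intro Bochner_Integration.integrable_sum P_int sum.cong refl Bochner_Integration.integral_sum)+
  have "(LINT \<Delta>|?M. (1 / real N)\<^sup>2 * (\<Sum>k=1..N. \<Sum>l=1..N. \<Prod>j\<in>u. kernel_product (X k \<Delta> j) (X l \<Delta> j))) =
     (1 / real N)\<^sup>2 * (\<Sum>k=1..N. \<Sum>l=1..N. g (int k - int l))"
    unfolding P g_def
    by (subst integral_mult_right_zero) (simp only: sums P_val)
  also have "(\<Sum>k=1..N. \<Sum>l=1..N. g (int k - int l)) = (\<Sum>l=1..N. \<Sum>k=1..N. g (int k - int l))"
    by (rule sum.swap)
  also have "\<dots> = real N * (\<Sum>k<N. g (int k))"
    by (simp only: g_sum) simp
  also have "(1 / real N)\<^sup>2 * (real N * (\<Sum>k<N. g (int k))) = 1 / real N * (\<Sum>k<N. g (int k))"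
    using N by (simp add: power2_eq_square)
  finally show "(LINT \<Delta>|?M. (1 / real N)\<^sup>2 * (\<Sum>k=1..N. \<Sum>l=1..N. \<Prod>j\<in>u. kernel_product (X k \<Delta> j) (X l \<Delta> j))) =
     1 / real N * (\<Sum>k<N. \<Prod>j\<in>u. bernoulli2 (frac (of_int (int k * z j) / real N)))"
    by (simp add: g_def)
qed

theorem rms_error_le_lattice_error:
  assumes F: "F \<in> sobolev_space s \<gamma>" and \<gamma>: "\<And>u. u \<subseteq> {1..s} \<Longrightarrow> 0 \<le> \<gamma> u" and N: "N > 0"
  shows "rms_error s N z F \<le> sqrt (squared_lattice_error s N \<gamma> z) * sobolev_norm s \<gamma> F"
proof -
  let ?S = "{1..s}"
  let ?M = "\<Pi>\<^sub>M j\<in>?S. restrict_space lborel {0..1::real}"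
  let ?U = "Pow ?S - {{}}"
  have Fc: "continuous_on (cube ?S) F"
    and F_weak: "\<And>u. u \<subseteq> ?S \<Longrightarrow> \<exists>G. is_weak_deriv s u F G"
    and F_zero: "\<And>u. u \<subseteq> ?S \<Longrightarrow> \<gamma> u = 0 \<Longrightarrow> deriv_energy s u F = 0"
    using F unfolding sobolev_space_def by blast+
  define G where "G = (\<lambda>u. weak_deriv s u F)"
  have G: "is_weak_deriv s u F (G u)" if "u \<subseteq> ?S" for u
    unfolding G_def weak_deriv_def by (rule someI_ex[OF F_weak[OF that]])
  define D where "D = (\<lambda>u. averaged_deriv s u (G u))"
  define E where "E = (\<lambda>u. deriv_energy s u F)"
  have E: "E u = (LINT x|cube_measure u. (D u x)\<^sup>2)" for u
    unfolding E_def D_def G_def deriv_energy_def averaged_deriv_def ..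
  define X where "X = (\<lambda>k \<Delta> j. frac (real k * of_int (z j) / real N + \<Delta> j))"
  define W where "W = (\<lambda>u \<Delta>. (1 / real N)\<^sup>2 * (\<Sum>k=1..N. \<Sum>l=1..N. \<Prod>j\<in>u. kernel_product (X k \<Delta> j) (X l \<Delta> j)))"
  have X01: "X k \<Delta> j \<in> {0..1}" for k \<Delta> j
    by (simp add: X_def frac_lt_1 less_imp_le)
  have W: "W u \<Delta> = (LINT y|cube_measure u. (1 / real N * (\<Sum>k=1..N. \<Prod>j\<in>u. bernoulli_kernel (X k \<Delta> j - 1/2) (y j)))\<^sup>2)"
    if "u \<subseteq> ?S" for u \<Delta>
    unfolding W_def using X01 finite_subset[OF that] by (subst integral_square_kernel_sum) auto
  have fin: "finite u" if "u \<subseteq> ?S" for u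
    using that finite_subset by auto
  have W_nonneg: "0 \<le> W u \<Delta>" if "u \<subseteq> ?S" for u \<Delta>
    unfolding W[OF that] by simp
  define n2 where "n2 = (\<Sum>u\<in>Pow ?S. E u / \<gamma> u)"
  have E_nonneg: "0 \<le> E u" for u
    unfolding E by simp
  have n2: "(\<Sum>u\<in>?U. E u / \<gamma> u) \<le> n2" "0 \<le> n2"
    unfolding n2_def using \<gamma> E_nonneg by (auto intro!: sum_mono2 sum_nonneg divide_nonneg_nonneg)
  have pointwise: "\<bar>cube_integral s F - shifted_lattice_rule s N z \<Delta> F\<bar>\<^sup>2 \<le> n2 * (\<Sum>u\<in>?U. \<gamma> u * W u \<Delta>)"
    if \<Delta>: "\<forall>k\<in>{1..N}. \<forall>j\<in>?S. frac (real k * of_int (z j) / real N + \<Delta> j) \<noteq> 0" for \<Delta>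
  proof -
    define a where "a = (\<lambda>u. LINT y|cube_measure u. D u y * (1 / real N * (\<Sum>k=1..N. \<Prod>j\<in>u. bernoulli_kernel (X k \<Delta> j - 1/2) (y j))))"
    have Fk: "F (\<lambda>j\<in>?S. frac (real k * of_int (z j) / real N + \<Delta> j) - 1/2) =
      cube_integral s F + (\<Sum>u\<in>?U. LINT y|cube_measure u. D u y * (\<Prod>j\<in>u. bernoulli_kernel (X k \<Delta> j - 1/2) (y j)))"
      if k: "k \<in> {1..N}" for k
    proof -
      let ?x = "\<lambda>j\<in>?S. frac (real k * of_int (z j) / real N + \<Delta> j) - 1/2"
      have int: "\<bar>?x j\<bar> < 1/2" if "j \<in> ?S" for j
      proof -
        have "0 < frac (real k * of_int (z j) / real N + \<Delta> j)"
          using \<Delta> k that by (metis frac_ge_0 less_eq_real_def)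
        then have "\<bar>frac (real k * of_int (z j) / real N + \<Delta> j) - 1/2\<bar> < 1/2"
          using frac_lt_1[of "real k * of_int (z j) / real N + \<Delta> j"] by linarith
        then show ?thesis
          using that by simp
      qed
      moreover have "?x \<in> cube ?S"
        unfolding cube_def
      proof (rule restrict_PiE_iff[THEN iffD2], rule ballI)
        fix j assume "j \<in> ?S"
        show "frac (real k * of_int (z j) / real N + \<Delta> j) - 1/2 \<in> {-1/2..1/2}"
          using frac_lt_1[of "real k * of_int (z j) / real N + \<Delta> j"] by (auto simp: less_imp_le)
      qed
      ultimately have "F ?x = (\<Sum>u\<in>Pow ?S. LINT y|cube_measure ?S. G u y * (\<Prod>j\<in>u. bernoulli_kernel (?x j) (y j)))"
        by (intro weak_representation[OF Fc G]) auto
      also have "\<dots> = (\<Sum>u\<in>Pow ?S. LINT y|cube_measure u. D u y * (\<Prod>j\<in>u. bernoulli_kernel (X k \<Delta> j - 1/2) (y j)))"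
      proof (intro sum.cong refl)
        fix u assume "u \<in> Pow ?S"
        then have u: "u \<subseteq> ?S" by simp
        have "(\<Prod>j\<in>u. bernoulli_kernel (?x j) (y j)) = (\<Prod>j\<in>u. bernoulli_kernel (X k \<Delta> j - 1/2) (y j))" for y
          using u by (intro prod.cong) (auto simp: X_def)
        then show "(LINT y|cube_measure ?S. G u y * (\<Prod>j\<in>u. bernoulli_kernel (?x j) (y j))) =
          (LINT y|cube_measure u. D u y * (\<Prod>j\<in>u. bernoulli_kernel (X k \<Delta> j - 1/2) (y j)))"
          unfolding D_def by (simp only: integral_averaged_deriv[OF G[OF u] u])
      qed
      also have "\<dots> = (LINT y|cube_measure {}. D {} y) + (\<Sum>u\<in>?U. LINT y|cube_measure u. D u y * (\<Prod>j\<in>u. bernoulli_kernel (X k \<Delta> j - 1/2) (y j)))"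
        by (subst sum.remove[of _ "{}"]) auto
      also have "(LINT y|cube_measure {}. D {} y) = (LINT y|cube_measure ?S. G {} y)"
        using integral_averaged_deriv[OF G, of "{}" undefined] by (simp add: D_def)
      also have "\<dots> = cube_integral s F"
        unfolding cube_integral_def by (rule weak_deriv_empty_integral[OF Fc G, symmetric]) simp
      finally show ?thesis .
    qed
    have int: "integrable (cube_measure u) (\<lambda>y. D u y * (\<Prod>j\<in>u. bernoulli_kernel (X k \<Delta> j - 1/2) (y j)))" if "u \<subseteq> ?S" for u k
      using integral_Cauchy_Schwarz(1)[OF averaged_deriv_square_integrable[OF G[OF that] that]
          square_kernel_sum_integrable[OF fin[OF that], of 1 "\<lambda>k j. X k \<Delta> j - 1/2" "{k}"]]
      by (simp add: D_def)
    have "shifted_lattice_rule s N z \<Delta> F = cube_integral s F +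
      1 / real N * (\<Sum>k=1..N. \<Sum>u\<in>?U. LINT y|cube_measure u. D u y * (\<Prod>j\<in>u. bernoulli_kernel (X k \<Delta> j - 1/2) (y j)))"
      unfolding shifted_lattice_rule_def
      by (subst sum.cong[OF refl Fk], assumption)
         (use N in \<open>simp add: sum.distrib distrib_left add_divide_distrib del: One_nat_def\<close>)
    also have "1 / real N * (\<Sum>k=1..N. \<Sum>u\<in>?U. LINT y|cube_measure u. D u y * (\<Prod>j\<in>u. bernoulli_kernel (X k \<Delta> j - 1/2) (y j))) = (\<Sum>u\<in>?U. a u)"
    proof -
      have "a u = 1 / real N * (\<Sum>k=1..N. LINT y|cube_measure u. D u y * (\<Prod>j\<in>u. bernoulli_kernel (X k \<Delta> j - 1/2) (y j)))"
        if "u \<in> ?U" for u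
      proof -
        have "a u = (LINT y|cube_measure u. 1 / real N * (\<Sum>k=1..N. D u y * (\<Prod>j\<in>u. bernoulli_kernel (X k \<Delta> j - 1/2) (y j))))"
          unfolding a_def sum_distrib_left by (simp only: mult.left_commute)
        also have "\<dots> = 1 / real N * (\<Sum>k=1..N. LINT y|cube_measure u. D u y * (\<Prod>j\<in>u. bernoulli_kernel (X k \<Delta> j - 1/2) (y j)))"
          using that by (subst integral_mult_right_zero, subst Bochner_Integration.integral_sum) (auto intro!: int simp del: One_nat_def)
        finally show ?thesis .
      qed
      then have "(\<Sum>u\<in>?U. a u) = (\<Sum>u\<in>?U. 1 / real N * (\<Sum>k=1..N. LINT y|cube_measure u. D u y * (\<Prod>j\<in>u. bernoulli_kernel (X k \<Delta> j - 1/2) (y j))))"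
        by (intro sum.cong) auto
      then show ?thesis
        by (simp only: sum_distrib_left) (rule sum.swap)
    qed
    finally have "\<bar>cube_integral s F - shifted_lattice_rule s N z \<Delta> F\<bar>\<^sup>2 = (\<Sum>u\<in>?U. a u)\<^sup>2"
      by simp
    also have "\<dots> \<le> (\<Sum>u\<in>?U. E u / \<gamma> u) * (\<Sum>u\<in>?U. \<gamma> u * W u \<Delta>)"
    proof (rule weighted_Cauchy_Schwarz_sum)
      fix u assume "u \<in> ?U"
      then have u: "u \<subseteq> ?S" by auto
      show "0 \<le> \<gamma> u" "0 \<le> E u" "0 \<le> W u \<Delta>"
        by (intro \<gamma> E_nonneg W_nonneg u)+
      show "\<gamma> u = 0 \<Longrightarrow> E u = 0"
        unfolding E_def by (rule F_zero[OF u])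
      show "(a u)\<^sup>2 \<le> E u * W u \<Delta>"
        unfolding a_def E W[OF u] D_def
        by (rule integral_Cauchy_Schwarz(2)[OF averaged_deriv_square_integrable[OF G[OF u] u] square_kernel_sum_integrable[OF fin[OF u]]])
    qed
    \<comment> \<open>The squared norm also counts the empty set, whose term is absent from the
      error because it reproduces the exact integral.\<close>
    also have "\<dots> \<le> n2 * (\<Sum>u\<in>?U. \<gamma> u * W u \<Delta>)"
      using \<gamma> W_nonneg by (intro mult_right_mono n2 sum_nonneg mult_nonneg_nonneg) auto
    finally show ?thesis .
  qed
  have W_int: "integrable ?M (W u)" if "u \<subseteq> ?S" for u
    using shift_average_kernel_sum(1)[OF that N, of z] unfolding W_def X_def .
  have W_val: "(LINT \<Delta>|?M. W u \<Delta>) = 1 / real N * (\<Sum>k<N. \<Prod>j\<in>u. bernoulli2 (frac (of_int (int k * z j) / real N)))"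
    if "u \<subseteq> ?S" for u
    using shift_average_kernel_sum(2)[OF that N, of z] unfolding W_def X_def .
  have "(LINT \<Delta>|?M. \<bar>cube_integral s F - shifted_lattice_rule s N z \<Delta> F\<bar>\<^sup>2) \<le> (LINT \<Delta>|?M. n2 * (\<Sum>u\<in>?U. \<gamma> u * W u \<Delta>))"
  \<comment> \<open>Only the upper bound is shown to be integrable: a left side that is not
    integrable would have the value 0.\<close>
  proof (rule integral_mono_AE')
    show "integrable ?M (\<lambda>\<Delta>. n2 * (\<Sum>u\<in>?U. \<gamma> u * W u \<Delta>))"
      by (intro integrable_mult_right Bochner_Integration.integrable_sum W_int) auto
    show "AE \<Delta> in ?M. \<bar>cube_integral s F - shifted_lattice_rule s N z \<Delta> F\<bar>\<^sup>2 \<le> n2 * (\<Sum>u\<in>?U. \<gamma> u * W u \<Delta>)"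
      using AE_shift_interior[where s = s and N = N and a = "\<lambda>k j. real k * of_int (z j) / real N"]
      by eventually_elim (rule pointwise)
    show "AE \<Delta> in ?M. 0 \<le> n2 * (\<Sum>u\<in>?U. \<gamma> u * W u \<Delta>)"
      using \<gamma> W_nonneg n2 by (intro AE_I2 mult_nonneg_nonneg sum_nonneg) auto
  qed
  also have "\<dots> = n2 * squared_lattice_error s N \<gamma> z"
    unfolding squared_lattice_error_def
    by (subst integral_mult_right_zero, subst Bochner_Integration.integral_sum)
       (auto intro!: W_int simp: W_val simp del: One_nat_def)
  finally have "rms_error s N z F \<le> sqrt (n2 * squared_lattice_error s N \<gamma> z)"
    unfolding rms_error_def by (rule real_sqrt_le_mono)
  also have "\<dots> = sqrt (squared_lattice_error s N \<gamma> z) * sobolev_norm s \<gamma> F"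
    by (simp add: real_sqrt_mult sobolev_norm_def n2_def E_def)
  finally show ?thesis .
qed

subsection \<open>Roots of unity\<close>

lemma cis_two_pi_int: "cis (2 * pi * of_int n) = 1"
  by (rule cis_multiple_2pi) simp

definition unity_root :: "nat \<Rightarrow> int \<Rightarrow> complex" where
  "unity_root N k = cis (2 * pi * of_int k / of_nat N)"

lemma unity_root_add: "unity_root N (k + l) = unity_root N k * unity_root N l"
  by (simp add: unity_root_def cis_mult add_divide_distrib distrib_left)

lemma unity_root_0 [simp]: "unity_root N 0 = 1"
  by (simp add: unity_root_def)

lemma unity_root_mult_self: "N > 0 \<Longrightarrow> unity_root N (int N * k) = 1"
  using cis_two_pi_int[of k] by (simp add: unity_root_def field_simps)

lemma unity_root_mod: "N > 0 \<Longrightarrow> unity_root N (k mod int N) = unity_root N k"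
  by (metis mod_mult_div_eq mult.right_neutral unity_root_add unity_root_mult_self)

lemma unity_root_cong: "N > 0 \<Longrightarrow> k mod int N = l mod int N \<Longrightarrow> unity_root N k = unity_root N l"
  by (metis unity_root_mod)

lemma unity_root_power: "unity_root N (int n * k) = unity_root N k ^ n"
  by (induction n) (simp_all add: algebra_simps unity_root_add)

lemma unity_root_eq_1_iff:
  assumes "N > 0"
  shows "unity_root N k = 1 \<longleftrightarrow> int N dvd k"
proof
  assume "unity_root N k = 1"
  then have "cos (2 * pi * of_int k / of_nat N) = 1"
    by (simp add: unity_root_def complex_eq_iff)
  then obtain n :: int where "2 * pi * of_int k / real N = of_int n * 2 * pi"
    unfolding cos_one_2pi_int by auto
  then have "real_of_int k = of_int (n * int N)"
    using assms by (simp add: field_simps)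
  then show "int N dvd k"
    by (metis dvd_triv_right of_int_eq_iff)
next
  assume "int N dvd k"
  then show "unity_root N k = 1"
    using unity_root_mult_self[OF assms] by (auto elim!: dvdE)
qed

lemma sum_unity_root:
  assumes "N > 0"
  shows "(\<Sum>k<N. unity_root N (int k * r)) = (if int N dvd r then of_nat N else 0)"
proof (cases "int N dvd r")
  case True
  then have "unity_root N r = 1"
    using unity_root_eq_1_iff[OF assms] by simp
  then show ?thesis
    using True by (simp add: unity_root_power)
next
  case False
  then have "unity_root N r \<noteq> 1"
    using unity_root_eq_1_iff[OF assms] by simp
  moreover have "unity_root N r ^ N = 1"
    using unity_root_mult_self[OF assms, of r] unity_root_power[of N N r] by simp
  ultimately show ?thesis
    using False by (simp add: unity_root_power sum_gp_strict)
qed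

subsection \<open>Fourier coefficients on residue classes\<close>

lemma has_sum_finite_sum:
  assumes "finite I" "\<And>i. i \<in> I \<Longrightarrow> (f i has_sum s i) A"
  shows "((\<lambda>x. \<Sum>i\<in>I. f i x) has_sum (\<Sum>i\<in>I. s i :: 'a :: topological_comm_monoid_add)) A"
  using assms by (induction I rule: finite_induct) (auto intro: has_sum_add)

lemma summable_on_abs_powr:
  assumes "a > 1"
  shows "(\<lambda>h::int. 1 / \<bar>of_int h\<bar> powr a :: real) summable_on (- {0})"
    and "infsum (\<lambda>h::int. 1 / \<bar>of_int h\<bar> powr a :: real) (- {0}) = 2 * zeta_real a"
proof -
  have s: "summable (\<lambda>n. 1 / real n powr a)"
    using assms summable_real_powr_iff[of "- a"] by (simp add: powr_minus field_simps)
  show "(\<lambda>h::int. 1 / \<bar>of_int h\<bar> powr a :: real) summable_on (- {0})"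
    using abs_summable_on_nonzero_int[of "\<lambda>h::int. 1 / \<bar>of_int h\<bar> powr a :: real"] s by simp
  show "infsum (\<lambda>h::int. 1 / \<bar>of_int h\<bar> powr a :: real) (- {0}) = 2 * zeta_real a"
    using infsum_nonzero_int[of "\<lambda>h::int. 1 / \<bar>of_int h\<bar> powr a :: real"] s
    by (simp add: zeta_real_def abs_of_nonneg add.commute)
qed

text \<open>All frequencies \<open>h\<close> with \<open>h * z\<close> in the residue class
  \<open>r\<close> agree on the lattice, so their Fourier coefficients are collected. This leaves a
  finite expansion with nonnegative coefficients. The exponent is \<open>2\<close> for the kernel
  and \<open>2 * lam\<close> after Jensen's inequality.\<close>

definition residue_coeff :: "nat \<Rightarrow> real \<Rightarrow> nat \<Rightarrow> int \<Rightarrow> real" where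
  "residue_coeff N a z r =
     infsum (\<lambda>h. (if h * int z mod int N = r then 1 else 0) / \<bar>of_int h\<bar> powr a) (- {0::int})"

lemma residue_coeff_summable:
  assumes "a > 1"
  shows "(\<lambda>h::int. (if P h then 1 else 0) / \<bar>of_int h\<bar> powr a :: real) summable_on (- {0})"
  by (rule summable_on_comparison_test[OF summable_on_abs_powr(1)[OF assms]]) auto

lemma residue_coeff_nonneg: "residue_coeff N a z r \<ge> 0"
  unfolding residue_coeff_def by (intro infsum_nonneg) auto

lemma sum_residue_indicator:
  fixes g :: "int \<Rightarrow> 'a :: comm_monoid_add"
  assumes "N > 0"
  shows "(\<Sum>r<N. if x mod int N = int r then g (int r) else 0) = g (x mod int N)"
proof -
  have "(\<Sum>r<N. if x mod int N = int r then g (int r) else 0) =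
      (\<Sum>r<N. if r = nat (x mod int N) then g (int r) else 0)"
    using assms by (intro sum.cong) (auto simp: nat_eq_iff)
  also have "\<dots> = g (x mod int N)"
    using assms by (auto simp: nat_less_iff)
  finally show ?thesis .
qed

lemma sum_residue_coeff:
  assumes "N > 0" "a > 1"
  shows "(\<Sum>r<N. residue_coeff N a z (int r)) = 2 * zeta_real a"
proof -
  have "((\<lambda>h::int. \<Sum>r<N. (if h * int z mod int N = int r then 1 else 0) / \<bar>of_int h\<bar> powr a) has_sum
      (\<Sum>r<N. residue_coeff N a z (int r))) (- {0})"
    unfolding residue_coeff_def
    by (intro has_sum_finite_sum has_sum_infsum residue_coeff_summable assms) auto
  moreover have "(\<Sum>r<N. (if h * int z mod int N = int r then 1 else 0) / \<bar>of_int h\<bar> powr a) = 1 / \<bar>of_int h\<bar> powr a" for h :: int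
    using sum_residue_indicator[OF assms(1), of "h * int z" "\<lambda>_. 1 / \<bar>of_int h\<bar> powr a"]
    by (simp add: if_distrib[of "\<lambda>x. x / _"] cong: if_cong)
  ultimately show ?thesis
    using summable_on_abs_powr(2)[OF assms(2)] by (simp add: infsumI)
qed

lemma omega_matrix_Fourier:
  assumes N: "N > 0"
  shows "of_real (omega_matrix N z k) = (\<Sum>r<N. of_real (residue_coeff N 2 z (int r)) * unity_root N (int k * int r))"
proof -
  let ?x = "real (k * z mod N) / real N"
  let ?f = "\<lambda>h::int. cis (2 * pi * of_int h * ?x) / of_real (\<bar>of_int h\<bar> powr 2)"
  have cis_eq: "cis (2 * pi * of_int h * ?x) = unity_root N (int k * (h * int z))" for h
  proof -
    have "cis (2 * pi * of_int h * ?x) = unity_root N (h * int (k * z mod N))"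
      by (simp add: unity_root_def mult.assoc)
    also have "\<dots> = unity_root N (int k * (h * int z))"
      by (rule unity_root_cong[OF N]) (simp add: zmod_int mod_mult_right_eq mult_ac)
    finally show ?thesis .
  qed
  have s: "(\<lambda>h. norm (?f h)) summable_on (- {0})"
    using summable_on_abs_powr(1)[of 2] by (simp add: norm_divide norm_power)
  have real: "of_real (Re x) = x" if "x = cnj x" for x
    using that by (simp add: complex_eq_iff)
  \<comment> \<open>The series is invariant under \<open>h\<close> to \<open>- h\<close> and hence
    equals its conjugate, so the real part taken in \<open>korobov_omega\<close> is the whole
    sum.\<close>
  have "infsum ?f (- {0}) = infsum (\<lambda>h. ?f (- h)) (- {0})"
    by (rule infsum_reindex_bij_betw[symmetric]) (auto intro!: bij_betw_byWitness[where f' = uminus])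
  also have "\<dots> = infsum (\<lambda>h. cnj (?f h)) (- {0})"
    by (simp add: cis_cnj)
  also have "\<dots> = cnj (infsum ?f (- {0}))"
    by (rule infsum_cnj)
  finally have "of_real (Re (infsum ?f (- {0}))) = infsum ?f (- {0})"
    by (rule real)
  then have "of_real (omega_matrix N z k) = infsum ?f (- {0})"
    by (simp add: omega_matrix_def korobov_omega_def Compl_eq_Diff_UNIV)
  also have "\<dots> = (\<Sum>r<N. of_real (residue_coeff N 2 z (int r)) * unity_root N (int k * int r))"
  proof (rule infsumI)
    have "((\<lambda>h::int. \<Sum>r<N. of_real ((if h * int z mod int N = int r then 1 else 0) / \<bar>of_int h\<bar> powr 2) * unity_root N (int k * int r)) has_sum
      (\<Sum>r<N. of_real (residue_coeff N 2 z (int r)) * unity_root N (int k * int r))) (- {0})"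
      unfolding residue_coeff_def
      by (intro has_sum_finite_sum has_sum_cmult_left has_sum_of_real has_sum_infsum residue_coeff_summable) auto
    moreover have "(\<Sum>r<N. of_real ((if h * int z mod int N = int r then 1 else 0) / \<bar>of_int h\<bar> powr 2) * unity_root N (int k * int r)) = ?f h" for h
    proof -
      have "(\<Sum>r<N. of_real ((if h * int z mod int N = int r then 1 else 0) / \<bar>of_int h\<bar> powr 2) * unity_root N (int k * int r)) =
         (\<Sum>r<N. if h * int z mod int N = int r then unity_root N (int k * int r) / of_real (\<bar>of_int h\<bar> powr 2) else 0)"
        by (intro sum.cong) auto
      also have "\<dots> = unity_root N (int k * (h * int z mod int N)) / of_real (\<bar>of_int h\<bar> powr 2)"
        by (rule sum_residue_indicator[OF N])
      also have "unity_root N (int k * (h * int z mod int N)) = unity_root N (int k * (h * int z))"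
        by (rule unity_root_cong[OF N]) (simp add: mod_mult_right_eq)
      finally show ?thesis
        by (simp only: cis_eq)
    qed
    ultimately show "(?f has_sum (\<Sum>r<N. of_real (residue_coeff N 2 z (int r)) * unity_root N (int k * int r))) (- {0})"
      by simp
  qed
  finally show ?thesis .
qed

text \<open>Only index tuples whose sum is divisible by \<open>N\<close> survive the average over \<open>k\<close>.\<close>

lemma mean_prod_omega:
  assumes N: "N > 0" and u: "finite u"
  shows "1 / real N * (\<Sum>k<N. \<Prod>i\<in>u. omega_matrix N (Z i) k) =
    (\<Sum>\<rho>\<in>PiE u (\<lambda>_. {..<N}). if int N dvd (\<Sum>i\<in>u. int (\<rho> i)) then \<Prod>i\<in>u. residue_coeff N 2 (Z i) (int (\<rho> i)) else 0)"
    (is "?L = ?R")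
proof -
  let ?c = "\<lambda>i r. complex_of_real (residue_coeff N 2 (Z i) (int r))"
  have prod_root: "(\<Prod>i\<in>u. unity_root N (int k * f i)) = unity_root N (int k * (\<Sum>i\<in>u. f i))" for k f
    using u by (induction u rule: finite_induct) (simp_all add: distrib_left unity_root_add)
  have "complex_of_real (\<Sum>k<N. \<Prod>i\<in>u. omega_matrix N (Z i) k) =
     (\<Sum>k<N. \<Prod>i\<in>u. \<Sum>r<N. ?c i r * unity_root N (int k * int r))"
    by (simp add: omega_matrix_Fourier[OF N])
  also have "\<dots> = (\<Sum>k<N. \<Sum>\<rho>\<in>PiE u (\<lambda>_. {..<N}). (\<Prod>i\<in>u. ?c i (\<rho> i)) * unity_root N (int k * (\<Sum>i\<in>u. int (\<rho> i))))"
    using u by (subst prod_sum_PiE) (auto simp: prod.distrib prod_root)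
  also have "\<dots> = (\<Sum>\<rho>\<in>PiE u (\<lambda>_. {..<N}). (\<Prod>i\<in>u. ?c i (\<rho> i)) * (\<Sum>k<N. unity_root N (int k * (\<Sum>i\<in>u. int (\<rho> i)))))"
    by (subst sum.swap) (simp add: sum_distrib_left)
  also have "\<dots> = (\<Sum>\<rho>\<in>PiE u (\<lambda>_. {..<N}). of_nat N * of_real (if int N dvd (\<Sum>i\<in>u. int (\<rho> i)) then \<Prod>i\<in>u. residue_coeff N 2 (Z i) (int (\<rho> i)) else 0))"
    unfolding sum_unity_root[OF N] by (intro sum.cong) auto
  also have "\<dots> = complex_of_real (real N * ?R)"
    by (simp add: sum_distrib_left)
  finally have "(\<Sum>k<N. \<Prod>i\<in>u. omega_matrix N (Z i) k) = real N * ?R"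
    by (simp only: of_real_eq_iff)
  then show ?thesis
    using N by simp
qed

subsection \<open>Jensen's inequality\<close>

text \<open>After division by \<open>x + y\<close> both summands lie in the unit interval, where
  \<open>t \<le> t powr lam\<close>.\<close>

lemma powr_add_le:
  fixes x y lam :: real
  assumes "x \<ge> 0" "y \<ge> 0" "0 < lam" "lam \<le> 1"
  shows "(x + y) powr lam \<le> x powr lam + y powr lam"
proof (cases "x + y = 0")
  case False
  then have s: "x + y > 0"
    using assms by auto
  have t: "t \<le> t powr lam" if "0 \<le> t" "t \<le> 1" for t :: real
  proof (cases "t = 0")
    case False
    then have "t powr 1 \<le> t powr lam"
      using that assms by (intro powr_mono') auto
    then show ?thesis
      using that False by simp
  qed simp
  have "1 = x / (x + y) + y / (x + y)"
    using s by (simp flip: add_divide_distrib)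
  also have "\<dots> \<le> (x / (x + y)) powr lam + (y / (x + y)) powr lam"
    using assms s by (intro add_mono t) (auto simp: field_simps)
  also have "\<dots> = (x powr lam + y powr lam) / (x + y) powr lam"
    using assms s by (simp add: powr_divide add_divide_distrib)
  finally show ?thesis
    using s by (simp add: field_simps)
next
  case True
  then have "x = 0" "y = 0"
    using assms by auto
  then show ?thesis
    by simp
qed

lemma powr_sum_le:
  fixes f :: "'a \<Rightarrow> real"
  assumes "\<And>i. i \<in> A \<Longrightarrow> f i \<ge> 0" "0 < lam" "lam \<le> 1"
  shows "(\<Sum>i\<in>A. f i) powr lam \<le> (\<Sum>i\<in>A. f i powr lam)"
  using assms
proof (induction A rule: infinite_finite_induct)
  case (insert x A)
  have "(f x + sum f A) powr lam \<le> f x powr lam + sum f A powr lam"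
    using insert by (intro powr_add_le sum_nonneg) auto
  then show ?case
    using insert by fastforce
qed auto

lemma powr_infsum_le:
  fixes f :: "'a \<Rightarrow> real"
  assumes "\<And>i. i \<in> A \<Longrightarrow> f i \<ge> 0" "0 < lam" "lam \<le> 1"
    and "f summable_on A" "(\<lambda>i. f i powr lam) summable_on A"
  shows "infsum f A powr lam \<le> infsum (\<lambda>i. f i powr lam) A"
proof (rule tendsto_upperbound)
  show "((\<lambda>F. sum f F powr lam) \<longlongrightarrow> infsum f A powr lam) (finite_subsets_at_top A)"
  proof (rule tendsto_powr')
    show "(sum f \<longlongrightarrow> infsum f A) (finite_subsets_at_top A)"
      using assms(4) has_sum_def has_sum_infsum by blast
    show "infsum f A \<noteq> 0 \<or> 0 < lam \<and> (\<forall>\<^sub>F F in finite_subsets_at_top A. 0 \<le> sum f F)"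
      using assms by (auto intro!: eventually_finite_subsets_at_top_weakI sum_nonneg)
  qed simp
  show "\<forall>\<^sub>F F in finite_subsets_at_top A. sum f F powr lam \<le> infsum (\<lambda>i. f i powr lam) A"
  proof (rule eventually_finite_subsets_at_top_weakI)
    fix F assume F: "finite F" "F \<subseteq> A"
    have "sum f F powr lam \<le> (\<Sum>i\<in>F. f i powr lam)"
      using F assms by (intro powr_sum_le) auto
    also have "\<dots> \<le> infsum (\<lambda>i. f i powr lam) A"
      using F assms by (intro finite_sum_le_infsum) auto
    finally show "sum f F powr lam \<le> infsum (\<lambda>i. f i powr lam) A" .
  qed
qed simp

text \<open>Subadditivity is applied to the series term by term. The condition
  \<open>1/2 < lam\<close> makes the exponent \<open>2 * lam\<close> exceed 1, so that the resulting
  series converges.\<close>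

lemma residue_coeff_powr_le:
  assumes "1/2 < lam" "lam \<le> 1"
  shows "residue_coeff N 2 z r powr lam \<le> residue_coeff N (2 * lam) z r"
proof -
  have eq: "((if P then 1 else 0) / \<bar>x\<bar> powr 2) powr lam = (if P then 1 else 0) / \<bar>x\<bar> powr (2 * lam)" for P and x :: real
    by (cases P) (simp_all add: powr_divide powr_powr del: powr_numeral)
  have "infsum (\<lambda>h::int. (if h * int z mod int N = r then 1 else 0) / \<bar>of_int h\<bar> powr 2) (- {0}) powr lam
    \<le> infsum (\<lambda>h::int. ((if h * int z mod int N = r then 1 else 0) / \<bar>of_int h\<bar> powr 2) powr lam) (- {0})"
  proof (rule powr_infsum_le)
    show "(\<lambda>h::int. ((if h * int z mod int N = r then 1 else 0) / \<bar>of_int h\<bar> powr 2) powr lam) summable_on - {0}"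
      unfolding eq by (rule residue_coeff_summable) (use assms in simp)
    show "(\<lambda>h::int. (if h * int z mod int N = r then 1 else 0) / \<bar>of_int h\<bar> powr 2 :: real) summable_on - {0}"
      by (rule residue_coeff_summable) simp
  qed (use assms in simp_all)
  then show ?thesis
    unfolding residue_coeff_def eq .
qed

subsection \<open>Averaging over the units\<close>

text \<open>At least half of the residues are units because \<open>b \<le> 2 * (b - 1)\<close>. For
  \<open>t = 0\<close> the residue 0 counts as a unit modulo 1. This is the origin of the factor 2
  in the error bound.\<close>

lemma card_unit_residues_ge:
  assumes "prime b"
  shows "b ^ t \<le> 2 * card (unit_residues (b ^ t))"
proof (cases "t = 0")
  case True
  then have "unit_residues (b ^ t) = {0}"
    by (auto simp: unit_residues_def)
  then show ?thesis
    using True by simp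
next
  case False
  have b: "b > 1"
    using assms prime_gt_1_nat by blast
  then have "b ^ t > 1"
    using False by (intro one_less_power) auto
  moreover have "unit_residues n = totatives n" if "n > 1" for n
  proof -
    have *: "coprime x n \<Longrightarrow> x \<noteq> n \<and> x \<noteq> 0" for x
      using that by (cases "x = 0") auto
    show ?thesis
    proof (rule Set.set_eqI)
      fix x
      show "x \<in> unit_residues n \<longleftrightarrow> x \<in> totatives n"
        unfolding unit_residues_def totatives_def using *[of x] by (cases "coprime x n") auto
    qed
  qed
  ultimately have "unit_residues (b ^ t) = totatives (b ^ t)"
    by blast
  then have "card (unit_residues (b ^ t)) = b ^ (t - 1) * (b - 1)"
    using totient_prime_power[OF assms, of t] False by (simp add: totient_def)
  moreover have "b ^ t = b ^ (t - 1) * b"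
    using False by (cases t) auto
  moreover have "b \<le> 2 * (b - 1)"
    using b by simp
  ultimately show ?thesis
    by (metis mult.left_commute mult_le_mono2)
qed

lemma unit_residues_nonempty: "prime b \<Longrightarrow> unit_residues (b ^ t) \<noteq> {}"
  using card_unit_residues_ge[of b t] prime_gt_0_nat[of b] by (auto dest!: card_gt_0_iff[THEN iffD1])

lemma finite_unit_residues [simp]: "finite (unit_residues n)"
  by (simp add: unit_residues_def)

text \<open>Substituting multiples of \<open>d\<close> gains the factor
  \<open>real d powr a\<close>, of which only \<open>real d\<close> is kept.\<close>

lemma infsum_multiples_le:
  fixes f :: "int \<Rightarrow> real"
  assumes d: "d > 0" and a: "a > 1" and f: "\<And>h. h \<noteq> 0 \<Longrightarrow> 0 \<le> f h" "\<And>h. h \<noteq> 0 \<Longrightarrow> f h \<noteq> 0 \<Longrightarrow> int d dvd h"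
    "\<And>h. h \<noteq> 0 \<Longrightarrow> f h \<le> D / \<bar>of_int h\<bar> powr a" and D: "D \<ge> 0"
  shows "infsum f (- {0}) \<le> D / real d * (2 * zeta_real a)"
proof -
  let ?m = "\<lambda>h::int. int d * h"
  have inj: "inj_on ?m (- {0})"
    using d by (auto simp: inj_on_def)
  have zero: "f h = 0" if "h \<in> - {0} - ?m ` (- {0})" for h
  proof (rule ccontr)
    assume "f h \<noteq> 0"
    then have "int d dvd h"
      using f(2)[of h] that by auto
    then obtain k where "h = int d * k" ..
    then show False
      using that by auto
  qed
  have "infsum f (- {0}) = infsum f (?m ` (- {0}))"
    using zero d by (intro infsum_cong_neutral) auto
  also have "\<dots> = infsum (f \<circ> ?m) (- {0})"
    by (rule infsum_reindex[OF inj])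
  also have "\<dots> \<le> infsum (\<lambda>h. D / real d powr a * (1 / \<bar>of_int h\<bar> powr a)) (- {0})"
  proof (rule infsum_mono)
    have "(f \<circ> ?m) h \<le> D / real d powr a * (1 / \<bar>of_int h\<bar> powr a)" if "h \<in> - {0}" for h
      using f(3)[of "?m h"] that d by (simp add: abs_mult powr_mult)
    then show le: "\<And>h. h \<in> - {0} \<Longrightarrow> (f \<circ> ?m) h \<le> D / real d powr a * (1 / \<bar>of_int h\<bar> powr a)" .
    show s: "(\<lambda>h. D / real d powr a * (1 / \<bar>of_int h\<bar> powr a)) summable_on (- {0})"
      by (intro summable_on_cmult_right summable_on_abs_powr a)
    show "(f \<circ> ?m) summable_on (- {0})"
      by (rule summable_on_comparison_test[OF s le]) (use f(1) d in auto)
  qed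
  also have "\<dots> = D / real d powr a * (2 * zeta_real a)"
    by (simp only: infsum_cmult_right' summable_on_abs_powr(2)[OF a])
  also have "\<dots> \<le> D / real d * (2 * zeta_real a)"
  proof (intro mult_right_mono divide_left_mono D)
    have "real d powr 1 \<le> real d powr a"
      using d a by (intro powr_mono) auto
    then show "real d \<le> real d powr a"
      using d by simp
    have "0 \<le> infsum (\<lambda>h::int. 1 / \<bar>of_int h\<bar> powr a :: real) (- {0})"
      by (intro infsum_nonneg) auto
    then show "0 \<le> 2 * zeta_real a"
      by (simp only: summable_on_abs_powr(2)[OF a])
  qed (use d in auto)
  finally show ?thesis .
qed

text \<open>Exchanging the sums leaves, for each frequency \<open>h\<close>, the number
  \<open>cnt h\<close> of units that move \<open>h\<close> into the class \<open>r\<close>. If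
  \<open>r = 0\<close>, all units may count, but only for multiples \<open>h\<close> of
  \<open>b ^ (m - w)\<close>. If \<open>r \<noteq> 0\<close>, let \<open>b ^ e\<close> be the power
  of \<open>b\<close> in \<open>r div b ^ w\<close>: then \<open>h\<close> is a multiple of
  \<open>b ^ e\<close> and at most \<open>b ^ e\<close> units count, so the two effects cancel. The
  remaining constant is paid for by \<open>card_unit_residues_ge\<close>.\<close>

lemma sum_units_residue_coeff_le:
  assumes b: "prime b" and w: "w \<le> m" and a: "a > 1" and r: "r < b ^ m"
  shows "(\<Sum>y\<in>unit_residues (b ^ (m - w)). residue_coeff (b ^ m) a (b ^ w * y) (int r))
    \<le> real (card (unit_residues (b ^ (m - w)))) * (2 / real (b ^ (m - w)) * (2 * zeta_real a))"
proof -
  define t where "t = m - w"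
  let ?U = "unit_residues (b ^ t)"
  have b0: "b > 0"
    using b prime_gt_0_nat by blast
  have m: "b ^ m = b ^ w * b ^ t"
    using w by (simp add: t_def flip: power_add)
  define cnt where "cnt = (\<lambda>h. card {y \<in> ?U. h * int (b ^ w * y) mod int (b ^ m) = int r})"
  have zeta: "0 \<le> 2 * zeta_real a"
  proof -
    have "0 \<le> infsum (\<lambda>h::int. 1 / \<bar>of_int h\<bar> powr a :: real) (- {0})"
      by (intro infsum_nonneg) auto
    then show ?thesis
      by (simp only: summable_on_abs_powr(2)[OF a])
  qed
  have sum_eq: "(\<Sum>y\<in>?U. residue_coeff (b ^ m) a (b ^ w * y) (int r)) = infsum (\<lambda>h. real (cnt h) / \<bar>of_int h\<bar> powr a) (- {0})"
  proof (rule infsumI[symmetric])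
    have "((\<lambda>h::int. \<Sum>y\<in>?U. (if h * int (b ^ w * y) mod int (b ^ m) = int r then 1 else 0) / \<bar>of_int h\<bar> powr a) has_sum
      (\<Sum>y\<in>?U. residue_coeff (b ^ m) a (b ^ w * y) (int r))) (- {0})"
      unfolding residue_coeff_def
      by (intro has_sum_finite_sum has_sum_infsum residue_coeff_summable a) auto
    moreover have "(\<Sum>y\<in>?U. (if h * int (b ^ w * y) mod int (b ^ m) = int r then 1 else 0) / \<bar>of_int h\<bar> powr a) = real (cnt h) / \<bar>of_int h\<bar> powr a" for h
      unfolding cnt_def by (simp add: sum.inter_filter[symmetric] flip: sum_divide_distrib)
    ultimately show "((\<lambda>h. real (cnt h) / \<bar>of_int h\<bar> powr a) has_sum (\<Sum>y\<in>?U. residue_coeff (b ^ m) a (b ^ w * y) (int r))) (- {0})"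
      by simp
  qed
  have bound: "infsum (\<lambda>h. real (cnt h) / \<bar>of_int h\<bar> powr a) (- {0}) \<le> real D / real (b ^ e) * (2 * zeta_real a)"
    if "\<And>h. cnt h \<noteq> 0 \<Longrightarrow> int (b ^ e) dvd h" "\<And>h. cnt h \<le> D" for D e
    by (rule infsum_multiples_le) (use that a b0 in \<open>auto intro!: divide_right_mono\<close>)
  have cnt_div: "\<exists>y\<in>?U. int (b ^ w) * (h * int y mod int (b ^ t)) = int r" if "cnt h \<noteq> 0" for h
  proof -
    from that have "{y \<in> ?U. h * int (b ^ w * y) mod int (b ^ m) = int r} \<noteq> {}"
      unfolding cnt_def by (metis card.empty)
    then obtain y where y: "y \<in> ?U" "h * int (b ^ w * y) mod int (b ^ m) = int r"
      by auto
    have "h * int (b ^ w * y) mod int (b ^ m) = int (b ^ w) * (h * int y) mod (int (b ^ w) * int (b ^ t))"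
      unfolding m by (simp add: mult_ac)
    also have "\<dots> = int (b ^ w) * (h * int y mod int (b ^ t))"
      by (rule mult_mod_right[symmetric])
    finally show ?thesis
      using y by auto
  qed
  have card2: "b ^ t \<le> 2 * card ?U"
    by (rule card_unit_residues_ge[OF b])
  have "infsum (\<lambda>h. real (cnt h) / \<bar>of_int h\<bar> powr a) (- {0}) \<le> real (card ?U) * (2 / real (b ^ t) * (2 * zeta_real a))"
  proof (cases "r = 0")
    case True
    have "int (b ^ t) dvd h" if "cnt h \<noteq> 0" for h
    proof -
      from cnt_div[OF that] obtain y where y: "y \<in> ?U" "h * int y mod int (b ^ t) = 0"
        using True b0 by auto
      then have "int (b ^ t) dvd h * int y"
        by auto
      moreover have "coprime (int (b ^ t)) (int y)"
        using y(1) by (auto simp: unit_residues_def coprime_commute)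
      ultimately show ?thesis
        by (simp add: coprime_dvd_mult_left_iff)
    qed
    moreover have "cnt h \<le> card ?U" for h
      unfolding cnt_def by (intro card_mono) auto
    ultimately have "infsum (\<lambda>h. real (cnt h) / \<bar>of_int h\<bar> powr a) (- {0}) \<le> real (card ?U) / real (b ^ t) * (2 * zeta_real a)"
      by (rule bound)
    also have "\<dots> \<le> real (card ?U) * (2 / real (b ^ t) * (2 * zeta_real a))"
      using zeta b0 by (simp add: field_simps)
    finally show ?thesis .
  next
    case False
    define r' where "r' = r div b ^ w"
    have r': "h * int y mod int (b ^ t) = int r'" if "int (b ^ w) * (h * int y mod int (b ^ t)) = int r" for h y
    proof -
      have "int r' = int r div int (b ^ w)"
        by (simp add: r'_def zdiv_int)
      then show ?thesis
        using b0 by (simp flip: that)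
    qed
    show ?thesis
    proof (cases "\<exists>h. cnt h \<noteq> 0")
      case False
      then have "infsum (\<lambda>h. real (cnt h) / \<bar>of_int h\<bar> powr a) (- {0}) = 0"
        by simp
      then show ?thesis
        using zeta by simp
    next
      case True
      then obtain h0 y0 where "int (b ^ w) * (h0 * int y0 mod int (b ^ t)) = int r"
        using cnt_div by blast
      then have eq0: "int (b ^ w) * int r' = int r" "h0 * int y0 mod int (b ^ t) = int r'"
        using r'[of h0 y0] by simp_all
      have r'0: "r' \<noteq> 0" "int r' < int (b ^ t)"
      proof -
        show "r' \<noteq> 0"
          using eq0(1) \<open>r \<noteq> 0\<close> by (intro notI) simp
        show "int r' < int (b ^ t)"
          unfolding eq0(2)[symmetric] using b0 by (intro pos_mod_bound) simp
      qed
      \<comment> \<open>Multiplication by a unit preserves divisibility by powers of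
        \<open>b\<close>, so \<open>h\<close> contains exactly the same power of \<open>b\<close> as
        \<open>r'\<close>; it is below \<open>t\<close> as \<open>0 < r' < b ^ t\<close>.\<close>
      define e where "e = multiplicity b r'"
      have e: "b ^ e dvd r'" "\<not> b ^ Suc e dvd r'"
        unfolding e_def using r'0 b by (auto simp: multiplicity_dvd power_dvd_iff_le_multiplicity not_prime_1 simp del: power_Suc dest: prime_gt_1_nat)
      have "b ^ e \<le> r'"
        using e(1) r'0 by (intro dvd_imp_le) auto
      then have "b ^ e < b ^ t"
        using r'0(2) by (simp only: of_nat_less_iff)
      then have et: "e < t"
        using prime_gt_1_nat[OF b] by (rule power_less_imp_less_exp[rotated])
      have bt: "int (b ^ t) = int (b ^ e) * int (b ^ (t - e))"
        using et by (simp flip: power_add)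
      have h_div: "int (b ^ e) dvd h \<and> \<not> int (b ^ Suc e) dvd h"
        if y: "y \<in> ?U" "h * int y mod int (b ^ t) = int r'" for h y
      proof -
        have co: "coprime (int (b ^ k)) (int y)" for k
          using y(1) et by (auto simp: unit_residues_def coprime_commute)
        have iff: "int (b ^ k) dvd h \<longleftrightarrow> b ^ k dvd r'" if "k \<le> t" for k
        proof -
          have "int (b ^ k) dvd int (b ^ t)"
            using that by (simp add: le_imp_power_dvd)
          then have "int (b ^ k) dvd h * int y \<longleftrightarrow> int (b ^ k) dvd int r'"
            unfolding y(2)[symmetric] by (rule dvd_mod_iff[symmetric])
          then show ?thesis
            using co[of k] by (simp add: coprime_dvd_mult_left_iff del: of_nat_power)
        qed
        show ?thesis
          using iff[of e] iff[of "Suc e"] e et by (simp del: power_Suc of_nat_power)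
      qed
      have dv: "int (b ^ e) dvd h" if "cnt h \<noteq> 0" for h
        using cnt_div[OF that] r' h_div by blast
      have "cnt h \<le> b ^ e" for h
      proof (cases "cnt h = 0")
        case False
        let ?A = "{y \<in> ?U. h * int (b ^ w * y) mod int (b ^ m) = int r}"
        have A: "h * int y mod int (b ^ t) = int r'" if "y \<in> ?A" for y
        proof (rule r')
          have "int (b ^ w) * (h * int y mod int (b ^ t)) = int (b ^ w) * (h * int y) mod (int (b ^ w) * int (b ^ t))"
            by (rule mult_mod_right)
          also have "\<dots> = h * int (b ^ w * y) mod int (b ^ m)"
            unfolding m by (simp add: mult_ac)
          finally show "int (b ^ w) * (h * int y mod int (b ^ t)) = int r"
            using that by simp
        qed
        obtain y where "y \<in> ?U" "h * int y mod int (b ^ t) = int r'"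
          using cnt_div[OF False] r' by blast
        with h_div have hd: "int (b ^ e) dvd h" "\<not> int (b ^ Suc e) dvd h"
          by blast+
        from hd(1) obtain h1 where h1: "h = int (b ^ e) * h1" ..
        have "\<not> int b dvd h1"
          using hd(2) unfolding h1 by (auto simp: mult_ac elim!: dvdE)
        then have co: "coprime (int (b ^ k)) h1" for k
          using b by (simp add: prime_imp_coprime)
        \<comment> \<open>The product \<open>h * y\<close> is fixed modulo \<open>b ^ t\<close>, and
          \<open>h\<close> is \<open>b ^ e\<close> times a number prime to \<open>b\<close>. Hence
          \<open>y\<close> is fixed modulo \<open>b ^ (t - e)\<close>, and the quotients tell the
          solutions apart.\<close>
        have "inj_on (\<lambda>y. y div b ^ (t - e)) ?A"
        proof (rule inj_onI)
          fix y y' assume yy: "y \<in> ?A" "y' \<in> ?A" "y div b ^ (t - e) = y' div b ^ (t - e)"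
          then have "h * int y mod int (b ^ t) = h * int y' mod int (b ^ t)"
            using A by simp
          then have "int (b ^ t) dvd h * int y - h * int y'"
            by (simp only: mod_eq_dvd_iff)
          then have "int (b ^ e) * int (b ^ (t - e)) dvd int (b ^ e) * (h1 * (int y - int y'))"
            unfolding bt by (simp add: h1 algebra_simps)
          then have "int (b ^ (t - e)) dvd h1 * (int y - int y')"
            using b0 by simp
          then have "int (b ^ (t - e)) dvd int y - int y'"
            using co[of "t - e"] by (simp add: coprime_dvd_mult_right_iff del: of_nat_power)
          then have "int y mod int (b ^ (t - e)) = int y' mod int (b ^ (t - e))"
            by (simp only: mod_eq_dvd_iff)
          then have "y mod b ^ (t - e) = y' mod b ^ (t - e)"
            by (metis of_nat_eq_iff zmod_int)
          with yy(3) show "y = y'"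
            by (metis div_mult_mod_eq)
        qed
        moreover have "(\<lambda>y. y div b ^ (t - e)) ` ?A \<subseteq> {..<b ^ e}"
        proof safe
          fix y assume "y \<in> ?U"
          then have "y < b ^ e * b ^ (t - e)"
            using et by (simp add: unit_residues_def flip: power_add)
          then show "y div b ^ (t - e) < b ^ e"
            by (rule less_mult_imp_div_less)
        qed
        ultimately have "card ?A \<le> card {..<b ^ e}"
          by (intro card_inj_on_le) auto
        then show ?thesis
          by (simp add: cnt_def)
      qed simp
      with dv have "infsum (\<lambda>h. real (cnt h) / \<bar>of_int h\<bar> powr a) (- {0}) \<le> real (b ^ e) / real (b ^ e) * (2 * zeta_real a)"
        by (rule bound)
      also have "\<dots> = 1 * (2 * zeta_real a)"
        using b0 by simp
      also have "\<dots> \<le> (real (2 * card ?U) / real (b ^ t)) * (2 * zeta_real a)"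
        using zeta card2 b0 by (intro mult_right_mono) (simp_all add: field_simps flip: of_nat_power of_nat_mult of_nat_le_iff)
      finally show ?thesis
        by (simp add: mult_ac)
    qed
  qed
  then show ?thesis
    unfolding sum_eq[unfolded t_def] t_def .
qed

definition mean_prod :: "nat \<Rightarrow> (nat \<Rightarrow> nat) \<Rightarrow> nat set \<Rightarrow> real" where
  "mean_prod N Z u = 1 / real N * (\<Sum>k<N. \<Prod>i\<in>u. omega_matrix N (Z i) k)"

lemma mean_prod_nonneg:
  assumes "N > 0" "finite u"
  shows "mean_prod N Z u \<ge> 0"
  unfolding mean_prod_def mean_prod_omega[OF assms]
  by (intro sum_nonneg) (auto intro!: prod_nonneg residue_coeff_nonneg)

lemma sum_PiE_insert:
  assumes "j \<notin> v"
  shows "(\<Sum>\<rho>\<in>PiE (insert j v) T. f \<rho>) = (\<Sum>\<rho>\<in>PiE v T. \<Sum>r\<in>T j. f (\<rho>(j := r)))"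
proof -
  have "(\<Sum>\<rho>\<in>PiE (insert j v) T. f \<rho>) = (\<Sum>(r, \<rho>)\<in>T j \<times> PiE v T. f (\<rho>(j := r)))"
    unfolding PiE_insert_eq by (subst sum.reindex[OF inj_combinator[OF assms]]) (simp add: case_prod_unfold)
  also have "\<dots> = (\<Sum>r\<in>T j. \<Sum>\<rho>\<in>PiE v T. f (\<rho>(j := r)))"
    by (rule sum.cartesian_product[symmetric])
  also have "\<dots> = (\<Sum>\<rho>\<in>PiE v T. \<Sum>r\<in>T j. f (\<rho>(j := r)))"
    by (rule sum.swap)
  finally show ?thesis .
qed

text \<open>The power is moved onto the single terms by subadditivity. The divisibility condition
  then determines the class index of \<open>j\<close> from the other indices, so that only one
  factor depends on the candidate \<open>x\<close>.\<close>

lemma mean_prod_insert_powr_le: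
  assumes N: "N > 0" and v: "finite v" "j \<notin> v" and lam: "1/2 < lam" "lam \<le> 1"
  shows "mean_prod N (Z(j := x)) (insert j v) powr lam \<le>
    (\<Sum>\<rho>\<in>PiE v (\<lambda>_. {..<N}). (\<Prod>i\<in>v. residue_coeff N (2 * lam) (Z i) (int (\<rho> i))) *
        residue_coeff N (2 * lam) x ((- (\<Sum>i\<in>v. int (\<rho> i))) mod int N))"
proof -
  let ?Z = "Z(j := x)"
  let ?P = "\<lambda>a \<rho>. \<Prod>i\<in>insert j v. residue_coeff N a (?Z i) (int (\<rho> i))"
  let ?D = "\<lambda>\<rho>. int N dvd (\<Sum>i\<in>insert j v. int (\<rho> i))"
  have P_powr: "?P 2 \<rho> powr lam \<le> ?P (2 * lam) \<rho>" for \<rho>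
  proof -
    have "?P 2 \<rho> powr lam = (\<Prod>i\<in>insert j v. residue_coeff N 2 (?Z i) (int (\<rho> i)) powr lam)"
      by (intro prod_powr_distrib residue_coeff_nonneg)
    also have "\<dots> \<le> ?P (2 * lam) \<rho>"
      using lam by (intro prod_mono) (auto intro: residue_coeff_powr_le)
    finally show ?thesis .
  qed
  have "mean_prod N ?Z (insert j v) powr lam = (\<Sum>\<rho>\<in>PiE (insert j v) (\<lambda>_. {..<N}). if ?D \<rho> then ?P 2 \<rho> else 0) powr lam"
    unfolding mean_prod_def using N v by (subst mean_prod_omega) simp_all
  also have "\<dots> \<le> (\<Sum>\<rho>\<in>PiE (insert j v) (\<lambda>_. {..<N}). (if ?D \<rho> then ?P 2 \<rho> else 0) powr lam)"
    using lam by (intro powr_sum_le) (auto intro!: prod_nonneg mult_nonneg_nonneg residue_coeff_nonneg)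
  also have "\<dots> \<le> (\<Sum>\<rho>\<in>PiE (insert j v) (\<lambda>_. {..<N}). if ?D \<rho> then ?P (2 * lam) \<rho> else 0)"
    using P_powr by (intro sum_mono) auto
  also have "\<dots> = (\<Sum>\<rho>\<in>PiE v (\<lambda>_. {..<N}). \<Sum>r<N. if ?D (\<rho>(j := r)) then ?P (2 * lam) (\<rho>(j := r)) else 0)"
    by (rule sum_PiE_insert[OF v(2)])
  also have "\<dots> = (\<Sum>\<rho>\<in>PiE v (\<lambda>_. {..<N}). (\<Prod>i\<in>v. residue_coeff N (2 * lam) (Z i) (int (\<rho> i))) *
        residue_coeff N (2 * lam) x ((- (\<Sum>i\<in>v. int (\<rho> i))) mod int N))"
  proof (intro sum.cong refl)
    fix \<rho>
    let ?s = "\<Sum>i\<in>v. int (\<rho> i)" and ?p = "\<Prod>i\<in>v. residue_coeff N (2 * lam) (Z i) (int (\<rho> i))"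
    have D: "?D (\<rho>(j := r)) \<longleftrightarrow> (- ?s) mod int N = int r" if "r < N" for r
    proof -
      have "(\<Sum>i\<in>insert j v. int ((\<rho>(j := r)) i)) = int r + ?s"
        using v by (auto intro!: sum.cong)
      moreover have "(- ?s) mod int N = int r \<longleftrightarrow> (- ?s) mod int N = int r mod int N"
        using that by simp
      moreover have "\<dots> \<longleftrightarrow> int N dvd int r + ?s"
        by (subst mod_eq_dvd_iff, subst dvd_minus_iff[symmetric]) (simp add: algebra_simps)
      ultimately show ?thesis
        by simp
    qed
    have P: "?P (2 * lam) (\<rho>(j := r)) = ?p * residue_coeff N (2 * lam) x (int r)" for r
    proof -
      have "(\<Prod>i\<in>v. residue_coeff N (2 * lam) (?Z i) (int ((\<rho>(j := r)) i))) = ?p"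
        using v by (intro prod.cong) auto
      then show ?thesis
        using v by simp
    qed
    have "(\<Sum>r<N. if ?D (\<rho>(j := r)) then ?P (2 * lam) (\<rho>(j := r)) else 0) =
        (\<Sum>r<N. if (- ?s) mod int N = int r then ?p * residue_coeff N (2 * lam) x (int r) else 0)"
      by (intro sum.cong refl) (simp only: D P lessThan_iff)
    also have "\<dots> = ?p * residue_coeff N (2 * lam) x ((- ?s) mod int N)"
      by (rule sum_residue_indicator[OF N])
    finally show "(\<Sum>r<N. if ?D (\<rho>(j := r)) then ?P (2 * lam) (\<rho>(j := r)) else 0) =
        ?p * residue_coeff N (2 * lam) x ((- ?s) mod int N)" .
  qed
  finally show ?thesis .
qed

lemma sum_PiE_residue_coeff:
  assumes "N > 0" "finite v" "a > 1"
  shows "(\<Sum>\<rho>\<in>PiE v (\<lambda>_. {..<N}). \<Prod>i\<in>v. residue_coeff N a (Z i) (int (\<rho> i))) = (2 * zeta_real a) ^ card v"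
proof -
  have "(\<Sum>\<rho>\<in>PiE v (\<lambda>_. {..<N}). \<Prod>i\<in>v. residue_coeff N a (Z i) (int (\<rho> i))) =
      (\<Prod>i\<in>v. \<Sum>r<N. residue_coeff N a (Z i) (int r))"
    using assms by (intro prod_sum_PiE[symmetric]) auto
  then show ?thesis
    using sum_residue_coeff[OF assms(1,3)] by simp
qed

lemma sum_units_mean_prod_powr_le:
  assumes b: "prime b" and w: "w \<le> m" and v: "finite v" "j \<notin> v" and lam: "1/2 < lam" "lam \<le> 1"
  defines "U \<equiv> unit_residues (b ^ (m - w))"
  shows "(\<Sum>y\<in>U. mean_prod (b ^ m) (Z(j := b ^ w * y)) (insert j v) powr lam)
    \<le> real (card U) * ((2 * zeta_real (2 * lam)) ^ Suc (card v) * (2 / real (b ^ (m - w))))"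
proof -
  have N: "b ^ m > 0"
    using b prime_gt_0_nat by simp
  let ?a = "2 * lam"
  let ?p = "\<lambda>\<rho>. \<Prod>i\<in>v. residue_coeff (b ^ m) ?a (Z i) (int (\<rho> i))"
  let ?r = "\<lambda>\<rho>. (- (\<Sum>i\<in>v. int (\<rho> i))) mod int (b ^ m)"
  let ?B = "real (card U) * (2 / real (b ^ (m - w)) * (2 * zeta_real ?a))"
  have "(\<Sum>y\<in>U. mean_prod (b ^ m) (Z(j := b ^ w * y)) (insert j v) powr lam)
    \<le> (\<Sum>y\<in>U. \<Sum>\<rho>\<in>PiE v (\<lambda>_. {..<b ^ m}). ?p \<rho> * residue_coeff (b ^ m) ?a (b ^ w * y) (?r \<rho>))"
    by (intro sum_mono mean_prod_insert_powr_le N v lam)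
  also have "\<dots> = (\<Sum>\<rho>\<in>PiE v (\<lambda>_. {..<b ^ m}). ?p \<rho> * (\<Sum>y\<in>U. residue_coeff (b ^ m) ?a (b ^ w * y) (?r \<rho>)))"
    by (subst sum.swap) (simp only: sum_distrib_left)
  also have "\<dots> \<le> (\<Sum>\<rho>\<in>PiE v (\<lambda>_. {..<b ^ m}). ?p \<rho> * ?B)"
  proof (intro sum_mono mult_left_mono prod_nonneg residue_coeff_nonneg)
    fix \<rho>
    have r: "0 \<le> ?r \<rho>" "?r \<rho> < int (b ^ m)"
      using N by (auto intro!: pos_mod_sign pos_mod_bound simp del: of_nat_power)
    then have "nat (?r \<rho>) < b ^ m"
      by (simp only: nat_less_iff)
    from sum_units_residue_coeff_le[OF b w _ this, of ?a] lam r(1)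
    show "(\<Sum>y\<in>U. residue_coeff (b ^ m) ?a (b ^ w * y) (?r \<rho>)) \<le> ?B"
      unfolding U_def by simp
  qed
  also have "\<dots> = (2 * zeta_real ?a) ^ card v * ?B"
    using lam by (simp only: sum_distrib_right[symmetric] sum_PiE_residue_coeff[OF N v(1)])
  finally show ?thesis
    by (simp add: mult_ac)
qed

lemma zeta_real_nonneg: "a > 1 \<Longrightarrow> 0 \<le> zeta_real a"
proof -
  assume a: "a > 1"
  have "0 \<le> infsum (\<lambda>h::int. 1 / \<bar>of_int h\<bar> powr a :: real) (- {0})"
    by (intro infsum_nonneg) auto
  then show ?thesis
    by (simp only: summable_on_abs_powr(2)[OF a])
qed

text \<open>Needed for the components with \<open>w j \<ge> m\<close>, which are set to 0 without
  any selection. No average is available there, and the single coefficient of \<open>j\<close> is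
  bounded by the sum of all of them.\<close>

lemma mean_prod_powr_le:
  assumes N: "N > 0" and v: "finite v" "j \<notin> v" and lam: "1/2 < lam" "lam \<le> 1"
  shows "mean_prod N (Z(j := x)) (insert j v) powr lam \<le> (2 * zeta_real (2 * lam)) ^ Suc (card v)"
proof -
  let ?a = "2 * lam"
  let ?p = "\<lambda>\<rho>. \<Prod>i\<in>v. residue_coeff N ?a (Z i) (int (\<rho> i))"
  let ?r = "\<lambda>\<rho>. (- (\<Sum>i\<in>v. int (\<rho> i))) mod int N"
  have "mean_prod N (Z(j := x)) (insert j v) powr lam \<le> (\<Sum>\<rho>\<in>PiE v (\<lambda>_. {..<N}). ?p \<rho> * residue_coeff N ?a x (?r \<rho>))"
    by (intro mean_prod_insert_powr_le assms)
  also have "\<dots> \<le> (\<Sum>\<rho>\<in>PiE v (\<lambda>_. {..<N}). ?p \<rho> * (2 * zeta_real ?a))"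
  proof (intro sum_mono mult_left_mono prod_nonneg residue_coeff_nonneg)
    fix \<rho>
    have r: "0 \<le> ?r \<rho>" "nat (?r \<rho>) < N"
      using N by (auto simp: nat_less_iff)
    have "residue_coeff N ?a x (int (nat (?r \<rho>))) \<le> (\<Sum>r<N. residue_coeff N ?a x (int r))"
      using r by (intro member_le_sum) (auto intro: residue_coeff_nonneg)
    then show "residue_coeff N ?a x (?r \<rho>) \<le> 2 * zeta_real ?a"
      using sum_residue_coeff[OF N, of ?a x] lam r(1) by simp
  qed
  also have "\<dots> = (2 * zeta_real ?a) ^ card v * (2 * zeta_real ?a)"
    using lam by (simp only: sum_distrib_right[symmetric] sum_PiE_residue_coeff[OF N v(1)])
  finally show ?thesis
    by (simp add: mult_ac)
qed

subsection \<open>The vectors of the construction\<close>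

lemma omega_matrix_scale:
  assumes "w \<le> m" "b > 0"
  shows "omega_matrix (b ^ m) (b ^ w * y) k = omega_matrix (b ^ (m - w)) y k"
proof -
  have m: "b ^ m = b ^ w * b ^ (m - w)"
    using assms by (simp flip: power_add)
  have "k * (b ^ w * y) mod b ^ m = b ^ w * (k * y mod b ^ (m - w))"
    unfolding m mult.left_commute[of k] by (rule mult_mod_right[symmetric])
  then show ?thesis
    using assms unfolding omega_matrix_def m by simp
qed

lemma omega_matrix_mod: "omega_matrix n y (k mod n) = omega_matrix n y k"
  by (simp add: omega_matrix_def mod_mult_left_eq)

text \<open>The reference object for folding: each vector of the construction turns out to be the
  class sum of an unfolded vector on all \<open>N\<close> points.\<close>

definition class_sum :: "nat \<Rightarrow> nat \<Rightarrow> (nat \<Rightarrow> real) \<Rightarrow> nat \<Rightarrow> real" where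
  "class_sum N n f k = (\<Sum>k'<N. if k' mod n = k then f k' else 0)"

text \<open>Folding twice is folding once: a class modulo \<open>b ^ (m - w'')\<close> is the
  disjoint union of the finer classes with indices \<open>i * b ^ (m - w'') + k\<close>.\<close>

lemma fold_sum_class_sum:
  assumes b: "b > 0" and w: "w' \<le> w''" "w'' \<le> m" and k: "k < b ^ (m - w'')"
  shows "fold_sum b m w'' w' (class_sum N (b ^ (m - w')) f) k = class_sum N (b ^ (m - w'')) f k"
proof -
  let ?n = "b ^ (m - w'')" and ?d = "b ^ (w'' - w')"
  have n': "b ^ (m - w') = ?d * ?n"
    using w by (simp flip: power_add)
  have "fold_sum b m w'' w' (class_sum N (b ^ (m - w')) f) k =
      (\<Sum>k'<N. \<Sum>i<?d. if k' mod (?d * ?n) = i * ?n + k then f k' else 0)"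
    unfolding fold_sum_def class_sum_def n' by (rule sum.swap)
  also have "\<dots> = (\<Sum>k'<N. if k' mod ?n = k then f k' else 0)"
  proof (intro sum.cong refl)
    fix k'
    let ?q = "k' mod (?d * ?n) div ?n"
    have q: "?q < ?d" "k' mod (?d * ?n) = ?q * ?n + k' mod ?n"
    proof -
      have "k' mod (?d * ?n) < ?d * ?n"
        using b by (intro mod_less_divisor) simp
      then show "?q < ?d"
        by (rule less_mult_imp_div_less)
      have "k' mod (?d * ?n) mod ?n = k' mod ?n"
        by (simp add: mod_mod_cancel)
      then show "k' mod (?d * ?n) = ?q * ?n + k' mod ?n"
        by (metis div_mult_mod_eq)
    qed
    have iff: "k' mod (?d * ?n) = i * ?n + k \<longleftrightarrow> i = ?q \<and> k' mod ?n = k" for i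
    proof
      assume *: "k' mod (?d * ?n) = i * ?n + k"
      have "(i * n + k) div n = i" if "k < n" for n
        using that by simp
      from this[OF k] have "?q = i"
        by (simp only: *)
      moreover have "k' mod ?n = (i * ?n + k) mod ?n"
        unfolding *[symmetric] by (simp add: mod_mod_cancel)
      ultimately show "i = ?q \<and> k' mod ?n = k"
        using k by simp
    qed (use q in simp)
    show "(\<Sum>i<?d. if k' mod (?d * ?n) = i * ?n + k then f k' else 0) = (if k' mod ?n = k then f k' else 0)"
    proof (cases "k' mod ?n = k")
      case True
      then have "(\<Sum>i<?d. if k' mod (?d * ?n) = i * ?n + k then f k' else 0) = (\<Sum>i<?d. if i = ?q then f k' else 0)"
        by (simp only: iff simp_thms)
      then show ?thesis
        using True q(1) by simp
    next
      case False
      then show ?thesis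
        by (simp only: iff simp_thms if_False sum.neutral_const)
    qed
  qed
  finally show ?thesis
    by (simp add: class_sum_def)
qed

lemma sum_Pow_insert:
  fixes f :: "'a set \<Rightarrow> 'b :: comm_monoid_add"
  assumes "finite A" "j \<notin> A"
  shows "(\<Sum>v\<in>Pow (insert j A). f v) = (\<Sum>v\<in>Pow A. f v) + (\<Sum>v\<in>Pow A. f (insert j v))"
proof -
  have "inj_on (insert j) (Pow A)"
    using assms by (auto simp: inj_on_def)
  then have "(\<Sum>v\<in>insert j ` Pow A. f v) = (\<Sum>v\<in>Pow A. f (insert j v))"
    by (simp add: sum.reindex)
  moreover have "(\<Sum>v\<in>Pow (insert j A). f v) = (\<Sum>v\<in>Pow A. f v) + (\<Sum>v\<in>insert j ` Pow A. f v)"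
    unfolding Pow_insert using assms by (intro sum.union_disjoint) auto
  ultimately show ?thesis
    by simp
qed

text \<open>The unfolded counterpart of the vector \<open>cbc_q\<close> of order \<open>l\<close>:
  the part of order \<open>l\<close> in the POD-weighted expansion, evaluated at each of the
  \<open>N\<close> points.\<close>

definition order_part ::
  "nat \<Rightarrow> (nat \<Rightarrow> real) \<Rightarrow> (nat \<Rightarrow> real) \<Rightarrow> (nat \<Rightarrow> nat) \<Rightarrow> nat \<Rightarrow> nat \<Rightarrow> nat \<Rightarrow> real" where
  "order_part N \<Gamma> \<gamma> Z j l k =
     (\<Sum>v\<in>Pow {1..j}. if card v = l then \<Gamma> l * (\<Prod>i\<in>v. \<gamma> i * omega_matrix N (Z i) k) else 0)"

lemma order_part_0: "\<Gamma> 0 = 1 \<Longrightarrow> order_part N \<Gamma> \<gamma> Z 0 l k = (if l = 0 then 1 else 0)"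
  by (simp add: order_part_def)

lemma order_part_large: "l > j \<Longrightarrow> order_part N \<Gamma> \<gamma> Z j l k = 0"
  unfolding order_part_def
proof (intro sum.neutral ballI)
  fix v assume "l > j" "v \<in> Pow {1..j}"
  then have "card v \<le> card {1..j}"
    by (intro card_mono) auto
  then show "(if card v = l then \<Gamma> l * (\<Prod>i\<in>v. \<gamma> i * omega_matrix N (Z i) k) else 0) = 0"
    using \<open>l > j\<close> by simp
qed

text \<open>The sets are split by membership of \<open>Suc j\<close>, and the quotient replaces the
  order weight of the smaller set by that of the larger. If \<open>\<Gamma> (l - 1) = 0\<close>,
  both sides vanish since \<open>\<Gamma> l = 0\<close> too.\<close>

lemma order_part_Suc:
  assumes "l = 0 \<or> (\<Gamma> (l - 1) = 0 \<longrightarrow> \<Gamma> l = 0)"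
  shows "order_part N \<Gamma> \<gamma> Z (Suc j) l k = order_part N \<Gamma> \<gamma> Z j l k +
    (if l = 0 then 0 else \<Gamma> l / \<Gamma> (l - 1) * \<gamma> (Suc j) * omega_matrix N (Z (Suc j)) k * order_part N \<Gamma> \<gamma> Z j (l - 1) k)"
proof -
  let ?g = "\<lambda>i. \<gamma> i * omega_matrix N (Z i) k"
  have ins: "{1..Suc j} = insert (Suc j) {1..j}"
    by auto
  have "order_part N \<Gamma> \<gamma> Z (Suc j) l k = order_part N \<Gamma> \<gamma> Z j l k +
     (\<Sum>v\<in>Pow {1..j}. if card (insert (Suc j) v) = l then \<Gamma> l * (\<Prod>i\<in>insert (Suc j) v. ?g i) else 0)"
    unfolding order_part_def ins by (rule sum_Pow_insert) auto
  also have "(\<Sum>v\<in>Pow {1..j}. if card (insert (Suc j) v) = l then \<Gamma> l * (\<Prod>i\<in>insert (Suc j) v. ?g i) else 0) =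
     (\<Sum>v\<in>Pow {1..j}. if l = 0 then 0 else \<Gamma> l / \<Gamma> (l - 1) * ?g (Suc j) * (if card v = l - 1 then \<Gamma> (l - 1) * (\<Prod>i\<in>v. ?g i) else 0))"
  proof (intro sum.cong refl)
    fix v assume "v \<in> Pow {1..j}"
    then have v: "finite v" "Suc j \<notin> v"
      using finite_subset by auto
    then show "(if card (insert (Suc j) v) = l then \<Gamma> l * (\<Prod>i\<in>insert (Suc j) v. ?g i) else 0) =
       (if l = 0 then 0 else \<Gamma> l / \<Gamma> (l - 1) * ?g (Suc j) * (if card v = l - 1 then \<Gamma> (l - 1) * (\<Prod>i\<in>v. ?g i) else 0))"
      using assms by (cases "\<Gamma> (l - 1) = 0") auto
  qed
  also have "\<dots> = (if l = 0 then 0 else \<Gamma> l / \<Gamma> (l - 1) * \<gamma> (Suc j) * omega_matrix N (Z (Suc j)) k * order_part N \<Gamma> \<gamma> Z j (l - 1) k)"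
    by (simp add: order_part_def sum_distrib_left mult.assoc del: One_nat_def)
  finally show ?thesis .
qed

lemma class_sum_add: "class_sum N n (\<lambda>k. f k + g k) k = class_sum N n f k + class_sum N n g k"
  unfolding class_sum_def by (auto simp: sum.distrib[symmetric] intro!: sum.cong)

text \<open>A row of the matrix of size \<open>n\<close> has period \<open>n\<close> and is constant
  on each class. This is why folding loses no information for the later steps.\<close>

lemma class_sum_omega:
  "class_sum N n (\<lambda>k. c * omega_matrix n y k * f k) k = c * omega_matrix n y k * class_sum N n f k"
  unfolding class_sum_def sum_distrib_left
  by (intro sum.cong refl) (auto simp: omega_matrix_mod)

lemma block_index:
  assumes "i < b ^ (w'' - w')" "k < b ^ (m - w'')" "w' \<le> w''" "w'' \<le> m"
  shows "i * b ^ (m - w'') + k < (b :: nat) ^ (m - w')"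
proof -
  have "i * b ^ (m - w'') + k < (i + 1) * b ^ (m - w'')"
    using assms(2) by simp
  also have "\<dots> \<le> b ^ (w'' - w') * b ^ (m - w'')"
    using assms(1) by (intro mult_le_mono1) simp
  also have "b ^ (w'' - w') * b ^ (m - w'') = b ^ (m - w')"
    using assms(3,4) by (simp flip: power_add)
  finally show ?thesis .
qed

locale reduced_cbc =
  fixes b m :: nat and w :: "nat \<Rightarrow> nat" and s :: nat and \<Gamma> \<gamma> :: "nat \<Rightarrow> real"
  assumes b: "prime b" and w: "reduction_indices w" and pod: "pod_parameters s \<Gamma> \<gamma>"
begin

lemma b_pos: "b > 0"
  using b prime_gt_0_nat by blast

lemma w_mono: "1 \<le> i \<Longrightarrow> i \<le> j \<Longrightarrow> w i \<le> w j"
  using w by (auto simp: reduction_indices_def mono_on_def)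

lemma \<Gamma>_0: "\<Gamma> 0 = 1"
  using pod by (simp add: pod_parameters_def)

lemma \<Gamma>_quotient: "l \<le> s \<Longrightarrow> l = 0 \<or> (\<Gamma> (l - 1) = 0 \<longrightarrow> \<Gamma> l = 0)"
  using pod by (cases l) (auto simp: pod_parameters_def)

definition Z :: "(nat \<Rightarrow> nat) \<Rightarrow> nat \<Rightarrow> nat" where
  "Z z i = b ^ w i * z i"

definition wp :: "nat \<Rightarrow> nat" where
  "wp j = (if j = 0 then 0 else w j)"

lemma fold_to_eq: "fold_to b m w (Suc j) v k = fold_sum b m (w (Suc j)) (wp j) v k"
  by (cases j) (simp_all add: fold_to_def wp_def)

lemma wp_le: "wp j \<le> w (Suc j)"
  using w_mono[of j "Suc j"] by (cases j) (auto simp: wp_def)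

lemma fold_sum_cong:
  assumes "\<And>k. k < b ^ (m - w') \<Longrightarrow> v k = v' k" "w' \<le> w''" "w'' \<le> m" "k < b ^ (m - w'')"
  shows "fold_sum b m w'' w' v k = fold_sum b m w'' w' v' k"
  unfolding fold_sum_def using assms block_index[OF _ assms(4,2,3)] by (intro sum.cong refl) auto

text \<open>Folds compose, and the row of \<omega> used in step \<open>j\<close> has the new length
  as its period. The recursion on the short vectors therefore follows the recursion of
  \<open>order_part\<close>; for \<open>l = 0\<close> the entries count the folded points.\<close>

lemma cbc_q_eq:
  assumes "j \<le> s" "wp j < m \<or> j = 0" "k < b ^ (m - wp j)"
  shows "cbc_q b m w \<Gamma> \<gamma> z j l k = class_sum (b ^ m) (b ^ (m - wp j)) (order_part (b ^ m) \<Gamma> \<gamma> (Z z) j l) k"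
  using assms
proof (induction j arbitrary: l k)
  case 0
  have "class_sum (b ^ m) (b ^ m) f k = f k" if "k < b ^ m" for f
  proof -
    have "class_sum (b ^ m) (b ^ m) f k = (\<Sum>k'<b ^ m. if k' = k then f k' else 0)"
      unfolding class_sum_def by (intro sum.cong) auto
    then show ?thesis
      using that by simp
  qed
  then show ?case
    using 0 by (simp add: wp_def order_part_0 \<Gamma>_0)
next
  case (Suc j)
  let ?N = "b ^ m" and ?n = "b ^ (m - w (Suc j))" and ?n' = "b ^ (m - wp j)"
  let ?O = "order_part ?N \<Gamma> \<gamma> (Z z)"
  have k: "k < ?n" and wm: "w (Suc j) < m"
    using Suc.prems by (auto simp: wp_def)
  have fold: "fold_to b m w (Suc j) (cbc_q b m w \<Gamma> \<gamma> z j l') k = class_sum ?N ?n (?O j l') k" for l'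
  proof -
    have "fold_to b m w (Suc j) (cbc_q b m w \<Gamma> \<gamma> z j l') k = fold_sum b m (w (Suc j)) (wp j) (class_sum ?N ?n' (?O j l')) k"
      unfolding fold_to_eq
    proof (rule fold_sum_cong)
      fix k assume "k < ?n'"
      then show "cbc_q b m w \<Gamma> \<gamma> z j l' k = class_sum ?N ?n' (?O j l') k"
        using Suc.prems wp_le[of j] wm by (intro Suc.IH) auto
    qed (use wp_le[of j] wm k in auto)
    also have "\<dots> = class_sum ?N ?n (?O j l') k"
      using wp_le[of j] wm k b_pos by (intro fold_sum_class_sum) auto
    finally show ?thesis .
  qed
  have om: "omega_matrix ?N (Z z (Suc j)) k' = omega_matrix ?n (z (Suc j)) k'" for k'
    unfolding Z_def using wm b_pos by (intro omega_matrix_scale) auto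
  have wps: "wp (Suc j) = w (Suc j)"
    by (simp add: wp_def)
  show ?case
  proof (cases "l \<le> Suc j")
    case False
    then have "class_sum ?N ?n (?O (Suc j) l) k = class_sum ?N ?n (\<lambda>_. 0) k"
      by (intro arg_cong2[where f = "class_sum ?N ?n"] ext refl) (simp add: order_part_large)
    then show ?thesis
      using False by (simp add: wps class_sum_def)
  next
    case True
    then have quot: "l = 0 \<or> (\<Gamma> (l - 1) = 0 \<longrightarrow> \<Gamma> l = 0)"
      using Suc.prems by (intro \<Gamma>_quotient) auto
    show ?thesis
    proof (cases "l = 0")
      case True
      then have "?O (Suc j) l = ?O j l"
        using order_part_Suc[OF quot] by (intro ext) simp
      then show ?thesis
        using True fold by (simp add: wps)
    next
      case False
      then have eq: "?O (Suc j) l = (\<lambda>k'. ?O j l k' + \<Gamma> l / \<Gamma> (l - 1) * \<gamma> (Suc j) * omega_matrix ?n (z (Suc j)) k' * ?O j (l - 1) k')"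
        using order_part_Suc[OF quot, of ?N \<gamma> "Z z" j] by (intro ext) (simp only: om if_False)
      show ?thesis
        unfolding eq wps class_sum_add class_sum_omega using False True by (simp add: fold)
    qed
  qed
qed

section \<open>The criterion as an increment of the worst-case error\<close>

definition increment :: "(nat \<Rightarrow> nat) \<Rightarrow> nat \<Rightarrow> nat \<Rightarrow> real" where
  "increment z j y = (\<Sum>v\<in>Pow {1..j - 1}. pod_weight \<Gamma> \<gamma> (insert j v) * mean_prod (b ^ m) ((Z z)(j := b ^ w j * y)) (insert j v))"

lemma cbc_qbar_eq:
  assumes "Suc j \<le> s" "w (Suc j) < m" "k < b ^ (m - w (Suc j))"
  shows "cbc_qbar b m w \<Gamma> \<gamma> z (Suc j) k = class_sum (b ^ m) (b ^ (m - w (Suc j)))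
    (\<lambda>k'. \<Sum>l=1..Suc j. \<Gamma> l / \<Gamma> (l - 1) * order_part (b ^ m) \<Gamma> \<gamma> (Z z) j (l - 1) k') k"
proof -
  let ?N = "b ^ m" and ?n = "b ^ (m - w (Suc j))" and ?n' = "b ^ (m - wp j)"
  let ?O = "order_part ?N \<Gamma> \<gamma> (Z z)"
  have fold: "fold_to b m w (Suc j) (cbc_q b m w \<Gamma> \<gamma> z j l') k = class_sum ?N ?n (?O j l') k" for l'
  proof -
    have "fold_to b m w (Suc j) (cbc_q b m w \<Gamma> \<gamma> z j l') k = fold_sum b m (w (Suc j)) (wp j) (class_sum ?N ?n' (?O j l')) k"
      unfolding fold_to_eq
      by (rule fold_sum_cong) (use assms wp_le[of j] in \<open>auto intro!: cbc_q_eq\<close>)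
    also have "\<dots> = class_sum ?N ?n (?O j l') k"
      using wp_le[of j] assms b_pos by (intro fold_sum_class_sum) auto
    finally show ?thesis .
  qed
  have "class_sum ?N ?n (\<lambda>k'. \<Sum>l\<in>A. c l * f l k') k = (\<Sum>l\<in>A. c l * class_sum ?N ?n (f l) k)" for A :: "nat set" and c :: "nat \<Rightarrow> real" and f
    unfolding class_sum_def sum_distrib_left
    by (subst sum.swap) (auto intro!: sum.cong)
  then show ?thesis
    unfolding cbc_qbar_def by (simp only: fold diff_Suc_1)
qed

text \<open>The classes of the folded vector are unfolded again by the periodicity of the row, and
  the quotients of order weights telescope. The factor \<open>\<gamma> j\<close>, left out by the
  criterion, stands on the left side, so that \<open>\<gamma> j = 0\<close> is covered as
  well.\<close>

lemma cbc_T_eq: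
  assumes "j \<in> {1..s}" "w j < m"
  shows "\<gamma> j * cbc_T b m w \<Gamma> \<gamma> z j y = real (b ^ m) * increment z j y"
proof -
  obtain i where j: "j = Suc i"
    using assms(1) by (cases j) auto
  let ?N = "b ^ m" and ?n = "b ^ (m - w j)"
  let ?O = "order_part ?N \<Gamma> \<gamma> (Z z)"
  let ?Z = "(Z z)(j := b ^ w j * y)"
  let ?h = "\<lambda>k'. \<Sum>l=1..j. \<Gamma> l / \<Gamma> (l - 1) * ?O i (l - 1) k'"
  have n: "?n > 0"
    using b_pos by simp
  have "cbc_T b m w \<Gamma> \<gamma> z j y = (\<Sum>k<?n. omega_matrix ?n y k * class_sum ?N ?n ?h k)"
    unfolding cbc_T_def using assms cbc_qbar_eq[of i] unfolding j by (intro sum.cong refl) simp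
  also have "\<dots> = (\<Sum>k<?n. \<Sum>k'<?N. if k' mod ?n = k then omega_matrix ?n y k * ?h k' else 0)"
    unfolding class_sum_def by (subst sum_distrib_left) (intro sum.cong refl, simp)
  also have "\<dots> = (\<Sum>k'<?N. \<Sum>k<?n. if k' mod ?n = k then omega_matrix ?n y k * ?h k' else 0)"
    by (rule sum.swap)
  also have "\<dots> = (\<Sum>k'<?N. omega_matrix ?N (b ^ w j * y) k' * ?h k')"
  proof (intro sum.cong refl)
    fix k'
    have "(\<Sum>k<?n. if k' mod ?n = k then omega_matrix ?n y k * ?h k' else 0) = omega_matrix ?n y (k' mod ?n) * ?h k'"
      using n by (simp add: eq_commute[of "k' mod ?n"])
    then show "(\<Sum>k<?n. if k' mod ?n = k then omega_matrix ?n y k * ?h k' else 0) = omega_matrix ?N (b ^ w j * y) k' * ?h k'"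
      using assms b_pos by (simp add: omega_matrix_mod omega_matrix_scale)
  qed
  finally have "\<gamma> j * cbc_T b m w \<Gamma> \<gamma> z j y = (\<Sum>k'<?N. \<gamma> j * omega_matrix ?N (b ^ w j * y) k' * ?h k')"
    by (simp add: sum_distrib_left mult.assoc)
  also have "\<dots> = (\<Sum>k'<?N. \<Sum>v\<in>Pow {1..i}. \<Gamma> (Suc (card v)) * (\<gamma> j * omega_matrix ?N (b ^ w j * y) k' * (\<Prod>i\<in>v. \<gamma> i * omega_matrix ?N (Z z i) k')))"
  proof (intro sum.cong refl)
    fix k'
    have "?h k' = (\<Sum>l=1..j. \<Sum>v\<in>Pow {1..i}. if card v = l - 1 then \<Gamma> l * (\<Prod>i\<in>v. \<gamma> i * omega_matrix ?N (Z z i) k') else 0)"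
      unfolding order_part_def sum_distrib_left
    proof (intro sum.cong refl)
      fix l v assume "l \<in> {1..j}"
      then have "l = 0 \<or> (\<Gamma> (l - 1) = 0 \<longrightarrow> \<Gamma> l = 0)"
        using assms(1) by (intro \<Gamma>_quotient) auto
      then show "\<Gamma> l / \<Gamma> (l - 1) * (if card v = l - 1 then \<Gamma> (l - 1) * (\<Prod>i\<in>v. \<gamma> i * omega_matrix ?N (Z z i) k') else 0) =
          (if card v = l - 1 then \<Gamma> l * (\<Prod>i\<in>v. \<gamma> i * omega_matrix ?N (Z z i) k') else 0)"
        using \<open>l \<in> {1..j}\<close> by auto
    qed
    also have "\<dots> = (\<Sum>v\<in>Pow {1..i}. \<Sum>l=1..j. if card v = l - 1 then \<Gamma> l * (\<Prod>i\<in>v. \<gamma> i * omega_matrix ?N (Z z i) k') else 0)"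
      by (rule sum.swap)
    also have "\<dots> = (\<Sum>v\<in>Pow {1..i}. \<Gamma> (Suc (card v)) * (\<Prod>i\<in>v. \<gamma> i * omega_matrix ?N (Z z i) k'))"
    proof (intro sum.cong refl)
      fix v assume "v \<in> Pow {1..i}"
      then have "card v \<le> card {1..i}"
        by (intro card_mono) auto
      then have "Suc (card v) \<in> {1..j}"
        by (simp add: j)
      moreover have "(\<Sum>l=1..j. if card v = l - 1 then \<Gamma> l * (\<Prod>i\<in>v. \<gamma> i * omega_matrix ?N (Z z i) k') else 0) =
          (\<Sum>l=1..j. if l = Suc (card v) then \<Gamma> l * (\<Prod>i\<in>v. \<gamma> i * omega_matrix ?N (Z z i) k') else 0)"
        by (intro sum.cong refl) auto
      ultimately show "(\<Sum>l=1..j. if card v = l - 1 then \<Gamma> l * (\<Prod>i\<in>v. \<gamma> i * omega_matrix ?N (Z z i) k') else 0) =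
          \<Gamma> (Suc (card v)) * (\<Prod>i\<in>v. \<gamma> i * omega_matrix ?N (Z z i) k')"
        by simp
    qed
    finally show "\<gamma> j * omega_matrix ?N (b ^ w j * y) k' * ?h k' =
      (\<Sum>v\<in>Pow {1..i}. \<Gamma> (Suc (card v)) * (\<gamma> j * omega_matrix ?N (b ^ w j * y) k' * (\<Prod>i\<in>v. \<gamma> i * omega_matrix ?N (Z z i) k')))"
      by (simp add: sum_distrib_left mult_ac)
  qed
  also have "\<dots> = (\<Sum>v\<in>Pow {1..i}. \<Sum>k'<?N. \<Gamma> (Suc (card v)) * (\<gamma> j * omega_matrix ?N (b ^ w j * y) k' * (\<Prod>i\<in>v. \<gamma> i * omega_matrix ?N (Z z i) k')))"
    by (rule sum.swap)
  also have "\<dots> = (\<Sum>v\<in>Pow {1..i}. real ?N * (pod_weight \<Gamma> \<gamma> (insert j v) * mean_prod ?N ?Z (insert j v)))"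
  proof (intro sum.cong refl)
    fix v assume "v \<in> Pow {1..i}"
    then have v: "finite v" "j \<notin> v"
      using finite_subset by (auto simp: j)
    have "(\<Prod>i\<in>v. omega_matrix ?N (?Z i) k') = (\<Prod>i\<in>v. omega_matrix ?N (Z z i) k')" for k'
      using v by (intro prod.cong) auto
    then show "(\<Sum>k'<?N. \<Gamma> (Suc (card v)) * (\<gamma> j * omega_matrix ?N (b ^ w j * y) k' * (\<Prod>i\<in>v. \<gamma> i * omega_matrix ?N (Z z i) k'))) =
       real ?N * (pod_weight \<Gamma> \<gamma> (insert j v) * mean_prod ?N ?Z (insert j v))"
      using v b_pos by (simp add: pod_weight_def mean_prod_def prod.distrib sum_distrib_left mult_ac)
  qed
  finally show ?thesis
    by (simp add: increment_def j sum_distrib_left)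
qed

lemma pod_weight_nonneg:
  assumes "u \<subseteq> {1..s}"
  shows "0 \<le> pod_weight \<Gamma> \<gamma> u"
proof -
  have "card u \<le> card {1..s}"
    using assms by (intro card_mono) auto
  then have "0 \<le> \<Gamma> (card u)"
    using pod \<Gamma>_0 by (cases "card u") (auto simp: pod_parameters_def)
  then show ?thesis
    unfolding pod_weight_def using pod assms by (intro mult_nonneg_nonneg prod_nonneg) (auto simp: pod_parameters_def)
qed

lemma increment_nonneg:
  assumes "j \<in> {1..s}"
  shows "0 \<le> increment z j y"
  unfolding increment_def
proof (intro sum_nonneg mult_nonneg_nonneg)
  fix v assume "v \<in> Pow {1..j - 1}"
  moreover have "{1..j - 1} \<subseteq> {1..s}"
    using assms by auto
  ultimately have v: "insert j v \<subseteq> {1..s}"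
    using assms by blast
  then show "0 \<le> pod_weight \<Gamma> \<gamma> (insert j v)"
    by (rule pod_weight_nonneg)
  show "0 \<le> mean_prod (b ^ m) ((Z z)(j := b ^ w j * y)) (insert j v)"
    using v finite_subset b_pos by (intro mean_prod_nonneg) auto
qed

lemma increment_powr_le_sum:
  assumes j: "j \<in> {1..s}" and lam: "1/2 < lam" "lam \<le> 1"
  shows "increment z j y powr lam \<le>
    (\<Sum>v\<in>Pow {1..j - 1}. pod_weight \<Gamma> \<gamma> (insert j v) powr lam * mean_prod (b ^ m) ((Z z)(j := b ^ w j * y)) (insert j v) powr lam)"
proof -
  have *: "0 \<le> pod_weight \<Gamma> \<gamma> (insert j v) \<and> 0 \<le> mean_prod (b ^ m) ((Z z)(j := b ^ w j * y)) (insert j v)"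
    if "v \<in> Pow {1..j - 1}" for v
  proof -
    have "{1..j - 1} \<subseteq> {1..s}"
      using j by auto
    then have v: "insert j v \<subseteq> {1..s}"
      using that j by blast
    then show ?thesis
      using finite_subset[OF v] b_pos by (intro conjI pod_weight_nonneg mean_prod_nonneg) auto
  qed
  have "increment z j y powr lam \<le>
     (\<Sum>v\<in>Pow {1..j - 1}. (pod_weight \<Gamma> \<gamma> (insert j v) * mean_prod (b ^ m) ((Z z)(j := b ^ w j * y)) (insert j v)) powr lam)"
    unfolding increment_def using * lam by (intro powr_sum_le) (auto intro: mult_nonneg_nonneg)
  also have "\<dots> = (\<Sum>v\<in>Pow {1..j - 1}. pod_weight \<Gamma> \<gamma> (insert j v) powr lam * mean_prod (b ^ m) ((Z z)(j := b ^ w j * y)) (insert j v) powr lam)"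
    by (intro sum.cong refl powr_mult)
  finally show ?thesis .
qed

text \<open>If \<open>w j < m\<close>, the selected component minimises the increment, so its power
  is at most the mean over all units. If \<open>w j \<ge> m\<close>, the factor
  \<open>b ^ min m (w j) * (2 / b ^ m)\<close> is 2 and the bound without averaging is
  enough.\<close>

lemma increment_powr_le:
  assumes j: "j \<in> {1..s}" and lam: "1/2 < lam" "lam \<le> 1" and z: "reduced_cbc_output b m w s \<Gamma> \<gamma> z"
  shows "increment z j (z j) powr lam \<le>
    (\<Sum>v\<in>Pow {1..j - 1}. pod_weight \<Gamma> \<gamma> (insert j v) powr lam *
       ((2 * zeta_real (2 * lam)) ^ Suc (card v) * (real b ^ min m (w j) * (2 / real (b ^ m)))))"
proof -
  let ?\<zeta> = "2 * zeta_real (2 * lam)"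
  have \<zeta>: "0 \<le> ?\<zeta>"
    using zeta_real_nonneg[of "2 * lam"] lam by simp
  have v: "finite v" "j \<notin> v" if "v \<in> Pow {1..j - 1}" for v
    using that finite_subset[of v "{1..j - 1}"] j by auto
  have N: "b ^ m > 0"
    using b_pos by simp
  show ?thesis
  proof (cases "w j < m")
    case False
    have two: "real b ^ min m (w j) * (2 / real (b ^ m)) = 2"
      using False b_pos by (simp add: min_absorb1)
    have "increment z j (z j) powr lam \<le>
      (\<Sum>v\<in>Pow {1..j - 1}. pod_weight \<Gamma> \<gamma> (insert j v) powr lam * mean_prod (b ^ m) ((Z z)(j := b ^ w j * z j)) (insert j v) powr lam)"
      by (rule increment_powr_le_sum[OF j lam])
    also have "\<dots> \<le> (\<Sum>v\<in>Pow {1..j - 1}. pod_weight \<Gamma> \<gamma> (insert j v) powr lam * (?\<zeta> ^ Suc (card v) * 2))"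
    proof (intro sum_mono mult_left_mono)
      fix u assume "u \<in> Pow {1..j - 1}"
      then have "mean_prod (b ^ m) ((Z z)(j := b ^ w j * z j)) (insert j u) powr lam \<le> ?\<zeta> ^ Suc (card u)"
        by (intro mean_prod_powr_le N v lam)
      also have "\<dots> \<le> ?\<zeta> ^ Suc (card u) * 2"
        using \<zeta> mult_left_mono[of 1 2 "?\<zeta> ^ Suc (card u)"] by simp
      finally show "mean_prod (b ^ m) ((Z z)(j := b ^ w j * z j)) (insert j u) powr lam \<le> ?\<zeta> ^ Suc (card u) * 2" .
    qed auto
    finally show ?thesis
      unfolding two .
  next
    case True
    let ?U = "unit_residues (b ^ (m - w j))"
    have U: "real (card ?U) > 0"
      using unit_residues_nonempty[OF b] by (simp add: card_gt_0_iff)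
    have min: "is_arg_min (cbc_T b m w \<Gamma> \<gamma> z j) (\<lambda>y. y \<in> ?U) (z j)"
      using z j True unfolding reduced_cbc_output_def by (auto simp del: One_nat_def)
    have le: "increment z j (z j) \<le> increment z j y" if y: "y \<in> ?U" for y
    proof -
      have "cbc_T b m w \<Gamma> \<gamma> z j (z j) \<le> cbc_T b m w \<Gamma> \<gamma> z j y"
        using min y by (auto simp: is_arg_min_def not_less)
      then have "\<gamma> j * cbc_T b m w \<Gamma> \<gamma> z j (z j) \<le> \<gamma> j * cbc_T b m w \<Gamma> \<gamma> z j y"
        using pod j by (intro mult_left_mono) (auto simp: pod_parameters_def)
      then show ?thesis
        using N unfolding cbc_T_eq[OF j True] by simp
    qed
    have "real (card ?U) * increment z j (z j) powr lam = (\<Sum>y\<in>?U. increment z j (z j) powr lam)"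
      by simp
    also have "\<dots> \<le> (\<Sum>y\<in>?U. increment z j y powr lam)"
      using lam by (intro sum_mono powr_mono2 le increment_nonneg j) auto
    also have "\<dots> \<le> (\<Sum>y\<in>?U. \<Sum>v\<in>Pow {1..j - 1}. pod_weight \<Gamma> \<gamma> (insert j v) powr lam * mean_prod (b ^ m) ((Z z)(j := b ^ w j * y)) (insert j v) powr lam)"
      by (intro sum_mono increment_powr_le_sum j lam)
    also have "\<dots> = (\<Sum>v\<in>Pow {1..j - 1}. pod_weight \<Gamma> \<gamma> (insert j v) powr lam * (\<Sum>y\<in>?U. mean_prod (b ^ m) ((Z z)(j := b ^ w j * y)) (insert j v) powr lam))"
      by (subst sum.swap) (simp only: sum_distrib_left)
    also have "\<dots> \<le> (\<Sum>v\<in>Pow {1..j - 1}. pod_weight \<Gamma> \<gamma> (insert j v) powr lam * (real (card ?U) * (?\<zeta> ^ Suc (card v) * (2 / real (b ^ (m - w j))))))"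
      using True by (intro sum_mono mult_left_mono sum_units_mean_prod_powr_le b v lam) auto
    also have "2 / real (b ^ (m - w j)) = real b ^ min m (w j) * (2 / real (b ^ m))"
    proof -
      have "real (b ^ m) = real b ^ w j * real (b ^ (m - w j))"
        using True by (simp flip: power_add)
      then show ?thesis
        using True b_pos by (simp add: min_absorb2 del: of_nat_power)
    qed
    also have "(\<Sum>v\<in>Pow {1..j - 1}. pod_weight \<Gamma> \<gamma> (insert j v) powr lam * (real (card ?U) * (?\<zeta> ^ Suc (card v) * (real b ^ min m (w j) * (2 / real (b ^ m))))))
      = real (card ?U) * (\<Sum>v\<in>Pow {1..j - 1}. pod_weight \<Gamma> \<gamma> (insert j v) powr lam * (?\<zeta> ^ Suc (card v) * (real b ^ min m (w j) * (2 / real (b ^ m)))))"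
      by (simp only: sum_distrib_left mult.left_commute)
    finally show ?thesis
      using U by (simp only: mult_le_cancel_left_pos)
  qed
qed

definition error_sum :: "(nat \<Rightarrow> nat) \<Rightarrow> nat \<Rightarrow> real" where
  "error_sum z j = (\<Sum>u\<in>Pow {1..j} - {{}}. pod_weight \<Gamma> \<gamma> u * mean_prod (b ^ m) (Z z) u)"

lemma sum_nonempty_Suc:
  fixes f :: "nat set \<Rightarrow> real"
  shows "(\<Sum>u\<in>Pow {1..Suc j} - {{}}. f u) = (\<Sum>u\<in>Pow {1..j} - {{}}. f u) + (\<Sum>v\<in>Pow {1..j}. f (insert (Suc j) v))"
proof -
  have ins: "{1..Suc j} = insert (Suc j) {1..j}"
    by auto
  have "(\<Sum>u\<in>Pow {1..Suc j}. f u) = (\<Sum>u\<in>Pow {1..j}. f u) + (\<Sum>v\<in>Pow {1..j}. f (insert (Suc j) v))"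
    unfolding ins by (rule sum_Pow_insert) auto
  then show ?thesis
    by (simp add: sum_diff1 del: One_nat_def)
qed

text \<open>Each nonempty set is counted at its largest element \<open>Suc j\<close>. As
  \<open>w\<close> is monotone, \<open>w (Suc j)\<close> is the maximum of \<open>w\<close> on that
  set. Subadditivity of the power adds up the increments.\<close>

lemma error_sum_powr_le:
  assumes lam: "1/2 < lam" "lam \<le> 1" and z: "reduced_cbc_output b m w s \<Gamma> \<gamma> z" and "j \<le> s"
  shows "error_sum z j powr lam \<le>
    (\<Sum>u\<in>Pow {1..j} - {{}}. pod_weight \<Gamma> \<gamma> u powr lam * ((2 * zeta_real (2 * lam)) ^ card u *
      (real b ^ min m (Max (w ` u)) * (2 / real (b ^ m)))))"
  using \<open>j \<le> s\<close>
proof (induction j)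
  case 0
  show ?case
    by (simp add: error_sum_def)
next
  case (Suc j)
  let ?f = "\<lambda>u. pod_weight \<Gamma> \<gamma> u powr lam * ((2 * zeta_real (2 * lam)) ^ card u * (real b ^ min m (Max (w ` u)) * (2 / real (b ^ m))))"
  have Zz: "(Z z)(Suc j := b ^ w (Suc j) * z (Suc j)) = Z z"
    by (auto simp: Z_def)
  have "error_sum z (Suc j) = error_sum z j + increment z (Suc j) (z (Suc j))"
    unfolding error_sum_def increment_def Zz sum_nonempty_Suc by simp
  moreover have "0 \<le> error_sum z j"
    unfolding error_sum_def
  proof (intro sum_nonneg mult_nonneg_nonneg)
    fix u assume "u \<in> Pow {1..j} - {{}}"
    then have u: "u \<subseteq> {1..s}"
      using Suc.prems by auto
    then show "0 \<le> pod_weight \<Gamma> \<gamma> u" "0 \<le> mean_prod (b ^ m) (Z z) u"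
      using finite_subset b_pos by (auto intro!: pod_weight_nonneg mean_prod_nonneg simp del: One_nat_def)
  qed
  ultimately have "error_sum z (Suc j) powr lam \<le> error_sum z j powr lam + increment z (Suc j) (z (Suc j)) powr lam"
    using Suc.prems lam by (simp only:) (intro powr_add_le increment_nonneg; simp)
  also have "\<dots> \<le> (\<Sum>u\<in>Pow {1..j} - {{}}. ?f u) + (\<Sum>v\<in>Pow {1..j}. ?f (insert (Suc j) v))"
  proof (rule add_mono)
    show "error_sum z j powr lam \<le> (\<Sum>u\<in>Pow {1..j} - {{}}. ?f u)"
      using Suc by simp
    have "increment z (Suc j) (z (Suc j)) powr lam \<le> (\<Sum>v\<in>Pow {1..Suc j - 1}. pod_weight \<Gamma> \<gamma> (insert (Suc j) v) powr lam *
       ((2 * zeta_real (2 * lam)) ^ Suc (card v) * (real b ^ min m (w (Suc j)) * (2 / real (b ^ m)))))"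
      using Suc.prems by (intro increment_powr_le lam z) auto
    also have "\<dots> = (\<Sum>v\<in>Pow {1..j}. ?f (insert (Suc j) v))"
    proof (intro sum.cong)
      fix v assume v: "v \<in> Pow {1..j}"
      then have f: "finite v" "Suc j \<notin> v"
        using finite_subset by auto
      have "w i \<le> w (Suc j)" if "i \<in> v" for i
        using that v by (intro w_mono) auto
      then have Max: "Max (w ` insert (Suc j) v) = w (Suc j)"
        using f by (intro Max_eqI) auto
      show "pod_weight \<Gamma> \<gamma> (insert (Suc j) v) powr lam * ((2 * zeta_real (2 * lam)) ^ Suc (card v) * (real b ^ min m (w (Suc j)) * (2 / real (b ^ m)))) = ?f (insert (Suc j) v)"
        by (simp only: card_insert_disjoint[OF f] Max)
    qed simp
    finally show "increment z (Suc j) (z (Suc j)) powr lam \<le> (\<Sum>v\<in>Pow {1..j}. ?f (insert (Suc j) v))" .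
  qed
  also have "\<dots> = (\<Sum>u\<in>Pow {1..Suc j} - {{}}. ?f u)"
    by (rule sum_nonempty_Suc[symmetric])
  finally show ?case .
qed

end

section \<open>The error bound in the Sobolev space\<close>

lemma bernoulli2_omega:
  assumes "N > 0"
  shows "bernoulli2 (frac (of_int (int k * int z) / real N)) = omega_matrix N z k / (2 * pi\<^sup>2)"
proof -
  have "real (k * z) / real N = real (k * z div N) + real (k * z mod N) / real N"
    using assms by (subst div_mult_mod_eq[of "k * z" N, symmetric]) (simp only: of_nat_add of_nat_mult, simp add: field_simps)
  then have fr: "frac (of_int (int k * int z) / real N) = real (k * z mod N) / real N"
    using assms by (subst frac_unique_iff) auto
  have "real (k * z mod N) / real N \<in> {0..1}"
    using assms by (auto simp: field_simps less_imp_le)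
  then show ?thesis
    unfolding fr omega_matrix_def by (subst korobov_omega_2) (auto simp: bernoulli2_def)
qed

theorem rms_error_reduced_cbc:
  assumes b: "prime b" and w: "reduction_indices w" and pod: "pod_parameters s \<Gamma> \<gamma>"
    and z: "reduced_cbc_output b m w s \<Gamma> (korobov_weights \<gamma>) z"
    and lam: "1/2 < lam" "lam \<le> 1" and F: "F \<in> sobolev_space s (pod_weight \<Gamma> \<gamma>)"
  shows "rms_error s (b ^ m) (generating_vector b w z) F
    \<le> (\<Sum>u\<in>Pow {1..s} - {{}}. pod_weight \<Gamma> \<gamma> u powr lam * rho lam ^ card u * (real b ^ min m (Max (w ` u)) * (2 / real (b ^ m))))
        powr (1 / (2 * lam)) * sobolev_norm s (pod_weight \<Gamma> \<gamma>) F"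
proof -
  let ?\<gamma> = "korobov_weights \<gamma>"
  have pod': "pod_parameters s \<Gamma> ?\<gamma>"
    using pod by (auto simp: pod_parameters_def korobov_weights_def)
  \<comment> \<open>\<open>K\<close> is the run of the construction with the weights of the Korobov
    space, \<open>P\<close> refers to the original weights of the norm and of the bound.\<close>
  interpret K: reduced_cbc b m w s \<Gamma> ?\<gamma>
    using b w pod' by unfold_locales
  interpret P: reduced_cbc b m w s \<Gamma> \<gamma>
    using b w pod by unfold_locales
  have N: "b ^ m > 0"
    using K.b_pos by simp
  have pw: "pod_weight \<Gamma> ?\<gamma> u = pod_weight \<Gamma> \<gamma> u / (2 * pi\<^sup>2) ^ card u" for u
    by (simp add: pod_weight_def korobov_weights_def prod_dividef)
  have err: "squared_lattice_error s (b ^ m) (pod_weight \<Gamma> \<gamma>) (generating_vector b w z) = K.error_sum z s"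
    unfolding squared_lattice_error_def K.error_sum_def
  proof (intro sum.cong refl)
    fix u
    have "(\<Prod>j\<in>u. bernoulli2 (frac (of_int (int k * generating_vector b w z j) / real (b ^ m)))) =
        (\<Prod>j\<in>u. omega_matrix (b ^ m) (K.Z z j) k) / (2 * pi\<^sup>2) ^ card u" for k
      unfolding generating_vector_def K.Z_def bernoulli2_omega[OF N] by (simp add: prod_dividef)
    then show "pod_weight \<Gamma> \<gamma> u * (1 / real (b ^ m) * (\<Sum>k<b ^ m. \<Prod>j\<in>u. bernoulli2 (frac (of_int (int k * generating_vector b w z j) / real (b ^ m))))) =
       pod_weight \<Gamma> ?\<gamma> u * mean_prod (b ^ m) (K.Z z) u"
      unfolding mean_prod_def pw by (simp only: sum_divide_distrib[symmetric]) simp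
  qed
  let ?X = "\<Sum>u\<in>Pow {1..s} - {{}}. pod_weight \<Gamma> \<gamma> u powr lam * rho lam ^ card u * (real b ^ min m (Max (w ` u)) * (2 / real (b ^ m)))"
  have "K.error_sum z s powr lam \<le> (\<Sum>u\<in>Pow {1..s} - {{}}. pod_weight \<Gamma> ?\<gamma> u powr lam * ((2 * zeta_real (2 * lam)) ^ card u *
      (real b ^ min m (Max (w ` u)) * (2 / real (b ^ m)))))"
    by (rule K.error_sum_powr_le[OF lam z order_refl])
  also have "\<dots> = ?X"
  proof (intro sum.cong refl)
    fix u
    have "pod_weight \<Gamma> ?\<gamma> u powr lam = pod_weight \<Gamma> \<gamma> u powr lam / ((2 * pi\<^sup>2) ^ card u) powr lam"
      unfolding pw by (rule powr_divide)
    also have "((2 * pi\<^sup>2) ^ card u) powr lam = ((2 * pi\<^sup>2) powr lam) ^ card u"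
    proof -
      have "(x ^ n) powr lam = (x powr lam) ^ n" if "x > 0" for x :: real and n
        using that by (simp only: powr_powr powr_realpow[symmetric] powr_gt_zero mult.commute)
      moreover have "0 < 2 * pi\<^sup>2"
        by simp
      ultimately show ?thesis .
    qed
    \<comment> \<open>The powers of \<open>2 * pi\<^sup>2\<close> in the Korobov weights turn
      \<open>2 * zeta_real (2 * lam)\<close> into \<open>rho lam\<close>.\<close>
    finally have "pod_weight \<Gamma> ?\<gamma> u powr lam * (2 * zeta_real (2 * lam)) ^ card u = pod_weight \<Gamma> \<gamma> u powr lam * rho lam ^ card u"
      by (simp add: rho_def powr_minus power_mult_distrib power_inverse field_simps)
    then show "pod_weight \<Gamma> ?\<gamma> u powr lam * ((2 * zeta_real (2 * lam)) ^ card u * (real b ^ min m (Max (w ` u)) * (2 / real (b ^ m)))) =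
       pod_weight \<Gamma> \<gamma> u powr lam * rho lam ^ card u * (real b ^ min m (Max (w ` u)) * (2 / real (b ^ m)))"
      by (simp only: mult.assoc[symmetric])
  qed
  finally have le: "K.error_sum z s powr lam \<le> ?X" .
  have "sqrt (K.error_sum z s) \<le> ?X powr (1 / (2 * lam))"
  proof (cases "K.error_sum z s > 0")
    case True
    then have "sqrt (K.error_sum z s) = (K.error_sum z s powr lam) powr (1 / (2 * lam))"
      using lam by (simp add: powr_powr powr_half_sqrt)
    also have "\<dots> \<le> ?X powr (1 / (2 * lam))"
      using le lam by (intro powr_mono2) auto
    finally show ?thesis .
  next
    case False
    then have "sqrt (K.error_sum z s) \<le> 0"
      by simp
    also have "0 \<le> ?X powr (1 / (2 * lam))"
      by simp
    finally show ?thesis .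
  qed
  then have "sqrt (K.error_sum z s) * sobolev_norm s (pod_weight \<Gamma> \<gamma>) F \<le> ?X powr (1 / (2 * lam)) * sobolev_norm s (pod_weight \<Gamma> \<gamma>) F"
  proof (rule mult_right_mono)
    have "0 \<le> deriv_energy s u F" for u
      unfolding deriv_energy_def by simp
    then show "0 \<le> sobolev_norm s (pod_weight \<Gamma> \<gamma>) F"
      unfolding sobolev_norm_def using P.pod_weight_nonneg by (intro real_sqrt_ge_zero sum_nonneg divide_nonneg_nonneg) auto
  qed
  moreover have "rms_error s (b ^ m) (generating_vector b w z) F \<le> sqrt (K.error_sum z s) * sobolev_norm s (pod_weight \<Gamma> \<gamma>) F"
    using rms_error_le_lattice_error[OF F P.pod_weight_nonneg N, of "generating_vector b w z"] unfolding err by simp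
  ultimately show ?thesis
    by linarith
qed

text \<open>Subtracting \<open>w 1\<close> from \<open>m\<close> and from all indices removes the
  same factor \<open>b ^ w 1\<close> from numerator and denominator. If \<open>w 1 > m\<close>,
  truncation gives \<open>m' = 0\<close>, and both sides of \<open>key\<close> are 2.\<close>

theorem rms_error_adjusted:
  assumes b: "prime b" and w: "reduction_indices w" and s: "1 \<le> s" and pod: "pod_parameters s \<Gamma> \<gamma>"
    and mw: "(m', w') \<in> {(m, w), (adjust_m m w, adjust_w w)}"
    and z: "reduced_cbc_output b m' w' s \<Gamma> (korobov_weights \<gamma>) z"
    and lam: "lam \<in> {1/2<..1}" and F: "F \<in> sobolev_space s (pod_weight \<Gamma> \<gamma>)"
  shows "rms_error s (b ^ m') (generating_vector b w' z) F
             \<le> (\<Sum>u\<in>Pow {1..s} - {{}}.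
                   pod_weight \<Gamma> \<gamma> u powr lam * rho lam ^ card u * real b ^ min m (Max (w ` u)))
                 powr (1 / (2 * lam))
               * (2 / real (b ^ m)) powr (1 / (2 * lam))
               * sobolev_norm s (pod_weight \<Gamma> \<gamma>) F"
proof -
  have b0: "b > 0"
    using b prime_gt_0_nat by blast
  have mono: "w i \<le> w j" if "1 \<le> i" "i \<le> j" for i j
    using w that by (auto simp: reduction_indices_def mono_on_def)
  have w': "reduction_indices w'"
    using mw w mono by (auto simp: reduction_indices_def adjust_w_def mono_on_def intro!: diff_le_mono)
  have key: "real b ^ min m' (Max (w' ` u)) * (2 / real (b ^ m')) = real b ^ min m (Max (w ` u)) * (2 / real (b ^ m))"
    if u: "u \<in> Pow {1..s} - {{}}" for u
  proof -
    have fin: "finite u" "u \<noteq> {}"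
      using u finite_subset by auto
    have Max1: "w 1 \<le> Max (w ` u)"
    proof -
      obtain i where i: "i \<in> u"
        using fin by blast
      then have "w 1 \<le> w i"
        using u by (intro mono) auto
      also have "w i \<le> Max (w ` u)"
        using fin i by (intro Max_ge) auto
      finally show ?thesis .
    qed
    have Max2: "Max (adjust_w w ` u) = Max (w ` u) - w 1"
    proof -
      have "Max ((\<lambda>x. x - w 1) ` (w ` u)) = Max (w ` u) - w 1"
        using fin by (intro mono_Max_commute[symmetric]) (auto intro!: monoI diff_le_mono)
      moreover have "(\<lambda>x. x - w 1) ` (w ` u) = adjust_w w ` u"
        by (auto simp: adjust_w_def image_image)
      ultimately show ?thesis
        by simp
    qed
    show ?thesis
    proof (cases "(m', w') = (m, w)")
      case False
      then have m': "m' = m - w 1" "w' = adjust_w w"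
        using mw by (auto simp: adjust_m_def)
      show ?thesis
      proof (cases "w 1 \<le> m")
        case True
        then have "m = m' + w 1" "min m (Max (w ` u)) = min m' (Max (w' ` u)) + w 1"
          using Max1 Max2 m' by auto
        then show ?thesis
          using b0 by (simp add: power_add)
      next
        case False
        then have "m' = 0" "min m (Max (w ` u)) = m"
          using Max1 m' by auto
        then show ?thesis
          using b0 by simp
      qed
    qed simp
  qed
  let ?S = "\<Sum>u\<in>Pow {1..s} - {{}}. pod_weight \<Gamma> \<gamma> u powr lam * rho lam ^ card u * real b ^ min m (Max (w ` u))"
  have "(\<Sum>u\<in>Pow {1..s} - {{}}. pod_weight \<Gamma> \<gamma> u powr lam * rho lam ^ card u * (real b ^ min m' (Max (w' ` u)) * (2 / real (b ^ m'))))
     = (\<Sum>u\<in>Pow {1..s} - {{}}. pod_weight \<Gamma> \<gamma> u powr lam * rho lam ^ card u * real b ^ min m (Max (w ` u)) * (2 / real (b ^ m)))"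
  proof (intro sum.cong refl)
    fix u assume u: "u \<in> Pow {1..s} - {{}}"
    show "pod_weight \<Gamma> \<gamma> u powr lam * rho lam ^ card u * (real b ^ min m' (Max (w' ` u)) * (2 / real (b ^ m'))) =
      pod_weight \<Gamma> \<gamma> u powr lam * rho lam ^ card u * real b ^ min m (Max (w ` u)) * (2 / real (b ^ m))"
      by (simp only: mult.assoc key[OF u])
  qed
  also have "\<dots> = ?S * (2 / real (b ^ m))"
    by (rule sum_distrib_right[symmetric])
  finally have eq: "(\<Sum>u\<in>Pow {1..s} - {{}}. pod_weight \<Gamma> \<gamma> u powr lam * rho lam ^ card u * (real b ^ min m' (Max (w' ` u)) * (2 / real (b ^ m')))) = ?S * (2 / real (b ^ m))" .
  have "(?S * (2 / real (b ^ m))) powr (1 / (2 * lam)) = ?S powr (1 / (2 * lam)) * (2 / real (b ^ m)) powr (1 / (2 * lam))"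
    by (rule powr_mult)
  then show ?thesis
    using rms_error_reduced_cbc[OF b w' pod z _ _ F, of lam] lam unfolding eq by simp
qed

subsection \<open>Programs over arrays\<close>

datatype expr =
    Const_E int | Cos_E nat nat | Sin_E nat nat | Omega_E nat nat
  | Order_E nat | Product_E nat | Reg_E nat nat
  | Plus_E expr expr | Minus_E expr expr | Times_E expr expr | Over_E expr expr

primrec expr_val :: "(nat \<Rightarrow> real) \<Rightarrow> (nat \<Rightarrow> real) \<Rightarrow> (nat \<Rightarrow> nat \<Rightarrow> real) \<Rightarrow> expr \<Rightarrow> real" where
  "expr_val \<Gamma> \<gamma> M (Const_E i) = of_int i"
| "expr_val \<Gamma> \<gamma> M (Cos_E k n) = cos (2 * pi * real k / real n)"
| "expr_val \<Gamma> \<gamma> M (Sin_E k n) = sin (2 * pi * real k / real n)"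
| "expr_val \<Gamma> \<gamma> M (Omega_E k n) = korobov_omega 2 (real k / real n)"
| "expr_val \<Gamma> \<gamma> M (Order_E l) = \<Gamma> l"
| "expr_val \<Gamma> \<gamma> M (Product_E j) = \<gamma> j"
| "expr_val \<Gamma> \<gamma> M (Reg_E i k) = M i k"
| "expr_val \<Gamma> \<gamma> M (Plus_E e f) = expr_val \<Gamma> \<gamma> M e + expr_val \<Gamma> \<gamma> M f"
| "expr_val \<Gamma> \<gamma> M (Minus_E e f) = expr_val \<Gamma> \<gamma> M e - expr_val \<Gamma> \<gamma> M f"
| "expr_val \<Gamma> \<gamma> M (Times_E e f) = expr_val \<Gamma> \<gamma> M e * expr_val \<Gamma> \<gamma> M f"
| "expr_val \<Gamma> \<gamma> M (Over_E e f) = expr_val \<Gamma> \<gamma> M e / expr_val \<Gamma> \<gamma> M f"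

primrec expr_reads :: "expr \<Rightarrow> (nat \<times> nat) set" where
  "expr_reads (Const_E i) = {}"
| "expr_reads (Cos_E k n) = {}"
| "expr_reads (Sin_E k n) = {}"
| "expr_reads (Omega_E k n) = {}"
| "expr_reads (Order_E l) = {}"
| "expr_reads (Product_E j) = {}"
| "expr_reads (Reg_E i k) = {(i, k)}"
| "expr_reads (Plus_E e f) = expr_reads e \<union> expr_reads f"
| "expr_reads (Minus_E e f) = expr_reads e \<union> expr_reads f"
| "expr_reads (Times_E e f) = expr_reads e \<union> expr_reads f"
| "expr_reads (Over_E e f) = expr_reads e \<union> expr_reads f"

text \<open>The number of temporaries beyond the first. Only the right operand counts one more,
  because it is evaluated while the value of the left operand is being held.\<close>

primrec expr_depth :: "expr \<Rightarrow> nat" where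
  "expr_depth (Const_E i) = 0"
| "expr_depth (Cos_E k n) = 0"
| "expr_depth (Sin_E k n) = 0"
| "expr_depth (Omega_E k n) = 0"
| "expr_depth (Order_E l) = 0"
| "expr_depth (Product_E j) = 0"
| "expr_depth (Reg_E i k) = 0"
| "expr_depth (Plus_E e f) = max (expr_depth e) (Suc (expr_depth f))"
| "expr_depth (Minus_E e f) = max (expr_depth e) (Suc (expr_depth f))"
| "expr_depth (Times_E e f) = max (expr_depth e) (Suc (expr_depth f))"
| "expr_depth (Over_E e f) = max (expr_depth e) (Suc (expr_depth f))"

text \<open>Reading a register costs 2: a copy is made by loading 0 and adding the register.\<close>

primrec expr_cost :: "expr \<Rightarrow> nat" where
  "expr_cost (Const_E i) = 1"
| "expr_cost (Cos_E k n) = 1"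
| "expr_cost (Sin_E k n) = 1"
| "expr_cost (Omega_E k n) = 1"
| "expr_cost (Order_E l) = 1"
| "expr_cost (Product_E j) = 1"
| "expr_cost (Reg_E i k) = 2"
| "expr_cost (Plus_E e f) = Suc (expr_cost e + expr_cost f)"
| "expr_cost (Minus_E e f) = Suc (expr_cost e + expr_cost f)"
| "expr_cost (Times_E e f) = Suc (expr_cost e + expr_cost f)"
| "expr_cost (Over_E e f) = Suc (expr_cost e + expr_cost f)"

text \<open>Left-nested, so that the number of temporaries does not grow with the number of summands.\<close>
primrec sum_E :: "nat \<Rightarrow> (nat \<Rightarrow> expr) \<Rightarrow> expr" where
  "sum_E 0 f = Const_E 0"
| "sum_E (Suc n) f = Plus_E (sum_E n f) (f n)"

lemma expr_val_sum_E [simp]: "expr_val \<Gamma> \<gamma> M (sum_E n f) = (\<Sum>i<n. expr_val \<Gamma> \<gamma> M (f i))"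
  by (induction n) simp_all

lemma expr_reads_sum_E [simp]: "expr_reads (sum_E n f) = (\<Union>i<n. expr_reads (f i))"
  by (induction n) (auto simp: less_Suc_eq)

lemma expr_depth_sum_E: "(\<And>i. i < n \<Longrightarrow> expr_depth (f i) \<le> d) \<Longrightarrow> expr_depth (sum_E n f) \<le> Suc d"
  by (induction n) (auto simp: less_Suc_eq)

lemma expr_cost_sum_E: "(\<And>i. i < n \<Longrightarrow> expr_cost (f i) \<le> c) \<Longrightarrow> expr_cost (sum_E n f) \<le> Suc (n * Suc c)"
proof (induction n)
  case (Suc n)
  then have "expr_cost (sum_E n f) \<le> Suc (n * Suc c)" "expr_cost (f n) \<le> c"
    by auto
  then show ?case
    by simp
qed simp

lemma expr_val_cong:
  assumes "\<And>i k. (i, k) \<in> expr_reads e \<Longrightarrow> M i k = M' i k"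
  shows "expr_val \<Gamma> \<gamma> M e = expr_val \<Gamma> \<gamma> M' e"
  using assms by (induction e) auto

abbreviation reg :: "nat \<Rightarrow> nat \<Rightarrow> nat" where
  "reg i k \<equiv> prod_encode (i, k)"

text \<open>Array \<open>0\<close> holds the temporaries.\<close>
primrec compile_expr :: "nat \<Rightarrow> expr \<Rightarrow> instruction list" where
  "compile_expr d (Const_E i) = [Load_int (reg 0 d) i]"
| "compile_expr d (Cos_E k n) = [Load_cos (reg 0 d) k n]"
| "compile_expr d (Sin_E k n) = [Load_sin (reg 0 d) k n]"
| "compile_expr d (Omega_E k n) = [Load_omega (reg 0 d) k n]"
| "compile_expr d (Order_E l) = [Load_order_weight (reg 0 d) l]"
| "compile_expr d (Product_E j) = [Load_product_weight (reg 0 d) j]"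
| "compile_expr d (Reg_E i k) = [Load_int (reg 0 d) 0, Add (reg 0 d) (reg 0 d) (reg i k)]"
| "compile_expr d (Plus_E e f) = compile_expr d e @ compile_expr (Suc d) f @ [Add (reg 0 d) (reg 0 d) (reg 0 (Suc d))]"
| "compile_expr d (Minus_E e f) = compile_expr d e @ compile_expr (Suc d) f @ [Sub (reg 0 d) (reg 0 d) (reg 0 (Suc d))]"
| "compile_expr d (Times_E e f) = compile_expr d e @ compile_expr (Suc d) f @ [Mul (reg 0 d) (reg 0 d) (reg 0 (Suc d))]"
| "compile_expr d (Over_E e f) = compile_expr d e @ compile_expr (Suc d) f @ [Div (reg 0 d) (reg 0 d) (reg 0 (Suc d))]"

definition exec_list :: "(nat \<Rightarrow> real) \<Rightarrow> (nat \<Rightarrow> real) \<Rightarrow> instruction list \<Rightarrow> (nat \<Rightarrow> real) \<Rightarrow> nat \<Rightarrow> real" where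
  "exec_list \<Gamma> \<gamma> = fold (exec_instr \<Gamma> \<gamma>)"

lemma exec_list_simps [simp]:
  "exec_list \<Gamma> \<gamma> [] \<sigma> = \<sigma>"
  "exec_list \<Gamma> \<gamma> (i # is) \<sigma> = exec_list \<Gamma> \<gamma> is (exec_instr \<Gamma> \<gamma> i \<sigma>)"
  "exec_list \<Gamma> \<gamma> (is @ is') \<sigma> = exec_list \<Gamma> \<gamma> is' (exec_list \<Gamma> \<gamma> is \<sigma>)"
  by (simp_all add: exec_list_def)

text \<open>Array \<open>0\<close> is masked, so that changes of the temporaries are invisible at
  the level of programs.\<close>

definition memory :: "(nat \<Rightarrow> real) \<Rightarrow> nat \<Rightarrow> nat \<Rightarrow> real" where
  "memory \<sigma> i k = (if i = 0 then 0 else \<sigma> (reg i k))"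

definition compiles_to :: "(nat \<Rightarrow> real) \<Rightarrow> (nat \<Rightarrow> real) \<Rightarrow> nat \<Rightarrow> instruction list \<Rightarrow> expr \<Rightarrow> bool" where
  "compiles_to \<Gamma> \<gamma> d is e \<longleftrightarrow> (\<forall>\<sigma>.
     exec_list \<Gamma> \<gamma> is \<sigma> (reg 0 d) = expr_val \<Gamma> \<gamma> (memory \<sigma>) e \<and>
     memory (exec_list \<Gamma> \<gamma> is \<sigma>) = memory \<sigma> \<and>
     (\<forall>d'<d. exec_list \<Gamma> \<gamma> is \<sigma> (reg 0 d') = \<sigma> (reg 0 d')))"

lemma compiles_to_binary:
  assumes e: "compiles_to \<Gamma> \<gamma> d is e" and f: "compiles_to \<Gamma> \<gamma> (Suc d) is' f"
    and i: "\<And>\<sigma>. exec_instr \<Gamma> \<gamma> i \<sigma> = \<sigma>(reg 0 d := h (\<sigma> (reg 0 d)) (\<sigma> (reg 0 (Suc d))))"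
    and g: "\<And>M. expr_val \<Gamma> \<gamma> M g = h (expr_val \<Gamma> \<gamma> M e) (expr_val \<Gamma> \<gamma> M f)"
  shows "compiles_to \<Gamma> \<gamma> d (is @ is' @ [i]) g"
  unfolding compiles_to_def
proof (intro allI)
  fix \<sigma>
  define \<sigma>1 \<sigma>2 where "\<sigma>1 = exec_list \<Gamma> \<gamma> is \<sigma>" and "\<sigma>2 = exec_list \<Gamma> \<gamma> is' \<sigma>1"
  have 1: "\<sigma>1 (reg 0 d) = expr_val \<Gamma> \<gamma> (memory \<sigma>) e" "memory \<sigma>1 = memory \<sigma>" "\<And>d'. d' < d \<Longrightarrow> \<sigma>1 (reg 0 d') = \<sigma> (reg 0 d')"
    using e by (auto simp: compiles_to_def \<sigma>1_def)
  have 2: "\<sigma>2 (reg 0 (Suc d)) = expr_val \<Gamma> \<gamma> (memory \<sigma>1) f" "memory \<sigma>2 = memory \<sigma>1" "\<And>d'. d' < Suc d \<Longrightarrow> \<sigma>2 (reg 0 d') = \<sigma>1 (reg 0 d')"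
    using f by (auto simp: compiles_to_def \<sigma>2_def)
  have 3: "exec_list \<Gamma> \<gamma> (is @ is' @ [i]) \<sigma> = \<sigma>2(reg 0 d := h (\<sigma>2 (reg 0 d)) (\<sigma>2 (reg 0 (Suc d))))"
    by (simp add: i \<sigma>1_def \<sigma>2_def)
  have "memory (\<sigma>2(reg 0 d := x)) = memory \<sigma>2" for x
    by (auto simp: memory_def fun_eq_iff)
  with 1 2 show "exec_list \<Gamma> \<gamma> (is @ is' @ [i]) \<sigma> (reg 0 d) = expr_val \<Gamma> \<gamma> (memory \<sigma>) g \<and>
     memory (exec_list \<Gamma> \<gamma> (is @ is' @ [i]) \<sigma>) = memory \<sigma> \<and>
     (\<forall>d'<d. exec_list \<Gamma> \<gamma> (is @ is' @ [i]) \<sigma> (reg 0 d') = \<sigma> (reg 0 d'))"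
    unfolding 3 by (simp add: g)
qed

lemma compile_expr_correct:
  assumes "\<And>i k. (i, k) \<in> expr_reads e \<Longrightarrow> i > 0"
  shows "compiles_to \<Gamma> \<gamma> d (compile_expr d e) e"
  using assms
proof (induction e arbitrary: d)
  case (Reg_E i k)
  then show ?case
    by (auto simp: compiles_to_def memory_def fun_eq_iff)
next
  case (Plus_E e f)
  show ?case
    unfolding compile_expr.simps
    by (rule compiles_to_binary[where h = "(+)", OF Plus_E.IH]) (use Plus_E.prems in auto)
next
  case (Minus_E e f)
  show ?case
    unfolding compile_expr.simps
    by (rule compiles_to_binary[where h = "(-)", OF Minus_E.IH]) (use Minus_E.prems in auto)
next
  case (Times_E e f)
  show ?case
    unfolding compile_expr.simps
    by (rule compiles_to_binary[where h = "(*)", OF Times_E.IH]) (use Times_E.prems in auto)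
next
  case (Over_E e f)
  show ?case
    unfolding compile_expr.simps
    by (rule compiles_to_binary[where h = "(/)", OF Over_E.IH]) (use Over_E.prems in auto)
qed (simp_all add: compiles_to_def memory_def fun_eq_iff)

lemma length_compile_expr: "length (compile_expr d e) = expr_cost e"
  by (induction e arbitrary: d) simp_all

lemma registers_binary:
  assumes "i \<in> set (is @ is' @ [x])"
    and "\<And>i. i \<in> set is \<Longrightarrow> instr_registers i \<subseteq> prod_encode ` (E \<union> {0} \<times> {d..d + a})"
    and "\<And>i. i \<in> set is' \<Longrightarrow> instr_registers i \<subseteq> prod_encode ` (F \<union> {0} \<times> {Suc d..Suc d + c})"
    and "instr_registers x \<subseteq> prod_encode ` ({0} \<times> {d, Suc d})"
  shows "instr_registers i \<subseteq> prod_encode ` (E \<union> F \<union> {0} \<times> {d..d + max a (Suc c)})"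
proof -
  have sub: "E \<union> {0} \<times> {d..d + a} \<subseteq> E \<union> F \<union> {0} \<times> {d..d + max a (Suc c)}"
    "F \<union> {0} \<times> {Suc d..Suc d + c} \<subseteq> E \<union> F \<union> {0} \<times> {d..d + max a (Suc c)}"
    "{0} \<times> {d, Suc d} \<subseteq> E \<union> F \<union> {0} \<times> {d..d + max a (Suc c)}"
    by auto
  from assms(1) consider "i \<in> set is" | "i \<in> set is'" | "i = x"
    by auto
  then show ?thesis
  proof cases
    case 1
    from order_trans[OF assms(2)[OF 1] image_mono[OF sub(1)]] show ?thesis .
  next
    case 2
    from order_trans[OF assms(3)[OF 2] image_mono[OF sub(2)]] show ?thesis .
  next
    case 3
    with assms(4) have "instr_registers i \<subseteq> prod_encode ` ({0} \<times> {d, Suc d})"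
      by (simp only:)
    from order_trans[OF this image_mono[OF sub(3)]] show ?thesis .
  qed
qed

lemma registers_compile_expr:
  assumes "i \<in> set (compile_expr d e)"
  shows "instr_registers i \<subseteq> prod_encode ` (expr_reads e \<union> {0} \<times> {d..d + expr_depth e})"
  using assms
proof (induction e arbitrary: d i)
  case (Plus_E e f)
  show ?case
    unfolding expr_reads.simps expr_depth.simps
    by (rule registers_binary[OF Plus_E.prems[unfolded compile_expr.simps] Plus_E.IH]) auto
next
  case (Minus_E e f)
  show ?case
    unfolding expr_reads.simps expr_depth.simps
    by (rule registers_binary[OF Minus_E.prems[unfolded compile_expr.simps] Minus_E.IH]) auto
next
  case (Times_E e f)
  show ?case
    unfolding expr_reads.simps expr_depth.simps
    by (rule registers_binary[OF Times_E.prems[unfolded compile_expr.simps] Times_E.IH]) auto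
next
  case (Over_E e f)
  show ?case
    unfolding expr_reads.simps expr_depth.simps
    by (rule registers_binary[OF Over_E.prems[unfolded compile_expr.simps] Over_E.IH]) auto
qed auto

section \<open>Assignment programs and their compilation\<close>

type_synonym assignment = "nat \<times> nat \<times> expr"

definition compile :: "assignment list \<Rightarrow> instruction list" where
  "compile P = concat (map (\<lambda>(i, k, e). compile_expr 0 e @ [Load_int (reg 0 1) 0, Add (reg i k) (reg 0 0) (reg 0 1)]) P)"

primrec assign :: "(nat \<Rightarrow> real) \<Rightarrow> (nat \<Rightarrow> real) \<Rightarrow> (nat \<Rightarrow> nat \<Rightarrow> real) \<Rightarrow> assignment list \<Rightarrow> nat \<Rightarrow> nat \<Rightarrow> real" where
  "assign \<Gamma> \<gamma> M [] = M"
| "assign \<Gamma> \<gamma> M (a # P) = assign \<Gamma> \<gamma> (case a of (i, k, e) \<Rightarrow> M(i := (M i)(k := expr_val \<Gamma> \<gamma> M e))) P"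

lemma assign_append [simp]: "assign \<Gamma> \<gamma> M (P @ P') = assign \<Gamma> \<gamma> (assign \<Gamma> \<gamma> M P) P'"
  by (induction P arbitrary: M) auto

text \<open>The bound on the depth lets programs of any length share twelve temporaries.\<close>
definition confined :: "(nat \<times> nat) set \<Rightarrow> assignment list \<Rightarrow> bool" where
  "confined S P \<longleftrightarrow> (\<forall>(i, k, e)\<in>set P. (i, k) \<in> S \<and> expr_reads e \<subseteq> S \<and> expr_depth e \<le> 10)"

lemma confined_append [simp]: "confined S (P @ P') \<longleftrightarrow> confined S P \<and> confined S P'"
  by (simp add: confined_def ball_Un)

lemma confined_mono: "confined S P \<Longrightarrow> S \<subseteq> S' \<Longrightarrow> confined S' P"
  by (fastforce simp: confined_def)

lemma confined_concat: "confined S (concat Ps) \<longleftrightarrow> (\<forall>P\<in>set Ps. confined S P)"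
  unfolding confined_def set_concat by blast

definition proper_addresses :: "(nat \<times> nat) set \<Rightarrow> bool" where
  "proper_addresses S \<longleftrightarrow> (\<forall>(i, k)\<in>S. i > 0)"

lemma compile_correct:
  assumes "confined S P" "proper_addresses S"
  shows "memory (exec_list \<Gamma> \<gamma> (compile P) \<sigma>) = assign \<Gamma> \<gamma> (memory \<sigma>) P"
  using assms(1)
proof (induction P arbitrary: \<sigma>)
  case Nil
  then show ?case
    by (simp add: compile_def)
next
  case (Cons a P)
  obtain i k e where a: "a = (i, k, e)"
    by (cases a)
  have reads: "i' > 0" if "(i', k') \<in> expr_reads e" for i' k'
    using Cons.prems assms(2) that by (force simp: a confined_def proper_addresses_def)
  have i: "i > 0"
    using Cons.prems assms(2) by (force simp: a confined_def proper_addresses_def)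
  let ?\<sigma>1 = "exec_list \<Gamma> \<gamma> (compile_expr 0 e) \<sigma>"
  let ?\<sigma>2 = "exec_list \<Gamma> \<gamma> [Load_int (reg 0 1) 0, Add (reg i k) (reg 0 0) (reg 0 1)] ?\<sigma>1"
  have 1: "?\<sigma>1 (reg 0 0) = expr_val \<Gamma> \<gamma> (memory \<sigma>) e" "memory ?\<sigma>1 = memory \<sigma>"
    using compile_expr_correct[of e \<Gamma> \<gamma> 0] reads by (auto simp: compiles_to_def)
  have "memory ?\<sigma>2 = (memory ?\<sigma>1)(i := (memory ?\<sigma>1 i)(k := ?\<sigma>1 (reg 0 0)))"
    using i by (auto simp: memory_def fun_eq_iff)
  then have 2: "memory ?\<sigma>2 = (memory \<sigma>)(i := (memory \<sigma> i)(k := expr_val \<Gamma> \<gamma> (memory \<sigma>) e))"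
    by (simp only: 1)
  have "exec_list \<Gamma> \<gamma> (compile (a # P)) \<sigma> = exec_list \<Gamma> \<gamma> (compile P) ?\<sigma>2"
    by (simp add: compile_def a)
  then have "memory (exec_list \<Gamma> \<gamma> (compile (a # P)) \<sigma>) = assign \<Gamma> \<gamma> (memory ?\<sigma>2) P"
    using Cons by (simp add: confined_def)
  then show ?case
    by (simp only: 2 a assign.simps prod.case)
qed

text \<open>The two additional instructions per assignment copy the value from temporary 0 to its
  target.\<close>

definition cost :: "assignment list \<Rightarrow> nat" where
  "cost P = sum_list (map (\<lambda>(i, k, e). expr_cost e + 2) P)"

lemma cost_append [simp]: "cost (P @ P') = cost P + cost P'"
  by (simp add: cost_def)

lemma cost_Nil [simp]: "cost [] = 0"
  by (simp add: cost_def)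

lemma cost_concat_map_le:
  assumes "\<And>x. x \<in> set xs \<Longrightarrow> cost (f x) \<le> c"
  shows "cost (concat (map f xs)) \<le> length xs * c"
  using assms by (induction xs) (auto simp: add_mono)

lemma cost_map_le:
  assumes "\<And>x. x \<in> set xs \<Longrightarrow> expr_cost (snd (snd (f x))) \<le> c"
  shows "cost (map f xs) \<le> length xs * (c + 2)"
  using assms
proof (induction xs)
  case (Cons x xs)
  have "cost (map f (x # xs)) = expr_cost (snd (snd (f x))) + 2 + cost (map f xs)"
    by (simp add: cost_def case_prod_unfold)
  moreover have "expr_cost (snd (snd (f x))) \<le> c" "cost (map f xs) \<le> length xs * (c + 2)"
    using Cons by auto
  ultimately show ?case
    by simp
qed simp

lemma length_compile: "length (compile P) = cost P"
  by (induction P) (auto simp: compile_def cost_def length_compile_expr)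

lemma registers_compile:
  assumes "confined S P" "i \<in> set (compile P)"
  shows "instr_registers i \<subseteq> prod_encode ` (S \<union> {0} \<times> {..11})"
proof -
  obtain i' k e where a: "(i', k, e) \<in> set P"
    and i: "i \<in> set (compile_expr 0 e) \<or> i \<in> {Load_int (reg 0 1) 0, Add (reg i' k) (reg 0 0) (reg 0 1)}"
    using assms(2) by (auto simp: compile_def)
  have S: "(i', k) \<in> S" "expr_reads e \<subseteq> S" "expr_depth e \<le> 10"
    using assms(1) a by (auto simp: confined_def)
  show ?thesis
  proof (cases "i \<in> set (compile_expr 0 e)")
    case True
    have "expr_reads e \<union> {0} \<times> {0..0 + expr_depth e} \<subseteq> S \<union> {0} \<times> {..11}"
      using S by auto
    with registers_compile_expr[OF True] show ?thesis
      by blast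
  next
    case False
    with i S(1) show ?thesis
      by auto
  qed
qed

lemma target_in_registers:
  assumes "(i, k, e) \<in> set P"
  shows "reg i k \<in> (\<Union>x\<in>set (compile P). instr_registers x)"
  using assms unfolding compile_def
  by (intro UN_I[of "Add (reg i k) (reg 0 0) (reg 0 1)"]) force+

lemma assign_frame:
  assumes "\<And>j k e. (j, k, e) \<in> set P \<Longrightarrow> j \<noteq> i"
  shows "assign \<Gamma> \<gamma> M P i = M i"
  using assms
proof (induction P arbitrary: M)
  case (Cons a P)
  obtain j k e where a: "a = (j, k, e)"
    by (cases a)
  have "j \<noteq> i"
    using Cons.prems[of j k e] by (simp add: a)
  have "assign \<Gamma> \<gamma> M (a # P) i = assign \<Gamma> \<gamma> (M(j := (M j)(k := expr_val \<Gamma> \<gamma> M e))) P i"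
    by (simp add: a)
  also have "\<dots> = (M(j := (M j)(k := expr_val \<Gamma> \<gamma> M e))) i"
    by (rule Cons.IH) (use Cons.prems in auto)
  also have "\<dots> = M i"
    using \<open>j \<noteq> i\<close> by simp
  finally show ?case .
qed simp

definition store :: "nat \<Rightarrow> nat \<Rightarrow> (nat \<Rightarrow> expr) \<Rightarrow> assignment list" where
  "store A L f = map (\<lambda>k. (A, k, f k)) [0..<L]"

lemma set_store: "set (store A L f) = (\<lambda>k. (A, k, f k)) ` {..<L}"
  by (auto simp: store_def)

text \<open>Entries are written in increasing order, so entry \<open>k\<close> may still read its
  own array at \<open>k\<close> and above. The folds of the POD vectors are carried out in place in
  this way.\<close>

lemma assign_store:
  assumes "\<And>k k'. k < L \<Longrightarrow> k' < k \<Longrightarrow> (A, k') \<notin> expr_reads (f k)"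
  shows "assign \<Gamma> \<gamma> M (store A L f) = M(A := \<lambda>k. if k < L then expr_val \<Gamma> \<gamma> M (f k) else M A k)"
  using assms
proof (induction L)
  case (Suc L)
  let ?M = "M(A := \<lambda>k. if k < L then expr_val \<Gamma> \<gamma> M (f k) else M A k)"
  have "assign \<Gamma> \<gamma> M (store A (Suc L) f) = assign \<Gamma> \<gamma> (assign \<Gamma> \<gamma> M (store A L f)) [(A, L, f L)]"
    by (simp add: store_def)
  also have "assign \<Gamma> \<gamma> M (store A L f) = ?M"
    using Suc by auto
  also have "expr_val \<Gamma> \<gamma> ?M (f L) = expr_val \<Gamma> \<gamma> M (f L)"
    using Suc.prems[of L] by (intro expr_val_cong) auto
  then have "assign \<Gamma> \<gamma> ?M [(A, L, f L)] = M(A := \<lambda>k. if k < Suc L then expr_val \<Gamma> \<gamma> M (f k) else M A k)"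
    by (auto simp: fun_eq_iff less_Suc_eq)
  finally show ?case .
qed (simp add: store_def)

lemma assign_accumulate:
  assumes "\<And>p k. p \<in> set ps \<Longrightarrow> (A, k) \<notin> expr_reads (f p)"
  shows "assign \<Gamma> \<gamma> M (map (\<lambda>p. (A, g p, Plus_E (Reg_E A (g p)) (f p))) ps) =
    M(A := \<lambda>k. M A k + (\<Sum>p\<leftarrow>ps. if g p = k then expr_val \<Gamma> \<gamma> M (f p) else 0))"
  using assms
proof (induction ps arbitrary: M)
  case (Cons p ps)
  let ?M = "M(A := (M A)(g p := M A (g p) + expr_val \<Gamma> \<gamma> M (f p)))"
  have "expr_val \<Gamma> \<gamma> ?M (f q) = expr_val \<Gamma> \<gamma> M (f q)" if "q \<in> set ps" for q
    using Cons.prems[of q] that by (intro expr_val_cong) auto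
  then have vals: "(\<Sum>q\<leftarrow>ps. if g q = k then expr_val \<Gamma> \<gamma> ?M (f q) else 0) = (\<Sum>q\<leftarrow>ps. if g q = k then expr_val \<Gamma> \<gamma> M (f q) else 0)" for k
    by (intro arg_cong[where f = sum_list] map_cong) auto
  have "assign \<Gamma> \<gamma> M (map (\<lambda>p. (A, g p, Plus_E (Reg_E A (g p)) (f p))) (p # ps)) =
      assign \<Gamma> \<gamma> ?M (map (\<lambda>p. (A, g p, Plus_E (Reg_E A (g p)) (f p))) ps)"
    by simp
  also have "\<dots> = ?M(A := \<lambda>k. ?M A k + (\<Sum>q\<leftarrow>ps. if g q = k then expr_val \<Gamma> \<gamma> ?M (f q) else 0))"
    by (rule Cons.IH) (use Cons.prems in auto)
  also have "\<dots> = M(A := \<lambda>k. M A k + (\<Sum>q\<leftarrow>p # ps. if g q = k then expr_val \<Gamma> \<gamma> M (f q) else 0))"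
    unfolding vals by (simp add: fun_eq_iff)
  finally show ?case .
qed simp

section \<open>Trees built from programs and comparisons\<close>

definition seq_tree :: "instruction list \<Rightarrow> Defs.tree \<Rightarrow> Defs.tree" where
  "seq_tree is t = foldr Exec is t"

lemma tree_output_seq: "tree_output \<Gamma> \<gamma> (seq_tree is t) \<sigma> = tree_output \<Gamma> \<gamma> t (exec_list \<Gamma> \<gamma> is \<sigma>)"
  by (induction "is" arbitrary: \<sigma>) (simp_all add: seq_tree_def)

lemma tree_cost_seq: "tree_cost \<Gamma> \<gamma> (seq_tree is t) \<sigma> = length is + tree_cost \<Gamma> \<gamma> t (exec_list \<Gamma> \<gamma> is \<sigma>)"
  by (induction "is" arbitrary: \<sigma>) (simp_all add: seq_tree_def)

lemma tree_states_seq: "tree_states \<Gamma> \<gamma> t (exec_list \<Gamma> \<gamma> is \<sigma>) \<subseteq> tree_states \<Gamma> \<gamma> (seq_tree is t) \<sigma>"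
  by (induction "is" arbitrary: \<sigma>) (auto simp: seq_tree_def)

lemma tree_registers_seq: "tree_registers (seq_tree is t) = (\<Union>i\<in>set is. instr_registers i) \<union> tree_registers t"
  by (induction "is") (auto simp: seq_tree_def)

lemma start_in_tree_states: "\<sigma> \<in> tree_states \<Gamma> \<gamma> t \<sigma>"
  by (cases t) auto

text \<open>The selected integer must be known to the later register addresses and to the output,
  neither of which can depend on register contents. It is therefore remembered by the branch that
  has been taken.\<close>

primrec argmin_tree :: "(nat \<Rightarrow> nat) \<Rightarrow> nat \<Rightarrow> nat list \<Rightarrow> (nat \<Rightarrow> Defs.tree) \<Rightarrow> Defs.tree" where
  "argmin_tree r best [] next_tree = next_tree best"
| "argmin_tree r best (y # ys) next_tree = If_le (r best) (r y) (argmin_tree r best ys next_tree) (argmin_tree r y ys next_tree)"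

lemma argmin_tree_run:
  "\<exists>y\<in>insert best (set ys). (\<forall>y'\<in>insert best (set ys). \<sigma> (r y) \<le> \<sigma> (r y')) \<and>
    tree_output \<Gamma> \<gamma> (argmin_tree r best ys next_tree) \<sigma> = tree_output \<Gamma> \<gamma> (next_tree y) \<sigma> \<and>
    tree_cost \<Gamma> \<gamma> (argmin_tree r best ys next_tree) \<sigma> = length ys + tree_cost \<Gamma> \<gamma> (next_tree y) \<sigma> \<and>
    tree_states \<Gamma> \<gamma> (next_tree y) \<sigma> \<subseteq> tree_states \<Gamma> \<gamma> (argmin_tree r best ys next_tree) \<sigma>"
proof (induction ys arbitrary: best)
  case (Cons x xs)
  define c where "c = (if \<sigma> (r best) \<le> \<sigma> (r x) then best else x)"
  obtain y where y: "y \<in> insert c (set xs)" "\<forall>y'\<in>insert c (set xs). \<sigma> (r y) \<le> \<sigma> (r y')"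
    "tree_output \<Gamma> \<gamma> (argmin_tree r c xs next_tree) \<sigma> = tree_output \<Gamma> \<gamma> (next_tree y) \<sigma>"
    "tree_cost \<Gamma> \<gamma> (argmin_tree r c xs next_tree) \<sigma> = length xs + tree_cost \<Gamma> \<gamma> (next_tree y) \<sigma>"
    "tree_states \<Gamma> \<gamma> (next_tree y) \<sigma> \<subseteq> tree_states \<Gamma> \<gamma> (argmin_tree r c xs next_tree) \<sigma>"
    using Cons.IH[of c] by (elim bexE conjE)
  have c: "\<sigma> (r c) \<le> \<sigma> (r best)" "\<sigma> (r c) \<le> \<sigma> (r x)" "c = best \<or> c = x"
    by (auto simp: c_def)
  have yc: "\<sigma> (r y) \<le> \<sigma> (r c)"
    using y(2) by simp
  show ?case
  proof (rule bexI[of _ y], intro conjI)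
    show "\<forall>y'\<in>insert best (set (x # xs)). \<sigma> (r y) \<le> \<sigma> (r y')"
      using y(2) order_trans[OF yc c(1)] order_trans[OF yc c(2)] by simp
    show "tree_output \<Gamma> \<gamma> (argmin_tree r best (x # xs) next_tree) \<sigma> = tree_output \<Gamma> \<gamma> (next_tree y) \<sigma>"
      using y(3) by (simp add: c_def split: if_splits)
    show "tree_cost \<Gamma> \<gamma> (argmin_tree r best (x # xs) next_tree) \<sigma> = length (x # xs) + tree_cost \<Gamma> \<gamma> (next_tree y) \<sigma>"
      using y(4) by (simp add: c_def split: if_splits)
    show "tree_states \<Gamma> \<gamma> (next_tree y) \<sigma> \<subseteq> tree_states \<Gamma> \<gamma> (argmin_tree r best (x # xs) next_tree) \<sigma>"
      using y(5) by (auto simp: c_def split: if_splits)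
    show "y \<in> insert best (set (x # xs))"
      using y(1) c(3) by auto
  qed
qed simp

lemma argmin_tree_registers:
  "tree_registers (argmin_tree r best ys next_tree) \<subseteq> r ` insert best (set ys) \<union> (\<Union>y\<in>insert best (set ys). tree_registers (next_tree y))"
  by (induction ys arbitrary: best) fastforce+

lemma argmin_tree_registers_cont:
  "y \<in> insert best (set ys) \<Longrightarrow> tree_registers (next_tree y) \<subseteq> tree_registers (argmin_tree r best ys next_tree)"
  by (induction ys arbitrary: best) auto

subsection \<open>The unit group modulo a prime power\<close>

lemma one_plus_power_expand: "\<exists>K. (1 + x :: nat) ^ n = 1 + n * x + x ^ 2 * K"
proof (induction n)
  case (Suc n)
  then obtain K where K: "(1 + x) ^ n = 1 + n * x + x ^ 2 * K" ..
  have "(1 + x) ^ Suc n = 1 + Suc n * x + x ^ 2 * (n + K + x * K)"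
    unfolding power_Suc K by (simp add: algebra_simps power2_eq_square)
  then show ?case ..
qed simp

text \<open>The powers of \<open>1 + b\<^sup>2\<close> modulo \<open>b ^ r\<close> are exactly the residues congruent to \<open>1\<close> modulo \<open>b\<^sup>2\<close>; the
  square makes this uniform in \<open>b\<close>, as \<open>1 + b\<close> would fail for \<open>b = 2\<close>.\<close>
definition gen :: "nat \<Rightarrow> nat" where
  "gen b = 1 + b ^ 2"

text \<open>Raising to the power \<open>b\<close> multiplies the linear term by \<open>b\<close>,
  while the quadratic remainder carries \<open>b ^ (2 * j + 4)\<close>, a higher power than
  \<open>b ^ (j + 3)\<close>. The cofactor thus stays prime to \<open>b\<close>, also for
  \<open>b = 2\<close>.\<close>

lemma gen_power_prime_power:
  assumes "prime b"
  shows "\<exists>u. gen b ^ (b ^ j) = 1 + b ^ (j + 2) * u \<and> \<not> b dvd u"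
proof (induction j)
  case 0
  have "gen b ^ (b ^ 0) = 1 + b ^ (0 + 2) * 1 \<and> \<not> b dvd 1"
    using assms by (simp add: gen_def power2_eq_square not_prime_1 prime_nat_iff)
  then show ?case ..
next
  case (Suc j)
  then obtain u where u: "gen b ^ (b ^ j) = 1 + b ^ (j + 2) * u" "\<not> b dvd u"
    by blast
  obtain K where K: "(1 + b ^ (j + 2) * u) ^ b = 1 + b * (b ^ (j + 2) * u) + (b ^ (j + 2) * u) ^ 2 * K"
    using one_plus_power_expand by blast
  have "gen b ^ (b ^ Suc j) = (gen b ^ (b ^ j)) ^ b"
    by (simp add: mult.commute flip: power_mult)
  also have "\<dots> = 1 + b ^ (Suc j + 2) * (u + b * (b ^ j * u ^ 2 * K))"
    unfolding u K by (simp add: power2_eq_square algebra_simps)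
  finally have "gen b ^ (b ^ Suc j) = 1 + b ^ (Suc j + 2) * (u + b * (b ^ j * u ^ 2 * K))" .
  moreover have "\<not> b dvd u + b * (b ^ j * u ^ 2 * K)"
    using u(2) by (simp add: dvd_add_left_iff)
  ultimately show ?case
    by blast
qed

lemma cong_1_add: "n dvd x \<Longrightarrow> [1 + x = 1] (mod n)" for n x :: nat
  using cong_add[OF cong_refl[of 1 n], of x 0] by (simp add: cong_0_iff)

lemma gen_power_cong_1:
  assumes "prime b"
  shows "[gen b ^ (b ^ (r - 2)) = 1] (mod b ^ r)"
proof -
  obtain u where u: "gen b ^ (b ^ (r - 2)) = 1 + b ^ (r - 2 + 2) * u"
    using gen_power_prime_power[OF assms] by blast
  have "b ^ r dvd b ^ (r - 2 + 2) * u"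
    by (intro dvd_mult2 le_imp_power_dvd) simp
  then show ?thesis
    unfolding u by (rule cong_1_add)
qed

lemma coprime_gen: "coprime (gen b) (b ^ r)"
proof -
  have "coprime (1 + b * b) b"
    by (metis coprime_1_left coprime_add_one_left coprime_mult_left_iff coprime_commute add.commute gcd_add_mult mult.commute coprime_iff_gcd_eq_1 gcd.commute gcd_add1)
  then show ?thesis
    by (simp add: gen_def power2_eq_square coprime_power_right_iff)
qed

text \<open>The order divides \<open>b ^ (r - 2)\<close>, but not \<open>b ^ (r - 3)\<close>,
  because the cofactor \<open>u\<close> is prime to \<open>b\<close>. For \<open>r \<le> 2\<close>
  truncated subtraction gives the correct order 1.\<close>

lemma ord_gen:
  assumes b: "prime b"
  shows "ord (b ^ r) (gen b) = b ^ (r - 2)"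
proof -
  have "ord (b ^ r) (gen b) dvd b ^ (r - 2)"
    unfolding ord_divides[symmetric] by (rule gen_power_cong_1[OF b])
  then obtain i where i: "i \<le> r - 2" "ord (b ^ r) (gen b) = b ^ i"
    using divides_primepow_nat[OF b] by blast
  have "i = r - 2"
  proof (rule ccontr)
    assume "i \<noteq> r - 2"
    with i have ir: "i \<le> r - 3" "r \<ge> 3"
      by auto
    then have "ord (b ^ r) (gen b) dvd b ^ (r - 3)"
      unfolding i by (simp add: le_imp_power_dvd)
    then have c: "[gen b ^ (b ^ (r - 3)) = 1] (mod b ^ r)"
      by (simp only: ord_divides)
    obtain u where u: "gen b ^ (b ^ (r - 3)) = 1 + b ^ (r - 3 + 2) * u" "\<not> b dvd u"
      using gen_power_prime_power[OF b] by blast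
    have "[1 + b ^ (r - 3 + 2) * u = 1 + 0] (mod b ^ r)"
      using c unfolding u by simp
    then have "b ^ r dvd b ^ (r - 3 + 2) * u"
      by (simp only: cong_add_lcancel_nat cong_0_iff)
    moreover have "b ^ r = b ^ (r - 3 + 2) * b"
    proof -
      have "r = Suc (r - 3 + 2)"
        using ir by simp
      then show ?thesis
        by (metis power_Suc2)
    qed
    ultimately have "b dvd u"
      using b prime_gt_0_nat[OF b] by simp
    with u(2) show False ..
  qed
  with i show ?thesis
    by simp
qed

lemma card_unit_residues:
  assumes "prime b"
  shows "card (unit_residues (b ^ k)) = (if k = 0 then 1 else b ^ (k - 1) * (b - 1))"
proof (cases "k = 0")
  case True
  have "unit_residues 1 = {0}"
    by (auto simp: unit_residues_def)
  then show ?thesis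
    using True by simp
next
  case False
  have "b ^ k > 1"
    using False prime_gt_1_nat[OF assms] by (intro one_less_power) auto
  have *: "coprime x n \<Longrightarrow> x \<noteq> n \<and> x \<noteq> 0" if "n > 1" for x n :: nat
    using that by (cases "x = 0") auto
  have "unit_residues (b ^ k) = totatives (b ^ k)"
  proof (rule Set.set_eqI)
    fix x
    show "x \<in> unit_residues (b ^ k) \<longleftrightarrow> x \<in> totatives (b ^ k)"
      unfolding unit_residues_def totatives_def using *[OF \<open>b ^ k > 1\<close>, of x] by (cases "coprime x (b ^ k)") auto
  qed
  then show ?thesis
    using totient_prime_power[OF assms, of k] False by (simp add: totient_def)
qed

text \<open>Since \<open>gen b\<close> generates the residues that are 1 modulo
  \<open>b ^ 2\<close>, its cosets are indexed by the units modulo \<open>b ^ 2\<close>, or modulo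
  \<open>b ^ r\<close> if \<open>r < 2\<close>. There are at most \<open>b ^ 2\<close> of them for
  every \<open>r\<close>.\<close>

definition reps :: "nat \<Rightarrow> nat \<Rightarrow> nat set" where
  "reps b r = unit_residues (b ^ min r 2)"

definition cyc :: "nat \<Rightarrow> nat \<Rightarrow> nat" where
  "cyc b r = b ^ (r - 2)"

definition unit_of :: "nat \<Rightarrow> nat \<Rightarrow> nat \<Rightarrow> nat \<Rightarrow> nat" where
  "unit_of b r c i = c * gen b ^ i mod b ^ r"

text \<open>Reduction modulo \<open>b ^ min r 2\<close> sends \<open>gen b\<close> to 1 and so
  recovers \<open>c\<close>; the order of \<open>gen b\<close> then recovers \<open>i\<close>.
  Surjectivity follows by counting.\<close>

lemma bij_betw_unit_of:
  assumes b: "prime b"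
  shows "bij_betw (\<lambda>(c, i). unit_of b r c i) (reps b r \<times> {..<cyc b r}) (unit_residues (b ^ r))"
proof -
  have b0: "b > 0"
    using prime_gt_0_nat[OF b] .
  have dvd_min: "b ^ min r 2 dvd b ^ r"
    by (intro le_imp_power_dvd) simp
  have gen1: "[gen b ^ i = 1] (mod b ^ min r 2)" for i
  proof -
    have "b ^ min r 2 dvd b ^ 2"
      by (intro le_imp_power_dvd) simp
    then have "[gen b = 1] (mod b ^ min r 2)"
      unfolding gen_def by (rule cong_1_add)
    then have "[gen b ^ i = 1 ^ i] (mod b ^ min r 2)"
      by (rule cong_pow)
    then show ?thesis
      by simp
  qed
  have inj: "inj_on (\<lambda>(c, i). unit_of b r c i) (reps b r \<times> {..<cyc b r})"
  proof -
    have key: "c = c' \<and> i = i'"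
      if *: "c \<in> reps b r" "c' \<in> reps b r" "i < cyc b r" "i' < cyc b r" "unit_of b r c i = unit_of b r c' i'" "i \<le> i'" for c c' i i'
    proof -
      have cg: "[c * gen b ^ i = c' * gen b ^ i'] (mod b ^ r)"
        using *(5) by (simp add: unit_of_def cong_def)
      then have "[c * gen b ^ i = c' * gen b ^ i'] (mod b ^ min r 2)"
        using dvd_min cong_dvd_modulus_nat by blast
      moreover have "[c * gen b ^ i = c * 1] (mod b ^ min r 2)" "[c' * gen b ^ i' = c' * 1] (mod b ^ min r 2)"
        by (rule cong_scalar_left[OF gen1])+
      ultimately have "[c = c'] (mod b ^ min r 2)"
        by (metis cong_sym cong_trans mult.right_neutral)
      then have cc: "c = c'"
        using *(1,2) by (auto simp: reps_def unit_residues_def cong_def)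
      have "coprime c (b ^ min r 2)"
        using *(1) by (simp add: reps_def unit_residues_def)
      then have "coprime c (b ^ r)"
        by (cases "r = 0") (auto simp: coprime_power_right_iff)
      then have "coprime (c * gen b ^ i) (b ^ r)"
        unfolding coprime_mult_left_iff coprime_power_left_iff using coprime_gen by blast
      moreover have "[c * gen b ^ i * gen b ^ (i' - i) = c * gen b ^ i * 1] (mod b ^ r)"
        using cg *(6) unfolding cc by (simp add: mult.assoc cong_sym_eq flip: power_add)
      ultimately have "[gen b ^ (i' - i) = 1] (mod b ^ r)"
        by (simp only: cong_mult_lcancel_nat)
      then have "cyc b r dvd i' - i"
        using ord_gen[OF b, of r] by (simp only: ord_divides cyc_def)
      moreover have "i' - i < cyc b r"
        using *(4) by simp
      ultimately have "i' - i = 0"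
        using dvd_imp_le by fastforce
      with *(6) cc show ?thesis
        by simp
    qed
    show ?thesis
    proof (rule inj_onI)
      fix p q
      assume p: "p \<in> reps b r \<times> {..<cyc b r}" and q: "q \<in> reps b r \<times> {..<cyc b r}"
        and eq: "(case p of (c, i) \<Rightarrow> unit_of b r c i) = (case q of (c, i) \<Rightarrow> unit_of b r c i)"
      obtain c i c' i' where pq: "p = (c, i)" "q = (c', i')"
        by (cases p, cases q)
      show "p = q"
      proof (cases "i \<le> i'")
        case True
        then show ?thesis
          using key[of c c' i i'] p q eq by (simp add: pq)
      next
        case False
        then show ?thesis
          using key[of c' c i' i] p q eq by (simp add: pq)
      qed
    qed
  qed
  have "(\<lambda>(c, i). unit_of b r c i) ` (reps b r \<times> {..<cyc b r}) \<subseteq> unit_residues (b ^ r)"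
  proof clarify
    fix c i assume "c \<in> reps b r"
    then have "coprime c (b ^ min r 2)"
      by (simp add: reps_def unit_residues_def)
    then have "coprime c (b ^ r)"
      by (cases "r = 0") (auto simp: coprime_power_right_iff)
    then have "coprime (c * gen b ^ i) (b ^ r)"
      unfolding coprime_mult_left_iff coprime_power_left_iff using coprime_gen by blast
    then have "coprime (c * gen b ^ i mod b ^ r) (b ^ r)"
      using b0 by (subst coprime_mod_left_iff) auto
    then show "unit_of b r c i \<in> unit_residues (b ^ r)"
      unfolding unit_residues_def unit_of_def mem_Collect_eq
      by (intro conjI mod_less_divisor) (use b0 in simp)
  qed
  moreover have "card (reps b r \<times> {..<cyc b r}) = card (unit_residues (b ^ r))"
  proof (cases "r < 2")
    case True
    then show ?thesis
      by (simp add: reps_def cyc_def min_absorb1)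
  next
    case False
    then have "b ^ (r - 1) = b * b ^ (r - 2)"
      by (simp flip: power_Suc add: Suc_diff_Suc numeral_2_eq_2)
    then show ?thesis
      using False by (simp add: reps_def cyc_def card_cartesian_product card_unit_residues[OF b] min_absorb2)
  qed
  ultimately show ?thesis
    using inj card_image[OF inj] by (intro bij_betw_imageI card_subset_eq) auto
qed

lemma unit_of_shift:
  assumes "prime b"
  shows "unit_of b r c i = unit_of b r c (i mod cyc b r)"
proof -
  have "[gen b ^ i = gen b ^ (i mod cyc b r)] (mod b ^ r)"
    using order_divides_expdiff[OF coprime_commute[THEN iffD1, OF coprime_gen[of b r]], of i "i mod cyc b r"] ord_gen[OF assms, of r]
    by (simp add: cyc_def)
  then have "[c * gen b ^ i = c * gen b ^ (i mod cyc b r)] (mod b ^ r)"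
    by (rule cong_scalar_left)
  then show ?thesis
    by (simp add: unit_of_def cong_def)
qed

text \<open>Every column index is \<open>b ^ e * u\<close> with a unit \<open>u\<close> modulo \<open>b ^ (r - e)\<close>.\<close>

lemma sum_over_levels:
  fixes h :: "nat \<Rightarrow> real"
  assumes b: "prime b"
  shows "(\<Sum>k<b ^ r. h k) = (\<Sum>e\<le>r. \<Sum>u\<in>unit_residues (b ^ (r - e)). h (b ^ e * u))"
proof (induction r arbitrary: h)
  case 0
  have "unit_residues 1 = {0}"
    by (auto simp: unit_residues_def)
  then show ?case
    by simp
next
  case (Suc r)
  have b0: "b > 0"
    using prime_gt_0_nat[OF b] .
  have split: "{..<b ^ Suc r} = unit_residues (b ^ Suc r) \<union> (\<lambda>k. b * k) ` {..<b ^ r}"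
  proof (intro equalityI subsetI)
    fix k assume k: "k \<in> {..<b ^ Suc r}"
    show "k \<in> unit_residues (b ^ Suc r) \<union> (\<lambda>k. b * k) ` {..<b ^ r}"
    proof (cases "b dvd k")
      case True
      then obtain l where "k = b * l" ..
      with k b0 show ?thesis
        by auto
    next
      case False
      then have "coprime k b"
        using b by (metis coprime_commute prime_imp_coprime_nat)
      with k show ?thesis
        by (simp add: unit_residues_def coprime_power_right_iff del: power_Suc)
    qed
  qed (use b0 in \<open>auto simp: unit_residues_def\<close>)
  have disj: "unit_residues (b ^ Suc r) \<inter> (\<lambda>k. b * k) ` {..<b ^ r} = {}"
  proof -
    have "\<not> coprime (b * k) (b ^ Suc r)" for k
      using b by (auto simp: coprime_power_right_iff coprime_mult_left_iff not_prime_1 simp del: power_Suc)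
    then show ?thesis
      by (auto simp: unit_residues_def simp del: power_Suc)
  qed
  have "(\<Sum>k<b ^ Suc r. h k) = (\<Sum>k\<in>unit_residues (b ^ Suc r). h k) + (\<Sum>k\<in>(\<lambda>k. b * k) ` {..<b ^ r}. h k)"
    unfolding split using disj by (intro sum.union_disjoint) auto
  also have "(\<Sum>k\<in>(\<lambda>k. b * k) ` {..<b ^ r}. h k) = (\<Sum>k<b ^ r. h (b * k))"
    using b0 by (subst sum.reindex) (auto simp: inj_on_def)
  also have "\<dots> = (\<Sum>e\<le>r. \<Sum>u\<in>unit_residues (b ^ (r - e)). h (b * (b ^ e * u)))"
    by (rule Suc.IH)
  also have "(\<Sum>k\<in>unit_residues (b ^ Suc r). h k) + \<dots> = (\<Sum>e\<le>Suc r. \<Sum>u\<in>unit_residues (b ^ (Suc r - e)). h (b ^ e * u))"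
    by (subst sum.atMost_Suc_shift) (simp add: mult.assoc)
  finally show ?case .
qed

subsection \<open>The fast Fourier transform\<close>

definition dft :: "nat \<Rightarrow> (nat \<Rightarrow> complex) \<Rightarrow> nat \<Rightarrow> complex" where
  "dft L f k = (\<Sum>l<L. f l * unity_root L (int (l * k)))"

text \<open>The reflected index \<open>(L - k) mod L\<close> conjugates the roots of unity, so a
  forward transform read backwards serves as an inverse transform. It is not normalised, hence the
  factor \<open>L\<close>.\<close>

lemma cyclic_correlation:
  assumes L: "L > 0" and i: "i < L"
  shows "dft L (\<lambda>k. dft L (\<lambda>p. of_real (a p)) k * dft L (\<lambda>l. of_real (x l)) ((L - k) mod L)) ((L - i) mod L) =
    of_real (real L * (\<Sum>l<L. a ((i + l) mod L) * x l))"
proof -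
  have neg: "unity_root L (int (l * ((L - k) mod L))) = unity_root L (- int (l * k))" if "k \<le> L" for l k
  proof (rule unity_root_cong[OF L])
    have "int (l * ((L - k) mod L)) mod int L = int (l * (L - k)) mod int L"
      by (simp add: zmod_int mod_mult_right_eq)
    also have "int (l * (L - k)) = int l * int L - int (l * k)"
      using that by (simp add: algebra_simps of_nat_diff)
    also have "\<dots> mod int L = - int (l * k) mod int L"
      by (metis diff_0 mod_diff_left_eq mod_mult_self2_is_0)
    finally show "int (l * ((L - k) mod L)) mod int L = - int (l * k) mod int L" .
  qed
  have "dft L (\<lambda>k. dft L (\<lambda>p. of_real (a p)) k * dft L (\<lambda>l. of_real (x l)) ((L - k) mod L)) ((L - i) mod L) =
     (\<Sum>k<L. (\<Sum>p<L. of_real (a p) * unity_root L (int (p * k))) * (\<Sum>l<L. of_real (x l) * unity_root L (- int (l * k))) * unity_root L (- int (k * i)))"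
    unfolding dft_def
  proof (intro sum.cong refl)
    fix k assume "k \<in> {..<L}"
    then have "k \<le> L" "i \<le> L"
      using i by auto
    then show "(\<Sum>p<L. of_real (a p) * unity_root L (int (p * k))) * (\<Sum>l<L. of_real (x l) * unity_root L (int (l * ((L - k) mod L)))) * unity_root L (int (k * ((L - i) mod L))) =
      (\<Sum>p<L. of_real (a p) * unity_root L (int (p * k))) * (\<Sum>l<L. of_real (x l) * unity_root L (- int (l * k))) * unity_root L (- int (k * i))"
      by (simp only: neg)
  qed
  also have "\<dots> = (\<Sum>k<L. \<Sum>p<L. \<Sum>l<L. of_real (a p * x l) * unity_root L (int k * (int p - int l - int i)))"
  proof (intro sum.cong refl)
    fix k
    have eq: "unity_root L (int k * (int p - int l - int i)) = unity_root L (int (p * k)) * unity_root L (- int (l * k)) * unity_root L (- int (k * i))" for p l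
      unfolding unity_root_add[symmetric] by (simp add: algebra_simps)
    show "(\<Sum>p<L. of_real (a p) * unity_root L (int (p * k))) * (\<Sum>l<L. of_real (x l) * unity_root L (- int (l * k))) * unity_root L (- int (k * i)) =
      (\<Sum>p<L. \<Sum>l<L. of_real (a p * x l) * unity_root L (int k * (int p - int l - int i)))"
    proof -
      have "(\<Sum>p<L. of_real (a p) * unity_root L (int (p * k))) * (\<Sum>l<L. of_real (x l) * unity_root L (- int (l * k))) * unity_root L (- int (k * i)) =
        (\<Sum>p<L. \<Sum>l<L. of_real (a p) * unity_root L (int (p * k)) * (of_real (x l) * unity_root L (- int (l * k))) * unity_root L (- int (k * i)))"
        by (subst sum_product) (simp only: sum_distrib_right)
      then show ?thesis
        by (simp only: eq of_real_mult mult_ac)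
    qed
  qed
  also have "\<dots> = (\<Sum>l<L. \<Sum>p<L. of_real (a p * x l) * (\<Sum>k<L. unity_root L (int k * (int p - int l - int i))))"
    unfolding sum_distrib_left by (subst sum.swap, subst (2) sum.swap, subst sum.swap) (rule refl)
  also have "\<dots> = (\<Sum>l<L. of_real (real L * (a ((i + l) mod L) * x l)))"
  proof (intro sum.cong refl)
    fix l
    have iff: "int L dvd int p - int l - int i \<longleftrightarrow> p = (i + l) mod L" if "p < L" for p
    proof -
      have "int L dvd int p - int l - int i \<longleftrightarrow> int p mod int L = (int i + int l) mod int L"
        by (simp add: mod_eq_dvd_iff algebra_simps)
      also have "\<dots> \<longleftrightarrow> int (p mod L) = int ((i + l) mod L)"
        by (simp add: zmod_int)
      finally show ?thesis
        using that by simp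
    qed
    have "(\<Sum>p<L. of_real (a p * x l) * (\<Sum>k<L. unity_root L (int k * (int p - int l - int i)))) =
      (\<Sum>p<L. if p = (i + l) mod L then of_real (real L * (a p * x l)) else (0 :: complex))"
      unfolding sum_unity_root[OF L] using iff by (intro sum.cong refl) auto
    then show "(\<Sum>p<L. of_real (a p * x l) * (\<Sum>k<L. unity_root L (int k * (int p - int l - int i)))) =
      complex_of_real (real L * (a ((i + l) mod L) * x l))"
      using L by simp
  qed
  also have "\<dots> = of_real (real L * (\<Sum>l<L. a ((i + l) mod L) * x l))"
    by (simp add: sum_distrib_left)
  finally show ?thesis .
qed

lemma sum_lessThan_add: "(\<Sum>k<x + y. h k) = (\<Sum>k<x. h k) + (\<Sum>k<y. h (x + k :: nat) :: 'a :: comm_monoid_add)"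
  by (induction y) (simp_all add: add.assoc)

lemma sum_digits: "(\<Sum>a<b * m. h a) = (\<Sum>a<m. \<Sum>c<b. h (c + b * a :: nat) :: 'a :: comm_monoid_add)"
proof (induction m)
  case (Suc m)
  have "b * Suc m = b * m + b"
    by simp
  then have "(\<Sum>a<b * Suc m. h a) = (\<Sum>a<b * m. h a) + (\<Sum>c<b. h (b * m + c))"
    by (simp only: sum_lessThan_add)
  then show ?case
    using Suc by (simp add: add.commute)
qed simp

text \<open>After \<open>s\<close> stages the entry \<open>k * b ^ (t - s) + p\<close> is the \<open>k\<close>-th Fourier coefficient of the
  subsequence of the input with indices congruent to \<open>p\<close> modulo \<open>b ^ (t - s)\<close>.\<close>
definition fft_stage :: "nat \<Rightarrow> nat \<Rightarrow> (nat \<Rightarrow> complex) \<Rightarrow> nat \<Rightarrow> nat \<Rightarrow> complex" where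
  "fft_stage b t f s i = (\<Sum>a<b ^ s. f (i mod b ^ (t - s) + b ^ (t - s) * a) * unity_root (b ^ s) (int (a * (i div b ^ (t - s)))))"

text \<open>The position, in stage \<open>s\<close>, of the \<open>c\<close>-th of the
  \<open>b\<close> entries that are combined into entry \<open>i\<close> of stage
  \<open>Suc s\<close>. The index of the Fourier coefficient is reduced modulo \<open>b ^ s\<close>,
  its period in stage \<open>s\<close>.\<close>

definition butterfly :: "nat \<Rightarrow> nat \<Rightarrow> nat \<Rightarrow> nat \<Rightarrow> nat \<Rightarrow> nat" where
  "butterfly b t s i c = (i div b ^ (t - Suc s)) mod b ^ s * b ^ (t - s) + (i mod b ^ (t - Suc s) + b ^ (t - Suc s) * c)"

lemma butterfly_digits:
  assumes "b > 0" "s < t" "c < b"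
  shows "butterfly b t s i c mod b ^ (t - s) = i mod b ^ (t - Suc s) + b ^ (t - Suc s) * c"
    and "butterfly b t s i c div b ^ (t - s) = (i div b ^ (t - Suc s)) mod b ^ s"
    and "butterfly b t s i c < b ^ t"
proof -
  let ?B = "b ^ (t - Suc s)"
  have B: "b ^ (t - s) = ?B * b"
    using assms by (simp flip: power_Suc2 add: Suc_diff_Suc)
  have "i mod ?B < ?B"
    using assms by simp
  then have "i mod ?B + ?B * c < ?B * (c + 1)"
    by simp
  also have "\<dots> \<le> ?B * b"
    using assms by (intro mult_le_mono2) simp
  finally have lt: "i mod ?B + ?B * c < b ^ (t - s)"
    unfolding B .
  have gen: "(q * n + p) mod n = p" "(q * n + p) div n = q" if "p < n" for p q n :: nat
    using that by auto
  show "butterfly b t s i c mod b ^ (t - s) = i mod ?B + ?B * c"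
    "butterfly b t s i c div b ^ (t - s) = (i div ?B) mod b ^ s"
    unfolding butterfly_def using gen[OF lt] by auto
  have "(i div ?B) mod b ^ s + 1 \<le> b ^ s"
    using assms by (simp add: Suc_le_eq)
  then have "((i div ?B) mod b ^ s + 1) * b ^ (t - s) \<le> b ^ s * b ^ (t - s)"
    by (rule mult_le_mono1)
  also have "b ^ s * b ^ (t - s) = b ^ t"
    using assms by (simp flip: power_add)
  finally show "butterfly b t s i c < b ^ t"
    unfolding butterfly_def using lt by simp
qed

text \<open>Writing the summation index as \<open>c + b * a\<close> splits the sum into
  \<open>b\<close> transforms of length \<open>b ^ s\<close>. The digit \<open>c\<close> contributes
  the twiddle factor, and the inner transforms depend on the coefficient index modulo
  \<open>b ^ s\<close> only.\<close>

lemma fft_stage_Suc: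
  assumes b: "b > 0" and s: "s < t"
  shows "fft_stage b t f (Suc s) i =
    (\<Sum>c<b. unity_root (b ^ Suc s) (int (c * (i div b ^ (t - Suc s)))) * fft_stage b t f s (butterfly b t s i c))"
proof -
  let ?B = "b ^ (t - Suc s)" and ?k = "i div b ^ (t - Suc s)" and ?p = "i mod b ^ (t - Suc s)"
  have B: "b ^ (t - s) = ?B * b"
    using s by (simp flip: power_Suc2 add: Suc_diff_Suc)
  have summand: "f (?p + ?B * (c + b * a)) * unity_root (b ^ Suc s) (int ((c + b * a) * ?k)) =
      unity_root (b ^ Suc s) (int (c * ?k)) * (f (butterfly b t s i c mod b ^ (t - s) + b ^ (t - s) * a) *
        unity_root (b ^ s) (int (a * (butterfly b t s i c div b ^ (t - s)))))" if "c < b" for a c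
  proof -
    have "unity_root (b ^ s) (int (a * (?k mod b ^ s))) = unity_root (b ^ s) (int (a * ?k))"
      using b by (intro unity_root_cong) (simp, simp only: zmod_int[symmetric] mod_mult_right_eq)
    also have "\<dots> = unity_root (b ^ Suc s) (int (b * a * ?k))"
      using b by (simp add: unity_root_def mult.assoc)
    finally have "unity_root (b ^ Suc s) (int ((c + b * a) * ?k)) = unity_root (b ^ Suc s) (int (c * ?k)) * unity_root (b ^ s) (int (a * (?k mod b ^ s)))"
      by (simp add: distrib_right unity_root_add[symmetric])
    moreover have "?p + ?B * (c + b * a) = butterfly b t s i c mod b ^ (t - s) + b ^ (t - s) * a"
      by (simp only: butterfly_digits(1)[OF b s that], simp only: B, simp add: algebra_simps)
    ultimately show ?thesis
      unfolding butterfly_digits(2)[OF b s that] by (simp only: mult_ac)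
  qed
  have "fft_stage b t f (Suc s) i = (\<Sum>a<b * b ^ s. f (?p + ?B * a) * unity_root (b ^ Suc s) (int (a * ?k)))"
    by (simp add: fft_stage_def)
  also have "\<dots> = (\<Sum>a<b ^ s. \<Sum>c<b. f (?p + ?B * (c + b * a)) * unity_root (b ^ Suc s) (int ((c + b * a) * ?k)))"
    by (rule sum_digits)
  also have "\<dots> = (\<Sum>c<b. \<Sum>a<b ^ s. f (?p + ?B * (c + b * a)) * unity_root (b ^ Suc s) (int ((c + b * a) * ?k)))"
    by (rule sum.swap)
  also have "\<dots> = (\<Sum>c<b. unity_root (b ^ Suc s) (int (c * ?k)) * fft_stage b t f s (butterfly b t s i c))"
    unfolding fft_stage_def sum_distrib_left by (intro sum.cong refl summand) simp
  finally show ?thesis .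
qed

lemma fft_stage_0: "i < b ^ t \<Longrightarrow> fft_stage b t f 0 i = f i"
  by (simp add: fft_stage_def)

lemma fft_stage_last: "fft_stage b t f t i = dft (b ^ t) f i"
  by (simp add: fft_stage_def dft_def)

subsection \<open>Programs for Fourier transforms and correlations\<close>

text \<open>Arrays 3 to 6 hold the real and imaginary parts of two buffers, 7 and 8 a saved transform.\<close>

definition copy :: "nat \<Rightarrow> nat \<Rightarrow> nat \<Rightarrow> assignment list" where
  "copy A B L = store A L (Reg_E B)"

definition fft_layer :: "nat \<Rightarrow> nat \<Rightarrow> nat \<Rightarrow> assignment list" where
  "fft_layer b t s =
     (let x = (\<lambda>i c. butterfly b t s i c); r = (\<lambda>i c. c * (i div b ^ (t - Suc s))); n = b ^ Suc s; L = b ^ t in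
      store 5 L (\<lambda>i. sum_E b (\<lambda>c. Minus_E (Times_E (Cos_E (r i c) n) (Reg_E 3 (x i c))) (Times_E (Sin_E (r i c) n) (Reg_E 4 (x i c))))) @
      store 6 L (\<lambda>i. sum_E b (\<lambda>c. Plus_E (Times_E (Cos_E (r i c) n) (Reg_E 4 (x i c))) (Times_E (Sin_E (r i c) n) (Reg_E 3 (x i c))))) @
      copy 3 5 L @ copy 4 6 L)"

definition fft :: "nat \<Rightarrow> nat \<Rightarrow> assignment list" where
  "fft b t = concat (map (fft_layer b t) [0..<t])"

definition correlate :: "nat \<Rightarrow> nat \<Rightarrow> (nat \<Rightarrow> expr) \<Rightarrow> (nat \<Rightarrow> expr) \<Rightarrow> assignment list" where
  "correlate b t ea ex =
     (let L = b ^ t; k' = (\<lambda>k. (L - k) mod L) in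
      store 3 L ea @ store 4 L (\<lambda>_. Const_E 0) @ fft b t @ copy 7 3 L @ copy 8 4 L @
      store 3 L ex @ store 4 L (\<lambda>_. Const_E 0) @ fft b t @
      store 5 L (\<lambda>k. Minus_E (Times_E (Reg_E 7 k) (Reg_E 3 (k' k))) (Times_E (Reg_E 8 k) (Reg_E 4 (k' k)))) @
      store 6 L (\<lambda>k. Plus_E (Times_E (Reg_E 7 k) (Reg_E 4 (k' k))) (Times_E (Reg_E 8 k) (Reg_E 3 (k' k)))) @
      copy 3 5 L @ copy 4 6 L @ fft b t)"

definition holds :: "(nat \<Rightarrow> nat \<Rightarrow> real) \<Rightarrow> nat \<Rightarrow> nat \<Rightarrow> nat \<Rightarrow> (nat \<Rightarrow> complex) \<Rightarrow> bool" where
  "holds M A B L F \<longleftrightarrow> (\<forall>i<L. M A i = Re (F i) \<and> M B i = Im (F i))"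

lemma Re_unity_root: "Re (unity_root n (int k)) = cos (2 * pi * real k / real n)"
  and Im_unity_root: "Im (unity_root n (int k)) = sin (2 * pi * real k / real n)"
  by (simp_all add: unity_root_def)

lemma assign_copy: "A \<noteq> B \<Longrightarrow> assign \<Gamma> \<gamma> M (copy A B L) = M(A := \<lambda>k. if k < L then M B k else M A k)"
  unfolding copy_def by (subst assign_store) (simp_all cong: if_cong)

lemma fft_layer_correct:
  assumes b: "b > 0" and s: "s < t" and M: "holds M 3 4 (b ^ t) (fft_stage b t f s)"
  shows "holds (assign \<Gamma> \<gamma> M (fft_layer b t s)) 3 4 (b ^ t) (fft_stage b t f (Suc s))"
    and "A \<notin> {3, 4, 5, 6} \<Longrightarrow> assign \<Gamma> \<gamma> M (fft_layer b t s) A = M A"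
proof -
  let ?L = "b ^ t" and ?x = "butterfly b t s" and ?r = "\<lambda>i c. c * (i div b ^ (t - Suc s))"
  let ?M' = "assign \<Gamma> \<gamma> M (fft_layer b t s)"
  have M': "?M' 3 = (\<lambda>i. if i < ?L then \<Sum>c<b. cos (2 * pi * real (?r i c) / real (b ^ Suc s)) * M 3 (?x i c) - sin (2 * pi * real (?r i c) / real (b ^ Suc s)) * M 4 (?x i c) else M 3 i)"
    "?M' 4 = (\<lambda>i. if i < ?L then \<Sum>c<b. cos (2 * pi * real (?r i c) / real (b ^ Suc s)) * M 4 (?x i c) + sin (2 * pi * real (?r i c) / real (b ^ Suc s)) * M 3 (?x i c) else M 4 i)"
    unfolding fft_layer_def Let_def by (simp_all add: assign_store assign_copy fun_eq_iff)
  show "holds ?M' 3 4 ?L (fft_stage b t f (Suc s))"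
    unfolding holds_def
  proof (intro allI impI)
    fix i assume i: "i < ?L"
    have x: "M 3 (?x i c) = Re (fft_stage b t f s (?x i c))" "M 4 (?x i c) = Im (fft_stage b t f s (?x i c))" if "c < b" for c
      using M butterfly_digits(3)[OF b s that] by (auto simp: holds_def)
    show "?M' 3 i = Re (fft_stage b t f (Suc s) i) \<and> ?M' 4 i = Im (fft_stage b t f (Suc s) i)"
      unfolding M' fft_stage_Suc[OF b s] using i
      by (simp add: x Re_unity_root Im_unity_root del: power_Suc of_nat_mult of_nat_power)
  qed
  show "A \<notin> {3, 4, 5, 6} \<Longrightarrow> ?M' A = M A"
    unfolding fft_layer_def Let_def by (simp add: assign_store assign_copy)
qed

lemma fft_correct:
  assumes b: "b > 0" and M: "holds M 3 4 (b ^ t) f"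
  shows "holds (assign \<Gamma> \<gamma> M (fft b t)) 3 4 (b ^ t) (dft (b ^ t) f)"
    and "A \<notin> {3, 4, 5, 6} \<Longrightarrow> assign \<Gamma> \<gamma> M (fft b t) A = M A"
proof -
  have "holds (assign \<Gamma> \<gamma> M (concat (map (fft_layer b t) [0..<s]))) 3 4 (b ^ t) (fft_stage b t f s) \<and>
      (\<forall>A. A \<notin> {3, 4, 5, 6} \<longrightarrow> assign \<Gamma> \<gamma> M (concat (map (fft_layer b t) [0..<s])) A = M A)" if "s \<le> t" for s
    using that
  proof (induction s)
    case 0
    then show ?case
      using M by (simp add: holds_def fft_stage_0)
  next
    case (Suc s)
    let ?M = "assign \<Gamma> \<gamma> M (concat (map (fft_layer b t) [0..<s]))"
    have IH: "holds ?M 3 4 (b ^ t) (fft_stage b t f s)" "\<And>A. A \<notin> {3, 4, 5, 6} \<Longrightarrow> ?M A = M A"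
      using Suc by auto
    have "s < t"
      using Suc.prems by simp
    note layer = fft_layer_correct[OF b this IH(1), where \<Gamma> = \<Gamma> and \<gamma> = \<gamma>]
    have "assign \<Gamma> \<gamma> M (concat (map (fft_layer b t) [0..<Suc s])) = assign \<Gamma> \<gamma> ?M (fft_layer b t s)"
      by simp
    then show ?case
      using layer(1) layer(2) IH(2) by (simp del: upt_Suc)
  qed
  from this[of t] show "holds (assign \<Gamma> \<gamma> M (fft b t)) 3 4 (b ^ t) (dft (b ^ t) f)"
    "A \<notin> {3, 4, 5, 6} \<Longrightarrow> assign \<Gamma> \<gamma> M (fft b t) A = M A"
    unfolding fft_def by (auto simp: holds_def fft_stage_last)
qed

lemma store_real_part:
  assumes "\<And>i. expr_reads (e i) \<inter> {3..8} \<times> UNIV = {}"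
  shows "holds (assign \<Gamma> \<gamma> M (store 3 L e @ store 4 L (\<lambda>_. Const_E 0))) 3 4 L (\<lambda>i. of_real (expr_val \<Gamma> \<gamma> M (e i)))"
    and "A \<notin> {3, 4} \<Longrightarrow> assign \<Gamma> \<gamma> M (store 3 L e @ store 4 L (\<lambda>_. Const_E 0)) A = M A"
proof -
  have "(3, k) \<notin> expr_reads (e i)" for i k
    using assms[of i] by auto
  then show "holds (assign \<Gamma> \<gamma> M (store 3 L e @ store 4 L (\<lambda>_. Const_E 0))) 3 4 L (\<lambda>i. of_real (expr_val \<Gamma> \<gamma> M (e i)))"
    "A \<notin> {3, 4} \<Longrightarrow> assign \<Gamma> \<gamma> M (store 3 L e @ store 4 L (\<lambda>_. Const_E 0)) A = M A"
    by (simp_all add: assign_store holds_def)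
qed

lemma correlate_correct:
  assumes b: "b > 0" and ea: "\<And>i. expr_reads (ea i) \<inter> {3..8} \<times> UNIV = {}" and ex: "\<And>i. expr_reads (ex i) \<inter> {3..8} \<times> UNIV = {}"
  shows "i < b ^ t \<Longrightarrow> assign \<Gamma> \<gamma> M (correlate b t ea ex) 3 ((b ^ t - i) mod b ^ t) =
      real (b ^ t) * (\<Sum>l<b ^ t. expr_val \<Gamma> \<gamma> M (ea ((i + l) mod b ^ t)) * expr_val \<Gamma> \<gamma> M (ex l))"
    and "A \<notin> {3..8} \<Longrightarrow> assign \<Gamma> \<gamma> M (correlate b t ea ex) A = M A"
proof -
  let ?L = "b ^ t"
  let ?k' = "\<lambda>k. (?L - k) mod ?L"
  let ?a = "\<lambda>i. expr_val \<Gamma> \<gamma> M (ea i)" and ?y = "\<lambda>i. expr_val \<Gamma> \<gamma> M (ex i)"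
  have L: "?L > 0"
    using b by simp
  define M1 where "M1 = assign \<Gamma> \<gamma> M (store 3 ?L ea @ store 4 ?L (\<lambda>_. Const_E 0))"
  define M2 where "M2 = assign \<Gamma> \<gamma> M1 (fft b t)"
  define M3 where "M3 = assign \<Gamma> \<gamma> M2 (copy 7 3 ?L @ copy 8 4 ?L)"
  define M4 where "M4 = assign \<Gamma> \<gamma> M3 (store 3 ?L ex @ store 4 ?L (\<lambda>_. Const_E 0))"
  define M5 where "M5 = assign \<Gamma> \<gamma> M4 (fft b t)"
  define M6 where "M6 = assign \<Gamma> \<gamma> M5
     (store 5 ?L (\<lambda>k. Minus_E (Times_E (Reg_E 7 k) (Reg_E 3 (?k' k))) (Times_E (Reg_E 8 k) (Reg_E 4 (?k' k)))) @
      store 6 ?L (\<lambda>k. Plus_E (Times_E (Reg_E 7 k) (Reg_E 4 (?k' k))) (Times_E (Reg_E 8 k) (Reg_E 3 (?k' k)))) @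
      copy 3 5 ?L @ copy 4 6 ?L)"
  have M7: "assign \<Gamma> \<gamma> M (correlate b t ea ex) = assign \<Gamma> \<gamma> M6 (fft b t)"
    by (simp add: correlate_def Let_def M6_def M5_def M4_def M3_def M2_def M1_def)
  have h1: "holds M1 3 4 ?L (\<lambda>i. of_real (?a i))" "\<And>A. A \<notin> {3, 4} \<Longrightarrow> M1 A = M A"
    unfolding M1_def using store_real_part[where e = ea and M = M and L = ?L and \<Gamma> = \<Gamma> and \<gamma> = \<gamma>, OF ea] by auto
  have h2: "holds M2 3 4 ?L (dft ?L (\<lambda>i. of_real (?a i)))" "\<And>A. A \<notin> {3, 4, 5, 6} \<Longrightarrow> M2 A = M A"
    unfolding M2_def using fft_correct[OF b h1(1)] h1(2) by auto
  have h3: "holds M3 7 8 ?L (dft ?L (\<lambda>i. of_real (?a i)))" "\<And>A. A \<notin> {3, 4, 5, 6, 7, 8} \<Longrightarrow> M3 A = M A"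
    unfolding M3_def using h2 by (auto simp: assign_copy holds_def)
  have ex_val: "expr_val \<Gamma> \<gamma> M3 (ex i) = ?y i" for i
  proof (rule expr_val_cong)
    fix A k assume "(A, k) \<in> expr_reads (ex i)"
    then have "A \<notin> {3..8}"
      using ex[of i] by auto
    then have "A \<notin> {3, 4, 5, 6, 7, 8}"
      by auto
    then show "M3 A k = M A k"
      using h3(2) by simp
  qed
  have h4: "holds M4 3 4 ?L (\<lambda>i. of_real (?y i))" "\<And>A. A \<notin> {3, 4} \<Longrightarrow> M4 A = M3 A"
    unfolding M4_def using store_real_part[where e = ex and M = M3 and L = ?L and \<Gamma> = \<Gamma> and \<gamma> = \<gamma>, OF ex] by (simp_all add: ex_val)
  have h5: "holds M5 3 4 ?L (dft ?L (\<lambda>i. of_real (?y i)))" "\<And>A. A \<notin> {3, 4, 5, 6} \<Longrightarrow> M5 A = M3 A"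
    unfolding M5_def using fft_correct[OF b h4(1)] h4(2) by auto
  have h5': "holds M5 7 8 ?L (dft ?L (\<lambda>i. of_real (?a i)))"
    using h3(1) h5(2) by (simp add: holds_def)
  have h6: "holds M6 3 4 ?L (\<lambda>k. dft ?L (\<lambda>i. of_real (?a i)) k * dft ?L (\<lambda>i. of_real (?y i)) (?k' k))"
    unfolding M6_def using h5(1) h5' L by (auto simp: assign_store assign_copy holds_def)
  have h6': "M6 A = M5 A" if "A \<notin> {3, 4, 5, 6}" for A
    unfolding M6_def using that by (simp add: assign_store assign_copy)
  show "assign \<Gamma> \<gamma> M (correlate b t ea ex) 3 (?k' i) = real ?L * (\<Sum>l<?L. ?a ((i + l) mod ?L) * ?y l)" if "i < ?L"
  proof -
    have "assign \<Gamma> \<gamma> M (correlate b t ea ex) 3 (?k' i) =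
      Re (dft ?L (\<lambda>k. dft ?L (\<lambda>i. of_real (?a i)) k * dft ?L (\<lambda>i. of_real (?y i)) (?k' k)) (?k' i))"
      unfolding M7 using fft_correct(1)[OF b h6, of \<Gamma> \<gamma>] L by (simp add: holds_def)
    then show ?thesis
      unfolding cyclic_correlation[OF L that] by simp
  qed
  show "assign \<Gamma> \<gamma> M (correlate b t ea ex) A = M A" if "A \<notin> {3..8}"
  proof -
    have A: "A \<notin> {3, 4, 5, 6, 7, 8}" "A \<notin> {3, 4, 5, 6}"
      using that by auto
    show ?thesis
      unfolding M7 using fft_correct(2)[OF b h6 A(2)] h6'[OF A(2)] h5(2)[OF A(2)] h3(2)[OF A(1)] by simp
  qed
qed

lemma confined_store:
  assumes "\<And>k. k < L \<Longrightarrow> (A, k) \<in> S \<and> expr_reads (f k) \<subseteq> S \<and> expr_depth (f k) \<le> 10"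
  shows "confined S (store A L f)"
  using assms by (auto simp: confined_def set_store)

lemma confined_copy:
  assumes "\<And>k. k < L \<Longrightarrow> (A, k) \<in> S \<and> (B, k) \<in> S"
  shows "confined S (copy A B L)"
  unfolding copy_def using assms by (intro confined_store) auto

lemma confined_fft_layer:
  assumes "b > 0" "s < t" "{3..6} \<times> {..<b ^ t} \<subseteq> S"
  shows "confined S (fft_layer b t s)"
proof -
  have S: "(A, k) \<in> S" if "A \<in> {3..6}" "k < b ^ t" for A k
    using assms(3) that by auto
  have x: "butterfly b t s i c < b ^ t" if "c < b" for i c
    using butterfly_digits(3)[OF assms(1,2) that] .
  have d: "expr_depth (sum_E b f) \<le> 10" if "\<And>c. c < b \<Longrightarrow> expr_depth (f c) \<le> 9" for f
    using expr_depth_sum_E[of b f 9] that by simp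
  show ?thesis
    unfolding fft_layer_def Let_def confined_append
    by (intro conjI confined_store confined_copy d) (auto intro!: S x)
qed

lemma confined_fft:
  assumes "b > 0" "{3..6} \<times> {..<b ^ t} \<subseteq> S"
  shows "confined S (fft b t)"
  unfolding fft_def confined_concat using assms by (auto intro: confined_fft_layer)

lemma confined_correlate:
  assumes b: "b > 0" and S: "{3..8} \<times> {..<b ^ t} \<subseteq> S"
    and ea: "\<And>i. i < b ^ t \<Longrightarrow> expr_reads (ea i) \<subseteq> S \<and> expr_depth (ea i) \<le> 10"
    and ex: "\<And>i. i < b ^ t \<Longrightarrow> expr_reads (ex i) \<subseteq> S \<and> expr_depth (ex i) \<le> 10"
  shows "confined S (correlate b t ea ex)"
proof -
  have S': "(A, k) \<in> S" if "A \<in> {3..8}" "k < b ^ t" for A k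
    using S that by auto
  have "{3..6} \<times> {..<b ^ t} \<subseteq> S"
    using S' by auto
  then have fft: "confined S (fft b t)"
    by (rule confined_fft[OF b])
  have L: "(b ^ t - k) mod b ^ t < b ^ t" for k
    using b by simp
  show ?thesis
    unfolding correlate_def Let_def confined_append
    by (intro conjI fft confined_store confined_copy) (use ea ex in \<open>auto intro!: S' L\<close>)
qed

lemma cost_store_le:
  assumes "\<And>k. k < L \<Longrightarrow> expr_cost (f k) \<le> c"
  shows "cost (store A L f) \<le> L * (c + 2)"
  using cost_map_le[of "[0..<L]" "\<lambda>k. (A, k, f k)" c] assms by (simp add: store_def)

lemma cost_fft_layer: "cost (fft_layer b t s) \<le> b ^ t * (20 * b + 14)"
proof -
  let ?L = "b ^ t"
  have sum: "expr_cost (sum_E b f) \<le> 10 * b + 1" if "\<And>c. expr_cost (f c) \<le> 9" for f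
    using expr_cost_sum_E[of b f 9] that by simp
  have c: "cost (copy A B ?L) \<le> ?L * 4" for A B
    unfolding copy_def using cost_store_le[of ?L "Reg_E B" 2 A] by simp
  have s: "cost (store A ?L f) \<le> ?L * (10 * b + 1 + 2)" if "\<And>k. expr_cost (f k) \<le> 10 * b + 1" for A f
    using that by (intro cost_store_le) simp
  have "cost (fft_layer b t s) \<le> ?L * (10 * b + 1 + 2) + (?L * (10 * b + 1 + 2) + (?L * 4 + ?L * 4))"
    unfolding fft_layer_def Let_def cost_append
    by (intro add_mono c s sum) auto
  also have "\<dots> = ?L * (20 * b + 14)"
    by (simp add: algebra_simps)
  finally show ?thesis .
qed

lemma cost_fft: "cost (fft b t) \<le> t * (b ^ t * (20 * b + 14))"
  unfolding fft_def using cost_concat_map_le[of "[0..<t]" "fft_layer b t" "b ^ t * (20 * b + 14)"] cost_fft_layer by simp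

lemma cost_correlate:
  assumes "\<And>i. expr_cost (ea i) \<le> 2" "\<And>i. expr_cost (ex i) \<le> 2"
  shows "cost (correlate b t ea ex) \<le> (t + 1) * (b ^ t * (60 * b + 80))"
proof -
  let ?L = "b ^ t"
  have c: "cost (copy A B ?L) \<le> ?L * 4" for A B
    unfolding copy_def using cost_store_le[of ?L "Reg_E B" 2 A] by simp
  have s: "cost (store A ?L f) \<le> ?L * 4" if "\<And>k. expr_cost (f k) \<le> 2" for A f
    using cost_store_le[of ?L f 2 A] that by simp
  have s': "cost (store A ?L f) \<le> ?L * 13" if "\<And>k. expr_cost (f k) \<le> 11" for A f
    using cost_store_le[of ?L f 11 A] that by simp
  have "cost (correlate b t ea ex) \<le> ?L * 4 + (?L * 4 + (t * (?L * (20 * b + 14)) + (?L * 4 + (?L * 4 +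
     (?L * 4 + (?L * 4 + (t * (?L * (20 * b + 14)) + (?L * 13 + (?L * 13 + (?L * 4 + (?L * 4 + t * (?L * (20 * b + 14)))))))))))))"
    unfolding correlate_def Let_def cost_append
    by (intro add_mono c s s' cost_fft assms) auto
  also have "\<dots> = t * (?L * (60 * b + 42)) + ?L * 58"
    by (simp add: algebra_simps)
  also have "\<dots> \<le> t * (?L * (60 * b + 80)) + ?L * (60 * b + 80)"
    by (intro add_mono mult_le_mono) auto
  also have "\<dots> = (t + 1) * (?L * (60 * b + 80))"
    by simp
  finally show ?thesis .
qed

subsection \<open>Fast multiplication by the matrix\<close>

text \<open>Undoes the reflection and the factor \<open>L\<close> of the correlation. Column indices
  of the level carry the factor \<open>b ^ e\<close>, so the row \<open>y\<close> matters only
  modulo \<open>b ^ (r - e)\<close>, and each value is added to all \<open>b ^ e\<close> rows of its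
  class.\<close>

definition level_tail :: "nat \<Rightarrow> nat \<Rightarrow> nat \<Rightarrow> nat \<Rightarrow> assignment list" where
  "level_tail b r e c =
     (let n' = b ^ (r - e); L = cyc b (r - e) in
      map (\<lambda>p. (2, unit_of b (r - e) c (fst p) + n' * snd p,
             Plus_E (Reg_E 2 (unit_of b (r - e) c (fst p) + n' * snd p))
               (Over_E (Reg_E 3 ((L - fst p) mod L)) (Const_E (int L)))))
        (List.product [0..<L] [0..<b ^ e]))"

text \<open>With discrete logarithms \<open>i\<close> of the row and \<open>l\<close> of the column,
  the matrix entry depends on \<open>c * d\<close> and on \<open>i + l\<close> only.\<close>

definition level :: "nat \<Rightarrow> nat \<Rightarrow> nat \<Rightarrow> nat \<Rightarrow> nat \<Rightarrow> assignment list" where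
  "level b r e c d =
     correlate b (r - e - 2) (\<lambda>i. Omega_E (unit_of b (r - e) (c * d) i) (b ^ (r - e))) (\<lambda>l. Reg_E 1 (b ^ e * unit_of b (r - e) d l)) @
     level_tail b r e c"

definition level_indices :: "nat \<Rightarrow> nat \<Rightarrow> (nat \<times> nat \<times> nat) list" where
  "level_indices b r = concat (map (\<lambda>e. concat (map (\<lambda>c. map (\<lambda>d. (e, c, d)) (sorted_list_of_set (reps b (r - e))))
     (sorted_list_of_set (reps b (r - e))))) [0..<Suc r])"

definition fast_multiply :: "nat \<Rightarrow> nat \<Rightarrow> assignment list" where
  "fast_multiply b r = store 2 (b ^ r) (\<lambda>_. Const_E 0) @
     concat (map (\<lambda>p. level b r (fst p) (fst (snd p)) (snd (snd p))) (level_indices b r))"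

lemma finite_reps [simp]: "finite (reps b r)"
  by (simp add: reps_def unit_residues_def)

lemma sum_list_level_indices:
  "(\<Sum>p\<leftarrow>level_indices b r. h p) = (\<Sum>e\<le>r. \<Sum>c\<in>reps b (r - e). \<Sum>d\<in>reps b (r - e). h (e, c, d) :: 'a :: comm_monoid_add)"
proof -
  have concat: "(\<Sum>p\<leftarrow>concat (map g xs). h p) = (\<Sum>x\<leftarrow>xs. \<Sum>p\<leftarrow>g x. h p)" for g :: "nat \<Rightarrow> (nat \<times> nat \<times> nat) list" and xs
    by (induction xs) simp_all
  have sorted: "(\<Sum>x\<leftarrow>sorted_list_of_set A. k x) = (\<Sum>x\<in>A. k x)" if "finite A" for A :: "nat set" and k :: "nat \<Rightarrow> 'a"
    using that sum_list_distinct_conv_sum_set[of "sorted_list_of_set A" k] by simp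
  have "(\<Sum>p\<leftarrow>level_indices b r. h p) = (\<Sum>e\<leftarrow>[0..<Suc r]. \<Sum>c\<in>reps b (r - e). \<Sum>d\<in>reps b (r - e). h (e, c, d))"
    unfolding level_indices_def concat by (simp add: sorted concat o_def del: upt_Suc)
  also have "\<dots> = (\<Sum>e\<in>{..r}. \<Sum>c\<in>reps b (r - e). \<Sum>d\<in>reps b (r - e). h (e, c, d))"
    by (simp add: interv_sum_list_conv_sum_set_nat atLeast0LessThan lessThan_Suc_atMost del: upt_Suc)
  finally show ?thesis .
qed

lemma set_level_indices:
  "(e, c, d) \<in> set (level_indices b r) \<Longrightarrow> e \<le> r \<and> c \<in> reps b (r - e) \<and> d \<in> reps b (r - e)"
  by (auto simp: level_indices_def)

lemma level_correct:
  assumes b: "prime b" and e: "e \<le> r"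
  shows "y < b ^ r \<Longrightarrow> assign \<Gamma> \<gamma> M (level b r e c d) 2 y = M 2 y +
      (\<Sum>i<cyc b (r - e). if unit_of b (r - e) c i = y mod b ^ (r - e) then
        \<Sum>l<cyc b (r - e). omega_matrix (b ^ (r - e)) (unit_of b (r - e) c i) (unit_of b (r - e) d l) * M 1 (b ^ e * unit_of b (r - e) d l) else 0)"
    and "A \<notin> {2..8} \<Longrightarrow> assign \<Gamma> \<gamma> M (level b r e c d) A = M A"
proof -
  let ?n' = "b ^ (r - e)" and ?L = "cyc b (r - e)" and ?u = "unit_of b (r - e)"
  let ?ea = "\<lambda>i. Omega_E (?u (c * d) i) ?n'" and ?ex = "\<lambda>l. Reg_E 1 (b ^ e * ?u d l)"
  define M1 where "M1 = assign \<Gamma> \<gamma> M (correlate b (r - e - 2) ?ea ?ex)"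
  have b0: "b > 0"
    using prime_gt_0_nat[OF b] .
  have L: "b ^ (r - e - 2) = ?L" and L0: "?L > 0"
    using b0 by (simp_all add: cyc_def)
  have dis: "expr_reads (?ea i) \<inter> {3..8} \<times> UNIV = {}" "expr_reads (?ex i) \<inter> {3..8} \<times> UNIV = {}" for i
    by auto
  have M1: "M1 A = M A" if "A \<notin> {3..8}" for A
    unfolding M1_def using correlate_correct(2)[OF b0 dis that] .
  have M1_3: "M1 3 ((?L - i) mod ?L) = real ?L * (\<Sum>l<?L. omega_matrix ?n' (?u c i) (?u d l) * M 1 (b ^ e * ?u d l))" if i: "i < ?L" for i
  proof -
    have "M1 3 ((?L - i) mod ?L) = real ?L * (\<Sum>l<?L. expr_val \<Gamma> \<gamma> M (?ea ((i + l) mod ?L)) * expr_val \<Gamma> \<gamma> M (?ex l))"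
      unfolding M1_def using correlate_correct(1)[OF b0 dis, of i "r - e - 2"] i unfolding L by simp
    moreover have "expr_val \<Gamma> \<gamma> M (?ea ((i + l) mod ?L)) = omega_matrix ?n' (?u c i) (?u d l)" for l
    proof -
      have "?u (c * d) ((i + l) mod ?L) = ?u (c * d) (i + l)"
        by (rule unit_of_shift[OF b, symmetric])
      also have "\<dots> = ?u d l * ?u c i mod ?n'"
        by (simp add: unit_of_def mod_mult_eq power_add mult_ac)
      finally show ?thesis
        by (simp add: omega_matrix_def)
    qed
    ultimately show ?thesis
      by simp
  qed
  have tail: "assign \<Gamma> \<gamma> M (level b r e c d) = M1(2 := \<lambda>k. M1 2 k +
     (\<Sum>p\<leftarrow>List.product [0..<?L] [0..<b ^ e]. if ?u c (fst p) + ?n' * snd p = k then M1 3 ((?L - fst p) mod ?L) / real ?L else 0))"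
    unfolding level_def assign_append M1_def[symmetric] level_tail_def Let_def
    by (subst assign_accumulate) (simp_all cong: if_cong)
  show "assign \<Gamma> \<gamma> M (level b r e c d) A = M A" if "A \<notin> {2..8}"
    unfolding tail using that M1[of A] by auto
  show "assign \<Gamma> \<gamma> M (level b r e c d) 2 y = M 2 y +
      (\<Sum>i<?L. if ?u c i = y mod ?n' then \<Sum>l<?L. omega_matrix ?n' (?u c i) (?u d l) * M 1 (b ^ e * ?u d l) else 0)"
    if y: "y < b ^ r"
  proof -
    have n: "b ^ r = ?n' * b ^ e"
      using e by (simp flip: power_add)
    have ult: "?u c i < ?n'" for i
      using b0 by (simp add: unit_of_def)
    have iff: "?u c i + ?n' * q = y \<longleftrightarrow> ?u c i = y mod ?n' \<and> q = y div ?n'" for i q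
    proof
      assume "?u c i + ?n' * q = y"
      with ult[of i] have "y mod ?n' = ?u c i" "y div ?n' = q"
        using b0 by auto
      then show "?u c i = y mod ?n' \<and> q = y div ?n'"
        by simp
    qed simp
    have q: "y div ?n' < b ^ e"
      using y unfolding n by (simp add: less_mult_imp_div_less mult.commute)
    have "(\<Sum>p\<leftarrow>List.product [0..<?L] [0..<b ^ e]. if ?u c (fst p) + ?n' * snd p = y then M1 3 ((?L - fst p) mod ?L) / real ?L else 0) =
       (\<Sum>p\<in>{..<?L} \<times> {..<b ^ e}. if ?u c (fst p) + ?n' * snd p = y then M1 3 ((?L - fst p) mod ?L) / real ?L else 0)"
      by (subst sum_list_distinct_conv_sum_set) (simp_all add: distinct_product atLeast0LessThan)
    also have "\<dots> = (\<Sum>i<?L. \<Sum>q<b ^ e. if ?u c i + ?n' * q = y then M1 3 ((?L - i) mod ?L) / real ?L else 0)"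
      by (simp add: sum.cartesian_product case_prod_unfold)
    also have "\<dots> = (\<Sum>i<?L. if ?u c i = y mod ?n' then \<Sum>l<?L. omega_matrix ?n' (?u c i) (?u d l) * M 1 (b ^ e * ?u d l) else 0)"
    proof (intro sum.cong refl)
      fix i assume i: "i \<in> {..<?L}"
      have "(\<Sum>q<b ^ e. if ?u c i + ?n' * q = y then M1 3 ((?L - i) mod ?L) / real ?L else 0) =
         (\<Sum>q<b ^ e. if q = y div ?n' then (if ?u c i = y mod ?n' then M1 3 ((?L - i) mod ?L) / real ?L else 0) else 0)"
        by (intro sum.cong refl) (simp add: iff)
      also have "\<dots> = (if ?u c i = y mod ?n' then M1 3 ((?L - i) mod ?L) / real ?L else 0)"
        using q by simp
      also have "\<dots> = (if ?u c i = y mod ?n' then \<Sum>l<?L. omega_matrix ?n' (?u c i) (?u d l) * M 1 (b ^ e * ?u d l) else 0)"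
        using M1_3[of i] i L0 by simp
      finally show "(\<Sum>q<b ^ e. if ?u c i + ?n' * q = y then M1 3 ((?L - i) mod ?L) / real ?L else 0) =
        (if ?u c i = y mod ?n' then \<Sum>l<?L. omega_matrix ?n' (?u c i) (?u d l) * M 1 (b ^ e * ?u d l) else 0)" .
    qed
    finally show ?thesis
      unfolding tail using M1[of 2] by simp
  qed
qed

text \<open>The programs for the levels leave the input in array 1 unchanged, so their contributions
  to array 2 simply add up.\<close>

lemma accumulate_concat:
  assumes step: "\<And>p M. p \<in> set ps \<Longrightarrow> (\<forall>y<n. assign \<Gamma> \<gamma> M (f p) 2 y = M 2 y + h (M 1) p y) \<and>
      (\<forall>A. A \<notin> {2..8} \<longrightarrow> assign \<Gamma> \<gamma> M (f p) A = M A)"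
  shows "(\<forall>y<n. assign \<Gamma> \<gamma> M (concat (map f ps)) 2 y = M 2 y + (\<Sum>p\<leftarrow>ps. h (M 1) p y)) \<and>
      (\<forall>A. A \<notin> {2..8} \<longrightarrow> assign \<Gamma> \<gamma> M (concat (map f ps)) A = M A)"
  using step
proof (induction ps arbitrary: M)
  case (Cons p ps)
  let ?M = "assign \<Gamma> \<gamma> M (f p)"
  have 1: "\<forall>y<n. ?M 2 y = M 2 y + h (M 1) p y" "\<forall>A. A \<notin> {2..8} \<longrightarrow> ?M A = M A"
    using Cons.prems[of p M] by auto
  have 2: "\<forall>y<n. assign \<Gamma> \<gamma> ?M (concat (map f ps)) 2 y = ?M 2 y + (\<Sum>p\<leftarrow>ps. h (?M 1) p y)"
    "\<forall>A. A \<notin> {2..8} \<longrightarrow> assign \<Gamma> \<gamma> ?M (concat (map f ps)) A = ?M A"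
    using Cons.IH[of ?M] Cons.prems by auto
  have "?M 1 = M 1"
    using 1(2) by simp
  then show ?case
    using 1 2 by (simp add: add.assoc)
qed simp

text \<open>For a unit row \<open>y\<close> the residue \<open>y mod b ^ (r - e)\<close> is again a
  unit, hence it occurs exactly once as \<open>unit_of b (r - e) c i\<close>, and each level adds
  the contribution of exactly its own columns.\<close>

theorem fast_multiply_correct:
  assumes b: "prime b"
  shows "y \<in> unit_residues (b ^ r) \<Longrightarrow> assign \<Gamma> \<gamma> M (fast_multiply b r) 2 y = (\<Sum>k<b ^ r. omega_matrix (b ^ r) y k * M 1 k)"
    and "A \<notin> {2..8} \<Longrightarrow> assign \<Gamma> \<gamma> M (fast_multiply b r) A = M A"
proof -
  let ?n = "b ^ r"
  let ?M0 = "assign \<Gamma> \<gamma> M (store 2 ?n (\<lambda>_. Const_E 0))"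
  let ?h = "\<lambda>v p y. (\<Sum>i<cyc b (r - fst p). if unit_of b (r - fst p) (fst (snd p)) i = y mod b ^ (r - fst p) then
        \<Sum>l<cyc b (r - fst p). omega_matrix (b ^ (r - fst p)) (unit_of b (r - fst p) (fst (snd p)) i) (unit_of b (r - fst p) (snd (snd p)) l) *
          v (b ^ fst p * unit_of b (r - fst p) (snd (snd p)) l) else (0 :: real))"
  have b0: "b > 0"
    using prime_gt_0_nat[OF b] .
  have M0: "?M0 = M(2 := \<lambda>k. if k < ?n then 0 else M 2 k)"
    by (subst assign_store) (simp_all cong: if_cong)
  have acc: "(\<forall>y<?n. assign \<Gamma> \<gamma> M (fast_multiply b r) 2 y = ?M0 2 y + (\<Sum>p\<leftarrow>level_indices b r. ?h (?M0 1) p y)) \<and>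
      (\<forall>A. A \<notin> {2..8} \<longrightarrow> assign \<Gamma> \<gamma> M (fast_multiply b r) A = ?M0 A)"
    unfolding fast_multiply_def assign_append
  proof (rule accumulate_concat)
    fix p M assume "p \<in> set (level_indices b r)"
    then have "fst p \<le> r"
      using set_level_indices[of "fst p" "fst (snd p)" "snd (snd p)"] by simp
    from level_correct[OF b this] show "(\<forall>y<?n. assign \<Gamma> \<gamma> M (level b r (fst p) (fst (snd p)) (snd (snd p))) 2 y = M 2 y + ?h (M 1) p y) \<and>
      (\<forall>A. A \<notin> {2..8} \<longrightarrow> assign \<Gamma> \<gamma> M (level b r (fst p) (fst (snd p)) (snd (snd p))) A = M A)"
      by blast
  qed
  then show "assign \<Gamma> \<gamma> M (fast_multiply b r) A = M A" if "A \<notin> {2..8}"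
    using that by (auto simp: M0)
  show "assign \<Gamma> \<gamma> M (fast_multiply b r) 2 y = (\<Sum>k<?n. omega_matrix ?n y k * M 1 k)" if y: "y \<in> unit_residues ?n"
  proof -
    have one_neq_2: "(1 :: nat) \<noteq> 2"
      by simp
    have yn: "y < ?n" and yc: "coprime y ?n"
      using y by (auto simp: unit_residues_def)
    have "assign \<Gamma> \<gamma> M (fast_multiply b r) 2 y = (\<Sum>p\<leftarrow>level_indices b r. ?h (M 1) p y)"
      using acc[THEN conjunct1, rule_format, OF yn] yn unfolding M0 fun_upd_other[OF one_neq_2] by simp
    also have "\<dots> = (\<Sum>e\<le>r. \<Sum>c\<in>reps b (r - e). \<Sum>d\<in>reps b (r - e). ?h (M 1) (e, c, d) y)"
      by (rule sum_list_level_indices)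
    also have "\<dots> = (\<Sum>e\<le>r. \<Sum>u\<in>unit_residues (b ^ (r - e)). omega_matrix ?n y (b ^ e * u) * M 1 (b ^ e * u))"
    proof (rule sum.cong[OF refl])
      fix e assume "e \<in> {..r}"
      then have e: "e \<le> r"
        by simp
      let ?n' = "b ^ (r - e)" and ?L = "cyc b (r - e)" and ?u = "unit_of b (r - e)" and ?R = "reps b (r - e)"
      let ?g = "\<lambda>x d l. omega_matrix ?n' x (?u d l) * M 1 (b ^ e * ?u d l)"
      have n: "?n = b ^ e * ?n'"
        using e by (simp flip: power_add)
      have bij: "bij_betw (\<lambda>(c, i). ?u c i) (?R \<times> {..<?L}) (unit_residues ?n')"
        by (rule bij_betw_unit_of[OF b])
      have ym: "y mod ?n' \<in> unit_residues ?n'"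
      proof -
        have "coprime y ?n'"
          using yc e by (cases "r - e = 0") (auto simp: coprime_power_right_iff)
        then have "coprime (y mod ?n') ?n'"
          using b0 by (subst coprime_mod_left_iff) auto
        moreover have "y mod ?n' < ?n'"
          using b0 by simp
        ultimately show ?thesis
          unfolding unit_residues_def by blast
      qed
      have "(\<Sum>c\<in>?R. \<Sum>d\<in>?R. ?h (M 1) (e, c, d) y) =
         (\<Sum>c\<in>?R. \<Sum>d\<in>?R. \<Sum>i<?L. if ?u c i = y mod ?n' then \<Sum>l<?L. ?g (?u c i) d l else 0)"
        by (simp cong: if_cong)
      also have "\<dots> = (\<Sum>c\<in>?R. \<Sum>i<?L. \<Sum>d\<in>?R. if ?u c i = y mod ?n' then \<Sum>l<?L. ?g (?u c i) d l else 0)"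
        by (intro sum.cong refl sum.swap)
      also have "\<dots> = (\<Sum>c\<in>?R. \<Sum>i<?L. if ?u c i = y mod ?n' then \<Sum>d\<in>?R. \<Sum>l<?L. ?g (?u c i) d l else 0)"
        by (intro sum.cong refl) simp
      also have "\<dots> = (\<Sum>p\<in>?R \<times> {..<?L}. (\<lambda>x. if x = y mod ?n' then \<Sum>d\<in>?R. \<Sum>l<?L. ?g x d l else 0) ((\<lambda>(c, i). ?u c i) p))"
        by (simp add: sum.cartesian_product case_prod_unfold cong: if_cong)
      also have "\<dots> = (\<Sum>x\<in>unit_residues ?n'. if x = y mod ?n' then \<Sum>d\<in>?R. \<Sum>l<?L. ?g x d l else 0)"
        by (rule sum.reindex_bij_betw[OF bij])
      also have "\<dots> = (\<Sum>d\<in>?R. \<Sum>l<?L. ?g (y mod ?n') d l)"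
        using ym by simp
      also have "\<dots> = (\<Sum>p\<in>?R \<times> {..<?L}. (\<lambda>x. omega_matrix ?n' (y mod ?n') x * M 1 (b ^ e * x)) ((\<lambda>(c, i). ?u c i) p))"
        by (simp add: sum.cartesian_product case_prod_unfold cong: if_cong)
      also have "\<dots> = (\<Sum>x\<in>unit_residues ?n'. omega_matrix ?n' (y mod ?n') x * M 1 (b ^ e * x))"
        by (rule sum.reindex_bij_betw[OF bij])
      also have "\<dots> = (\<Sum>u\<in>unit_residues ?n'. omega_matrix ?n y (b ^ e * u) * M 1 (b ^ e * u))"
      proof (intro sum.cong refl)
        fix u
        have "b ^ e * u * y mod ?n = b ^ e * (u * y mod ?n')"
          unfolding n mult.assoc by (rule mult_mod_right[symmetric])
        then have "omega_matrix ?n y (b ^ e * u) = omega_matrix ?n' (y mod ?n') u"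
          using b0 by (simp add: omega_matrix_def n mod_mult_right_eq)
        then show "omega_matrix ?n' (y mod ?n') u * M 1 (b ^ e * u) = omega_matrix ?n y (b ^ e * u) * M 1 (b ^ e * u)"
          by simp
      qed
      finally show "(\<Sum>c\<in>?R. \<Sum>d\<in>?R. ?h (M 1) (e, c, d) y) = (\<Sum>u\<in>unit_residues ?n'. omega_matrix ?n y (b ^ e * u) * M 1 (b ^ e * u))" .
    qed
    also have "\<dots> = (\<Sum>k<?n. omega_matrix ?n y k * M 1 k)"
      by (rule sum_over_levels[OF b, symmetric])
    finally show ?thesis .
  qed
qed

lemma confined_fast_multiply:
  assumes b: "prime b"
  shows "confined ({1..8} \<times> {..<b ^ r}) (fast_multiply b r)"
proof -
  let ?S = "{1..8} \<times> {..<b ^ r}"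
  have b0: "b > 0"
    using prime_gt_0_nat[OF b] .
  have "confined ?S (level b r e c d)" if e: "e \<le> r" for e c d
  proof -
    have n: "b ^ r = b ^ (r - e) * b ^ e"
      using e by (simp flip: power_add)
    have u: "unit_of b (r - e) c i < b ^ (r - e)" for c i
      using b0 by (simp add: unit_of_def)
    have L: "b ^ (r - e - 2) \<le> b ^ r"
      using b0 by (intro power_increasing) auto
    have read: "b ^ e * unit_of b (r - e) d l < b ^ r" for l
      unfolding n using u[of d l] b0 by (simp add: mult.commute)
    have target: "unit_of b (r - e) c i + b ^ (r - e) * q < b ^ r" if "q < b ^ e" for i q
    proof -
      have "unit_of b (r - e) c i + b ^ (r - e) * q < b ^ (r - e) * (q + 1)"
        using u[of c i] by simp
      also have "\<dots> \<le> b ^ (r - e) * b ^ e"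
        using that by (intro mult_le_mono2) simp
      finally show ?thesis
        unfolding n .
    qed
    have idx: "(cyc b (r - e) - i) mod cyc b (r - e) < b ^ r" for i
    proof -
      have "(cyc b (r - e) - i) mod cyc b (r - e) < cyc b (r - e)"
        using b0 by (simp add: cyc_def)
      then show ?thesis
        using L by (simp add: cyc_def)
    qed
    have "confined ?S (correlate b (r - e - 2) (\<lambda>i. Omega_E (unit_of b (r - e) (c * d) i) (b ^ (r - e))) (\<lambda>l. Reg_E 1 (b ^ e * unit_of b (r - e) d l)))"
      using L read by (intro confined_correlate[OF b0]) auto
    moreover have "confined ?S (level_tail b r e c)"
      unfolding level_tail_def Let_def confined_def using target idx by auto
    ultimately show ?thesis
      by (simp add: level_def)
  qed
  then have "confined ?S (level b r (fst p) (fst (snd p)) (snd (snd p)))" if "p \<in> set (level_indices b r)" for p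
    using that set_level_indices[of "fst p" "fst (snd p)" "snd (snd p)" b r] by simp
  then show ?thesis
    unfolding fast_multiply_def confined_append confined_concat
    by (auto intro!: confined_store)
qed

lemma sum_powers_le:
  assumes "b \<ge> (2 :: nat)"
  shows "(\<Sum>e\<le>r. b ^ (r - e)) \<le> 2 * b ^ r"
proof (induction r)
  case (Suc r)
  have "(\<Sum>e\<le>Suc r. b ^ (Suc r - e)) = b ^ Suc r + (\<Sum>e\<le>r. b ^ (r - e))"
    by (subst sum.atMost_Suc_shift) simp
  also have "\<dots> \<le> b ^ Suc r + 2 * b ^ r"
    using Suc by simp
  also have "\<dots> \<le> 2 * b ^ Suc r"
    using assms by simp
  finally show ?case .
qed simp

text \<open>Each level has at most \<open>b ^ 4\<close> pairs of cosets. The correlations shrink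
  geometrically with the level, but every tail may touch \<open>b ^ r\<close> rows; the
  \<open>r + 1\<close> levels together therefore stay within a multiple of
  \<open>(r + 1) * b ^ r\<close>.\<close>

lemma cost_fast_multiply:
  assumes b: "prime b"
  shows "cost (fast_multiply b r) \<le> (3 + b ^ 4 * (120 * b + 170)) * ((r + 1) * b ^ r)"
proof -
  let ?n = "b ^ r" and ?K = "60 * b + 80"
  have b2: "b \<ge> 2"
    using prime_ge_2_nat[OF b] .
  have lev: "cost (level b r e c d) \<le> (r + 1) * ?K * b ^ (r - e) + 9 * ?n" if e: "e \<le> r" for e c d
  proof -
    have L: "b ^ (r - e - 2) \<le> b ^ (r - e)"
      using b2 by (intro power_increasing) auto
    have "cost (correlate b (r - e - 2) (\<lambda>i. Omega_E (unit_of b (r - e) (c * d) i) (b ^ (r - e))) (\<lambda>l. Reg_E 1 (b ^ e * unit_of b (r - e) d l)))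
      \<le> (r - e - 2 + 1) * (b ^ (r - e - 2) * ?K)"
      by (rule cost_correlate) simp_all
    also have "\<dots> \<le> (r + 1) * (b ^ (r - e) * ?K)"
      using L by (intro mult_le_mono) auto
    finally have 1: "cost (correlate b (r - e - 2) (\<lambda>i. Omega_E (unit_of b (r - e) (c * d) i) (b ^ (r - e))) (\<lambda>l. Reg_E 1 (b ^ e * unit_of b (r - e) d l)))
      \<le> (r + 1) * ?K * b ^ (r - e)"
      by (simp only: mult_ac)
    have "cost (level_tail b r e c) \<le> length (List.product [0..<cyc b (r - e)] [0..<b ^ e]) * (7 + 2)"
      unfolding level_tail_def Let_def by (rule cost_map_le) simp
    also have "\<dots> = cyc b (r - e) * b ^ e * 9"
      by (simp add: length_product)
    also have "\<dots> \<le> b ^ (r - e) * b ^ e * 9"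
      using L by (intro mult_le_mono1) (simp add: cyc_def)
    also have "b ^ (r - e) * b ^ e = ?n"
      using e by (simp flip: power_add)
    finally show ?thesis
      using 1 by (simp add: level_def)
  qed
  have concat_cost: "cost (concat (map f ps)) = (\<Sum>p\<leftarrow>ps. cost (f p))" for f :: "nat \<times> nat \<times> nat \<Rightarrow> assignment list" and ps
    by (induction ps) simp_all
  have reps: "card (reps b k) \<le> b ^ 2" for k
  proof -
    have "card (reps b k) \<le> card {..<b ^ min k 2}"
      by (intro card_mono) (auto simp: reps_def unit_residues_def)
    also have "\<dots> \<le> b ^ 2"
      using b2 by (simp add: power_increasing)
    finally show ?thesis .
  qed
  have "cost (concat (map (\<lambda>p. level b r (fst p) (fst (snd p)) (snd (snd p))) (level_indices b r))) =
     (\<Sum>e\<le>r. \<Sum>c\<in>reps b (r - e). \<Sum>d\<in>reps b (r - e). cost (level b r e c d))"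
    unfolding concat_cost by (subst sum_list_level_indices) simp
  also have "\<dots> \<le> (\<Sum>e\<le>r. \<Sum>c\<in>reps b (r - e). \<Sum>d\<in>reps b (r - e). (r + 1) * ?K * b ^ (r - e) + 9 * ?n)"
    by (intro sum_mono lev) auto
  also have "\<dots> = (\<Sum>e\<le>r. card (reps b (r - e)) * card (reps b (r - e)) * ((r + 1) * ?K * b ^ (r - e) + 9 * ?n))"
    by (simp add: mult.assoc)
  also have "\<dots> \<le> (\<Sum>e\<le>r. b ^ 2 * b ^ 2 * ((r + 1) * ?K * b ^ (r - e) + 9 * ?n))"
    by (intro sum_mono mult_le_mono reps order_refl)
  also have "\<dots> = b ^ 4 * ((r + 1) * ?K * (\<Sum>e\<le>r. b ^ (r - e)) + (r + 1) * (9 * ?n))"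
    by (simp add: sum.distrib sum_distrib_left[symmetric] flip: power_add)
  also have "\<dots> \<le> b ^ 4 * ((r + 1) * ?K * (2 * ?n) + (r + 1) * (9 * ?n))"
    using sum_powers_le[OF b2, of r] by (intro mult_le_mono2 add_mono order_refl)
  also have "\<dots> = b ^ 4 * (120 * b + 169) * ((r + 1) * ?n)"
    by (simp add: algebra_simps)
  also have "\<dots> \<le> b ^ 4 * (120 * b + 170) * ((r + 1) * ?n)"
    by (intro mult_le_mono) auto
  finally have 2: "cost (concat (map (\<lambda>p. level b r (fst p) (fst (snd p)) (snd (snd p))) (level_indices b r))) \<le> b ^ 4 * (120 * b + 170) * ((r + 1) * ?n)" .
  have "cost (store 2 ?n (\<lambda>_. Const_E 0)) \<le> ?n * (1 + 2)"
    by (rule cost_store_le) simp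
  also have "\<dots> \<le> 3 * ((r + 1) * ?n)"
    by simp
  finally show ?thesis
    using 2 by (simp only: fast_multiply_def cost_append distrib_right)
qed

subsection \<open>Trees carrying out the construction\<close>

text \<open>By monotonicity of \<open>w\<close> the indices with \<open>w j < m\<close> are closed
  downwards, so comparison with their supremum decides membership, also when the supremum is
  infinite or the set is empty.\<close>

lemma cbc_steps_eq:
  assumes w: "reduction_indices w"
  shows "cbc_steps s m w = {j \<in> {1..s}. w j < m}"
proof (rule Set.set_eqI)
  fix j
  have mono: "w i \<le> w k" if "1 \<le> i" "i \<le> k" for i k
    using w that by (auto simp: reduction_indices_def mono_on_def)
  show "j \<in> cbc_steps s m w \<longleftrightarrow> j \<in> {j \<in> {1..s}. w j < m}"
  proof (cases "1 \<le> j \<and> j \<le> s")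
    case True
    have "enat j \<le> s_star m w \<longleftrightarrow> w j < m"
    proof
      assume "w j < m"
      then show "enat j \<le> s_star m w"
        unfolding s_star_def using True by (intro Sup_upper) auto
    next
      assume le: "enat j \<le> s_star m w"
      show "w j < m"
      proof (rule ccontr)
        assume "\<not> w j < m"
        have "i \<le> j - 1" if "1 \<le> i" "w i < m" for i
          using mono[of j i] True that \<open>\<not> w j < m\<close> by (cases "j \<le> i") auto
        then have "s_star m w \<le> enat (j - 1)"
          unfolding s_star_def by (intro Sup_least) auto
        with le True show False
          using order_trans[of "enat j" "s_star m w" "enat (j - 1)"] by auto
      qed
    qed
    then show ?thesis
      using True by (auto simp: cbc_steps_def)
  next
    case False
    then show ?thesis
      by (auto simp: cbc_steps_def)
  qed
qed

lemma steps_interval: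
  assumes w: "reduction_indices w"
  obtains J where "J \<le> s" "{j \<in> {1..s}. w j < m} = {1..J}"
proof -
  let ?S = "{j \<in> {1..s}. w j < m}"
  define J where "J = Max (insert 0 ?S)"
  have J: "J \<in> insert 0 ?S"
    unfolding J_def by (rule Max_in) auto
  have "?S = {1..J}"
  proof (rule Set.set_eqI)
    fix j
    show "j \<in> ?S \<longleftrightarrow> j \<in> {1..J}"
    proof
      assume "j \<in> ?S"
      then have "j \<le> J"
        unfolding J_def by (intro Max_ge) auto
      with \<open>j \<in> ?S\<close> show "j \<in> {1..J}"
        by simp
    next
      assume j: "j \<in> {1..J}"
      then have "w j \<le> w J"
        using w by (auto simp: reduction_indices_def mono_on_def)
      with J j show "j \<in> ?S"
        by auto
    qed
  qed
  with J that show thesis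
    by auto
qed

lemma reduction_indices_adjust: "reduction_indices w \<Longrightarrow> reduction_indices (adjust_w w)"
  by (auto simp: reduction_indices_def mono_on_def adjust_w_def intro: diff_le_mono)

text \<open>The adjustment changes neither the lengths nor the set of executed steps. If
  \<open>w 1 > m\<close>, all lengths are 1 on both sides by truncated subtraction.\<close>

lemma adjust_diff:
  assumes "reduction_indices w" "1 \<le> j"
  shows "adjust_m m w - adjust_w w j = m - w j" and "adjust_w w j < adjust_m m w \<longleftrightarrow> w j < m"
proof -
  have "w 1 \<le> w j"
    using assms by (auto simp: reduction_indices_def mono_on_def)
  then show "adjust_m m w - adjust_w w j = m - w j" "adjust_w w j < adjust_m m w \<longleftrightarrow> w j < m"
    by (auto simp: adjust_m_def adjust_w_def)
qed

definition units :: "nat \<Rightarrow> nat list" where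
  "units n = sorted_list_of_set (unit_residues n)"

lemma set_units [simp]: "set (units n) = unit_residues n"
  by (simp add: units_def)

lemma length_units: "length (units n) \<le> n"
proof -
  have "unit_residues n \<subseteq> {..<n}"
    by (auto simp: unit_residues_def)
  then have "card (unit_residues n) \<le> card {..<n}"
    by (intro card_mono) auto
  then show ?thesis
    by (simp add: units_def)
qed

text \<open>\<open>A j\<close> computes the criterion of step \<open>j\<close> into array 2, \<open>B j y\<close> updates the data after \<open>y\<close> has been selected.\<close>
primrec cbc_tree ::
  "(nat \<Rightarrow> assignment list) \<Rightarrow> (nat \<Rightarrow> nat \<Rightarrow> assignment list) \<Rightarrow> (nat \<Rightarrow> nat) \<Rightarrow> nat \<Rightarrow> nat \<Rightarrow> (nat \<Rightarrow> nat) \<Rightarrow> Defs.tree" where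
  "cbc_tree A B n 0 j z = Halt z"
| "cbc_tree A B n (Suc r) j z =
     seq_tree (compile (A (Suc j)))
       (argmin_tree (reg 2) (hd (units (n (Suc j)))) (units (n (Suc j)))
         (\<lambda>y. seq_tree (compile (B (Suc j) y)) (cbc_tree A B n r (Suc j) (z(Suc j := y)))))"

lemma insert_hd_units: "unit_residues n \<noteq> {} \<Longrightarrow> insert (hd (units n)) (unit_residues n) = unit_residues n"
  using hd_in_set[of "units n"] by (auto simp: units_def)

text \<open>All branches draw on the same addresses \<open>S\<close> and the same temporaries, so
  the number of branches does not enter the memory cost.\<close>

lemma cbc_tree_registers_subset:
  assumes "\<And>i. j < i \<Longrightarrow> i \<le> j + r \<Longrightarrow> confined S (A i)"
    and "\<And>i y. j < i \<Longrightarrow> i \<le> j + r \<Longrightarrow> y \<in> unit_residues (n i) \<Longrightarrow> confined S (B i y) \<and> (2, y) \<in> S"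
    and "\<And>i. unit_residues (n i) \<noteq> {}"
  shows "tree_registers (cbc_tree A B n r j z) \<subseteq> prod_encode ` (S \<union> {0} \<times> {..11})"
  using assms(1,2)
proof (induction r arbitrary: j z)
  case (Suc r)
  let ?U = "unit_residues (n (Suc j))" and ?R = "prod_encode ` (S \<union> {0} \<times> {..11})"
  have cont: "tree_registers (seq_tree (compile (B (Suc j) y)) (cbc_tree A B n r (Suc j) (z(Suc j := y)))) \<subseteq> ?R" if y: "y \<in> ?U" for y
  proof -
    have "confined S (B (Suc j) y)"
      using Suc.prems(2)[of "Suc j" y] y by simp
    moreover have "tree_registers (cbc_tree A B n r (Suc j) (z(Suc j := y))) \<subseteq> ?R"
    proof (rule Suc.IH)
      fix i assume i: "Suc j < i" "i \<le> Suc j + r"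
      then show "confined S (A i)"
        using Suc.prems(1)[of i] by simp
      fix y assume "y \<in> unit_residues (n i)"
      then show "confined S (B i y) \<and> (2, y) \<in> S"
        using Suc.prems(2)[of i y] i by simp
    qed
    ultimately show ?thesis
      unfolding tree_registers_seq using registers_compile by (intro Un_least UN_least)
  qed
  have A: "(\<Union>i\<in>set (compile (A (Suc j))). instr_registers i) \<subseteq> ?R"
    using Suc.prems(1)[of "Suc j"] by (intro UN_least registers_compile) auto
  have reg2: "reg 2 ` ?U \<subseteq> ?R"
    using Suc.prems(2)[of "Suc j"] by auto
  have "tree_registers (argmin_tree (reg 2) (hd (units (n (Suc j)))) (units (n (Suc j)))
         (\<lambda>y. seq_tree (compile (B (Suc j) y)) (cbc_tree A B n r (Suc j) (z(Suc j := y))))) \<subseteq> ?R"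
    by (rule order_trans[OF argmin_tree_registers]) (use reg2 cont in \<open>simp only: set_units insert_hd_units[OF assms(3)] Un_least UN_least\<close>)
  with A show ?case
    unfolding cbc_tree.simps tree_registers_seq by (rule Un_least)
qed simp

text \<open>\<open>holds_vector\<close> asks for registers that occur in the tree, so it has to be
  known that the targets of the programs do.\<close>

lemma cbc_tree_registers_supset:
  assumes ne: "\<And>i. unit_residues (n i) \<noteq> {}" and i: "j < i" "i \<le> j + r"
    and x: "x \<in> set (A i) \<or> (\<exists>y\<in>unit_residues (n i). x \<in> set (B i y))"
  shows "reg (fst x) (fst (snd x)) \<in> tree_registers (cbc_tree A B n r j z)"
  using i
proof (induction r arbitrary: j z)
  case (Suc r)
  let ?c = "\<lambda>y. seq_tree (compile (B (Suc j) y)) (cbc_tree A B n r (Suc j) (z(Suc j := y)))"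
  let ?t = "argmin_tree (reg 2) (hd (units (n (Suc j)))) (units (n (Suc j))) ?c"
  have target: "reg (fst x) (fst (snd x)) \<in> (\<Union>i\<in>set (compile P). instr_registers i)" if "x \<in> set P" for P
    using target_in_registers[of "fst x" "fst (snd x)" "snd (snd x)" P] that by simp
  have c: "tree_registers (?c y) \<subseteq> tree_registers ?t" if "y \<in> unit_residues (n (Suc j))" for y
    using that by (intro argmin_tree_registers_cont) simp
  consider "i = Suc j" "x \<in> set (A i)" | y where "i = Suc j" "y \<in> unit_residues (n i)" "x \<in> set (B i y)" | "i > Suc j"
    using x Suc.prems by fastforce
  then show ?case
  proof cases
    case 1
    then show ?thesis
      using target by (simp add: tree_registers_seq)
  next
    case 2
    then have "reg (fst x) (fst (snd x)) \<in> tree_registers (?c y)"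
      using target by (simp add: tree_registers_seq)
    then show ?thesis
      using c[OF 2(2)[unfolded 2(1)]] unfolding cbc_tree.simps tree_registers_seq[of _ ?t] by blast
  next
    case 3
    obtain y where y: "y \<in> unit_residues (n (Suc j))"
      using ne by blast
    have "reg (fst x) (fst (snd x)) \<in> tree_registers (?c y)"
      unfolding tree_registers_seq using 3 Suc.prems by (intro UnI2 Suc.IH) auto
    then show ?thesis
      using c[OF y] unfolding cbc_tree.simps tree_registers_seq[of _ ?t] by blast
  qed
qed simp

lemma cbc_q_cong:
  assumes "\<And>i. 1 \<le> i \<Longrightarrow> i \<le> j \<Longrightarrow> z i = z' i"
  shows "cbc_q b m w \<Gamma> \<gamma> z j = cbc_q b m w \<Gamma> \<gamma> z' j"
  using assms
proof (induction j)
  case (Suc j)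
  have "cbc_q b m w \<Gamma> \<gamma> z j = cbc_q b m w \<Gamma> \<gamma> z' j"
    by (rule Suc.IH) (use Suc.prems in simp)
  moreover have "z (Suc j) = z' (Suc j)"
    using Suc.prems by simp
  ultimately show ?case
    by (intro ext) simp
qed (simp add: fun_eq_iff)

lemma cbc_qbar_cong:
  assumes "\<And>i. 1 \<le> i \<Longrightarrow> i < j \<Longrightarrow> z i = z' i"
  shows "cbc_qbar b m w \<Gamma> \<gamma> z j = cbc_qbar b m w \<Gamma> \<gamma> z' j"
proof -
  have "cbc_q b m w \<Gamma> \<gamma> z (j - 1) = cbc_q b m w \<Gamma> \<gamma> z' (j - 1)"
    by (rule cbc_q_cong) (use assms in auto)
  then show ?thesis
    unfolding cbc_qbar_def by (intro ext) (simp only:)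
qed

lemma cbc_T_cong:
  assumes "\<And>i. 1 \<le> i \<Longrightarrow> i < j \<Longrightarrow> z i = z' i"
  shows "cbc_T b m w \<Gamma> \<gamma> z j = cbc_T b m w \<Gamma> \<gamma> z' j"
  using cbc_qbar_cong[of j z z' b m w \<Gamma> \<gamma>] assms by (simp add: cbc_T_def fun_eq_iff)

section \<open>Running the construction for an abstract invariant\<close>

definition criterion_program :: "nat \<Rightarrow> nat \<Rightarrow> (nat \<Rightarrow> nat) \<Rightarrow> (nat \<Rightarrow> nat \<Rightarrow> expr) \<Rightarrow> nat \<Rightarrow> assignment list" where
  "criterion_program b m w f j = store 1 (b ^ (m - w j)) (f j) @ fast_multiply b (m - w j)"

definition cbc_program_tree ::
  "nat \<Rightarrow> nat \<Rightarrow> (nat \<Rightarrow> nat) \<Rightarrow> nat \<Rightarrow> (nat \<Rightarrow> nat \<Rightarrow> expr) \<Rightarrow> (nat \<Rightarrow> nat \<Rightarrow> assignment list) \<Rightarrow> assignment list \<Rightarrow> Defs.tree" where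
  "cbc_program_tree b m w J f B P0 =
     seq_tree (compile P0) (cbc_tree (criterion_program b m w f) B (\<lambda>j. b ^ (m - w j)) J 0 (\<lambda>_. 0))"

lemma memory_cost_program_tree:
  assumes "prime b" "finite S" "confined S P0"
    and "\<And>i. i \<in> {1..J} \<Longrightarrow> confined S (criterion_program b m w f i)"
    and "\<And>i y. i \<in> {1..J} \<Longrightarrow> y \<in> unit_residues (b ^ (m - w i)) \<Longrightarrow> confined S (B i y)"
    and "\<And>i y. i \<in> {1..J} \<Longrightarrow> y < b ^ (m - w i) \<Longrightarrow> (2, y) \<in> S"
  shows "memory_cost (cbc_program_tree b m w J f B P0) \<le> card S + 12"
proof -
  have "tree_registers (cbc_program_tree b m w J f B P0) \<subseteq> prod_encode ` (S \<union> {0} \<times> {..11})"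
    unfolding cbc_program_tree_def tree_registers_seq
  proof (intro Un_least UN_least)
    show "instr_registers i \<subseteq> prod_encode ` (S \<union> {0} \<times> {..11})" if "i \<in> set (compile P0)" for i
      by (rule registers_compile[OF assms(3) that])
    show "tree_registers (cbc_tree (criterion_program b m w f) B (\<lambda>j. b ^ (m - w j)) J 0 (\<lambda>_. 0)) \<subseteq> prod_encode ` (S \<union> {0} \<times> {..11})"
    proof (rule cbc_tree_registers_subset)
      fix i assume i: "0 < i" "i \<le> 0 + J"
      then show "confined S (criterion_program b m w f i)"
        using assms(4)[of i] by simp
      show "confined S (B i y) \<and> (2, y) \<in> S" if "y \<in> unit_residues (b ^ (m - w i))" for y
        using assms(5,6)[of i y] i that by (simp add: unit_residues_def)
    qed (rule unit_residues_nonempty[OF assms(1)])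
  qed
  then have "memory_cost (cbc_program_tree b m w J f B P0) \<le> card (prod_encode ` (S \<union> {0} \<times> {..11}))"
    unfolding memory_cost_def by (rule card_mono[rotated]) (use assms(2) in simp)
  also have "\<dots> \<le> card (S \<union> {0} \<times> {..11})"
    by (rule card_image_le) (use assms(2) in simp)
  also have "\<dots> \<le> card S + card ({0 :: nat} \<times> {..11 :: nat})"
    by (rule card_Un_le)
  finally show ?thesis
    by (simp add: card_cartesian_product)
qed

text \<open>The common frame of the POD and the product construction. \<open>Inv j z M\<close>
  describes the data kept after step \<open>j\<close> in the arrays from 9 on; the arrays below are
  scratch space, which \<open>Inv_arrays\<close> expresses. In \<open>Inv_Suc\<close> the update may
  rely on array 1 still holding the folded sum of the step.\<close>

locale cbc_program = reduced_cbc b m w s \<Gamma> \<gamma> for b m w s \<Gamma> \<gamma> +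
  fixes J :: nat and f :: "nat \<Rightarrow> nat \<Rightarrow> expr" and B :: "nat \<Rightarrow> nat \<Rightarrow> assignment list" and P0 :: "assignment list"
    and S :: "(nat \<times> nat) set" and Inv :: "nat \<Rightarrow> (nat \<Rightarrow> nat) \<Rightarrow> (nat \<Rightarrow> nat \<Rightarrow> real) \<Rightarrow> bool"
  assumes J: "{j \<in> {1..s}. w j < m} = {1..J}"
    and S: "proper_addresses S" "confined S P0"
    and confined_A: "\<And>j. j \<in> {1..J} \<Longrightarrow> confined S (criterion_program b m w f j)"
    and confined_B: "\<And>j y. j \<in> {1..J} \<Longrightarrow> y \<in> unit_residues (b ^ (m - w j)) \<Longrightarrow> confined S (B j y)"
    and f_reads: "\<And>j k. expr_reads (f j k) \<subseteq> {9..} \<times> UNIV"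
    and f_val: "\<And>j z M k. j < J \<Longrightarrow> Inv j z M \<Longrightarrow> k < b ^ (m - w (Suc j)) \<Longrightarrow>
      expr_val \<Gamma> \<gamma> M (f (Suc j) k) = cbc_qbar b m w \<Gamma> \<gamma> z (Suc j) k"
    and Inv_arrays: "\<And>j z M M'. Inv j z M \<Longrightarrow> (\<And>a. a \<ge> 9 \<Longrightarrow> M' a = M a) \<Longrightarrow> Inv j z M'"
    and Inv_cong: "\<And>j z z' M. Inv j z M \<Longrightarrow> (\<And>i. 1 \<le> i \<Longrightarrow> i \<le> j \<Longrightarrow> z i = z' i) \<Longrightarrow> Inv j z' M"
    and Inv_0: "Inv 0 (\<lambda>_. 0) (assign \<Gamma> \<gamma> (\<lambda>_ _. 0) P0)"
    and Inv_Suc: "\<And>j z M y. j < J \<Longrightarrow> Inv j z M \<Longrightarrow> y \<in> unit_residues (b ^ (m - w (Suc j))) \<Longrightarrow>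
      (\<And>k. k < b ^ (m - w (Suc j)) \<Longrightarrow> M 1 k = cbc_qbar b m w \<Gamma> \<gamma> z (Suc j) k) \<Longrightarrow>
      Inv (Suc j) (z(Suc j := y)) (assign \<Gamma> \<gamma> M (B (Suc j) y))"
begin

abbreviation A where "A \<equiv> criterion_program b m w f"
abbreviation n where "n j \<equiv> b ^ (m - w j)"
abbreviation qbar where "qbar \<equiv> cbc_qbar b m w \<Gamma> \<gamma>"
abbreviation T where "T \<equiv> cbc_T b m w \<Gamma> \<gamma>"

lemma units_ne: "unit_residues (n i) \<noteq> {}"
  by (rule unit_residues_nonempty[OF b])

lemma A_correct:
  assumes j: "j < J" and Inv: "Inv j z M"
  defines "M' \<equiv> assign \<Gamma> \<gamma> M (A (Suc j))"
  shows "Inv j z M'"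
    and "k < n (Suc j) \<Longrightarrow> M' 1 k = qbar z (Suc j) k"
    and "y \<in> unit_residues (n (Suc j)) \<Longrightarrow> M' 2 y = T z (Suc j) y"
proof -
  let ?n = "n (Suc j)"
  have reads: "(1, k') \<notin> expr_reads (f (Suc j) k)" for k k'
    using f_reads[of "Suc j" k] by auto
  define M1 where "M1 = assign \<Gamma> \<gamma> M (store 1 ?n (f (Suc j)))"
  have M1: "M1 = M(1 := \<lambda>k. if k < ?n then qbar z (Suc j) k else M 1 k)"
    unfolding M1_def using reads by (subst assign_store) (simp_all add: f_val[OF j Inv] cong: if_cong)
  have M': "M' = assign \<Gamma> \<gamma> M1 (fast_multiply b (m - w (Suc j)))"
    by (simp add: M'_def M1_def criterion_program_def)
  have other: "M' a = M1 a" if "a \<notin> {2..8}" for a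
    unfolding M' by (rule fast_multiply_correct(2)[OF b that])
  show "Inv j z M'"
    by (rule Inv_arrays[OF Inv]) (simp add: other M1)
  show "k < ?n \<Longrightarrow> M' 1 k = qbar z (Suc j) k"
    by (simp add: other M1)
  show "y \<in> unit_residues ?n \<Longrightarrow> M' 2 y = T z (Suc j) y"
    unfolding M' cbc_T_def by (subst fast_multiply_correct(1)[OF b]) (simp_all add: M1)
qed

abbreviation step_cost where
  "step_cost i y \<equiv> cost (A i) + length (units (n i)) + cost (B i y)"

text \<open>Two moments of the run are recorded: one after the criterion has been computed, and one
  after the update, when the invariant of the next step holds.\<close>

definition selected :: "(nat \<Rightarrow> real) set \<Rightarrow> (nat \<Rightarrow> nat) \<Rightarrow> nat \<Rightarrow> bool" where
  "selected X z i \<longleftrightarrow> z i \<in> unit_residues (n i) \<and> (\<forall>y\<in>unit_residues (n i). T z i (z i) \<le> T z i y) \<and>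
     (\<exists>\<sigma>\<in>X. (\<forall>k<n i. memory \<sigma> 1 k = qbar z i k) \<and> (\<forall>y\<in>unit_residues (n i). memory \<sigma> 2 y = T z i y)) \<and>
     (\<exists>\<sigma>\<in>X. Inv i z (memory \<sigma>))"

lemma selected_mono: "selected X z i \<Longrightarrow> X \<subseteq> Y \<Longrightarrow> selected Y z i"
  unfolding selected_def by blast

lemma run:
  assumes "j + r = J" "Inv j z (memory \<sigma>)"
  defines "t \<equiv> cbc_tree A B n r j z"
  defines "z' \<equiv> tree_output \<Gamma> \<gamma> t \<sigma>"
  shows "(\<forall>i. i \<notin> {j<..J} \<longrightarrow> z' i = z i) \<and>
    (\<forall>i\<in>{j<..J}. selected (tree_states \<Gamma> \<gamma> t \<sigma>) z' i) \<and>
    tree_cost \<Gamma> \<gamma> t \<sigma> = (\<Sum>i\<in>{j<..J}. step_cost i (z' i))"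
  using assms(1,2) unfolding t_def z'_def
proof (induction r arbitrary: j z \<sigma>)
  case 0
  then show ?case
    by simp
next
  case (Suc r)
  let ?i = "Suc j"
  let ?U = "unit_residues (n ?i)"
  let ?c = "\<lambda>y. seq_tree (compile (B ?i y)) (cbc_tree A B n r ?i (z(?i := y)))"
  let ?a = "argmin_tree (reg 2) (hd (units (n ?i))) (units (n ?i)) ?c"
  let ?t = "cbc_tree A B n (Suc r) j z"
  have j: "j < J" and i: "?i \<in> {1..J}"
    using Suc.prems(1) by auto
  define \<sigma>1 where "\<sigma>1 = exec_list \<Gamma> \<gamma> (compile (A ?i)) \<sigma>"
  have m1: "memory \<sigma>1 = assign \<Gamma> \<gamma> (memory \<sigma>) (A ?i)"
    unfolding \<sigma>1_def by (rule compile_correct[OF confined_A[OF i] S(1)])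
  note A = A_correct[OF j Suc.prems(2), folded m1]
  have set: "insert (hd (units (n ?i))) (set (units (n ?i))) = ?U"
    by (simp add: insert_hd_units units_ne)
  obtain y where y: "y \<in> ?U" "\<forall>y'\<in>?U. \<sigma>1 (reg 2 y) \<le> \<sigma>1 (reg 2 y')"
    "tree_output \<Gamma> \<gamma> ?a \<sigma>1 = tree_output \<Gamma> \<gamma> (?c y) \<sigma>1"
    "tree_cost \<Gamma> \<gamma> ?a \<sigma>1 = length (units (n ?i)) + tree_cost \<Gamma> \<gamma> (?c y) \<sigma>1"
    "tree_states \<Gamma> \<gamma> (?c y) \<sigma>1 \<subseteq> tree_states \<Gamma> \<gamma> ?a \<sigma>1"
    using argmin_tree_run[of "hd (units (n ?i))" "units (n ?i)" \<sigma>1 "reg 2" \<Gamma> \<gamma> ?c] unfolding set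
    by (elim bexE conjE)
  define \<sigma>2 where "\<sigma>2 = exec_list \<Gamma> \<gamma> (compile (B ?i y)) \<sigma>1"
  define z1 where "z1 = z(?i := y)"
  let ?t1 = "cbc_tree A B n r ?i z1"
  have m2: "memory \<sigma>2 = assign \<Gamma> \<gamma> (memory \<sigma>1) (B ?i y)"
    unfolding \<sigma>2_def by (rule compile_correct[OF confined_B[OF i y(1)] S(1)])
  have Inv2: "Inv ?i z1 (memory \<sigma>2)"
    unfolding m2 z1_def by (rule Inv_Suc[OF j A(1) y(1) A(2)])
  define z' where "z' = tree_output \<Gamma> \<gamma> ?t1 \<sigma>2"
  have IH: "\<And>i. i \<notin> {?i<..J} \<Longrightarrow> z' i = z1 i"
    "\<And>i. i \<in> {?i<..J} \<Longrightarrow> selected (tree_states \<Gamma> \<gamma> ?t1 \<sigma>2) z' i"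
    "tree_cost \<Gamma> \<gamma> ?t1 \<sigma>2 = (\<Sum>i\<in>{?i<..J}. step_cost i (z' i))"
    using Suc.IH[OF _ Inv2] Suc.prems(1) unfolding z'_def by simp_all
  have out: "tree_output \<Gamma> \<gamma> ?t \<sigma> = z'"
    unfolding cbc_tree.simps tree_output_seq \<sigma>1_def[symmetric] y(3) \<sigma>2_def[symmetric] z1_def[symmetric] z'_def ..
  have states: "tree_states \<Gamma> \<gamma> ?t1 \<sigma>2 \<subseteq> tree_states \<Gamma> \<gamma> ?t \<sigma>" "\<sigma>1 \<in> tree_states \<Gamma> \<gamma> ?t \<sigma>"
  proof -
    have a: "tree_states \<Gamma> \<gamma> ?a \<sigma>1 \<subseteq> tree_states \<Gamma> \<gamma> ?t \<sigma>"
      unfolding cbc_tree.simps \<sigma>1_def by (rule tree_states_seq)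
    then show "\<sigma>1 \<in> tree_states \<Gamma> \<gamma> ?t \<sigma>"
      using start_in_tree_states by (rule subsetD)
    have "tree_states \<Gamma> \<gamma> ?t1 \<sigma>2 \<subseteq> tree_states \<Gamma> \<gamma> (?c y) \<sigma>1"
      unfolding \<sigma>2_def z1_def by (rule tree_states_seq)
    with y(5) a show "tree_states \<Gamma> \<gamma> ?t1 \<sigma>2 \<subseteq> tree_states \<Gamma> \<gamma> ?t \<sigma>"
      by (meson order_trans)
  qed
  have z_i: "z' ?i = y" and z_le: "\<And>i. i \<notin> {j<..J} \<Longrightarrow> z' i = z i"
    using IH(1) j by (auto simp: z1_def)
  have agree: "z i = z' i" if "1 \<le> i" "i < ?i" for i
    using that by (intro z_le[symmetric]) simp
  \<comment> \<open>The criterion of a step depends on earlier components only, and the remaining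
    run does not change these.\<close>
  have qbar': "qbar z ?i = qbar z' ?i" and T': "T z ?i = T z' ?i"
    by (rule cbc_qbar_cong[OF agree], assumption+) (rule cbc_T_cong[OF agree], assumption+)
  have split: "{j<..J} = insert ?i {?i<..J}"
    using j by auto
  have step: "selected (tree_states \<Gamma> \<gamma> ?t \<sigma>) z' ?i"
    unfolding selected_def
  proof (intro conjI)
    show "z' ?i \<in> ?U"
      using y(1) z_i by simp
    have "\<sigma>1 (reg 2 y') = T z' ?i y'" if "y' \<in> ?U" for y'
      using A(3)[OF that] unfolding T' by (simp add: memory_def)
    then show "\<forall>y\<in>?U. T z' ?i (z' ?i) \<le> T z' ?i y"
      using y(1,2) z_i by simp
    show "\<exists>\<sigma>'\<in>tree_states \<Gamma> \<gamma> ?t \<sigma>. (\<forall>k<n ?i. memory \<sigma>' 1 k = qbar z' ?i k) \<and> (\<forall>y\<in>?U. memory \<sigma>' 2 y = T z' ?i y)"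
      using A(2,3) unfolding qbar' T' by (intro bexI[OF _ states(2)]) simp
    have "\<sigma>2 \<in> tree_states \<Gamma> \<gamma> ?t \<sigma>"
      by (rule subsetD[OF states(1) start_in_tree_states])
    moreover have "Inv ?i z' (memory \<sigma>2)"
      by (rule Inv_cong[OF Inv2]) (use IH(1) in simp)
    ultimately show "\<exists>\<sigma>'\<in>tree_states \<Gamma> \<gamma> ?t \<sigma>. Inv ?i z' (memory \<sigma>')"
      by blast
  qed
  have steps: "selected (tree_states \<Gamma> \<gamma> ?t \<sigma>) z' i" if "i \<in> {j<..J}" for i
    using selected_mono[OF IH(2) states(1)] step that unfolding split by auto
  have cost: "tree_cost \<Gamma> \<gamma> ?t \<sigma> = (\<Sum>i\<in>{j<..J}. step_cost i (z' i))"
  proof -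
    have "tree_cost \<Gamma> \<gamma> ?t \<sigma> = step_cost ?i y + tree_cost \<Gamma> \<gamma> ?t1 \<sigma>2"
      unfolding cbc_tree.simps tree_cost_seq \<sigma>1_def[symmetric] y(4) \<sigma>2_def[symmetric] z1_def[symmetric] length_compile by simp
    then show ?thesis
      unfolding split IH(3) by (simp add: z_i)
  qed
  show ?case
    unfolding out using z_le steps cost by blast
qed

abbreviation program_tree where "program_tree \<equiv> cbc_program_tree b m w J f B P0"

theorem program_tree_correct:
  defines "z \<equiv> tree_output \<Gamma> \<gamma> program_tree initial_state"
  shows "carries_out_cbc b m w s \<Gamma> \<gamma> program_tree"
    and "j \<in> {1..J} \<Longrightarrow> \<exists>\<sigma>\<in>tree_states \<Gamma> \<gamma> program_tree initial_state. Inv j z (memory \<sigma>)"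
    and "j \<in> {1..J} \<Longrightarrow> z j \<in> unit_residues (n j)"
    and "arithmetic_cost \<Gamma> \<gamma> program_tree = cost P0 + (\<Sum>i=1..J. step_cost i (z i))"
proof -
  let ?t = "cbc_tree A B n J 0 (\<lambda>_. 0)" and ?X = "tree_states \<Gamma> \<gamma> program_tree initial_state"
  define \<sigma> where "\<sigma> = exec_list \<Gamma> \<gamma> (compile P0) initial_state"
  have "memory \<sigma> = assign \<Gamma> \<gamma> (memory initial_state) P0"
    unfolding \<sigma>_def by (rule compile_correct[OF S(2,1)])
  also have "memory initial_state = (\<lambda>_ _. 0)"
    by (simp add: memory_def initial_state_def fun_eq_iff)
  finally have Inv: "Inv 0 (\<lambda>_. 0) (memory \<sigma>)"
    using Inv_0 by simp
  have z: "z = tree_output \<Gamma> \<gamma> ?t \<sigma>"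
    unfolding z_def cbc_program_tree_def tree_output_seq \<sigma>_def ..
  have cost: "arithmetic_cost \<Gamma> \<gamma> program_tree = cost P0 + tree_cost \<Gamma> \<gamma> ?t \<sigma>"
    unfolding arithmetic_cost_def cbc_program_tree_def tree_cost_seq \<sigma>_def length_compile ..
  have states: "tree_states \<Gamma> \<gamma> ?t \<sigma> \<subseteq> tree_states \<Gamma> \<gamma> program_tree initial_state"
    unfolding cbc_program_tree_def \<sigma>_def by (rule tree_states_seq)
  have int: "{0<..J} = {1..J}"
    by auto
  have run: "\<And>i. i \<notin> {1..J} \<Longrightarrow> z i = 0" "\<And>i. i \<in> {1..J} \<Longrightarrow> selected (tree_states \<Gamma> \<gamma> ?t \<sigma>) z i"
    "tree_cost \<Gamma> \<gamma> ?t \<sigma> = (\<Sum>i=1..J. step_cost i (z i))"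
    using run[OF add_0 Inv] unfolding z int by blast+
  have steps: "z i \<in> unit_residues (n i)" "\<forall>y\<in>unit_residues (n i). T z i (z i) \<le> T z i y"
    "\<exists>\<sigma>'\<in>?X. (\<forall>k<n i. memory \<sigma>' 1 k = qbar z i k) \<and> (\<forall>y\<in>unit_residues (n i). memory \<sigma>' 2 y = T z i y)"
    "\<exists>\<sigma>'\<in>?X. Inv i z (memory \<sigma>')" if "i \<in> {1..J}" for i
    by (rule selected_mono[OF run(2)[OF that] states, unfolded selected_def, THEN conjunct1]
      selected_mono[OF run(2)[OF that] states, unfolded selected_def, THEN conjunct2, THEN conjunct1]
      selected_mono[OF run(2)[OF that] states, unfolded selected_def, THEN conjunct2, THEN conjunct2, THEN conjunct1]
      selected_mono[OF run(2)[OF that] states, unfolded selected_def, THEN conjunct2, THEN conjunct2, THEN conjunct2])+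
  show "j \<in> {1..J} \<Longrightarrow> \<exists>\<sigma>\<in>?X. Inv j z (memory \<sigma>)"
    by (rule steps(4))
  show "j \<in> {1..J} \<Longrightarrow> z j \<in> unit_residues (n j)"
    by (rule steps(1))
  have total: "arithmetic_cost \<Gamma> \<gamma> program_tree = cost P0 + (\<Sum>i=1..J. step_cost i (z i))"
    by (simp only: cost run(3))
  then show "arithmetic_cost \<Gamma> \<gamma> program_tree = cost P0 + (\<Sum>i=1..J. step_cost i (z i))" .
  have J_iff: "w j < m \<longleftrightarrow> j \<in> {1..J}" if "j \<in> {1..s}" for j
    unfolding J[symmetric] using that by simp
  have outcome: "reduced_cbc_output b m w s \<Gamma> \<gamma> z"
    unfolding reduced_cbc_output_def
  proof (intro ballI)
    fix j assume j: "j \<in> {1..s}"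
    show "if w j < m then is_arg_min (T z j) (\<lambda>y. y \<in> unit_residues (n j)) (z j) else z j = 0"
    proof (cases "w j < m")
      case True
      then have "j \<in> {1..J}"
        using J_iff[OF j] by simp
      from steps(1,2)[OF this] have "is_arg_min (T z j) (\<lambda>y. y \<in> unit_residues (n j)) (z j)"
        by (auto simp: is_arg_min_def not_less)
      then show ?thesis
        using True by simp
    next
      case False
      then have "z j = 0"
        using J_iff[OF j] by (intro run(1)) simp
      then show ?thesis
        using False by simp
    qed
  qed
  have held: "(\<exists>\<sigma>\<in>tree_states \<Gamma> \<gamma> program_tree initial_state. holds_vector program_tree \<sigma> {..<n j} (qbar z j)) \<and>
      (\<exists>\<sigma>\<in>tree_states \<Gamma> \<gamma> program_tree initial_state. holds_vector program_tree \<sigma> (unit_residues (n j)) (T z j))"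
    if j: "j \<in> {1..J}" for j
  proof -
    obtain \<sigma>' where \<sigma>': "\<sigma>' \<in> ?X" "\<And>k. k < n j \<Longrightarrow> memory \<sigma>' 1 k = qbar z j k"
      "\<And>y. y \<in> unit_residues (n j) \<Longrightarrow> memory \<sigma>' 2 y = T z j y"
      using steps(3)[OF j] by auto
    have reg: "reg a k \<in> tree_registers program_tree" if "(a, k, e) \<in> set (A j)" for a k e
    proof -
      have "reg (fst (a, k, e)) (fst (snd (a, k, e))) \<in> tree_registers ?t"
        by (rule cbc_tree_registers_supset[OF units_ne, where i = j]) (use j that in auto)
      then show ?thesis
        unfolding cbc_program_tree_def tree_registers_seq by simp
    qed
    have r1: "reg 1 k \<in> tree_registers program_tree" if "k < n j" for k
      by (rule reg[of _ _ "f j k"], unfold criterion_program_def set_append set_store)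
        (use that in \<open>intro UnI1 image_eqI[of _ _ k]; simp\<close>)
    have r2: "reg 2 k \<in> tree_registers program_tree" if "k < n j" for k
      by (rule reg[of _ _ "Const_E 0"], unfold criterion_program_def fast_multiply_def set_append set_store)
        (use that in \<open>intro UnI2 UnI1 image_eqI[of _ _ k]; simp\<close>)
    have "holds_vector program_tree \<sigma>' {..<n j} (qbar z j)"
      unfolding holds_vector_def
    proof
      fix k assume "k \<in> {..<n j}"
      then show "\<exists>r\<in>tree_registers program_tree. \<sigma>' r = qbar z j k"
        using \<sigma>'(2)[of k] by (intro bexI[OF _ r1]) (auto simp: memory_def)
    qed
    moreover have "holds_vector program_tree \<sigma>' (unit_residues (n j)) (T z j)"
      unfolding holds_vector_def
    proof
      fix k assume k: "k \<in> unit_residues (n j)"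
      then have "k < n j"
        by (simp add: unit_residues_def)
      then show "\<exists>r\<in>tree_registers program_tree. \<sigma>' r = T z j k"
        using \<sigma>'(3)[OF k] by (intro bexI[OF _ r2]) (auto simp: memory_def)
    qed
    ultimately show ?thesis
      using \<sigma>'(1) by (intro conjI bexI[of _ \<sigma>'])
  qed
  show "carries_out_cbc b m w s \<Gamma> \<gamma> program_tree"
    unfolding carries_out_cbc_def Let_def z_def[symmetric] cbc_steps_eq[OF w] J
    by (rule conjI[OF outcome], intro ballI, rule held)
qed

end

section \<open>Folding in programs and the lengths it reads\<close>

definition previous :: "(nat \<Rightarrow> nat) \<Rightarrow> nat \<Rightarrow> nat" where
  "previous w j = (if j = 1 then 0 else w (j - 1))"

definition folded :: "nat \<Rightarrow> nat \<Rightarrow> (nat \<Rightarrow> nat) \<Rightarrow> nat \<Rightarrow> nat \<Rightarrow> nat \<Rightarrow> expr" where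
  "folded b m w a j k = sum_E (b ^ (w j - previous w j)) (\<lambda>i. Reg_E a (i * b ^ (m - w j) + k))"

lemma expr_val_folded: "expr_val \<Gamma> \<gamma> M (folded b m w a j k) = fold_to b m w j (M a) k"
  by (simp add: folded_def fold_to_def fold_sum_def previous_def)

lemma expr_depth_folded: "expr_depth (folded b m w a j k) \<le> 1"
  unfolding folded_def using expr_depth_sum_E[of "b ^ (w j - previous w j)" _ 0] by simp

lemma expr_cost_folded: "expr_cost (folded b m w a j k) \<le> 1 + 3 * b ^ (w j - previous w j)"
  unfolding folded_def using expr_cost_sum_E[of "b ^ (w j - previous w j)" "\<lambda>i. Reg_E a (i * b ^ (m - w j) + k)" 2] by simp

lemma fold_to_cong:
  assumes "previous w j \<le> w j" "w j \<le> m" "k < b ^ (m - w j)" "\<And>k. k < b ^ (m - previous w j) \<Longrightarrow> v k = v' k"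
  shows "fold_to b m w j v k = fold_to b m w j v' k"
  using assms block_index[OF _ assms(3,1,2)] unfolding fold_to_def fold_sum_def previous_def
  by (intro sum.cong refl) auto

lemma fold_to_const: "fold_to b m w j (\<lambda>_. c) k = real (b ^ (w j - previous w j)) * c"
  by (simp add: fold_to_def fold_sum_def previous_def)

lemma fold_to_sum: "fold_to b m w j (\<lambda>k. \<Sum>l\<in>X. v l k) k = (\<Sum>l\<in>X. fold_to b m w j (v l) k)"
  unfolding fold_to_def fold_sum_def by (rule sum.swap)

text \<open>The adjusted situation with at least one executed step. The condition
  \<open>w 1 = 0\<close> makes the vector read by the first fold as long as the one it
  produces.\<close>

locale reduced_steps =
  fixes b m :: nat and w :: "nat \<Rightarrow> nat" and s J :: nat
  assumes b: "prime b" and w: "reduction_indices w" and w_1: "w 1 = 0"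
    and J: "{j \<in> {1..s}. w j < m} = {1..J}" and J_pos: "1 \<le> J"
begin

abbreviation n where "n j \<equiv> b ^ (m - w j)"
abbreviation n' where "n' j \<equiv> b ^ (m - previous w j)"

lemma b_pos: "b > 0"
  using b prime_gt_0_nat by blast

lemma w_mono: "1 \<le> i \<Longrightarrow> i \<le> j \<Longrightarrow> w i \<le> w j"
  using w by (auto simp: reduction_indices_def mono_on_def)

lemma step:
  assumes "j \<in> {1..J}"
  shows "w j < m" and "j \<le> s" and "previous w j \<le> w j"
proof -
  have "j \<in> {j \<in> {1..s}. w j < m}"
    unfolding J by (rule assms)
  then show "w j < m" "j \<le> s"
    by auto
  show "previous w j \<le> w j"
    using w_mono[of "j - 1" j] assms by (auto simp: previous_def)
qed

lemma n_1: "n 1 = b ^ m"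
  by (simp only: w_1 diff_zero)

lemma n'_1: "n' 1 = n 1"
  by (simp only: previous_def w_1 diff_zero simp_thms if_True)

lemma n'_Suc: "1 \<le> j \<Longrightarrow> n' (Suc j) = n j"
  by (simp add: previous_def)

lemma n_antimono: "1 \<le> i \<Longrightarrow> i \<le> j \<Longrightarrow> n j \<le> n i"
  using w_mono[of i j] b_pos by (intro power_increasing) auto

lemma n'_le: "1 \<le> l \<Longrightarrow> l < j \<Longrightarrow> n' j \<le> n l"
  using n_antimono[of l "j - 1"] by (simp add: previous_def)

lemma n'_le_max: "n' j \<le> b ^ m"
  using b_pos by (intro power_increasing) auto

lemma n_le_max: "n j \<le> b ^ m"
  using b_pos by (intro power_increasing) auto

lemma n_folds: "j \<in> {1..J} \<Longrightarrow> n j * b ^ (w j - previous w j) = n' j"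
  using step[of j] by (simp flip: power_add)

lemma folded_reads:
  assumes "j \<in> {1..J}" "k < n j"
  shows "expr_reads (folded b m w a j k) \<subseteq> {a} \<times> {k..<n' j}"
  using block_index[OF _ assms(2) step(3)[OF assms(1)]] step(1)[OF assms(1)] by (auto simp: folded_def)

text \<open>The length read in step \<open>Suc j\<close> is the length produced in step
  \<open>j\<close>, so the sums agree up to a shift and one additional term for the first step. With
  the weights \<open>j\<close>, the shift costs a factor 2, since
  \<open>j + 1 \<le> 2 * j\<close>.\<close>

lemma sum_n'_le: "(\<Sum>j=1..J. n' j) \<le> 2 * (\<Sum>j=1..J. n j)"
  and sum_index_n'_le: "(\<Sum>j=1..J. j * n' j) \<le> 3 * (\<Sum>j=1..J. j * n j)"
proof -
  have 1: "(\<Sum>j=1..Suc k. n' j) = n 1 + (\<Sum>j=1..k. n j)" for k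
    by (induction k) (simp_all add: n'_1[simplified] n'_Suc)
  have 2: "(\<Sum>j=1..Suc k. j * n' j) \<le> n 1 + 2 * (\<Sum>j=1..k. j * n j)" for k
    by (induction k) (simp_all add: n'_1[simplified] n'_Suc)
  obtain k where k: "J = Suc k"
    using J_pos by (cases J) auto
  have "n 1 \<le> (\<Sum>j=1..J. n j)" "n 1 \<le> (\<Sum>j=1..J. j * n j)"
    using J_pos member_le_sum[of 1 "{1..J}" n] member_le_sum[of 1 "{1..J}" "\<lambda>j. j * n j"] by simp_all
  moreover have "(\<Sum>j=1..k. n j) \<le> (\<Sum>j=1..J. n j)" "(\<Sum>j=1..k. j * n j) \<le> (\<Sum>j=1..J. j * n j)"
    unfolding k by simp_all
  ultimately show "(\<Sum>j=1..J. n' j) \<le> 2 * (\<Sum>j=1..J. n j)" "(\<Sum>j=1..J. j * n' j) \<le> 3 * (\<Sum>j=1..J. j * n j)"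
    using 1[of k] 2[of k] unfolding k[symmetric] by linarith+
qed

lemma confined_criterion:
  assumes "j \<in> {1..J}" "{1..8} \<times> {..<b ^ m} \<subseteq> S"
    and "\<And>k. k < n j \<Longrightarrow> expr_reads (f j k) \<subseteq> S" "\<And>k. expr_depth (f j k) \<le> 10"
  shows "confined S (criterion_program b m w f j)"
  unfolding criterion_program_def confined_append
proof
  show "confined S (store 1 (n j) (f j))"
    using assms n_le_max[of j] by (intro confined_store) auto
  have "{1..8} \<times> {..<n j} \<subseteq> S"
    using n_le_max[of j] assms(2) by auto
  then show "confined S (fast_multiply b (m - w j))"
    by (rule confined_mono[OF confined_fast_multiply[OF b]])
qed

abbreviation fast_cost where "fast_cost \<equiv> 3 + b ^ 4 * (120 * b + 170)"

lemma step_cost_le: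
  assumes j: "j \<in> {1..J}" and f: "n j * (expr_bound + 2) + update_bound \<le> x" "\<And>k. expr_cost (f j k) \<le> expr_bound"
    and B: "cost (B j y) \<le> update_bound"
  shows "cost (criterion_program b m w f j) + length (units (n j)) + cost (B j y) \<le> x + (2 * fast_cost + 1) * ((m - w j) * n j)"
proof -
  let ?r = "m - w j"
  have r: "1 \<le> ?r"
    using step(1)[OF j] by simp
  have "cost (store 1 (n j) (f j)) \<le> n j * (expr_bound + 2)"
    by (rule cost_store_le) (rule f(2))
  moreover have "cost (fast_multiply b ?r) \<le> 2 * fast_cost * (?r * n j)"
  proof -
    have "cost (fast_multiply b ?r) \<le> fast_cost * ((?r + 1) * n j)"
      by (rule cost_fast_multiply[OF b])
    \<comment> \<open>An executed step has \<open>w j < m\<close>, hence \<open>?r \<ge> 1\<close>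
      and \<open>?r + 1 \<le> 2 * ?r\<close>.\<close>
    also have "\<dots> \<le> fast_cost * ((2 * ?r) * n j)"
      using r by (intro mult_le_mono2 mult_le_mono1) simp
    finally show ?thesis
      by (simp only: mult_ac)
  qed
  moreover have "length (units (n j)) \<le> ?r * n j"
    using length_units[of "n j"] mult_le_mono1[OF r, of "n j"] by linarith
  ultimately have "cost (criterion_program b m w f j) + length (units (n j)) + cost (B j y) \<le>
      (n j * (expr_bound + 2) + update_bound) + (2 * fast_cost * (?r * n j) + ?r * n j)"
    using B unfolding criterion_program_def cost_append by linarith
  also have "\<dots> \<le> x + (2 * fast_cost * (?r * n j) + ?r * n j)"
    by (rule add_right_mono[OF f(1)])
  finally show ?thesis
    by (simp only: distrib_right mult_1)
qed

end


text \<open>No array is read after it has been overwritten by an earlier store of the list, so all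
  expressions are evaluated as in the original memory.\<close>

lemma assign_stores:
  assumes "sorted_wrt (\<lambda>l l'. g l \<noteq> g l' \<and> (\<forall>k. expr_reads (h l' k) \<inter> {g l} \<times> UNIV = {})) ls"
    and "\<And>l k k'. l \<in> set ls \<Longrightarrow> k < L \<Longrightarrow> k' < k \<Longrightarrow> (g l, k') \<notin> expr_reads (h l k)"
    and "l \<in> set ls" "k < L"
  shows "assign \<Gamma> \<gamma> M (concat (map (\<lambda>l. store (g l) L (h l)) ls)) (g l) k = expr_val \<Gamma> \<gamma> M (h l k)"
  using assms(1-3)
proof (induction ls arbitrary: M)
  case (Cons x ls)
  let ?M = "assign \<Gamma> \<gamma> M (store (g x) L (h x))"
  let ?P = "concat (map (\<lambda>l. store (g l) L (h l)) ls)"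
  have M: "?M = M(g x := \<lambda>k. if k < L then expr_val \<Gamma> \<gamma> M (h x k) else M (g x) k)"
    by (rule assign_store) (use Cons.prems(2) in simp)
  have split: "assign \<Gamma> \<gamma> M (concat (map (\<lambda>l. store (g l) L (h l)) (x # ls))) = assign \<Gamma> \<gamma> ?M ?P"
    by simp
  show ?case
  proof (cases "l \<in> set ls")
    case True
    have "assign \<Gamma> \<gamma> ?M ?P (g l) k = expr_val \<Gamma> \<gamma> ?M (h l k)"
      by (rule Cons.IH) (use Cons.prems True in auto)
    also have "\<dots> = expr_val \<Gamma> \<gamma> M (h l k)"
    proof (rule expr_val_cong)
      fix a i assume "(a, i) \<in> expr_reads (h l k)"
      then have "a \<noteq> g x"
        using Cons.prems(1) True by auto
      then show "?M a i = M a i"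
        unfolding M by simp
    qed
    finally show ?thesis
      unfolding split .
  next
    case False
    then have "l = x"
      using Cons.prems(3) by simp
    have "assign \<Gamma> \<gamma> ?M ?P (g x) = ?M (g x)"
      by (rule assign_frame) (use Cons.prems(1) in \<open>auto simp: set_store\<close>)
    then show ?thesis
      unfolding split \<open>l = x\<close> using assms(4) by (simp add: M)
  qed
qed simp

subsection \<open>The construction for POD weights\<close>

text \<open>Array \<open>8 + l\<close> holds \<open>q\<^sub>j\<^sub>,\<^sub>l\<close> for \<open>l \<ge> 1\<close>; the vector \<open>q\<^sub>j\<^sub>,\<^sub>0\<close> is constant and need not be stored.\<close>

definition pod_fold :: "nat \<Rightarrow> nat \<Rightarrow> (nat \<Rightarrow> nat) \<Rightarrow> nat \<Rightarrow> nat \<Rightarrow> nat \<Rightarrow> expr" where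
  "pod_fold b m w j l k =
     (if l = 0 then Const_E (int (b ^ w j)) else if l < j then folded b m w (8 + l) j k else Const_E 0)"

definition pod_criterion :: "nat \<Rightarrow> nat \<Rightarrow> (nat \<Rightarrow> nat) \<Rightarrow> nat \<Rightarrow> nat \<Rightarrow> expr" where
  "pod_criterion b m w j k = sum_E j (\<lambda>l. Times_E (Over_E (Order_E (Suc l)) (Order_E l)) (pod_fold b m w j l k))"

definition pod_entry :: "nat \<Rightarrow> nat \<Rightarrow> (nat \<Rightarrow> nat) \<Rightarrow> nat \<Rightarrow> nat \<Rightarrow> nat \<Rightarrow> nat \<Rightarrow> expr" where
  "pod_entry b m w j y l k =
     Plus_E (pod_fold b m w j l k)
       (Times_E (Times_E (Times_E (Over_E (Order_E l) (Order_E (l - 1))) (Product_E j))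
         (Omega_E (k * y mod b ^ (m - w j)) (b ^ (m - w j)))) (pod_fold b m w j (l - 1) k))"

text \<open>The order of \<open>l\<close> is descending, because the vector of order
  \<open>l\<close> is computed from the old vectors of orders \<open>l\<close> and
  \<open>l - 1\<close>.\<close>

definition pod_update :: "nat \<Rightarrow> nat \<Rightarrow> (nat \<Rightarrow> nat) \<Rightarrow> nat \<Rightarrow> nat \<Rightarrow> assignment list" where
  "pod_update b m w j y = concat (map (\<lambda>l. store (8 + l) (b ^ (m - w j)) (pod_entry b m w j y l)) (rev [1..<Suc j]))"

definition pod_invariant ::
  "nat \<Rightarrow> nat \<Rightarrow> (nat \<Rightarrow> nat) \<Rightarrow> (nat \<Rightarrow> real) \<Rightarrow> (nat \<Rightarrow> real) \<Rightarrow> nat \<Rightarrow> (nat \<Rightarrow> nat) \<Rightarrow> (nat \<Rightarrow> nat \<Rightarrow> real) \<Rightarrow> bool" where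
  "pod_invariant b m w \<Gamma> \<gamma> j z M \<longleftrightarrow> (\<forall>l\<in>{1..j}. \<forall>k<b ^ (m - w j). M (8 + l) k = cbc_q b m w \<Gamma> \<gamma> z j l k)"

text \<open>The vector of order \<open>l\<close> appears first in step \<open>l\<close>, with length
  \<open>b ^ (m - w l)\<close>, and only becomes shorter. This staircase keeps the memory within the
  sum of the lengths, although \<open>J\<close> vectors are stored.\<close>

definition pod_addresses :: "nat \<Rightarrow> nat \<Rightarrow> (nat \<Rightarrow> nat) \<Rightarrow> nat \<Rightarrow> (nat \<times> nat) set" where
  "pod_addresses b m w J = {1..8} \<times> {..<b ^ m} \<union> (\<Union>l\<in>{1..J}. {8 + l} \<times> {..<b ^ (m - w l)})"

lemma cbc_q_large: "l > j \<Longrightarrow> cbc_q b m w \<Gamma> \<gamma> z j l k = 0"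
  by (cases j) auto

lemma expr_depth_pod_fold: "expr_depth (pod_fold b m w j l k) \<le> 1"
  using expr_depth_folded by (auto simp: pod_fold_def)

lemma expr_depth_pod: "expr_depth (pod_criterion b m w j k) \<le> 10" "expr_depth (pod_entry b m w j y l k) \<le> 10"
proof -
  have "expr_depth (pod_criterion b m w j k) \<le> Suc 2"
    unfolding pod_criterion_def using expr_depth_pod_fold by (intro expr_depth_sum_E) (auto intro: order_trans)
  then show "expr_depth (pod_criterion b m w j k) \<le> 10"
    by simp
  show "expr_depth (pod_entry b m w j y l k) \<le> 10"
    using expr_depth_pod_fold[of b m w j l k] expr_depth_pod_fold[of b m w j "l - 1" k] by (simp add: pod_entry_def)
qed

lemma pod_fold_reads: "expr_reads (pod_fold b m w j l k) \<subseteq> {8 + l} \<times> {k..} \<and> (l = 0 \<longrightarrow> expr_reads (pod_fold b m w j l k) = {})"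
  by (auto simp: pod_fold_def folded_def)

context reduced_steps begin

abbreviation pod_S where "pod_S \<equiv> pod_addresses b m w J"

lemma pod_fold_confined:
  assumes "j \<in> {1..J}" "k < n j"
  shows "expr_reads (pod_fold b m w j l k) \<subseteq> pod_S"
proof (cases "0 < l \<and> l < j")
  case True
  then have "{8 + l} \<times> {k..<n' j} \<subseteq> {8 + l} \<times> {..<n l}"
    using n'_le[of l j] by auto
  moreover have "{8 + l} \<times> {..<n l} \<subseteq> pod_S"
    unfolding pod_addresses_def using True assms(1) by (intro le_supI2 UN_upper) auto
  ultimately show ?thesis
    using folded_reads[OF assms, of "8 + l"] True by (simp add: pod_fold_def)
next
  case False
  then show ?thesis
    by (auto simp: pod_fold_def)
qed

lemma confined_pod_criterion: "j \<in> {1..J} \<Longrightarrow> confined pod_S (criterion_program b m w (pod_criterion b m w) j)"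
proof (rule confined_criterion)
  fix k assume "j \<in> {1..J}" "k < n j"
  then show "expr_reads (pod_criterion b m w j k) \<subseteq> pod_S"
    using pod_fold_confined[of j k] by (auto simp: pod_criterion_def)
qed (auto simp: expr_depth_pod pod_addresses_def)

lemma confined_pod_update:
  assumes j: "j \<in> {1..J}"
  shows "confined pod_S (pod_update b m w j y)"
  unfolding pod_update_def confined_concat
proof
  fix P assume "P \<in> set (map (\<lambda>l. store (8 + l) (n j) (pod_entry b m w j y l)) (rev [1..<Suc j]))"
  then obtain l where l: "1 \<le> l" "l \<le> j" and P: "P = store (8 + l) (n j) (pod_entry b m w j y l)"
    by auto
  show "confined pod_S P"
    unfolding P
  proof (rule confined_store)
    fix k assume k: "k < n j"
    then have "k < n l"
      using n_antimono[OF l] by simp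
    then have "(8 + l, k) \<in> pod_S"
      unfolding pod_addresses_def using l j by (intro UnI2 UN_I[of l]) auto
    then show "(8 + l, k) \<in> pod_S \<and> expr_reads (pod_entry b m w j y l k) \<subseteq> pod_S \<and> expr_depth (pod_entry b m w j y l k) \<le> 10"
      using pod_fold_confined[OF j k, of l] pod_fold_confined[OF j k, of "l - 1"] expr_depth_pod(2) by (simp add: pod_entry_def)
  qed
qed

lemma card_pod_S: "finite pod_S" "card pod_S \<le> 9 * (\<Sum>j=1..J. n j)"
proof -
  show "finite pod_S"
    by (auto simp: pod_addresses_def)
  have "card pod_S \<le> card ({1..8 :: nat} \<times> {..<b ^ m}) + card (\<Union>l\<in>{1..J}. {8 + l} \<times> {..<n l})"
    unfolding pod_addresses_def by (rule card_Un_le)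
  also have "\<dots> \<le> 8 * b ^ m + (\<Sum>l=1..J. card ({8 + l} \<times> {..<n l}))"
    by (intro add_mono card_UN_le) (auto simp: card_cartesian_product)
  also have "\<dots> = 8 * n 1 + (\<Sum>l=1..J. n l)"
    unfolding n_1 by (simp add: card_cartesian_product)
  also have "n 1 \<le> (\<Sum>l=1..J. n l)"
    using J_pos by (intro member_le_sum) auto
  finally show "card pod_S \<le> 9 * (\<Sum>j=1..J. n j)"
    by simp
qed

lemma expr_cost_pod_fold: "expr_cost (pod_fold b m w j l k) \<le> 1 + 3 * b ^ (w j - previous w j)"
  using expr_cost_folded by (simp add: pod_fold_def)

lemma pod_step_cost:
  assumes j: "j \<in> {1..J}"
  shows "cost (criterion_program b m w (pod_criterion b m w) j) + length (units (n j)) + cost (pod_update b m w j y)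
    \<le> 31 * (j * n' j) + (2 * fast_cost + 1) * ((m - w j) * n j)"
proof (rule step_cost_le[OF j, where expr_bound = "1 + j * (6 + 3 * b ^ (w j - previous w j))"
      and update_bound = "j * (n j * (13 + 6 * b ^ (w j - previous w j)))"])
  let ?c = "b ^ (w j - previous w j)"
  have c: "1 \<le> ?c"
    using b_pos by simp
  show "expr_cost (pod_criterion b m w j k) \<le> 1 + j * (6 + 3 * ?c)" for k
  proof -
    have "expr_cost (pod_criterion b m w j k) \<le> Suc (j * Suc (5 + 3 * ?c))"
      unfolding pod_criterion_def by (rule expr_cost_sum_E) (use expr_cost_pod_fold in simp)
    then show ?thesis
      by simp
  qed
  have "expr_cost (pod_entry b m w j y l k) \<le> 11 + 6 * ?c" for l k
    using expr_cost_pod_fold[of j l k] expr_cost_pod_fold[of j "l - 1" k] by (simp add: pod_entry_def)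
  then have "cost (store (8 + l) (n j) (pod_entry b m w j y l)) \<le> n j * (11 + 6 * ?c + 2)" for l
    by (intro cost_store_le)
  then have "cost (pod_update b m w j y) \<le> length (rev [1..<Suc j]) * (n j * (11 + 6 * ?c + 2))"
    unfolding pod_update_def by (intro cost_concat_map_le)
  also have "length (rev [1..<Suc j]) = j"
    unfolding length_rev length_upt by simp
  also have "11 + 6 * ?c + 2 = 13 + 6 * ?c"
    by simp
  finally show "cost (pod_update b m w j y) \<le> j * (n j * (13 + 6 * ?c))" .
  \<comment> \<open>The constant is \<open>31 = 3 + 9 + 19\<close>; the number of folded blocks
    times the new length is the previous length.\<close>
  have "n j * (1 + j * (6 + 3 * ?c) + 2) + j * (n j * (13 + 6 * ?c)) \<le> n j * (3 * (j * ?c) + j * (9 * ?c)) + j * (n j * (19 * ?c))"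
  proof (rule add_mono[OF mult_le_mono2 mult_le_mono2[OF mult_le_mono2]])
    show "13 + 6 * ?c \<le> 19 * ?c"
      using c by linarith
    have "1 \<le> j * ?c" "j * (6 + 3 * ?c) \<le> j * (9 * ?c)"
      using c j mult_le_mono2[of "6 + 3 * ?c" "9 * ?c" j] by auto
    then show "1 + j * (6 + 3 * ?c) + 2 \<le> 3 * (j * ?c) + j * (9 * ?c)"
      by linarith
  qed
  also have "\<dots> = 31 * (j * n' j)"
    unfolding n_folds[OF j, symmetric] by (simp add: algebra_simps)
  finally show "n j * (1 + j * (6 + 3 * ?c) + 2) + j * (n j * (13 + 6 * ?c)) \<le> 31 * (j * n' j)" .
qed

lemma cbc_q_0:
  assumes "j \<le> J"
  shows "cbc_q b m w \<Gamma> \<gamma> z j 0 = (\<lambda>_. real (b ^ (if j = 0 then 0 else w j)))"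
  using assms
proof (induction j)
  case (Suc j)
  have "previous w (Suc j) = (if j = 0 then 0 else w j)"
    by (simp add: previous_def)
  then have "cbc_q b m w \<Gamma> \<gamma> z (Suc j) 0 = (\<lambda>_. real (b ^ (w (Suc j) - previous w (Suc j))) * real (b ^ previous w (Suc j)))"
    using Suc by (intro ext) (simp add: fold_to_const)
  also have "\<dots> = (\<lambda>_. real (b ^ w (Suc j)))"
    using step(3)[of "Suc j"] Suc.prems by (simp flip: of_nat_mult power_add)
  finally show ?case
    by simp
qed (simp add: fun_eq_iff)

lemma pod_fold_val:
  assumes j: "j < J" and inv: "pod_invariant b m w \<Gamma> \<gamma> j z M" and k: "k < n (Suc j)" and l: "l \<le> Suc j"
  shows "expr_val \<Gamma> \<gamma> M (pod_fold b m w (Suc j) l k) = fold_to b m w (Suc j) (cbc_q b m w \<Gamma> \<gamma> z j l) k"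
proof -
  have i: "Suc j \<in> {1..J}"
    using j by simp
  note st = step[OF i]
  consider "l = 0" | "0 < l" "l \<le> j" | "l = Suc j"
    using l by linarith
  then show ?thesis
  proof cases
    case 1
    have prev: "previous w (Suc j) = (if j = 0 then 0 else w j)"
      by (simp add: previous_def)
    have "fold_to b m w (Suc j) (cbc_q b m w \<Gamma> \<gamma> z j 0) k = real (b ^ (w (Suc j) - previous w (Suc j))) * real (b ^ previous w (Suc j))"
      using cbc_q_0[of j \<Gamma> \<gamma> z] j by (simp only: fold_to_const prev less_imp_le)
    also have "\<dots> = real (b ^ w (Suc j))"
      using st(3) by (simp flip: of_nat_mult power_add)
    finally show ?thesis
      using 1 by (simp add: pod_fold_def)
  next
    case 2
    then have prev: "previous w (Suc j) = w j"
      by (simp add: previous_def)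
    have "fold_to b m w (Suc j) (M (8 + l)) k = fold_to b m w (Suc j) (cbc_q b m w \<Gamma> \<gamma> z j l) k"
      by (rule fold_to_cong[OF st(3) less_imp_le[OF st(1)] k]) (use inv 2 in \<open>simp add: pod_invariant_def prev\<close>)
    then show ?thesis
      using 2 by (simp add: pod_fold_def expr_val_folded)
  next
    case 3
    have "fold_to b m w (Suc j) (cbc_q b m w \<Gamma> \<gamma> z j l) = fold_to b m w (Suc j) (\<lambda>_. 0)"
      using 3 by (intro arg_cong[where f = "fold_to b m w (Suc j)"] ext cbc_q_large) simp
    then show ?thesis
      using 3 by (simp add: pod_fold_def fold_to_const)
  qed
qed

lemma pod_program:
  assumes pod: "pod_parameters s \<Gamma> \<gamma>"
  shows "cbc_program b m w s \<Gamma> \<gamma> J (pod_criterion b m w) (pod_update b m w) [] pod_S (pod_invariant b m w \<Gamma> \<gamma>)"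
proof unfold_locales
  show "proper_addresses pod_S"
    by (auto simp: proper_addresses_def pod_addresses_def)
  show "confined pod_S []"
    by (simp add: confined_def)
  show "expr_reads (pod_criterion b m w j k) \<subseteq> {9..} \<times> UNIV" for j k
  proof -
    have "expr_reads (pod_fold b m w j l k) \<subseteq> {9..} \<times> UNIV" for l
      using pod_fold_reads[of b m w j l k] by (cases l) auto
    then show ?thesis
      by (auto simp: pod_criterion_def)
  qed
  show "expr_val \<Gamma> \<gamma> M (pod_criterion b m w (Suc j) k) = cbc_qbar b m w \<Gamma> \<gamma> z (Suc j) k"
    if "j < J" "pod_invariant b m w \<Gamma> \<gamma> j z M" "k < n (Suc j)" for j z M k
  proof -
    have "expr_val \<Gamma> \<gamma> M (pod_criterion b m w (Suc j) k) =
        (\<Sum>l<Suc j. \<Gamma> (Suc l) / \<Gamma> l * fold_to b m w (Suc j) (cbc_q b m w \<Gamma> \<gamma> z j l) k)"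
      unfolding pod_criterion_def expr_val_sum_E using pod_fold_val[OF that] by (intro sum.cong refl) simp
    also have "\<dots> = cbc_qbar b m w \<Gamma> \<gamma> z (Suc j) k"
      unfolding cbc_qbar_def One_nat_def sum.atLeast1_atMost_eq by simp
    finally show ?thesis .
  qed
  show "pod_invariant b m w \<Gamma> \<gamma> j z M'" if "pod_invariant b m w \<Gamma> \<gamma> j z M" "\<And>a. a \<ge> 9 \<Longrightarrow> M' a = M a" for j z M M'
    using that by (simp add: pod_invariant_def)
  show "pod_invariant b m w \<Gamma> \<gamma> j z' M" if "pod_invariant b m w \<Gamma> \<gamma> j z M" "\<And>i. 1 \<le> i \<Longrightarrow> i \<le> j \<Longrightarrow> z i = z' i" for j z z' M
    using that(1) cbc_q_cong[of j z z' b m w \<Gamma> \<gamma>, OF that(2)] by (simp add: pod_invariant_def)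
  show "pod_invariant b m w \<Gamma> \<gamma> 0 (\<lambda>_. 0) (assign \<Gamma> \<gamma> (\<lambda>_ _. 0) [])"
    by (simp add: pod_invariant_def)
  show "pod_invariant b m w \<Gamma> \<gamma> (Suc j) (z(Suc j := y)) (assign \<Gamma> \<gamma> M (pod_update b m w (Suc j) y))"
    if j: "j < J" and inv: "pod_invariant b m w \<Gamma> \<gamma> j z M" for j z M y
    unfolding pod_invariant_def
  proof (intro ballI allI impI)
    fix l k assume l: "l \<in> {1..Suc j}" and k: "k < n (Suc j)"
    let ?z = "z(Suc j := y)"
    have q: "cbc_q b m w \<Gamma> \<gamma> ?z j = cbc_q b m w \<Gamma> \<gamma> z j"
      by (rule cbc_q_cong) simp
    have sorted: "sorted_wrt (\<lambda>l l'. 8 + l \<noteq> 8 + l' \<and> (\<forall>k. expr_reads (pod_entry b m w (Suc j) y l' k) \<inter> {8 + l} \<times> UNIV = {})) (rev [1..<Suc (Suc j)])"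
      unfolding sorted_wrt_rev
    proof (rule sorted_wrt_mono_rel[OF _ sorted_wrt_upt])
      fix l l' :: nat assume "l < l'"
      moreover have "expr_reads (pod_entry b m w (Suc j) y l k) \<subseteq> {..8 + l} \<times> UNIV" for k
        using pod_fold_reads[of b m w "Suc j" l k] pod_fold_reads[of b m w "Suc j" "l - 1" k] by (auto simp: pod_entry_def)
      ultimately show "8 + l' \<noteq> 8 + l \<and> (\<forall>k. expr_reads (pod_entry b m w (Suc j) y l k) \<inter> {8 + l'} \<times> UNIV = {})"
        by fastforce
    qed
    have "(8 + l, k') \<notin> expr_reads (pod_entry b m w (Suc j) y l k)" if "k' < k" for l k k'
      using that pod_fold_reads[of b m w "Suc j" l k] pod_fold_reads[of b m w "Suc j" "l - 1" k] by (auto simp: pod_entry_def)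
    then have "assign \<Gamma> \<gamma> M (pod_update b m w (Suc j) y) (8 + l) k = expr_val \<Gamma> \<gamma> M (pod_entry b m w (Suc j) y l k)"
      unfolding pod_update_def using l k by (intro assign_stores[OF sorted]) auto
    also have "\<dots> = fold_to b m w (Suc j) (cbc_q b m w \<Gamma> \<gamma> z j l) k +
        \<Gamma> l / \<Gamma> (l - 1) * \<gamma> (Suc j) * omega_matrix (n (Suc j)) y k * fold_to b m w (Suc j) (cbc_q b m w \<Gamma> \<gamma> z j (l - 1)) k"
      using l pod_fold_val[OF j inv k, of l] pod_fold_val[OF j inv k, of "l - 1"] by (simp add: pod_entry_def omega_matrix_def le_diff_conv)
    also have "\<dots> = cbc_q b m w \<Gamma> \<gamma> ?z (Suc j) l k"
      using l by (simp add: q)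
    finally show "assign \<Gamma> \<gamma> M (pod_update b m w (Suc j) y) (8 + l) k = cbc_q b m w \<Gamma> \<gamma> ?z (Suc j) l k" .
  qed
qed (use b w pod J confined_pod_criterion confined_pod_update in simp_all)

end


subsection \<open>The construction for product weights\<close>

text \<open>Array 9 holds the sum of \<open>q\<^sub>j\<^sub>,\<^sub>l\<close> over \<open>l\<close>, whose folded vector is the next \<open>cbc_qbar\<close>.\<close>

definition product_update :: "nat \<Rightarrow> nat \<Rightarrow> (nat \<Rightarrow> nat) \<Rightarrow> nat \<Rightarrow> nat \<Rightarrow> assignment list" where
  "product_update b m w j y = store 9 (b ^ (m - w j)) (\<lambda>k. Plus_E (Reg_E 1 k)
     (Times_E (Times_E (Product_E j) (Omega_E (k * y mod b ^ (m - w j)) (b ^ (m - w j)))) (Reg_E 1 k)))"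

text \<open>The length is the one read by the next fold; this covers the start \<open>j = 0\<close>,
  where it is \<open>b ^ m\<close>.\<close>

definition product_invariant ::
  "nat \<Rightarrow> nat \<Rightarrow> (nat \<Rightarrow> nat) \<Rightarrow> (nat \<Rightarrow> real) \<Rightarrow> nat \<Rightarrow> (nat \<Rightarrow> nat) \<Rightarrow> (nat \<Rightarrow> nat \<Rightarrow> real) \<Rightarrow> bool" where
  "product_invariant b m w \<gamma> j z M \<longleftrightarrow>
     (\<forall>k<b ^ (m - previous w (Suc j)). M 9 k = (\<Sum>l\<le>j. cbc_q b m w (\<lambda>_. 1) \<gamma> z j l k))"

context reduced_steps begin

abbreviation product_S :: "(nat \<times> nat) set" where "product_S \<equiv> {1..9} \<times> {..<b ^ m}"
abbreviation product_start where "product_start \<equiv> store 9 (b ^ m) (\<lambda>_. Const_E 1)"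

lemma confined_product_criterion: "j \<in> {1..J} \<Longrightarrow> confined product_S (criterion_program b m w (folded b m w 9) j)"
proof (rule confined_criterion)
  fix k assume j: "j \<in> {1..J}" "k < n j"
  have "{9} \<times> {k..<n' j} \<subseteq> product_S"
    using n'_le_max[of j] by auto
  with folded_reads[OF j] show "expr_reads (folded b m w 9 j k) \<subseteq> product_S"
    by (rule order_trans)
qed (auto intro: order_trans[OF expr_depth_folded])

lemma confined_product_update: "confined product_S (product_update b m w j y)"
  unfolding product_update_def using n_le_max[of j] by (intro confined_store) auto

lemma product_step_cost:
  assumes j: "j \<in> {1..J}"
  shows "cost (criterion_program b m w (folded b m w 9) j) + length (units (n j)) + cost (product_update b m w j y)
    \<le> 17 * n' j + (2 * fast_cost + 1) * ((m - w j) * n j)"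
proof (rule step_cost_le[OF j, where expr_bound = "1 + 3 * b ^ (w j - previous w j)" and update_bound = "n j * (9 + 2)"])
  let ?c = "b ^ (w j - previous w j)"
  have c: "1 \<le> ?c"
    using b_pos by simp
  show "expr_cost (folded b m w 9 j k) \<le> 1 + 3 * ?c" for k
    by (rule expr_cost_folded)
  show "cost (product_update b m w j y) \<le> n j * (9 + 2)"
    unfolding product_update_def by (rule cost_store_le) simp
  have "n j * (1 + 3 * ?c + 2) + n j * (9 + 2) = n j * (14 + 3 * ?c)"
    by (simp add: algebra_simps)
  also have "\<dots> \<le> n j * (17 * ?c)"
    using c by (intro mult_le_mono2) linarith
  finally show "n j * (1 + 3 * ?c + 2) + n j * (9 + 2) \<le> 17 * n' j"
    unfolding n_folds[OF j, symmetric] by (simp only: mult_ac)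
qed

lemma fold_product_invariant:
  assumes j: "j < J" and inv: "product_invariant b m w \<gamma> j z M" and k: "k < n (Suc j)"
  shows "fold_to b m w (Suc j) (M 9) k = (\<Sum>l\<le>j. fold_to b m w (Suc j) (cbc_q b m w (\<lambda>_. 1) \<gamma> z j l) k)"
    and "fold_to b m w (Suc j) (M 9) k = cbc_qbar b m w (\<lambda>_. 1) \<gamma> z (Suc j) k"
proof -
  have i: "Suc j \<in> {1..J}"
    using j by simp
  have "fold_to b m w (Suc j) (M 9) k = fold_to b m w (Suc j) (\<lambda>k. \<Sum>l\<le>j. cbc_q b m w (\<lambda>_. 1) \<gamma> z j l k) k"
    by (rule fold_to_cong[OF step(3)[OF i] less_imp_le[OF step(1)[OF i]] k]) (use inv in \<open>simp add: product_invariant_def\<close>)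
  then show 1: "fold_to b m w (Suc j) (M 9) k = (\<Sum>l\<le>j. fold_to b m w (Suc j) (cbc_q b m w (\<lambda>_. 1) \<gamma> z j l) k)"
    by (simp only: fold_to_sum)
  show "fold_to b m w (Suc j) (M 9) k = cbc_qbar b m w (\<lambda>_. 1) \<gamma> z (Suc j) k"
    unfolding 1 cbc_qbar_def One_nat_def sum.atLeast1_atMost_eq by (simp flip: lessThan_Suc_atMost)
qed

lemma product_program:
  assumes pod: "pod_parameters s (\<lambda>_. 1) \<gamma>"
  shows "cbc_program b m w s (\<lambda>_. 1) \<gamma> J (folded b m w 9) (product_update b m w) product_start product_S (product_invariant b m w \<gamma>)"
proof unfold_locales
  show "proper_addresses product_S"
    by (auto simp: proper_addresses_def)
  show "confined product_S product_start"
    by (intro confined_store) auto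
  show "expr_reads (folded b m w 9 j k) \<subseteq> {9..} \<times> UNIV" for j k
    by (auto simp: folded_def)
  show "expr_val (\<lambda>_. 1) \<gamma> M (folded b m w 9 (Suc j) k) = cbc_qbar b m w (\<lambda>_. 1) \<gamma> z (Suc j) k"
    if "j < J" "product_invariant b m w \<gamma> j z M" "k < n (Suc j)" for j z M k
    unfolding expr_val_folded by (rule fold_product_invariant(2)[OF that])
  show "product_invariant b m w \<gamma> j z M'" if "product_invariant b m w \<gamma> j z M" "\<And>a. a \<ge> 9 \<Longrightarrow> M' a = M a" for j z M M'
    using that by (simp add: product_invariant_def)
  show "product_invariant b m w \<gamma> j z' M" if "product_invariant b m w \<gamma> j z M" "\<And>i. 1 \<le> i \<Longrightarrow> i \<le> j \<Longrightarrow> z i = z' i" for j z z' M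
    using that(1) cbc_q_cong[of j z z' b m w "\<lambda>_. 1" \<gamma>, OF that(2)] by (simp add: product_invariant_def)
  show "product_invariant b m w \<gamma> 0 (\<lambda>_. 0) (assign (\<lambda>_. 1) \<gamma> (\<lambda>_ _. 0) product_start)"
    by (subst assign_store) (simp_all add: product_invariant_def previous_def)
  show "product_invariant b m w \<gamma> (Suc j) (z(Suc j := y)) (assign (\<lambda>_. 1) \<gamma> M (product_update b m w (Suc j) y))"
    if j: "j < J" and inv: "product_invariant b m w \<gamma> j z M"
      and M1: "\<And>k. k < n (Suc j) \<Longrightarrow> M 1 k = cbc_qbar b m w (\<lambda>_. 1) \<gamma> z (Suc j) k" for j z M y
    unfolding product_invariant_def
  proof (intro allI impI)
    fix k assume "k < n' (Suc (Suc j))"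
    then have k: "k < n (Suc j)"
      by (simp add: previous_def)
    let ?z = "z(Suc j := y)"
    let ?F = "\<lambda>l. fold_to b m w (Suc j) (cbc_q b m w (\<lambda>_. 1) \<gamma> z j l) k"
    have q: "cbc_q b m w (\<lambda>_. 1) \<gamma> ?z j = cbc_q b m w (\<lambda>_. 1) \<gamma> z j"
      by (rule cbc_q_cong) simp
    have "fold_to b m w (Suc j) (cbc_q b m w (\<lambda>_. 1) \<gamma> z j (Suc j)) = fold_to b m w (Suc j) (\<lambda>_. 0)"
      by (intro arg_cong[where f = "fold_to b m w (Suc j)"] ext cbc_q_large) simp
    then have F_last: "?F (Suc j) = 0"
      by (simp add: fold_to_const)
    have M1_F: "M 1 k = (\<Sum>l\<le>j. ?F l)"
      using fold_product_invariant[OF j inv k] M1[OF k] by simp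
    have "(\<Sum>l\<le>Suc j. cbc_q b m w (\<lambda>_. 1) \<gamma> ?z (Suc j) l k) = ?F 0 + (\<Sum>l\<le>j. cbc_q b m w (\<lambda>_. 1) \<gamma> ?z (Suc j) (Suc l) k)"
      unfolding sum.atMost_Suc_shift by (simp add: q)
    also have "(\<Sum>l\<le>j. cbc_q b m w (\<lambda>_. 1) \<gamma> ?z (Suc j) (Suc l) k) =
        (\<Sum>l\<le>j. ?F (Suc l) + \<gamma> (Suc j) * omega_matrix (n (Suc j)) y k * ?F l)"
      by (intro sum.cong refl) (simp add: q)
    \<comment> \<open>The two sums over \<open>l\<close> differ only by the term of order
      \<open>Suc j\<close>, which vanishes. Summed over all orders, the recursion is thus
      multiplication by 1 plus \<gamma> times \<omega>.\<close>
    also have "?F 0 + \<dots> = (\<Sum>l\<le>Suc j. ?F l) + \<gamma> (Suc j) * omega_matrix (n (Suc j)) y k * (\<Sum>l\<le>j. ?F l)"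
      unfolding sum.atMost_Suc_shift sum.distrib sum_distrib_left by simp
    also have "(\<Sum>l\<le>Suc j. ?F l) = (\<Sum>l\<le>j. ?F l)"
      using F_last by simp
    finally have "(\<Sum>l\<le>Suc j. cbc_q b m w (\<lambda>_. 1) \<gamma> ?z (Suc j) l k) = M 1 k + \<gamma> (Suc j) * omega_matrix (n (Suc j)) y k * M 1 k"
      unfolding M1_F .
    moreover have "assign (\<lambda>_. 1) \<gamma> M (product_update b m w (Suc j) y) 9 k = M 1 k + \<gamma> (Suc j) * omega_matrix (n (Suc j)) y k * M 1 k"
      unfolding product_update_def using k by (subst assign_store) (simp_all add: omega_matrix_def)
    ultimately show "assign (\<lambda>_. 1) \<gamma> M (product_update b m w (Suc j) y) 9 k = (\<Sum>l\<le>Suc j. cbc_q b m w (\<lambda>_. 1) \<gamma> ?z (Suc j) l k)"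
      by (simp only:)
  qed
qed (use b w pod J confined_product_criterion confined_product_update in simp_all)

theorem pod_tree:
  defines "t \<equiv> cbc_program_tree b m w J (pod_criterion b m w) (pod_update b m w) []"
  shows "pod_parameters s \<Gamma> \<gamma> \<Longrightarrow> carries_out_pod_cbc b m w s \<Gamma> \<gamma> t"
    and "pod_parameters s \<Gamma> \<gamma> \<Longrightarrow> arithmetic_cost \<Gamma> \<gamma> t \<le> (2 * fast_cost + 94) * (\<Sum>j=1..J. (m - w j + j) * n j)"
    and "memory_cost t \<le> 21 * (\<Sum>j=1..J. n j)"
proof -
  have run: "carries_out_pod_cbc b m w s \<Gamma> \<gamma> t \<and> arithmetic_cost \<Gamma> \<gamma> t \<le> (2 * fast_cost + 94) * (\<Sum>j=1..J. (m - w j + j) * n j)"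
    if pod: "pod_parameters s \<Gamma> \<gamma>"
  proof
    interpret C: cbc_program b m w s \<Gamma> \<gamma> J "pod_criterion b m w" "pod_update b m w" "[]" pod_S "pod_invariant b m w \<Gamma> \<gamma>"
      by (rule pod_program[OF pod])
    define z where "z = tree_output \<Gamma> \<gamma> t initial_state"
    note correct = C.program_tree_correct[folded t_def, folded z_def]
    have held: "\<exists>\<sigma>\<in>tree_states \<Gamma> \<gamma> t initial_state. \<forall>l\<in>{1..j}. holds_vector t \<sigma> {..<b ^ (m - w j)} (cbc_q b m w \<Gamma> \<gamma> z j l)"
      if j: "j \<in> {1..J}" for j
    proof -
      obtain \<sigma> where \<sigma>: "\<sigma> \<in> tree_states \<Gamma> \<gamma> t initial_state" "pod_invariant b m w \<Gamma> \<gamma> j z (memory \<sigma>)"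
        using correct(2)[OF j] by (elim bexE)
      have reg: "reg (8 + l) k \<in> tree_registers t" if l: "l \<in> {1..j}" and k: "k < b ^ (m - w j)" for l k
      proof -
        let ?x = "(8 + l, k, pod_entry b m w j (z j) l k)"
        have "?x \<in> set (pod_update b m w j (z j))"
          unfolding pod_update_def set_concat set_map set_rev using l k
          by (intro UnionI[of "set (store (8 + l) (b ^ (m - w j)) (pod_entry b m w j (z j) l))"] imageI) (auto simp: set_store)
        with correct(3)[OF j] have "\<exists>y\<in>unit_residues (b ^ (m - w j)). ?x \<in> set (pod_update b m w j y)"
          by (rule bexI[rotated])
        then have "reg (fst ?x) (fst (snd ?x)) \<in> tree_registers (cbc_tree (criterion_program b m w (pod_criterion b m w)) (pod_update b m w) (\<lambda>j. b ^ (m - w j)) J 0 (\<lambda>_. 0))"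
          by (intro cbc_tree_registers_supset[where i = j] C.units_ne disjI2) (use j in auto)
        then show ?thesis
          unfolding t_def cbc_program_tree_def tree_registers_seq by simp
      qed
      have "holds_vector t \<sigma> {..<b ^ (m - w j)} (cbc_q b m w \<Gamma> \<gamma> z j l)" if l: "l \<in> {1..j}" for l
        unfolding holds_vector_def
      proof
        fix k assume "k \<in> {..<b ^ (m - w j)}"
        then have k: "k < b ^ (m - w j)"
          by simp
        have "\<sigma> (reg (8 + l) k) = cbc_q b m w \<Gamma> \<gamma> z j l k"
          using \<sigma>(2) l k by (simp add: pod_invariant_def memory_def)
        then show "\<exists>r\<in>tree_registers t. \<sigma> r = cbc_q b m w \<Gamma> \<gamma> z j l k"
          by (rule bexI[OF _ reg[OF l k]])
      qed
      with \<sigma>(1) show ?thesis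
        by (intro bexI[of _ \<sigma>] ballI)
    qed
    show "carries_out_pod_cbc b m w s \<Gamma> \<gamma> t"
      unfolding carries_out_pod_cbc_def Let_def z_def[symmetric] cbc_steps_eq[OF w] J
      by (rule conjI[OF correct(1)], rule ballI, rule held)
    have "arithmetic_cost \<Gamma> \<gamma> t = (\<Sum>j=1..J. cost (criterion_program b m w (pod_criterion b m w) j) + length (units (b ^ (m - w j))) + cost (pod_update b m w j (z j)))"
      using correct(4) by simp
    also have "\<dots> \<le> (\<Sum>j=1..J. 31 * (j * b ^ (m - previous w j)) + (2 * fast_cost + 1) * ((m - w j) * b ^ (m - w j)))"
      by (intro sum_mono pod_step_cost)
    also have "\<dots> = 31 * (\<Sum>j=1..J. j * b ^ (m - previous w j)) + (2 * fast_cost + 1) * (\<Sum>j=1..J. (m - w j) * b ^ (m - w j))"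
      by (simp only: sum.distrib sum_distrib_left)
    \<comment> \<open>Here \<open>93 = 31 * 3\<close>, the factor 3 coming from the shift of the
      lengths.\<close>
    also have "\<dots> \<le> 93 * (\<Sum>j=1..J. j * b ^ (m - w j)) + (2 * fast_cost + 1) * (\<Sum>j=1..J. (m - w j) * b ^ (m - w j))"
      using sum_index_n'_le by linarith
    also have "\<dots> \<le> (2 * fast_cost + 94) * (\<Sum>j=1..J. j * b ^ (m - w j)) + (2 * fast_cost + 94) * (\<Sum>j=1..J. (m - w j) * b ^ (m - w j))"
      by (intro add_mono mult_le_mono1) simp_all
    also have "\<dots> = (2 * fast_cost + 94) * (\<Sum>j=1..J. (m - w j + j) * b ^ (m - w j))"
      by (simp only: distrib_left[symmetric] sum.distrib[symmetric] distrib_right[symmetric] add.commute)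
    finally show "arithmetic_cost \<Gamma> \<gamma> t \<le> (2 * fast_cost + 94) * (\<Sum>j=1..J. (m - w j + j) * b ^ (m - w j))" .
  qed
  show "pod_parameters s \<Gamma> \<gamma> \<Longrightarrow> carries_out_pod_cbc b m w s \<Gamma> \<gamma> t"
    by (rule run[THEN conjunct1])
  show "pod_parameters s \<Gamma> \<gamma> \<Longrightarrow> arithmetic_cost \<Gamma> \<gamma> t \<le> (2 * fast_cost + 94) * (\<Sum>j=1..J. (m - w j + j) * n j)"
    by (rule run[THEN conjunct2])
  have "memory_cost t \<le> card pod_S + 12"
    unfolding t_def
  proof (rule memory_cost_program_tree[OF b card_pod_S(1)])
    show "confined pod_S []"
      by (simp add: confined_def)
    show "(2, y) \<in> pod_S" if "y < n i" for i y
      using that n_le_max[of i] by (auto simp: pod_addresses_def)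
  qed (rule confined_pod_criterion confined_pod_update, assumption)+
  \<comment> \<open>Here \<open>21 = 9 + 12\<close>: the twelve temporaries are absorbed because the
    sum of the lengths is at least 1.\<close>
  also have "\<dots> \<le> 21 * (\<Sum>j=1..J. n j)"
  proof -
    have "n 1 \<le> (\<Sum>j=1..J. n j)"
      using J_pos by (intro member_le_sum) auto
    moreover have "1 \<le> n 1"
      using b_pos by simp
    ultimately show ?thesis
      using card_pod_S(2) by linarith
  qed
  finally show "memory_cost t \<le> 21 * (\<Sum>j=1..J. n j)" .
qed

theorem product_tree:
  defines "t \<equiv> cbc_program_tree b m w J (folded b m w 9) (product_update b m w) product_start"
  shows "pod_parameters s (\<lambda>_. 1) \<gamma> \<Longrightarrow> carries_out_cbc b m w s (\<lambda>_. 1) \<gamma> t"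
    and "pod_parameters s (\<lambda>_. 1) \<gamma> \<Longrightarrow> arithmetic_cost (\<lambda>_. 1) \<gamma> t \<le> (2 * fast_cost + 38) * (\<Sum>j=1..J. (m - w j) * n j)"
    and "memory_cost t \<le> 21 * n 1"
proof -
  have run: "carries_out_cbc b m w s (\<lambda>_. 1) \<gamma> t \<and> arithmetic_cost (\<lambda>_. 1) \<gamma> t \<le> (2 * fast_cost + 38) * (\<Sum>j=1..J. (m - w j) * n j)"
    if pod: "pod_parameters s (\<lambda>_. 1) \<gamma>"
  proof
    interpret C: cbc_program b m w s "\<lambda>_. 1" \<gamma> J "folded b m w 9" "product_update b m w" product_start product_S "product_invariant b m w \<gamma>"
      by (rule product_program[OF pod])
    define z where "z = tree_output (\<lambda>_. 1) \<gamma> t initial_state"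
    note correct = C.program_tree_correct[folded t_def, folded z_def]
    show "carries_out_cbc b m w s (\<lambda>_. 1) \<gamma> t"
      by (rule correct(1))
    let ?N = "\<Sum>j=1..J. b ^ (m - w j)" and ?R = "\<Sum>j=1..J. (m - w j) * b ^ (m - w j)"
    have "b ^ (m - w j) \<le> (m - w j) * b ^ (m - w j)" if "j \<in> {1..J}" for j
    proof -
      have "1 \<le> m - w j"
        using step(1)[OF that] by linarith
      then have "1 * b ^ (m - w j) \<le> (m - w j) * b ^ (m - w j)"
        by (rule mult_le_mono1)
      then show ?thesis
        by (simp only: mult_1)
    qed
    then have NR: "?N \<le> ?R"
      by (rule sum_mono)
    \<comment> \<open>Initialising the vector of length \<open>b ^ m\<close> is affordable, because
      with \<open>w 1 = 0\<close> this is the length of the first step.\<close>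
    have start: "cost product_start \<le> 3 * ?R"
    proof -
      have "b ^ m \<le> ?R"
        by (rule order_trans[OF _ NR], unfold n_1[symmetric]) (use J_pos in \<open>intro member_le_sum; auto\<close>)
      then have "3 * b ^ m \<le> 3 * ?R"
        by (rule mult_le_mono2)
      moreover have "cost product_start \<le> 3 * b ^ m"
        using cost_store_le[of "b ^ m" "\<lambda>_. Const_E 1" 1 9] by simp
      ultimately show ?thesis
        by (rule order_trans[rotated])
    qed
    have "arithmetic_cost (\<lambda>_. 1) \<gamma> t = cost product_start + (\<Sum>j=1..J. cost (criterion_program b m w (folded b m w 9) j) + length (units (b ^ (m - w j))) + cost (product_update b m w j (z j)))"
      by (rule correct(4))
    also have "\<dots> \<le> 3 * ?R + (\<Sum>j=1..J. 17 * b ^ (m - previous w j) + (2 * fast_cost + 1) * ((m - w j) * b ^ (m - w j)))"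
      by (intro add_mono sum_mono product_step_cost start)
    also have "\<dots> = 3 * ?R + (17 * (\<Sum>j=1..J. b ^ (m - previous w j)) + (2 * fast_cost + 1) * ?R)"
      by (simp only: sum.distrib sum_distrib_left)
    also have "\<dots> \<le> 3 * ?R + (17 * (2 * ?R) + (2 * fast_cost + 1) * ?R)"
      using sum_n'_le NR by linarith
    \<comment> \<open>\<open>38 = 3 + 34 + 1\<close>: initialisation, folding and updating with
      shifted lengths, and comparisons.\<close>
    also have "\<dots> = (2 * fast_cost + 38) * ?R"
      by (simp add: distrib_right)
    finally show "arithmetic_cost (\<lambda>_. 1) \<gamma> t \<le> (2 * fast_cost + 38) * ?R" .
  qed
  show "pod_parameters s (\<lambda>_. 1) \<gamma> \<Longrightarrow> carries_out_cbc b m w s (\<lambda>_. 1) \<gamma> t"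
    by (rule run[THEN conjunct1])
  show "pod_parameters s (\<lambda>_. 1) \<gamma> \<Longrightarrow> arithmetic_cost (\<lambda>_. 1) \<gamma> t \<le> (2 * fast_cost + 38) * (\<Sum>j=1..J. (m - w j) * n j)"
    by (rule run[THEN conjunct2])
  have "memory_cost t \<le> card product_S + 12"
    unfolding t_def
  proof (rule memory_cost_program_tree[OF b])
    show "confined product_S product_start"
      by (intro confined_store) auto
    show "(2, y) \<in> product_S" if "y < n i" for i y
      using that n_le_max[of i] by auto
    show "finite product_S"
      by simp
  qed (erule confined_product_criterion, rule confined_product_update)
  also have "card product_S = 9 * n 1"
    unfolding n_1 by (simp add: card_cartesian_product)
  also have "9 * n 1 + 12 \<le> 21 * n 1"
    using b_pos by simp
  finally show "memory_cost t \<le> 21 * n 1" .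
qed

end

section \<open>Assembling the trees and the theorem\<close>

lemma carries_out_no_steps:
  assumes w: "reduction_indices w" and none: "{j \<in> {1..s}. w j < m} = {}"
  shows "carries_out_pod_cbc b m w s \<Gamma> \<gamma> (Halt (\<lambda>_. 0))"
proof -
  have "\<not> w j < m" if "j \<in> {1..s}" for j
    using none that by blast
  moreover have "cbc_steps s m w = {}"
    unfolding cbc_steps_eq[OF w] by (rule none)
  ultimately show ?thesis
    by (simp add: carries_out_pod_cbc_def carries_out_cbc_def reduced_cbc_output_def)
qed

text \<open>The programs are determined by \<open>b\<close>, the adjusted indices and the number of
  steps, so one tree serves all weights. If no step is executed, the cost bounds are empty sums in
  the first claim, which the tree consisting of \<open>Halt\<close> meets.\<close>

lemma ex_cbc_trees:
  fixes b m s :: nat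
  assumes b: "prime b" and w: "reduction_indices w"
  defines "steps \<equiv> cbc_steps s m w"
  shows "\<exists>t. (\<forall>\<Gamma> \<gamma>. pod_parameters s \<Gamma> \<gamma> \<longrightarrow> carries_out_pod_cbc b (adjust_m m w) (adjust_w w) s \<Gamma> \<gamma> t \<and>
      arithmetic_cost \<Gamma> \<gamma> t \<le> (2 * (3 + b ^ 4 * (120 * b + 170)) + 94) * (\<Sum>j\<in>steps. (m - w j + j) * b ^ (m - w j))) \<and>
    memory_cost t \<le> 21 * (\<Sum>j\<in>steps. b ^ (m - w j))"
    and "\<exists>t. (\<forall>\<gamma>. pod_parameters s (\<lambda>_. 1) \<gamma> \<longrightarrow> carries_out_cbc b (adjust_m m w) (adjust_w w) s (\<lambda>_. 1) \<gamma> t \<and>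
      arithmetic_cost (\<lambda>_. 1) \<gamma> t \<le> (2 * (3 + b ^ 4 * (120 * b + 170)) + 38) * (\<Sum>j\<in>steps. (m - w j) * b ^ (m - w j))) \<and>
    memory_cost t \<le> 21 * b ^ (m - w 1)"
proof -
  let ?m = "adjust_m m w" and ?w = "adjust_w w"
  have w': "reduction_indices ?w"
    by (rule reduction_indices_adjust[OF w])
  obtain J where J: "{j \<in> {1..s}. w j < m} = {1..J}"
    using steps_interval[OF w] by metis
  have J': "{j \<in> {1..s}. ?w j < ?m} = {1..J}"
    unfolding J[symmetric] using adjust_diff(2)[OF w] by auto
  have steps: "steps = {1..J}"
    unfolding steps_def cbc_steps_eq[OF w] J ..
  have diff: "?m - ?w j = m - w j" if "j \<in> {1..J}" for j
    using adjust_diff(1)[OF w, of j] that by simp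
  have "(\<exists>t. (\<forall>\<Gamma> \<gamma>. pod_parameters s \<Gamma> \<gamma> \<longrightarrow> carries_out_pod_cbc b ?m ?w s \<Gamma> \<gamma> t \<and>
      arithmetic_cost \<Gamma> \<gamma> t \<le> (2 * (3 + b ^ 4 * (120 * b + 170)) + 94) * (\<Sum>j=1..J. (m - w j + j) * b ^ (m - w j))) \<and>
    memory_cost t \<le> 21 * (\<Sum>j=1..J. b ^ (m - w j))) \<and>
   (\<exists>t. (\<forall>\<gamma>. pod_parameters s (\<lambda>_. 1) \<gamma> \<longrightarrow> carries_out_cbc b ?m ?w s (\<lambda>_. 1) \<gamma> t \<and>
      arithmetic_cost (\<lambda>_. 1) \<gamma> t \<le> (2 * (3 + b ^ 4 * (120 * b + 170)) + 38) * (\<Sum>j=1..J. (m - w j) * b ^ (m - w j))) \<and>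
    memory_cost t \<le> 21 * b ^ (m - w 1))"
  proof (cases "J = 0")
    case True
    have none: "{j \<in> {1..s}. ?w j < ?m} = {}"
      unfolding J' True by simp
    note halt = carries_out_no_steps[OF w' none, of b]
    have "arithmetic_cost \<Gamma> \<gamma> (Halt (\<lambda>_. 0)) = 0" "memory_cost (Halt (\<lambda>_. 0)) = 0" for \<Gamma> \<gamma>
      by (simp_all add: arithmetic_cost_def memory_cost_def)
    then show ?thesis
      using halt halt[unfolded carries_out_pod_cbc_def, THEN conjunct1] by (intro conjI exI[of _ "Halt (\<lambda>_. 0)"]) simp_all
  next
    case False
    interpret reduced_steps b ?m ?w s J
      by unfold_locales (use b w' J' False in \<open>simp_all add: adjust_w_def\<close>)
    have sums: "(\<Sum>j=1..J. (?m - ?w j + j) * b ^ (?m - ?w j)) = (\<Sum>j=1..J. (m - w j + j) * b ^ (m - w j))"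
      "(\<Sum>j=1..J. (?m - ?w j) * b ^ (?m - ?w j)) = (\<Sum>j=1..J. (m - w j) * b ^ (m - w j))"
      "(\<Sum>j=1..J. b ^ (?m - ?w j)) = (\<Sum>j=1..J. b ^ (m - w j))"
      by (rule sum.cong[OF refl], simp only: diff)+
    have n_1': "b ^ (?m - ?w 1) = b ^ (m - w 1)"
      by (subst diff) (use False in auto)
    show ?thesis
      using pod_tree[unfolded sums] product_tree[unfolded sums n_1'] by blast
  qed
  then show "\<exists>t. (\<forall>\<Gamma> \<gamma>. pod_parameters s \<Gamma> \<gamma> \<longrightarrow> carries_out_pod_cbc b ?m ?w s \<Gamma> \<gamma> t \<and>
      arithmetic_cost \<Gamma> \<gamma> t \<le> (2 * (3 + b ^ 4 * (120 * b + 170)) + 94) * (\<Sum>j\<in>steps. (m - w j + j) * b ^ (m - w j))) \<and>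
    memory_cost t \<le> 21 * (\<Sum>j\<in>steps. b ^ (m - w j))"
    "\<exists>t. (\<forall>\<gamma>. pod_parameters s (\<lambda>_. 1) \<gamma> \<longrightarrow> carries_out_cbc b ?m ?w s (\<lambda>_. 1) \<gamma> t \<and>
      arithmetic_cost (\<lambda>_. 1) \<gamma> t \<le> (2 * (3 + b ^ 4 * (120 * b + 170)) + 38) * (\<Sum>j\<in>steps. (m - w j) * b ^ (m - w j))) \<and>
    memory_cost t \<le> 21 * b ^ (m - w 1)"
    unfolding steps by (rule conjunct1, rule conjunct2)
qed

lemma pod_parameters_korobov: "pod_parameters s \<Gamma> \<gamma> \<Longrightarrow> pod_parameters s \<Gamma> (korobov_weights \<gamma>)"
  by (simp add: pod_parameters_def korobov_weights_def)

text \<open>The order of the quantifiers carries the meaning of the cost estimates: \<open>C\<close>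
  depends on \<open>b\<close> only, through the number of coset pairs and the radix of the
  transforms, and \<open>t\<close> is fixed before the weights. The error estimate covers the run
  with and without adjustment and every way of breaking ties; the cost estimates concern the
  adjusted run.\<close>

theorem theorem5:
  fixes b :: nat
  assumes "prime b"
  shows
    "(\<forall>m s w \<Gamma> \<gamma>. 1 \<le> s \<and> reduction_indices w \<and> pod_parameters s \<Gamma> \<gamma> \<longrightarrow>
        (\<forall>(m', w') \<in> {(m, w), (adjust_m m w, adjust_w w)}. \<forall>z lam F.
           reduced_cbc_output b m' w' s \<Gamma> (korobov_weights \<gamma>) z \<and>
           lam \<in> {1/2<..1} \<and> F \<in> sobolev_space s (pod_weight \<Gamma> \<gamma>) \<longrightarrow>
           rms_error s (b ^ m') (generating_vector b w' z) F
             \<le> (\<Sum>u\<in>Pow {1..s} - {{}}.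
                   pod_weight \<Gamma> \<gamma> u powr lam * rho lam ^ card u * real b ^ min m (Max (w ` u)))
                 powr (1 / (2 * lam))
               * (2 / real (b ^ m)) powr (1 / (2 * lam))
               * sobolev_norm s (pod_weight \<Gamma> \<gamma>) F))
     \<and> (\<exists>C. \<forall>m s w. 1 \<le> s \<and> reduction_indices w \<longrightarrow>
          (\<exists>t.
             (\<forall>\<Gamma> \<gamma>. pod_parameters s \<Gamma> \<gamma> \<longrightarrow>
                carries_out_pod_cbc b (adjust_m m w) (adjust_w w) s \<Gamma> (korobov_weights \<gamma>) t \<and>
                real (arithmetic_cost \<Gamma> (korobov_weights \<gamma>) t)
                  \<le> C * (\<Sum>j\<in>cbc_steps s m w. real ((m - w j + j) * b ^ (m - w j)))) \<and>
             real (memory_cost t) \<le> C * (\<Sum>j\<in>cbc_steps s m w. real (b ^ (m - w j)))))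
     \<and> (\<exists>C. \<forall>m s w. 1 \<le> s \<and> reduction_indices w \<longrightarrow>
          (\<exists>t.
             (\<forall>\<gamma>. pod_parameters s (\<lambda>l. 1) \<gamma> \<longrightarrow>
                carries_out_cbc b (adjust_m m w) (adjust_w w) s (\<lambda>l. 1) (korobov_weights \<gamma>) t \<and>
                real (arithmetic_cost (\<lambda>l. 1) (korobov_weights \<gamma>) t)
                  \<le> C * (\<Sum>j\<in>cbc_steps s m w. real ((m - w j) * b ^ (m - w j)))) \<and>
             real (memory_cost t) \<le> C * real (b ^ (m - w 1))))"
proof (intro conjI)
  let ?K = "2 * (3 + b ^ 4 * (120 * b + 170))"
  show "\<forall>m s w \<Gamma> \<gamma>. 1 \<le> s \<and> reduction_indices w \<and> pod_parameters s \<Gamma> \<gamma> \<longrightarrow>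
        (\<forall>(m', w') \<in> {(m, w), (adjust_m m w, adjust_w w)}. \<forall>z lam F.
           reduced_cbc_output b m' w' s \<Gamma> (korobov_weights \<gamma>) z \<and>
           lam \<in> {1/2<..1} \<and> F \<in> sobolev_space s (pod_weight \<Gamma> \<gamma>) \<longrightarrow>
           rms_error s (b ^ m') (generating_vector b w' z) F
             \<le> (\<Sum>u\<in>Pow {1..s} - {{}}.
                   pod_weight \<Gamma> \<gamma> u powr lam * rho lam ^ card u * real b ^ min m (Max (w ` u)))
                 powr (1 / (2 * lam))
               * (2 / real (b ^ m)) powr (1 / (2 * lam))
               * sobolev_norm s (pod_weight \<Gamma> \<gamma>) F)"
    by (intro allI impI ballI, clarify, rule rms_error_adjusted[OF assms]) assumption+
  have cost: "real x \<le> real C * (\<Sum>j\<in>A. real (g j))" if "x \<le> c * (\<Sum>j\<in>A. g j)" "c \<le> C" for x c C :: nat and A :: "nat set" and g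
  proof -
    have "x \<le> C * (\<Sum>j\<in>A. g j)"
      by (rule order_trans[OF that(1) mult_le_mono1[OF that(2)]])
    then have "real x \<le> real (C * (\<Sum>j\<in>A. g j))"
      by (simp only: of_nat_le_iff)
    then show ?thesis
      by (simp only: of_nat_mult of_nat_sum)
  qed
  show "\<exists>C. \<forall>m s w. 1 \<le> s \<and> reduction_indices w \<longrightarrow>
          (\<exists>t.
             (\<forall>\<Gamma> \<gamma>. pod_parameters s \<Gamma> \<gamma> \<longrightarrow>
                carries_out_pod_cbc b (adjust_m m w) (adjust_w w) s \<Gamma> (korobov_weights \<gamma>) t \<and>
                real (arithmetic_cost \<Gamma> (korobov_weights \<gamma>) t)
                  \<le> C * (\<Sum>j\<in>cbc_steps s m w. real ((m - w j + j) * b ^ (m - w j)))) \<and>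
             real (memory_cost t) \<le> C * (\<Sum>j\<in>cbc_steps s m w. real (b ^ (m - w j))))"
  proof (intro exI[of _ "real (?K + 94)"] allI impI)
    fix m s :: nat and w assume "1 \<le> s \<and> reduction_indices w"
    then obtain t where t: "\<And>\<Gamma> \<gamma>. pod_parameters s \<Gamma> \<gamma> \<Longrightarrow> carries_out_pod_cbc b (adjust_m m w) (adjust_w w) s \<Gamma> \<gamma> t"
      "\<And>\<Gamma> \<gamma>. pod_parameters s \<Gamma> \<gamma> \<Longrightarrow> arithmetic_cost \<Gamma> \<gamma> t \<le> (?K + 94) * (\<Sum>j\<in>cbc_steps s m w. (m - w j + j) * b ^ (m - w j))"
      "memory_cost t \<le> 21 * (\<Sum>j\<in>cbc_steps s m w. b ^ (m - w j))"
      using ex_cbc_trees(1)[OF assms, of w s m] by blast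
    show "\<exists>t. (\<forall>\<Gamma> \<gamma>. pod_parameters s \<Gamma> \<gamma> \<longrightarrow>
                carries_out_pod_cbc b (adjust_m m w) (adjust_w w) s \<Gamma> (korobov_weights \<gamma>) t \<and>
                real (arithmetic_cost \<Gamma> (korobov_weights \<gamma>) t)
                  \<le> real (?K + 94) * (\<Sum>j\<in>cbc_steps s m w. real ((m - w j + j) * b ^ (m - w j)))) \<and>
             real (memory_cost t) \<le> real (?K + 94) * (\<Sum>j\<in>cbc_steps s m w. real (b ^ (m - w j)))"
      by (intro exI[of _ t] conjI allI impI t(1) cost[OF t(2)] cost[OF t(3)] pod_parameters_korobov) simp_all
  qed
  show "\<exists>C. \<forall>m s w. 1 \<le> s \<and> reduction_indices w \<longrightarrow>
          (\<exists>t.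
             (\<forall>\<gamma>. pod_parameters s (\<lambda>l. 1) \<gamma> \<longrightarrow>
                carries_out_cbc b (adjust_m m w) (adjust_w w) s (\<lambda>l. 1) (korobov_weights \<gamma>) t \<and>
                real (arithmetic_cost (\<lambda>l. 1) (korobov_weights \<gamma>) t)
                  \<le> C * (\<Sum>j\<in>cbc_steps s m w. real ((m - w j) * b ^ (m - w j)))) \<and>
             real (memory_cost t) \<le> C * real (b ^ (m - w 1)))"
  proof (intro exI[of _ "real (?K + 38)"] allI impI)
    fix m s :: nat and w assume "1 \<le> s \<and> reduction_indices w"
    then obtain t where t: "\<And>\<gamma>. pod_parameters s (\<lambda>_. 1) \<gamma> \<Longrightarrow> carries_out_cbc b (adjust_m m w) (adjust_w w) s (\<lambda>_. 1) \<gamma> t"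
      "\<And>\<gamma>. pod_parameters s (\<lambda>_. 1) \<gamma> \<Longrightarrow> arithmetic_cost (\<lambda>_. 1) \<gamma> t \<le> (?K + 38) * (\<Sum>j\<in>cbc_steps s m w. (m - w j) * b ^ (m - w j))"
      "memory_cost t \<le> 21 * b ^ (m - w 1)"
      using ex_cbc_trees(2)[OF assms, of w s m] by blast
    have "memory_cost t \<le> (?K + 38) * b ^ (m - w 1)"
      by (rule order_trans[OF t(3) mult_le_mono1]) simp
    then have "real (memory_cost t) \<le> real ((?K + 38) * b ^ (m - w 1))"
      by (simp only: of_nat_le_iff)
    then have memory: "real (memory_cost t) \<le> real (?K + 38) * real (b ^ (m - w 1))"
      by (simp only: of_nat_mult)
    show "\<exists>t. (\<forall>\<gamma>. pod_parameters s (\<lambda>l. 1) \<gamma> \<longrightarrow>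
                carries_out_cbc b (adjust_m m w) (adjust_w w) s (\<lambda>l. 1) (korobov_weights \<gamma>) t \<and>
                real (arithmetic_cost (\<lambda>l. 1) (korobov_weights \<gamma>) t)
                  \<le> real (?K + 38) * (\<Sum>j\<in>cbc_steps s m w. real ((m - w j) * b ^ (m - w j)))) \<and>
             real (memory_cost t) \<le> real (?K + 38) * real (b ^ (m - w 1))"
      by (intro exI[of _ t] conjI allI impI t(1) cost[OF t(2)] memory pod_parameters_korobov) simp_all
  qed
qed

end
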